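(* Let $\alpha>0$ be a countable ordinal, $n\ge 1$ an integer, and $X_{\alpha,n}$ the corresponding countable Stone space. The groups $\mathrm{Homeo}(X_{\alpha,n})$ equipped with the compact-open topology (for varying $\alpha>0$ and $n\geq 1$) fall into exactly three coarse equivalence classes, which are determined by $\alpha$ and $n$ as follows. (1) If $n=1$, then for all $\alpha$, $\mathrm{Homeo}(X_{\alpha,1})$ is coarsely bounded and hence quasi-isometric to a point. (2) If $n>1$ and $\alpha$ is a successor ordinal, then $\mathrm{Homeo}(X_{\alpha,n})$ is quasi-isometric to the countably infinite Hamming cube. (3) If $n>1$ and $\alpha$ is a limit ordinal, then $\mathrm{Homeo}(X_{\alpha,n})$ is coarsely equivalent to the set of leaves of the regular one-ended tree of countably infinite valence.
   Context: A Stone space is a compact, Hausdorff, totally disconnected space. The Cantor--Bendixson derivative $X'$ of $X$ is $X$ minus its isolated points; $X^{(0)}=X$, $X^{(\beta+1)}=(X^{(\beta)})'$, and $X^{(\lambda)}=\bigcap_{\beta<\lambda}X^{(\beta)}$ for $\lambda$ a limit ordinal. For a nonempty countable Stone space $X$ there are a countable ordinal $\alpha$ and an integer $n\ge1$ such that $X^{(\alpha)}$ has exactly $n$ points; the pair $(\alpha,n)$ determines $X$ up to homeomorphism, and $X_{\alpha,n}$ denotes this space (a model is $\omega^\alpha\cdot n+1$ with the order topology). The ordinal $0$ is considered neither a successor nor a limit ordinal. Coarse structure on a topological group $G$: a set $E\subset G\times G$ is an entourage of the canonical (left-)coarse structure iff $\sup_{(g,h)\in E}d(g,h)<\infty$ for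 every continuous left-invariant pseudometric $d$ on $G$. A subset $A\subset G$ is coarsely bounded (in $G$) if it has finite diameter in every continuous left-invariant pseudometric on $G$; $G$ is coarsely bounded if it is so in itself. A map between coarse spaces is a coarse equivalence if it is bornologous (images of entourages are entourages), expanding (preimages of entourages are entourages) and cobounded (there is an entourage $E$ of the target such that every point of the target is $E$-related to a point of the image). Metric spaces carry the coarse structure whose entourages are the sets on which the metric is bounded. A continuous left-invariant pseudometric $d$ on $G$ is maximal if for every continuous left-invariant pseudometric $d'$ on $G$ there are constants $K,C$ with $d'\le Kd+C$; such $d$, if it exists, is unique up to quasi-isometry. "$G$ is quasi-isometric to $Y$" means that $G$ admits a maximal continuous left-invariant pseudometric $d$ and $(G,d)$ is quasi-isometric to $Y$. The countably infinite Hamming cube is the graph whose vertices are the binary sequences indexed by $\omega$ with finitely many $1$'s, two vertices being joined by an edge iff they differ in exactly one coordinate, with its graph metric. The regular one-ended tree of countably infinite valence is the tree with a height function from its vertices to $\{0,1,2,\dots\}$ such that vertices of height $0$ are leaves, each vertex of height $k\ge 0$ is adjacent to exactly one vertex of height $k+1$, each vertex of height $k\ge1$ is adjacent to countably infinitely many vertices of height $k-1$, and there are no other adjacencies. (In particular it has countably infinitely many leaves, every non-leaf vertex has countably infinite valence, and any two geodesic rays share a common tail.) Its set of leaves carries the subspace metric from the graph metric (edges of length 1). *)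

theory Defs
  imports "HOL-Analysis.Analysis" "HOL-Library.Countable_Set_Type" "HOL-Algebra.Bij"
begin

section \<open>Countable ordinals\<close>

text \<open>
  The countable ordinals are exactly the elements of \<open>\<omega>\<^sub>1\<close>, which the library provides as
  the well-order \<open>cardSuc natLeq\<close>. An element \<open>\<alpha>\<close> stands for the order type of
  \<open>{..<\<alpha>}\<close>; the lemmas \<open>countable_lessThan_ordinal\<close> and \<open>countable_well_order_ordinal\<close>
  confirm that precisely the countable order types occur.
\<close>

typedef countable_ordinal = "Field (cardSuc natLeq)"
proof -
  include cardinal_syntax
  have "natLeq <o cardSuc natLeq"
    by (rule cardSuc_greater[OF natLeq_Card_order])
  then have "|Field natLeq| \<le>o |Field (cardSuc natLeq)|"
    by (intro card_of_mono2 ordLess_imp_ordLeq)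
  then have "Field (cardSuc natLeq) \<noteq> {}"
    using card_of_empty3 by (fastforce simp: Field_natLeq)
  then show ?thesis
    by blast
qed

lemma Well_order_omega1: "Well_order (cardSuc natLeq)"
  using cardSuc_Card_order[OF natLeq_Card_order] by (simp add: card_order_on_def)

instantiation countable_ordinal :: wellorder
begin

definition less_eq_countable_ordinal :: "countable_ordinal \<Rightarrow> countable_ordinal \<Rightarrow> bool" where
  "\<alpha> \<le> \<beta> \<longleftrightarrow> (Rep_countable_ordinal \<alpha>, Rep_countable_ordinal \<beta>) \<in> cardSuc natLeq"

definition less_countable_ordinal :: "countable_ordinal \<Rightarrow> countable_ordinal \<Rightarrow> bool" where
  "\<alpha> < \<beta> \<longleftrightarrow> \<alpha> \<le> \<beta> \<and> \<alpha> \<noteq> (\<beta> :: countable_ordinal)"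

instance
proof -
  interpret wo: wo_rel "cardSuc natLeq"
    using Well_order_omega1 by (simp add: wo_rel_def)
  note Rep = Rep_countable_ordinal Rep_countable_ordinal_inject
  have refl: "\<alpha> \<le> \<alpha>" for \<alpha> :: countable_ordinal
    using wo.REFL Rep(1) by (auto simp: less_eq_countable_ordinal_def refl_on_def)
  have antisym: "\<alpha> = \<beta>" if "\<alpha> \<le> \<beta>" "\<beta> \<le> \<alpha>" for \<alpha> \<beta> :: countable_ordinal
  proof -
    have "Rep_countable_ordinal \<alpha> = Rep_countable_ordinal \<beta>"
      using that unfolding less_eq_countable_ordinal_def by (rule antisymD[OF wo.ANTISYM])
    then show ?thesis
      by (simp add: Rep_countable_ordinal_inject)
  qed
  have trans: "\<alpha> \<le> \<gamma>" if "\<alpha> \<le> \<beta>" "\<beta> \<le> \<gamma>" for \<alpha> \<beta> \<gamma> :: countable_ordinal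
    using transD[OF wo.TRANS] that unfolding less_eq_countable_ordinal_def by blast
  have total: "\<alpha> \<le> \<beta> \<or> \<beta> \<le> \<alpha>" for \<alpha> \<beta> :: countable_ordinal
    using wo.TOTALS Rep(1) by (auto simp: less_eq_countable_ordinal_def)
  have wf: "wf {(\<alpha> :: countable_ordinal, \<beta>). \<alpha> < \<beta>}"
  proof (rule wf_subset)
    show "wf (inv_image (cardSuc natLeq - Id) Rep_countable_ordinal)"
      by (rule wf_inv_image[OF wo.WF])
    show "{(\<alpha> :: countable_ordinal, \<beta>). \<alpha> < \<beta>}
            \<subseteq> inv_image (cardSuc natLeq - Id) Rep_countable_ordinal"
      using Rep by (auto simp: less_countable_ordinal_def less_eq_countable_ordinal_def)
  qed
  show "OFCLASS(countable_ordinal, wellorder_class)"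
  proof
    fix P :: "countable_ordinal \<Rightarrow> bool" and \<alpha>
    assume "\<And>\<alpha>. (\<And>\<beta>. \<beta> < \<alpha> \<Longrightarrow> P \<beta>) \<Longrightarrow> P \<alpha>"
    then show "P \<alpha>"
      using wf_induct[OF wf, of P \<alpha>] by blast
  qed (use refl antisym trans total in \<open>auto simp: less_countable_ordinal_def\<close>)
qed

end

instantiation countable_ordinal :: zero
begin

definition zero_countable_ordinal :: countable_ordinal where
  "(0 :: countable_ordinal) = (LEAST \<alpha>. True)"

instance ..

end

lemma Rep_image_lessThan:
  "Rep_countable_ordinal ` {..<\<alpha>} = underS (cardSuc natLeq) (Rep_countable_ordinal \<alpha>)"
proof -
  have "x \<in> Rep_countable_ordinal ` {..<\<alpha>}"
    if "x \<in> underS (cardSuc natLeq) (Rep_countable_ordinal \<alpha>)" for x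
  proof -
    have "x \<in> Field (cardSuc natLeq)"
      using that by (auto simp: underS_def Field_def)
    then obtain \<beta> where "x = Rep_countable_ordinal \<beta>"
      using Rep_countable_ordinal_cases by blast
    then show ?thesis
      using that by (auto simp: underS_def less_countable_ordinal_def less_eq_countable_ordinal_def)
  qed
  then show ?thesis
    by (auto simp: underS_def less_countable_ordinal_def less_eq_countable_ordinal_def
        Rep_countable_ordinal_inject)
qed

lemma countable_lessThan_ordinal: "countable {..<\<alpha> :: countable_ordinal}"
proof -
  include cardinal_syntax
  let ?U = "underS (cardSuc natLeq) (Rep_countable_ordinal \<alpha>)"
  have "|?U| <o cardSuc natLeq"
    by (rule card_of_underS[OF cardSuc_Card_order[OF natLeq_Card_order] Rep_countable_ordinal])
  then have "|?U| \<le>o natLeq"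
    using cardSuc_ordLess_ordLeq[OF natLeq_Card_order card_of_Card_order]
      cardSuc_ordLeq_ordLess[OF natLeq_Card_order card_of_Card_order] by blast
  then have "countable ?U"
    using countable_card_le_natLeq by blast
  then have "countable (Rep_countable_ordinal ` {..<\<alpha>})"
    by (simp add: Rep_image_lessThan)
  then show ?thesis
    by (rule countable_image_inj_on) (simp add: inj_on_def Rep_countable_ordinal_inject)
qed

lemma countable_well_order_ordinal:
  includes cardinal_syntax
  assumes "Well_order r" and "countable (Field r)"
  shows "\<exists>\<alpha>. (r, Restr (cardSuc natLeq) (Rep_countable_ordinal ` {..<\<alpha>})) \<in> ordIso"
proof -
  have "|Field r| <o cardSuc natLeq"
    using assms(2) cardSuc_ordLeq_ordLess[OF natLeq_Card_order card_of_Card_order]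
      countable_card_le_natLeq by blast
  moreover have "\<not> cardSuc natLeq \<le>o r"
  proof
    assume "cardSuc natLeq \<le>o r"
    then have "|Field (cardSuc natLeq)| \<le>o |Field r|"
      using card_of_mono2 by blast
    then have "cardSuc natLeq \<le>o |Field r|"
      using card_of_Field_ordIso[OF cardSuc_Card_order[OF natLeq_Card_order]]
        ordIso_ordLeq_trans ordIso_symmetric by blast
    with calculation show False
      using not_ordLeq_ordLess by blast
  qed
  ultimately have "r <o cardSuc natLeq"
    using assms(1) Well_order_omega1 not_ordLeq_iff_ordLess by blast
  then obtain a where "a \<in> Field (cardSuc natLeq)"
    and "(r, Restr (cardSuc natLeq) (underS (cardSuc natLeq) a)) \<in> ordIso"
    using ordLess_iff_ordIso_Restr[OF Well_order_omega1 assms(1)] by blast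
  then show ?thesis
    using Rep_image_lessThan Rep_countable_ordinal_cases by metis
qed

definition is_predecessor :: "countable_ordinal \<Rightarrow> countable_ordinal \<Rightarrow> bool" where
  "is_predecessor \<beta> \<alpha> \<longleftrightarrow> \<beta> < \<alpha> \<and> (\<forall>\<gamma><\<alpha>. \<gamma> \<le> \<beta>)"

definition successor_ordinal :: "countable_ordinal \<Rightarrow> bool" where
  "successor_ordinal \<alpha> \<longleftrightarrow> (\<exists>\<beta>. is_predecessor \<beta> \<alpha>)"

definition limit_ordinal :: "countable_ordinal \<Rightarrow> bool" where
  "limit_ordinal \<alpha> \<longleftrightarrow> \<alpha> \<noteq> 0 \<and> \<not> successor_ordinal \<alpha>"

definition predecessor :: "countable_ordinal \<Rightarrow> countable_ordinal" where
  "predecessor \<alpha> = (THE \<beta>. is_predecessor \<beta> \<alpha>)"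

lemma predecessor_eq: "is_predecessor \<beta> \<alpha> \<Longrightarrow> predecessor \<alpha> = \<beta>"
  unfolding predecessor_def is_predecessor_def
  by (rule the_equality) (auto intro: antisym)

lemma predecessor_less: "successor_ordinal \<alpha> \<Longrightarrow> predecessor \<alpha> < \<alpha>"
  unfolding successor_ordinal_def using predecessor_eq is_predecessor_def by metis


section \<open>Countable Stone spaces and the Cantor--Bendixson derivative\<close>

definition totally_disconnected_space :: "'a topology \<Rightarrow> bool" where
  "totally_disconnected_space X \<longleftrightarrow> (\<forall>C \<in> connected_components_of X. \<exists>x. C = {x})"

definition stone_space :: "'a topology \<Rightarrow> bool" where
  "stone_space X \<longleftrightarrow> compact_space X \<and> Hausdorff_space X \<and> totally_disconnected_space X"

definition remove_isolated :: "'a topology \<Rightarrow> 'a set \<Rightarrow> 'a set" where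
  "remove_isolated X S = S - {x. openin (subtopology X S) {x}}"

function CB_derivative :: "'a topology \<Rightarrow> countable_ordinal \<Rightarrow> 'a set" where
  "CB_derivative X \<alpha> =
    (if \<alpha> = 0 then topspace X
     else if successor_ordinal \<alpha> then remove_isolated X (CB_derivative X (predecessor \<alpha>))
     else (\<Inter>\<beta>\<in>{..<\<alpha>}. CB_derivative X \<beta>))"
  by auto
termination
  by (relation "inv_image {(\<beta>, \<alpha>). \<beta> < \<alpha>} snd") (auto simp: wf predecessor_less)

declare CB_derivative.simps [simp del]

text \<open>
  The space denoted \<open>X\<^bsub>\<alpha>,n\<^esub>\<close> is unique only up to homeomorphism, so it is rendered as a
  property of a topological space.
\<close>

definition countable_stone_space_of_type :: "countable_ordinal \<Rightarrow> nat \<Rightarrow> 'a topology \<Rightarrow> bool" where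
  "countable_stone_space_of_type \<alpha> n X \<longleftrightarrow>
     stone_space X \<and> countable (topspace X) \<and>
     finite (CB_derivative X \<alpha>) \<and> card (CB_derivative X \<alpha>) = n"


section \<open>Homeomorphism groups with the compact-open topology\<close>

text \<open>
  As in \<^const>\<open>BijGroup\<close>, self-maps of the space are extensional functions, so that
  distinct elements of the carrier are distinct as maps on the space.
\<close>

definition Homeo :: "'a topology \<Rightarrow> ('a \<Rightarrow> 'a) monoid" where
  "Homeo X = (BijGroup (topspace X))
     \<lparr>carrier := {f \<in> Bij (topspace X). homeomorphic_map X X f}\<rparr>"

definition compact_open_topology :: "'a topology \<Rightarrow> ('a \<Rightarrow> 'a) topology" where
  "compact_open_topology X = topology_generated_by
     {{f \<in> carrier (Homeo X). f ` K \<subseteq> U} | K U. compactin X K \<and> openin X U}"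


section \<open>Coarse spaces\<close>

record 'a coarse_space =
  points :: "'a set"
  entourages :: "'a rel set"

definition coarse_equivalence :: "'a coarse_space \<Rightarrow> 'b coarse_space \<Rightarrow> ('a \<Rightarrow> 'b) \<Rightarrow> bool" where
  "coarse_equivalence A B f \<longleftrightarrow>
     f \<in> points A \<rightarrow> points B \<and>
     (\<forall>E \<in> entourages A. map_prod f f ` E \<in> entourages B) \<and>
     (\<forall>E \<in> entourages B. map_prod f f -` E \<inter> points A \<times> points A \<in> entourages A) \<and>
     (\<exists>E \<in> entourages B. \<forall>y \<in> points B. \<exists>x \<in> points A. (y, f x) \<in> E)"

definition coarsely_equivalent :: "'a coarse_space \<Rightarrow> 'b coarse_space \<Rightarrow> bool" where
  "coarsely_equivalent A B \<longleftrightarrow> (\<exists>f. coarse_equivalence A B f)"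

definition metric_coarse_space :: "'a set \<Rightarrow> ('a \<Rightarrow> 'a \<Rightarrow> real) \<Rightarrow> 'a coarse_space" where
  "metric_coarse_space M d =
     \<lparr>points = M, entourages = {E. E \<subseteq> M \<times> M \<and> (\<exists>B. \<forall>(x, y) \<in> E. d x y \<le> B)}\<rparr>"

definition quasi_isometric ::
    "'a set \<Rightarrow> ('a \<Rightarrow> 'a \<Rightarrow> real) \<Rightarrow> 'b set \<Rightarrow> ('b \<Rightarrow> 'b \<Rightarrow> real) \<Rightarrow> bool" where
  "quasi_isometric M d N e \<longleftrightarrow>
     (\<exists>f K C. f \<in> M \<rightarrow> N \<and> K \<ge> 1 \<and> C \<ge> 0 \<and>
        (\<forall>x \<in> M. \<forall>y \<in> M. d x y / K - C \<le> e (f x) (f y) \<and> e (f x) (f y) \<le> K * d x y + C) \<and>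
        (\<forall>z \<in> N. \<exists>x \<in> M. e z (f x) \<le> C))"


section \<open>The coarse geometry of topological groups\<close>

definition continuous_left_invariant_pseudometric ::
    "('g, 'm) monoid_scheme \<Rightarrow> 'g topology \<Rightarrow> ('g \<Rightarrow> 'g \<Rightarrow> real) \<Rightarrow> bool" where
  "continuous_left_invariant_pseudometric G T d \<longleftrightarrow>
     (\<forall>x \<in> carrier G. d x x = 0) \<and>
     (\<forall>x \<in> carrier G. \<forall>y \<in> carrier G. 0 \<le> d x y \<and> d x y = d y x) \<and>
     (\<forall>x \<in> carrier G. \<forall>y \<in> carrier G. \<forall>z \<in> carrier G. d x z \<le> d x y + d y z) \<and>
     (\<forall>g \<in> carrier G. \<forall>x \<in> carrier G. \<forall>y \<in> carrier G. d (g \<otimes>\<^bsub>G\<^esub> x) (g \<otimes>\<^bsub>G\<^esub> y) = d x y) \<and>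
     continuous_map (prod_topology T T) euclideanreal (\<lambda>(x, y). d x y)"

definition group_coarse_space :: "('g, 'm) monoid_scheme \<Rightarrow> 'g topology \<Rightarrow> 'g coarse_space" where
  "group_coarse_space G T =
     \<lparr>points = carrier G,
      entourages = {E. E \<subseteq> carrier G \<times> carrier G \<and>
        (\<forall>d. continuous_left_invariant_pseudometric G T d \<longrightarrow> (\<exists>B. \<forall>(g, h) \<in> E. d g h \<le> B))}\<rparr>"

definition coarsely_bounded_in ::
    "('g, 'm) monoid_scheme \<Rightarrow> 'g topology \<Rightarrow> 'g set \<Rightarrow> bool" where
  "coarsely_bounded_in G T A \<longleftrightarrow>
     A \<subseteq> carrier G \<and>
     (\<forall>d. continuous_left_invariant_pseudometric G T d \<longrightarrow>
        (\<exists>B. \<forall>x \<in> A. \<forall>y \<in> A. d x y \<le> B))"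

definition coarsely_bounded_group :: "('g, 'm) monoid_scheme \<Rightarrow> 'g topology \<Rightarrow> bool" where
  "coarsely_bounded_group G T \<longleftrightarrow> coarsely_bounded_in G T (carrier G)"

definition maximal_pseudometric ::
    "('g, 'm) monoid_scheme \<Rightarrow> 'g topology \<Rightarrow> ('g \<Rightarrow> 'g \<Rightarrow> real) \<Rightarrow> bool" where
  "maximal_pseudometric G T d \<longleftrightarrow>
     continuous_left_invariant_pseudometric G T d \<and>
     (\<forall>d'. continuous_left_invariant_pseudometric G T d' \<longrightarrow>
        (\<exists>K C. \<forall>x \<in> carrier G. \<forall>y \<in> carrier G. d' x y \<le> K * d x y + C))"

definition group_quasi_isometric ::
    "('g, 'm) monoid_scheme \<Rightarrow> 'g topology \<Rightarrow> 'b set \<Rightarrow> ('b \<Rightarrow> 'b \<Rightarrow> real) \<Rightarrow> bool" where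
  "group_quasi_isometric G T N e \<longleftrightarrow>
     (\<exists>d. maximal_pseudometric G T d \<and> quasi_isometric (carrier G) d N e)"

definition Homeo_coarse_space :: "'a topology \<Rightarrow> ('a \<Rightarrow> 'a) coarse_space" where
  "Homeo_coarse_space X = group_coarse_space (Homeo X) (compact_open_topology X)"


section \<open>The model graphs\<close>

text \<open>A simple graph is given by its symmetric, irreflexive adjacency relation.\<close>

definition graph_dist :: "'v rel \<Rightarrow> 'v \<Rightarrow> 'v \<Rightarrow> real" where
  "graph_dist E x y = real (LEAST n. (x, y) \<in> E ^^ n)"

definition hamming_vertices :: "(nat \<Rightarrow> bool) set" where
  "hamming_vertices = {s. finite {i. s i}}"

definition hamming_edges :: "(nat \<Rightarrow> bool) rel" where
  "hamming_edges = {(s, t) \<in> hamming_vertices \<times> hamming_vertices. \<exists>!i. s i \<noteq> t i}"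

definition simple_path :: "'v rel \<Rightarrow> 'v \<Rightarrow> 'v list \<Rightarrow> 'v \<Rightarrow> bool" where
  "simple_path E x p y \<longleftrightarrow>
     p \<noteq> [] \<and> hd p = x \<and> last p = y \<and> distinct p \<and> successively (\<lambda>u v. (u, v) \<in> E) p"

definition tree :: "'v set \<Rightarrow> 'v rel \<Rightarrow> bool" where
  "tree V E \<longleftrightarrow>
     V \<noteq> {} \<and> E \<subseteq> V \<times> V \<and> sym E \<and> irrefl E \<and> (\<forall>x \<in> V. \<forall>y \<in> V. \<exists>!p. simple_path E x p y)"

definition leaves :: "'v set \<Rightarrow> 'v rel \<Rightarrow> 'v set" where
  "leaves V E = {v \<in> V. \<exists>!w. (v, w) \<in> E}"

definition regular_one_ended_tree :: "'v set \<Rightarrow> 'v rel \<Rightarrow> ('v \<Rightarrow> nat) \<Rightarrow> bool" where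
  "regular_one_ended_tree V E height \<longleftrightarrow>
     tree V E \<and>
     (\<forall>v \<in> V. height v = 0 \<longrightarrow> v \<in> leaves V E) \<and>
     (\<forall>v \<in> V. \<exists>!w. (v, w) \<in> E \<and> height w = height v + 1) \<and>
     (\<forall>v \<in> V. height v \<ge> 1 \<longrightarrow>
        countable {w. (v, w) \<in> E \<and> height w + 1 = height v} \<and>
        infinite {w. (v, w) \<in> E \<and> height w + 1 = height v}) \<and>
     (\<forall>(v, w) \<in> E. height w = height v + 1 \<or> height v = height w + 1)"

text \<open>
  The rest of this section checks that such a tree exists: the parent of the vertex \<open>(k, n)\<close> is
  \<open>(k + 1, a)\<close>, where \<open>n\<close> encodes the pair \<open>(a, b)\<close>.
\<close>

lemma simple_path_exists:
  assumes "(x, y) \<in> E\<^sup>*"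
  shows "\<exists>p. simple_path E x p y"
  using assms
proof (induction rule: rtrancl_induct)
  case base
  have "simple_path E x [x] x"
    by (simp add: simple_path_def)
  then show ?case ..
next
  case (step y z)
  then obtain p where p: "simple_path E x p y"
    by blast
  show ?case
  proof (cases "z \<in> set p")
    case True
    then obtain q r where q: "p = (q @ [z]) @ r"
      by (auto simp: in_set_conv_decomp)
    then have "successively (\<lambda>u v. (u, v) \<in> E) (q @ [z])"
      using p unfolding simple_path_def by (metis successively_append_iff)
    then have "simple_path E x (q @ [z]) z"
      using p q by (cases q) (auto simp: simple_path_def)
    then show ?thesis ..
  next
    case False
    then have "simple_path E x (p @ [z]) z"
      using p step.hyps by (auto simp: simple_path_def successively_append_iff)
    then show ?thesis ..
  qed
qed

lemma successively_crossing:
  assumes "successively R p" "p \<noteq> []" "hd p \<in> S" "last p \<notin> S"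
  shows "\<exists>q u v r. p = q @ u # v # r \<and> R u v \<and> u \<in> S \<and> v \<notin> S"
  using assms
proof (induction p)
  case Nil
  then show ?case by simp
next
  case (Cons a p)
  then have ne: "p \<noteq> []" by auto
  then obtain b p' where p: "p = b # p'" by (cases p) auto
  show ?case
  proof (cases "b \<in> S")
    case True
    then obtain q u v r where "p = q @ u # v # r" "R u v" "u \<in> S" "v \<notin> S"
      using Cons p by auto
    then have "a # p = (a # q) @ u # v # r \<and> R u v \<and> u \<in> S \<and> v \<notin> S" by simp
    then show ?thesis by blast
  next
    case False
    then have "a # p = [] @ a # b # p' \<and> R a b \<and> a \<in> S \<and> b \<notin> S"
      using Cons.prems p by simp
    then show ?thesis by blast
  qed
qed

lemma tree_from_parent:
  fixes par :: "'v \<Rightarrow> 'v" and height :: "'v \<Rightarrow> nat"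
  assumes height: "\<And>v. height (par v) = Suc (height v)"
    and meet: "\<And>x y. \<exists>i j. (par ^^ i) x = (par ^^ j) y"
  defines "E \<equiv> {(v, w). w = par v \<or> v = par w}"
  shows "tree UNIV E"
proof -
  have sym: "sym E" and irr: "irrefl E"
    using height by (auto simp: E_def sym_def irrefl_def) (metis n_not_Suc_n)+
  have up: "(x, (par ^^ i) x) \<in> E\<^sup>*" for x i
    by (induction i) (auto simp: E_def intro: rtrancl.rtrancl_into_rtrancl)
  have conn: "(x, y) \<in> E\<^sup>*" for x y
    using meet[of x y] up sym_rtrancl[OF sym] by (metis rtrancl_trans symD)
  have height_iter: "height ((par ^^ i) x) = height x + i" for x i
    by (induction i) (auto simp: height)
  define sub where "sub c = {v. \<exists>i. (par ^^ i) v = c}" for c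
  have exit: "u = c \<and> v = par c" if "(u, v) \<in> E" "u \<in> sub c" "v \<notin> sub c" for u v c
  proof -
    from that(2) obtain i where i: "(par ^^ i) u = c" by (auto simp: sub_def)
    have "(par ^^ Suc i) v = (par ^^ i) (par v)" by (simp add: funpow_swap1)
    then have "u \<noteq> par v"
      using i that(3) unfolding sub_def by blast
    then have v: "v = par u" using that by (auto simp: E_def)
    have "i = 0"
    proof (rule ccontr)
      assume "i \<noteq> 0"
      then obtain j where "i = Suc j" by (cases i) auto
      then have "(par ^^ j) v = c" using i v by (simp add: funpow_swap1)
      then show False using that(3) by (auto simp: sub_def)
    qed
    then show ?thesis using i v by simp
  qed
  have parent_notin: "par c \<notin> sub c" for c
  proof
    assume "par c \<in> sub c"
    then obtain i where "(par ^^ i) (par c) = c" by (auto simp: sub_def)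
    then show False using height_iter[of i "par c"] height[of c] by simp
  qed
  have same_head: "c = d"
    if p: "simple_path E x (x # c # p) y" and q: "simple_path E x (x # d # q) y"
      and c: "x = par c" for x y c d p q
  proof -
    have "y \<in> sub c"
    proof (rule ccontr)
      assume "y \<notin> sub c"
      moreover have "c \<in> sub c" by (auto simp: sub_def intro: exI[of _ 0])
      ultimately obtain s u v r where "c # p = s @ u # v # r" "(u, v) \<in> E" "u \<in> sub c" "v \<notin> sub c"
        using successively_crossing[of "\<lambda>u v. (u, v) \<in> E" "c # p" "sub c"] p
        by (auto simp: simple_path_def)
      then have "x \<in> set (c # p)" using exit c by auto
      then show False using p by (auto simp: simple_path_def)
    qed
    moreover have "x \<notin> sub c" using c parent_notin by simp
    ultimately obtain s u v r where *: "x # d # q = s @ u # v # r" "(u, v) \<in> E" "u \<notin> sub c" "v \<in> sub c"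
      using successively_crossing[of "\<lambda>u v. (u, v) \<in> E" "x # d # q" "- sub c"] q
      by (auto simp: simple_path_def)
    then have "v = c" "u = x" using exit[of v u c] symD[OF sym] c by auto
    moreover have "s = []"
      using * q \<open>u = x\<close> by (cases s) (auto simp: simple_path_def)
    ultimately show ?thesis using * by simp
  qed
  have unique: "p = q" if "simple_path E x p y" "simple_path E x q y" for x y p q
    using that
  proof (induction p arbitrary: x q)
    case Nil
    then show ?case by (simp add: simple_path_def)
  next
    case (Cons a p)
    then have a: "a = x" by (simp add: simple_path_def)
    obtain q' where q: "q = x # q'"
      using Cons.prems by (cases q) (auto simp: simple_path_def)
    show ?case
    proof (cases "x = y")
      case True
      then show ?thesis using Cons.prems a q
        by (auto simp: simple_path_def split: if_splits dest: last_in_set)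
    next
      case False
      then obtain c p' d q'' where p': "p = c # p'" and q': "q' = d # q''"
        using Cons.prems a q by (cases p; cases q') (auto simp: simple_path_def)
      have pc: "simple_path E x (x # c # p') y" and pd: "simple_path E x (x # d # q'') y"
        using Cons.prems a q p' q' by auto
      then have "(x, c) \<in> E" "(x, d) \<in> E"
        by (auto simp: simple_path_def)
      then have "c = d"
        using same_head[OF pc pd] same_head[OF pd pc] by (auto simp: E_def)
      moreover have "simple_path E c p y" "simple_path E d q' y"
        using pc pd p' q' by (auto simp: simple_path_def)
      ultimately show ?thesis
        using Cons.IH a q by auto
    qed
  qed
  show ?thesis
    unfolding tree_def using sym irr simple_path_exists[OF conn] unique by auto
qed

lemma regular_one_ended_tree_exists:
  "\<exists>E. regular_one_ended_tree (UNIV :: (nat \<times> nat) set) E fst"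
proof -
  define par :: "nat \<times> nat \<Rightarrow> nat \<times> nat" where "par v = (Suc (fst v), fst (prod_decode (snd v)))" for v
  define E where "E = {(v, w). w = par v \<or> v = par w}"
  have decr: "fst (prod_decode n) \<le> n - 1" for n
  proof -
    obtain a b where ab: "prod_decode n = (a, b)" by (cases "prod_decode n")
    then have "n = prod_encode (a, b)"
      using prod_decode_inverse[of n] by simp
    then have n: "n = triangle (a + b) + a"
      by (simp add: prod_encode_def)
    have "a \<le> n - 1"
    proof (cases "a + b")
      case 0
      then show ?thesis by simp
    next
      case (Suc k)
      then have "triangle (a + b) \<ge> 1" by simp
      then show ?thesis using n by linarith
    qed
    then show ?thesis using ab by simp
  qed
  have iter_fst: "fst ((par ^^ i) v) = fst v + i" for i v
    by (induction i) (auto simp: par_def)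
  have iter_snd: "snd ((par ^^ i) v) \<le> snd v - i" for i v
  proof (induction i)
    case (Suc i)
    have "snd ((par ^^ Suc i) v) = fst (prod_decode (snd ((par ^^ i) v)))"
      by (simp add: par_def[of "(par ^^ i) v"])
    then show ?case using Suc decr[of "snd ((par ^^ i) v)"] by linarith
  qed simp
  have iter: "(par ^^ i) v = (fst v + i, 0)" if "i \<ge> snd v" for i v
    using iter_fst[of i v] iter_snd[of i v] that by (simp add: prod_eq_iff)
  have "(par ^^ (snd x + snd y + fst y)) x = (par ^^ (snd x + snd y + fst x)) y" for x y
    by (simp add: iter)
  then have "\<exists>i j. (par ^^ i) x = (par ^^ j) y" for x y
    by blast
  moreover have "fst (par v) = Suc (fst v)" for v
    by (simp add: par_def)
  ultimately have "tree UNIV E"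
    unfolding E_def by (intro tree_from_parent[where height = fst])
  moreover have children: "{w. (v, w) \<in> E \<and> fst w + 1 = fst v} = range (\<lambda>b. (fst v - 1, prod_encode (snd v, b)))"
    if "fst v \<ge> 1" for v
  proof -
    have "(v, w) \<in> E \<and> fst w + 1 = fst v \<longleftrightarrow> v = par w" for w
      by (auto simp: E_def par_def)
    moreover have "v = par w \<longleftrightarrow> w \<in> range (\<lambda>b. (fst v - 1, prod_encode (snd v, b)))" for w
    proof
      assume "v = par w"
      then have "w = (fst v - 1, prod_encode (snd v, snd (prod_decode (snd w))))"
        by (auto simp: par_def)
      then show "w \<in> range (\<lambda>b. (fst v - 1, prod_encode (snd v, b)))" by blast
    next
      assume "w \<in> range (\<lambda>b. (fst v - 1, prod_encode (snd v, b)))"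
      then show "v = par w" using that by (auto simp: par_def)
    qed
    ultimately show ?thesis by blast
  qed
  moreover have "infinite (range (\<lambda>b. (k :: nat, prod_encode (a, b))))" for k a
    by (intro range_inj_infinite injI) simp
  moreover have "(v, w) \<in> E \<longleftrightarrow> w = par v" if "fst v = 0" for v w
    using that by (auto simp: E_def par_def)
  moreover have "(v, w) \<in> E \<and> fst w = fst v + 1 \<longleftrightarrow> w = par v" for v w
    by (auto simp: E_def par_def)
  moreover have "\<forall>(v, w) \<in> E. fst w = fst v + 1 \<or> fst v = fst w + 1"
    by (auto simp: E_def par_def)
  ultimately have "regular_one_ended_tree UNIV E fst"
    unfolding regular_one_ended_tree_def leaves_def by simp
  then show ?thesis ..
qed

end

theory Submission
  imports Defs
begin

text \<open>
  Everything happens in the countable Boolean algebra of clopen subsets of a single space \<open>X\<close>. Two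
  clopen sets with a unique point of maximal Cantor--Bendixson rank, of equal rank, are homeomorphic
  (back and forth). Hence a homeomorphism supported near one top point \<open>p\<close> is a bounded product of a
  fixed swap and of elements of any given open subgroup: small clopen sets can be moved into every
  neighbourhood of \<open>p\<close>, and the swaps needed to copy a given homeomorphism can be conjugated there.
  This settles \<open>n = 1\<close>.

  For \<open>n > 1\<close> split \<open>X\<close> into blocks around the top points. A homeomorphism \<open>g\<close> carries the blocks to
  another clopen partition, recorded as a labelling of \<open>X\<close> by top points; the set where it differs
  from the original labelling (the junk of \<open>g\<close>) is clopen and avoids the top points. Homeomorphisms
  whose junk has rank below a fixed \<open>\<beta> < \<alpha>\<close> form a coarsely bounded set. If \<open>\<alpha> = \<beta> + 1\<close>, counting
  junk points of rank \<open>\<beta>\<close> is therefore a maximal pseudometric, and the group looks like finitely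
  supported words in \<open>n\<close> letters with the Hamming metric; since all balls are infinite, an extra
  letter can be absorbed, which makes all these word spaces bi-Lipschitz equivalent. If \<open>\<alpha>\<close> is a
  limit, the group is an increasing union of bounded open subgroups with infinite countable indices,
  an ultrametric space coded by the leaves of the tree.
\<close>

section \<open>Clopen sets and partial homeomorphisms\<close>

text \<open>Coarse boundedness quantifies over all continuous left-invariant pseudometrics. Every
  upper bound is therefore proved for an arbitrary length function \<open>L\<close> of which little
  more is known than subadditivity and a bound on the stabiliser of some finite clopen family. This
  forces the shape of the estimates: an element is written as a product whose number of factors does
  not depend on it, each factor being fixed in advance, supported where \<open>L\<close> is small,
  or conjugate to such an element by something of bounded length. Lower bounds need only one
  pseudometric each, and junk supplies it. Junk of rank below \<beta> is harmless because every
  block contains a peaked set whose peak has rank \<beta>, and such a set does not change its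
  homeomorphism type when clopen sets of smaller rank are added or removed. It is a reservoir in
  which the junk can be collected and relabelled at bounded cost. The two unbounded classes are told
  apart by chains of bounded steps: the edges of the Hamming cube connect everything, while in the
  ultrametric model the relation generated by an entourage is again an entourage.\<close>

locale clopen_space =
  fixes T :: "'a set" and \<A> :: "'a set set"
  assumes countable_T: "countable T"
    and clopen_sub: "U \<in> \<A> \<Longrightarrow> U \<subseteq> T"
    and clopen_T: "T \<in> \<A>"
    and clopen_Diff: "U \<in> \<A> \<Longrightarrow> V \<in> \<A> \<Longrightarrow> U - V \<in> \<A>"
    and clopen_Un: "U \<in> \<A> \<Longrightarrow> V \<in> \<A> \<Longrightarrow> U \<union> V \<in> \<A>"
    and separated: "x \<in> T \<Longrightarrow> y \<in> T \<Longrightarrow> x \<noteq> y \<Longrightarrow> \<exists>U\<in>\<A>. x \<in> U \<and> y \<notin> U"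
    and compact: "U \<in> \<A> \<Longrightarrow> \<C> \<subseteq> \<A> \<Longrightarrow> U \<subseteq> \<Union>\<C> \<Longrightarrow> \<exists>\<F>. finite \<F> \<and> \<F> \<subseteq> \<C> \<and> U \<subseteq> \<Union>\<F>"
begin

section \<open>Compactness and countability of the clopen algebra\<close>

lemma clopen_empty: "{} \<in> \<A>"
  using clopen_Diff[OF clopen_T clopen_T] by simp

lemma clopen_Int: "U \<in> \<A> \<Longrightarrow> V \<in> \<A> \<Longrightarrow> U \<inter> V \<in> \<A>"
  using clopen_Diff[of U "U - V"] clopen_Diff[of U V] by (simp add: Diff_Diff_Int)

lemma clopen_UN: "finite I \<Longrightarrow> (\<And>i. i \<in> I \<Longrightarrow> U i \<in> \<A>) \<Longrightarrow> (\<Union>i\<in>I. U i) \<in> \<A>"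
  by (induction I rule: finite_induct) (auto intro: clopen_empty clopen_Un)

lemma clopen_INT: "finite I \<Longrightarrow> V \<in> \<A> \<Longrightarrow> (\<And>i. i \<in> I \<Longrightarrow> U i \<in> \<A>) \<Longrightarrow> V \<inter> (\<Inter>i\<in>I. U i) \<in> \<A>"
proof (induction I rule: finite_induct)
  case (insert i I)
  then have "U i \<inter> (V \<inter> (\<Inter>i\<in>I. U i)) \<in> \<A>"
    by (auto intro: clopen_Int)
  then show ?case by (simp add: Int_left_commute Int_assoc)
qed simp

lemmas clopen_intros = clopen_empty clopen_Int clopen_Un clopen_Diff clopen_T

text \<open>Compactness as an induction principle: finitely many good clopen sets cover
  \<open>U\<close>, heredity makes the cover disjoint, and the pieces are added up. Embeddings,
  finite counts and uniform bounds on ranks are all obtained through it.\<close>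

lemma clopen_induct:
  assumes "U \<in> \<A>"
    and local: "\<And>x. x \<in> U \<Longrightarrow> \<exists>W\<in>\<A>. x \<in> W \<and> P W"
    and empty: "P {}"
    and subset: "\<And>V W. V \<in> \<A> \<Longrightarrow> W \<in> \<A> \<Longrightarrow> V \<subseteq> W \<Longrightarrow> P W \<Longrightarrow> P V"
    and union: "\<And>V W. V \<in> \<A> \<Longrightarrow> W \<in> \<A> \<Longrightarrow> V \<inter> W = {} \<Longrightarrow> P V \<Longrightarrow> P W \<Longrightarrow> P (V \<union> W)"
  shows "P U"
proof -
  have "\<exists>\<F>. finite \<F> \<and> \<F> \<subseteq> {W \<in> \<A>. P W} \<and> U \<subseteq> \<Union>\<F>"
    using local by (intro compact[OF assms(1)]) blast+
  then obtain \<F> where \<F>: "finite \<F>" "\<F> \<subseteq> {W \<in> \<A>. P W}" "U \<subseteq> \<Union>\<F>"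
    by blast
  have "\<Union>\<F> \<in> \<A> \<and> P (\<Union>\<F>)"
    using \<F>(1,2)
  proof (induction \<F> rule: finite_induct)
    case (insert W \<F>)
    have "\<Union>\<F> - W \<in> \<A>" using insert clopen_Diff by auto
    moreover have "P (\<Union>\<F> - W)" using insert subset[of "\<Union>\<F> - W" "\<Union>\<F>"] calculation by auto
    ultimately have "P (W \<union> (\<Union>\<F> - W))" "W \<union> (\<Union>\<F> - W) \<in> \<A>"
      using insert union[of W "\<Union>\<F> - W"] clopen_Un[of W "\<Union>\<F> - W"] by blast+
    then show ?case by (simp add: Un_Diff_cancel)
  qed (use empty clopen_empty in auto)
  then show ?thesis using subset[of U "\<Union>\<F>"] assms(1) \<F>(3) by blast
qed

lemma separated_finite:
  assumes "x \<in> U" "U \<in> \<A>" "finite F"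
  shows "\<exists>W\<in>\<A>. x \<in> W \<and> W \<subseteq> U \<and> W \<inter> F \<subseteq> {x}"
proof -
  have "\<exists>W\<in>\<A>. x \<in> W \<and> y \<notin> W" if "y \<noteq> x" for y
  proof (cases "y \<in> T")
    case True
    then show ?thesis using separated[of x y] assms clopen_sub that by auto
  next
    case False
    then show ?thesis using assms clopen_sub by auto
  qed
  then have "\<forall>y\<in>F - {x}. \<exists>W\<in>\<A>. x \<in> W \<and> y \<notin> W" by blast
  then obtain w where "\<forall>y\<in>F - {x}. w y \<in> \<A> \<and> x \<in> w y \<and> y \<notin> w y"
    by metis
  then show ?thesis using assms
    by (intro bexI[of _ "U \<inter> (\<Inter>y\<in>F - {x}. w y)"] clopen_INT) auto
qed

lemma avoid_point:
  assumes "x \<in> U" "U \<in> \<A>" "y \<noteq> x"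
  shows "\<exists>W\<in>\<A>. x \<in> W \<and> W \<subseteq> U \<and> y \<notin> W"
  using separated_finite[of x U "{y}"] assms by auto

text \<open>Since \<open>T\<close> is countable, excluding its points one at a time shrinks the
  neighbourhoods to \<open>p\<close>; compactness of \<open>U\<close> then yields a single
  \<open>N k\<close> disjoint from it. This sequence drives the back-and-forth argument.\<close>

lemma nbhd_base:
  assumes "p \<in> A" "A \<in> \<A>"
  shows "\<exists>N :: nat \<Rightarrow> 'a set. N 0 = A \<and> decseq N \<and> (\<forall>k. N k \<in> \<A> \<and> p \<in> N k) \<and>
           (\<forall>U\<in>\<A>. p \<notin> U \<longrightarrow> (\<exists>k. U \<inter> N k = {})) \<and> (\<Inter>k. N k) = {p}"
proof -
  have ne: "T \<noteq> {}" using assms clopen_sub by auto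
  define e where "e = from_nat_into T"
  have e: "range e = T" unfolding e_def using ne countable_T by (rule range_from_nat_into)
  have "\<exists>W. W \<in> \<A> \<and> p \<in> W \<and> W \<subseteq> A \<and> (y \<noteq> p \<longrightarrow> y \<notin> W)" for y
    using avoid_point[OF assms, of y] assms by (cases "y = p") auto
  then obtain w where w: "\<And>y. w y \<in> \<A> \<and> p \<in> w y \<and> w y \<subseteq> A \<and> (y \<noteq> p \<longrightarrow> y \<notin> w y)"
    by metis
  define N where "N k = A \<inter> (\<Inter>i\<in>{..<k}. w (e i))" for k
  have N: "N k \<in> \<A> \<and> p \<in> N k" for k
    using w assms unfolding N_def by (auto intro!: clopen_INT)
  have dec: "decseq N" unfolding N_def decseq_def by auto
  have Int: "y = p" if "\<And>k. y \<in> N k" for y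
  proof (rule ccontr)
    assume "y \<noteq> p"
    have "y \<in> T" using that[of 0] clopen_sub assms by (auto simp: N_def)
    then obtain i where "e i = y" using e by blast
    then have "y \<notin> N (Suc i)" using w \<open>y \<noteq> p\<close> unfolding N_def by auto
    then show False using that by blast
  qed
  have "\<exists>k. U \<inter> N k = {}" if "U \<in> \<A>" "p \<notin> U" for U
  proof -
    have "\<exists>\<F>. finite \<F> \<and> \<F> \<subseteq> range (\<lambda>k. T - N k) \<and> U \<subseteq> \<Union>\<F>"
    proof (rule compact[OF that(1)])
      show "range (\<lambda>k. T - N k) \<subseteq> \<A>" using N clopen_Diff clopen_T by auto
      show "U \<subseteq> \<Union> (range (\<lambda>k. T - N k))"
      proof
        fix y assume y: "y \<in> U"
        then have "y \<noteq> p" using that by auto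
        then obtain k where "y \<notin> N k" using Int[of y] by auto
        moreover have "y \<in> T" using y clopen_sub[OF that(1)] by auto
        ultimately show "y \<in> \<Union> (range (\<lambda>k. T - N k))" by auto
      qed
    qed
    then obtain \<F> where \<F>: "finite \<F>" "\<F> \<subseteq> range (\<lambda>k. T - N k)" "U \<subseteq> \<Union>\<F>" by blast
    obtain I where "finite I" "\<F> = (\<lambda>k. T - N k) ` I"
      using finite_subset_image[OF \<F>(1,2)] by blast
    then have I: "finite I" "U \<subseteq> (\<Union>k\<in>I. T - N k)" using \<F>(3) by simp_all
    obtain m where m: "\<And>k. k \<in> I \<Longrightarrow> k \<le> m" using I(1) finite_nat_set_iff_bounded_le by auto
    have "U \<inter> N m = {}"
    proof (rule equals0I)
      fix y assume y: "y \<in> U \<inter> N m"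
      then obtain k where k: "k \<in> I" "y \<notin> N k" using I(2) by blast
      then show False using y decseqD[OF dec m[OF k(1)]] by blast
    qed
    then show ?thesis ..
  qed
  moreover have "N 0 = A" by (simp add: N_def)
  ultimately show ?thesis using N dec Int by (intro exI[of _ N]) auto
qed

text \<open>Each clopen set is a finite union of members of the countable family of all
  \<open>N p k\<close>. This later gives countable branching in the limit case.\<close>

lemma countable_clopen: "countable \<A>"
proof -
  have "\<forall>p\<in>T. \<exists>N :: nat \<Rightarrow> 'a set. (\<forall>k. N k \<in> \<A> \<and> p \<in> N k) \<and> (\<forall>U\<in>\<A>. p \<notin> U \<longrightarrow> (\<exists>k. U \<inter> N k = {}))"
    using nbhd_base clopen_T by meson
  then obtain N :: "'a \<Rightarrow> nat \<Rightarrow> 'a set" where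
    N: "\<And>p. p \<in> T \<Longrightarrow> (\<forall>k. N p k \<in> \<A> \<and> p \<in> N p k) \<and> (\<forall>U\<in>\<A>. p \<notin> U \<longrightarrow> (\<exists>k. U \<inter> N p k = {}))"
    by metis
  define B where "B = (\<lambda>(p, k). N p k) ` (T \<times> UNIV)"
  have cB: "countable B" unfolding B_def using countable_T by auto
  have "U \<in> Union ` {F. finite F \<and> F \<subseteq> B}" if U: "U \<in> \<A>" for U
  proof -
    have "U \<subseteq> \<Union>{V \<in> B. V \<subseteq> U}"
    proof
      fix p assume p: "p \<in> U"
      then have pT: "p \<in> T" using U clopen_sub by auto
      have Np: "\<forall>k. N p k \<in> \<A> \<and> p \<in> N p k" "\<forall>V\<in>\<A>. p \<notin> V \<longrightarrow> (\<exists>k. V \<inter> N p k = {})"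
        using N pT by auto
      obtain k where "(T - U) \<inter> N p k = {}" using Np(2) p clopen_Diff[OF clopen_T U] by blast
      moreover have "N p k \<subseteq> T" using Np(1) clopen_sub by auto
      moreover have "N p k \<in> B" using pT unfolding B_def by auto
      ultimately show "p \<in> \<Union>{V \<in> B. V \<subseteq> U}" using Np(1) by blast
    qed
    moreover have "{V \<in> B. V \<subseteq> U} \<subseteq> \<A>" using N unfolding B_def by auto
    ultimately obtain \<F> where "finite \<F>" "\<F> \<subseteq> {V \<in> B. V \<subseteq> U}" "U \<subseteq> \<Union>\<F>"
      using compact[OF U] by meson
    then show ?thesis by (intro image_eqI[of _ _ \<F>]) auto
  qed
  then show ?thesis
    using countable_Collect_finite_subset[OF cB] by (meson countable_image countable_subset subsetI)
qed

text \<open>A homeomorphism between clopen sets, expressed through the clopen algebra alone: clopen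
  sets form a base, so matching clopen subsets is continuity in both directions. Values of
  \<open>f\<close> outside \<open>A\<close> carry no information, hence the congruence rule
  \<open>ciso_cong\<close>.\<close>

definition ciso :: "('a \<Rightarrow> 'a) \<Rightarrow> 'a set \<Rightarrow> 'a set \<Rightarrow> bool" where
  "ciso f A B \<longleftrightarrow> A \<in> \<A> \<and> B \<in> \<A> \<and> bij_betw f A B \<and> (\<forall>U\<subseteq>A. U \<in> \<A> \<longleftrightarrow> f ` U \<in> \<A>)"

lemma ciso_clopen: "ciso f A B \<Longrightarrow> A \<in> \<A>" "ciso f A B \<Longrightarrow> B \<in> \<A>"
  and ciso_bij: "ciso f A B \<Longrightarrow> bij_betw f A B"
  and ciso_image: "ciso f A B \<Longrightarrow> f ` A = B"
  and ciso_inj: "ciso f A B \<Longrightarrow> inj_on f A"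
  and ciso_image_clopen: "ciso f A B \<Longrightarrow> U \<in> \<A> \<Longrightarrow> U \<subseteq> A \<Longrightarrow> f ` U \<in> \<A>"
  and ciso_mem: "ciso f A B \<Longrightarrow> x \<in> A \<Longrightarrow> f x \<in> B"
  by (auto simp: ciso_def bij_betw_def)

lemma ciso_clopen_iff: "ciso f A B \<Longrightarrow> U \<subseteq> A \<Longrightarrow> f ` U \<in> \<A> \<longleftrightarrow> U \<in> \<A>"
  by (simp add: ciso_def)

lemma cisoI:
  "A \<in> \<A> \<Longrightarrow> B \<in> \<A> \<Longrightarrow> bij_betw f A B \<Longrightarrow> (\<And>U. U \<subseteq> A \<Longrightarrow> f ` U \<in> \<A> \<longleftrightarrow> U \<in> \<A>) \<Longrightarrow> ciso f A B"
  by (simp add: ciso_def)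

lemma ciso_id: "A \<in> \<A> \<Longrightarrow> ciso id A A"
  by (auto simp: ciso_def)

lemma ciso_cong: "(\<And>x. x \<in> A \<Longrightarrow> f x = g x) \<Longrightarrow> ciso f A B \<longleftrightarrow> ciso g A B"
proof -
  assume eq: "\<And>x. x \<in> A \<Longrightarrow> f x = g x"
  then have "f ` U = g ` U" if "U \<subseteq> A" for U using that by (intro image_cong) auto
  moreover have "bij_betw f A B \<longleftrightarrow> bij_betw g A B" using eq by (rule bij_betw_cong)
  ultimately show ?thesis unfolding ciso_def by auto
qed

lemma ciso_inv: "ciso f A B \<Longrightarrow> ciso (inv_into A f) B A"
proof -
  assume f: "ciso f A B"
  have "inv_into A f ` U \<in> \<A> \<longleftrightarrow> U \<in> \<A>" if "U \<subseteq> B" for U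
  proof -
    have "inv_into A f ` U \<subseteq> A" using that bij_betw_inv_into[OF ciso_bij[OF f]] by (auto simp: bij_betw_def)
    moreover have "f ` inv_into A f ` U = U" using that ciso_image[OF f] by (simp add: image_inv_into_cancel)
    ultimately show ?thesis using ciso_clopen_iff[OF f, of "inv_into A f ` U"] by simp
  qed
  then show ?thesis using f by (intro cisoI) (auto intro: ciso_clopen ciso_bij bij_betw_inv_into)
qed

lemma ciso_comp: "ciso f A B \<Longrightarrow> ciso g B C \<Longrightarrow> ciso (g \<circ> f) A C"
proof -
  assume f: "ciso f A B" and g: "ciso g B C"
  have "(g \<circ> f) ` U \<in> \<A> \<longleftrightarrow> U \<in> \<A>" if "U \<subseteq> A" for U
  proof -
    have "f ` U \<subseteq> B" using that ciso_image[OF f] by auto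
    then show ?thesis using ciso_clopen_iff[OF g, of "f ` U"] ciso_clopen_iff[OF f that]
      by (simp add: image_comp)
  qed
  then show ?thesis using f g by (intro cisoI) (auto intro: ciso_clopen ciso_bij bij_betw_trans)
qed

lemma ciso_subset: "ciso f A B \<Longrightarrow> U \<in> \<A> \<Longrightarrow> U \<subseteq> A \<Longrightarrow> ciso f U (f ` U)"
  by (intro cisoI) (auto simp: ciso_clopen_iff intro: ciso_image_clopen ciso_bij bij_betw_subset)

text \<open>Clopenness can be tested on the pieces of a finite clopen partition. Disjointness of the
  targets makes the image of \<open>U \<inter> A i\<close> the trace on \<open>B i\<close> of the
  image of \<open>U\<close>.\<close>

lemma ciso_UN:
  assumes I: "finite I"
    and ciso: "\<And>i. i \<in> I \<Longrightarrow> ciso (f i) (A i) (B i)"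
    and A: "\<And>i j. i \<in> I \<Longrightarrow> j \<in> I \<Longrightarrow> i \<noteq> j \<Longrightarrow> A i \<inter> A j = {}"
    and B: "\<And>i j. i \<in> I \<Longrightarrow> j \<in> I \<Longrightarrow> i \<noteq> j \<Longrightarrow> B i \<inter> B j = {}"
    and h: "\<And>i x. i \<in> I \<Longrightarrow> x \<in> A i \<Longrightarrow> h x = f i x"
  shows "ciso h (\<Union>i\<in>I. A i) (\<Union>i\<in>I. B i)"
proof -
  have hi: "ciso h (A i) (B i)" if "i \<in> I" for i
    using ciso[OF that] h[OF that] ciso_cong[of "A i" h "f i" "B i"] by simp
  have inj: "inj_on h (\<Union>i\<in>I. A i)"
  proof (rule inj_onI)
    fix x y assume "x \<in> (\<Union>i\<in>I. A i)" "y \<in> (\<Union>i\<in>I. A i)" and eq: "h x = h y"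
    then obtain i j where ij: "i \<in> I" "x \<in> A i" "j \<in> I" "y \<in> A j" by blast
    then have "h x \<in> B i" "h y \<in> B j" using ciso_mem[OF hi] by simp_all
    then have "i = j" using B ij eq by auto
    then show "x = y" using inj_onD[OF ciso_inj[OF hi[OF ij(1)]] eq] ij by simp
  qed
  have im: "h ` (\<Union>i\<in>I. A i) = (\<Union>i\<in>I. B i)" using ciso_image[OF hi] by (simp add: image_UN)
  have "h ` U \<in> \<A> \<longleftrightarrow> U \<in> \<A>" if U: "U \<subseteq> (\<Union>i\<in>I. A i)" for U
  proof -
    have eq: "U = (\<Union>i\<in>I. U \<inter> A i)" using U by auto
    then have eq2: "h ` U = (\<Union>i\<in>I. h ` (U \<inter> A i))" by (metis image_UN)
    have AB: "A i \<in> \<A>" "B i \<in> \<A>" if "i \<in> I" for i using ciso_clopen[OF ciso[OF that]] by auto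
    have 1: "U \<in> \<A> \<longleftrightarrow> (\<forall>i\<in>I. U \<inter> A i \<in> \<A>)"
      using eq clopen_UN[OF I, of "\<lambda>i. U \<inter> A i"] clopen_Int AB(1) by auto
    have *: "h ` (U \<inter> A i) = h ` U \<inter> B i" if i: "i \<in> I" for i
    proof
      show "h ` (U \<inter> A i) \<subseteq> h ` U \<inter> B i" using ciso_mem[OF hi[OF i]] by auto
      show "h ` U \<inter> B i \<subseteq> h ` (U \<inter> A i)"
      proof clarsimp
        fix x assume x: "x \<in> U" "h x \<in> B i"
        then obtain j where j: "j \<in> I" "x \<in> A j" using U by blast
        then have "h x \<in> B j" using ciso_mem[OF hi] by simp
        then have "i = j" using B[OF i j(1)] x by auto
        then show "h x \<in> h ` (U \<inter> A i)" using x j by simp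
      qed
    qed
    have 2: "h ` U \<in> \<A> \<longleftrightarrow> (\<forall>i\<in>I. h ` (U \<inter> A i) \<in> \<A>)"
      using eq2 clopen_UN[OF I, of "\<lambda>i. h ` (U \<inter> A i)"] clopen_Int AB(2) * by auto
    show ?thesis unfolding 1 2 using ciso_clopen_iff[OF hi] by simp
  qed
  moreover have "(\<Union>i\<in>I. A i) \<in> \<A>" "(\<Union>i\<in>I. B i) \<in> \<A>"
    using ciso_clopen[OF ciso] by (auto intro!: clopen_UN[OF I])
  ultimately show ?thesis using inj im by (intro cisoI) (auto simp: bij_betw_def)
qed

lemma ciso_Un:
  assumes "ciso f A B" "ciso g C D" "A \<inter> C = {}" "B \<inter> D = {}"
    and "\<And>x. x \<in> A \<Longrightarrow> h x = f x" "\<And>x. x \<in> C \<Longrightarrow> h x = g x"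
  shows "ciso h (A \<union> C) (B \<union> D)"
proof -
  have "ciso h (\<Union>i\<in>UNIV. if i then A else C) (\<Union>i\<in>UNIV. if i then B else D)"
    by (rule ciso_UN[where f = "\<lambda>i. if i then f else g"]) (use assms in \<open>auto split: if_splits\<close>)
  then show ?thesis by (simp add: UNIV_bool Un_commute)
qed

text \<open>For disjoint clopen sets this involution extends a partial homeomorphism to all of
  \<open>T\<close> without any comparison of complements, and it is its own inverse.\<close>

definition swap :: "('a \<Rightarrow> 'a) \<Rightarrow> 'a set \<Rightarrow> 'a set \<Rightarrow> 'a \<Rightarrow> 'a" where
  "swap f A B x = (if x \<in> A then f x else if x \<in> B then inv_into A f x else x)"

lemma swap_ciso:
  assumes "ciso f A B" "A \<inter> B = {}"
  shows "ciso (swap f A B) T T"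
proof -
  have AB: "A \<in> \<A>" "B \<in> \<A>" using assms ciso_clopen by auto
  have "ciso (swap f A B) (A \<union> B) (B \<union> A)"
    using assms by (intro ciso_Un[OF assms(1) ciso_inv[OF assms(1)]]) (auto simp: swap_def)
  then have "ciso (swap f A B) ((A \<union> B) \<union> (T - (A \<union> B))) ((B \<union> A) \<union> (T - (A \<union> B)))"
    by (rule ciso_Un[OF _ ciso_id]) (use AB in \<open>auto simp: swap_def intro!: clopen_intros\<close>)
  moreover have "(A \<union> B) \<union> (T - (A \<union> B)) = T" "(B \<union> A) \<union> (T - (A \<union> B)) = T"
    using AB clopen_sub by auto
  ultimately show ?thesis by simp
qed

end

section \<open>Cantor--Bendixson rank and homogeneity\<close>

text \<open>Two properties of Cantor--Bendixson rank that determine it: \<open>x\<close> is isolated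
  among the points of rank at least \<open>rk x\<close>, and every smaller rank occurs arbitrarily
  close to \<open>x\<close>. \<open>CB_derivative_from_rank\<close> recovers the derivatives from
  them.\<close>

locale ranked_space = clopen_space T \<A> for T :: "'a set" and \<A> +
  fixes rk :: "'a \<Rightarrow> 'o::wellorder"
  assumes rank_isolated: "x \<in> T \<Longrightarrow> \<exists>U\<in>\<A>. x \<in> U \<and> (\<forall>y\<in>U - {x}. rk y < rk x)"
    and rank_dense: "U \<in> \<A> \<Longrightarrow> x \<in> U \<Longrightarrow> \<gamma> < rk x \<Longrightarrow> \<exists>y\<in>U. rk y = \<gamma>"
begin

text \<open>These are the clopen pieces of type (\<gamma>, 1) with \<gamma> = \<open>rk p\<close>;
  by \<open>peaked_ciso\<close> the rank of the peak is their only invariant.\<close>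

definition peaked :: "'a set \<Rightarrow> 'a \<Rightarrow> bool" where
  "peaked A p \<longleftrightarrow> A \<in> \<A> \<and> p \<in> A \<and> (\<forall>y\<in>A - {p}. rk y < rk p)"

lemma peaked_clopen: "peaked A p \<Longrightarrow> A \<in> \<A>"
  and peaked_mem: "peaked A p \<Longrightarrow> p \<in> A"
  and peaked_less: "peaked A p \<Longrightarrow> y \<in> A \<Longrightarrow> y \<noteq> p \<Longrightarrow> rk y < rk p"
  and peaked_unique: "peaked A p \<Longrightarrow> y \<in> A \<Longrightarrow> rk y \<ge> rk p \<Longrightarrow> y = p"
  by (auto simp: peaked_def) (meson Diff_iff insertE leD not_less singletonD)

lemma peaked_subset: "peaked A p \<Longrightarrow> W \<in> \<A> \<Longrightarrow> W \<subseteq> A \<Longrightarrow> p \<in> W \<Longrightarrow> peaked W p"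
  by (auto simp: peaked_def)

lemma peaked_exists:
  assumes "U \<in> \<A>" "p \<in> U"
  shows "\<exists>W\<subseteq>U. peaked W p"
proof -
  have "p \<in> T" using assms clopen_sub by auto
  then obtain V where V: "V \<in> \<A>" "p \<in> V" "\<forall>y\<in>V - {p}. rk y < rk p" using rank_isolated by meson
  then have "peaked (U \<inter> V) p" using assms by (auto simp: peaked_def intro: clopen_Int)
  then show ?thesis by blast
qed

lemma rank_dense_avoiding:
  assumes "U \<in> \<A>" "x \<in> U" "\<gamma> < rk x" "finite F"
  shows "\<exists>y\<in>U - F. rk y = \<gamma>"
proof -
  obtain W where W: "W \<in> \<A>" "x \<in> W" "W \<subseteq> U" "W \<inter> F \<subseteq> {x}" using separated_finite[OF assms(2,1,4)] by meson
  obtain y where y: "y \<in> W" "rk y = \<gamma>" using rank_dense[OF W(1,2) assms(3)] by blast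
  then have "y \<noteq> x" using assms(3) by auto
  then show ?thesis using W y by blast
qed

lemma rank_dense_infinite:
  assumes "U \<in> \<A>" "x \<in> U" "\<gamma> < rk x"
  shows "infinite {y \<in> U. rk y = \<gamma>}"
  using rank_dense_avoiding[OF assms, of "{y \<in> U. rk y = \<gamma>}"] by auto

text \<open>Induction on the rank of \<open>x\<close>. In a neighbourhood \<open>W\<close> where
  \<open>x\<close> and \<open>f x\<close> are both strict maxima, different ranks would give by
  density a second point on one side whose rank is the smaller of the two. By induction its partner
  has the same rank, which contradicts strict maximality on the other side.\<close>

lemma ciso_rank:
  assumes f: "ciso f A B" and "x \<in> A"
  shows "rk (f x) = rk x"
  using assms(2)
proof (induction "rk x" arbitrary: x rule: less_induct)
  case less
  have A: "A \<in> \<A>" "B \<in> \<A>" using f ciso_clopen by auto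
  have fx: "f x \<in> B" using ciso_mem[OF f less.prems] .
  obtain U where U: "U \<subseteq> A" "peaked U x" using peaked_exists[OF A(1) less.prems] by blast
  obtain V where V: "V \<subseteq> B" "peaked V (f x)" using peaked_exists[OF A(2) fx] by blast
  define W where "W = {y \<in> U. f y \<in> V}"
  have fW: "f ` W = f ` U \<inter> V" by (auto simp: W_def)
  then have fWA: "f ` W \<in> \<A>"
    using peaked_clopen[OF V(2)] ciso_image_clopen[OF f peaked_clopen[OF U(2)] U(1)] clopen_Int by simp
  have WA: "W \<in> \<A>" using fWA ciso_clopen_iff[OF f, of W] U(1) by (auto simp: W_def)
  have xW: "x \<in> W" using peaked_mem[OF U(2)] peaked_mem[OF V(2)] by (simp add: W_def)
  show ?case
  proof (rule linorder_cases)
    assume lt: "rk (f x) < rk x"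
    obtain y where y: "y \<in> W" "rk y = rk (f x)" using rank_dense[OF WA xW lt] by blast
    have yA: "y \<in> A" using y U(1) by (auto simp: W_def)
    have "y \<noteq> x" using y lt by auto
    then have "f y \<noteq> f x" using inj_onD[OF ciso_inj[OF f] _ yA less.prems] by blast
    then have "rk (f y) < rk (f x)" using peaked_less[OF V(2), of "f y"] y(1) by (auto simp: W_def)
    moreover have "rk (f y) = rk y" using less.hyps[of y] y(2) lt yA by simp
    ultimately show ?thesis using y(2) by simp
  next
    assume lt: "rk x < rk (f x)"
    obtain z where z: "z \<in> f ` W" "rk z = rk x" using rank_dense[OF fWA _ lt] xW by blast
    then obtain y where y: "y \<in> W" "z = f y" by blast
    have yA: "y \<in> A" using y U(1) by (auto simp: W_def)
    have "y \<noteq> x" using y z lt by auto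
    then have "rk y < rk x" using peaked_less[OF U(2), of y] y(1) by (auto simp: W_def)
    moreover from this have "rk (f y) = rk y" using less.hyps[of y] yA by simp
    ultimately show ?thesis using y(2) z(2) by simp
  qed
qed

section \<open>Back and forth between peaked sets\<close>

definition peaked_ciso_below :: "'o \<Rightarrow> bool" where
  "peaked_ciso_below \<gamma> \<longleftrightarrow>
     (\<forall>A B p q. peaked A p \<and> peaked B q \<and> rk p = rk q \<and> rk q < \<gamma> \<longrightarrow> (\<exists>f. ciso f A B))"

text \<open>A point \<open>q\<close> of rank at least \<gamma> has room for every clopen set of
  ranks below \<gamma>: copies of small peaked pieces occur near \<open>q\<close> by density of
  ranks, and compactness leaves finitely many pieces. \<open>peaked_ciso_below\<close> stands for
  the induction hypothesis of \<open>peaked_ciso\<close>; \<open>embed\<close> later discharges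
  it.\<close>

lemma embed_aux:
  assumes P: "peaked_ciso_below \<gamma>"
    and A: "A \<in> \<A>" "\<And>y. y \<in> A \<Longrightarrow> rk y < \<gamma>"
    and B: "B \<in> \<A>" "q \<in> B" "\<gamma> \<le> rk q"
  shows "\<exists>f C. ciso f A C \<and> C \<subseteq> B - {q}"
proof -
  \<comment> \<open>\<open>Q\<close> quantifies over all neighbourhoods of \<open>q\<close>, so that
    a second piece can be placed in what the first one leaves of \<open>B\<close>.\<close>
  define Q where "Q A \<longleftrightarrow> (\<forall>B\<in>\<A>. q \<in> B \<longrightarrow> (\<exists>f C. ciso f A C \<and> C \<subseteq> B - {q}))" for A
  have "Q A"
  proof (rule clopen_induct[OF A(1)])
    fix x assume x: "x \<in> A"
    obtain W where W: "W \<subseteq> A" "peaked W x" using peaked_exists[OF A(1) x] by blast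
    have lt: "rk x < rk q" using A(2)[OF x] B(3) by simp
    have "\<exists>f C. ciso f W C \<and> C \<subseteq> B - {q}" if B': "B \<in> \<A>" "q \<in> B" for B
    proof -
      obtain y where y: "y \<in> B" "rk y = rk x" using rank_dense[OF B' lt] by blast
      have "q \<noteq> y" using y lt by auto
      then obtain V where V: "V \<in> \<A>" "y \<in> V" "V \<subseteq> B" "q \<notin> V"
        using avoid_point[OF y(1) B'(1)] by blast
      obtain V' where V': "V' \<subseteq> V" "peaked V' y" using peaked_exists[OF V(1,2)] by blast
      obtain f where "ciso f W V'" using P W(2) V'(2) y(2) A(2)[OF x] unfolding peaked_ciso_below_def by metis
      then show ?thesis using V V' by blast
    qed
    then have "Q W" unfolding Q_def by simp
    then show "\<exists>W\<in>\<A>. x \<in> W \<and> Q W" using peaked_clopen[OF W(2)] peaked_mem[OF W(2)] by auto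
  next
    show "Q {}" unfolding Q_def using ciso_id[OF clopen_empty] by blast
  next
    fix V W assume VW: "V \<in> \<A>" "W \<in> \<A>" "V \<subseteq> W" and Q: "Q W"
    show "Q V" unfolding Q_def
    proof (intro ballI impI)
      fix B assume "B \<in> \<A>" "q \<in> B"
      then obtain f C where f: "ciso f W C" "C \<subseteq> B - {q}" using Q unfolding Q_def by blast
      then have "ciso f V (f ` V)" using ciso_subset VW by blast
      moreover have "f ` V \<subseteq> C" using ciso_image[OF f(1)] VW(3) by blast
      ultimately show "\<exists>f C. ciso f V C \<and> C \<subseteq> B - {q}" using f(2) by blast
    qed
  next
    fix V W assume VW: "V \<in> \<A>" "W \<in> \<A>" "V \<inter> W = {}" and Q: "Q V" "Q W"
    show "Q (V \<union> W)" unfolding Q_def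
    proof (intro ballI impI)
      fix B assume B: "B \<in> \<A>" "q \<in> B"
      then obtain f C where f: "ciso f V C" "C \<subseteq> B - {q}" using Q unfolding Q_def by blast
      have "B - C \<in> \<A>" "q \<in> B - C" using B f ciso_clopen clopen_Diff by auto
      then obtain g D where g: "ciso g W D" "D \<subseteq> B - C - {q}" using Q(2) unfolding Q_def by blast
      have "ciso (\<lambda>x. if x \<in> V then f x else g x) (V \<union> W) (C \<union> D)"
        by (rule ciso_Un[OF f(1) g(1)]) (use VW f g in auto)
      moreover have "C \<union> D \<subseteq> B - {q}" using f g by auto
      ultimately show "\<exists>f C. ciso f (V \<union> W) C \<and> C \<subseteq> B - {q}" by blast
    qed
  qed
  then show ?thesis using B unfolding Q_def by blast
qed

definition extends :: "('a \<Rightarrow> 'a) \<Rightarrow> 'a set \<Rightarrow> 'a set \<Rightarrow> ('a \<Rightarrow> 'a) \<Rightarrow> 'a set \<Rightarrow> 'a set \<Rightarrow> bool" where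
  "extends f' C' D' f C D \<longleftrightarrow> C \<subseteq> C' \<and> D \<subseteq> D' \<and> (\<forall>x\<in>C. f' x = f x)"

text \<open>Only \<open>Y - C\<close> needs a place, and \<open>B - D\<close> is still a
  neighbourhood of \<open>q\<close> because the partial map never reaches the peak.\<close>

lemma extend_forth:
  assumes P: "peaked_ciso_below \<gamma>"
    and A: "peaked A p" and B: "peaked B q" and rank: "rk p = \<gamma>" "rk q = \<gamma>"
    and f: "ciso f C D" "C \<subseteq> A - {p}" "D \<subseteq> B - {q}"
    and Y: "Y \<in> \<A>" "Y \<subseteq> A - {p}"
  shows "\<exists>f' C' D'. ciso f' C' D' \<and> extends f' C' D' f C D \<and> Y \<subseteq> C' \<and> C' \<subseteq> A - {p} \<and> D' \<subseteq> B - {q}"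
proof -
  have CD: "C \<in> \<A>" "D \<in> \<A>" using f ciso_clopen by auto
  have 1: "Y - C \<in> \<A>" "B - D \<in> \<A>" using Y CD peaked_clopen[OF B] clopen_Diff by auto
  have 2: "rk y < \<gamma>" if "y \<in> Y - C" for y using peaked_less[OF A, of y] that Y rank by auto
  have 3: "q \<in> B - D" using peaked_mem[OF B] f by auto
  obtain g E where g: "ciso g (Y - C) E" "E \<subseteq> B - D - {q}"
    using embed_aux[OF P 1(1) 2 1(2) 3] rank by auto
  define f' where "f' x = (if x \<in> C then f x else g x)" for x
  have "ciso f' (C \<union> (Y - C)) (D \<union> E)"
    by (rule ciso_Un[OF f(1) g(1)]) (use g in \<open>auto simp: f'_def\<close>)
  moreover have "extends f' (C \<union> (Y - C)) (D \<union> E) f C D" by (auto simp: extends_def f'_def)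
  ultimately show ?thesis using f g Y
    by (intro exI[of _ f'] exI[of _ "C \<union> (Y - C)"] exI[of _ "D \<union> E"]) auto
qed

text \<open>The forward step for the inverse map, inverted again.\<close>

lemma extend_back:
  assumes P: "peaked_ciso_below \<gamma>"
    and A: "peaked A p" and B: "peaked B q" and rank: "rk p = \<gamma>" "rk q = \<gamma>"
    and f: "ciso f C D" "C \<subseteq> A - {p}" "D \<subseteq> B - {q}"
    and Y: "Y \<in> \<A>" "Y \<subseteq> B - {q}"
  shows "\<exists>f' C' D'. ciso f' C' D' \<and> extends f' C' D' f C D \<and> Y \<subseteq> D' \<and> C' \<subseteq> A - {p} \<and> D' \<subseteq> B - {q}"
proof -
  obtain g D' C' where g: "ciso g D' C'" "extends g D' C' (inv_into C f) D C" "Y \<subseteq> D'"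
    "D' \<subseteq> B - {q}" "C' \<subseteq> A - {p}"
    using extend_forth[OF P B A rank(2,1) ciso_inv[OF f(1)] f(3,2) Y] by blast
  have "inv_into D' g x = f x" if x: "x \<in> C" for x
  proof -
    have "f x \<in> D" using ciso_mem[OF f(1) x] .
    then have "g (f x) = x" "f x \<in> D'"
      using g(2) inv_into_f_f[OF ciso_inj[OF f(1)] x] by (auto simp: extends_def)
    then show ?thesis using inv_into_f_f[OF ciso_inj[OF g(1)], of "f x"] by simp
  qed
  then have "extends (inv_into D' g) C' D' f C D" using g(2) by (auto simp: extends_def)
  then show ?thesis using ciso_inv[OF g(1)] g by blast
qed

lemma extends_trans:
  "extends f' C' D' f C D \<Longrightarrow> extends f'' C'' D'' f' C' D' \<Longrightarrow> extends f'' C'' D'' f C D"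
  by (auto simp: extends_def)

text \<open>The union of the chain, completed by sending \<open>p\<close> to \<open>q\<close>. A
  clopen set that avoids \<open>p\<close> lies in a single stage, where clopenness is preserved; a
  set that contains \<open>p\<close> is treated through its complement in \<open>A\<close>.\<close>

lemma ciso_limit:
  assumes A: "A \<in> \<A>" "p \<in> A" and B: "B \<in> \<A>" "q \<in> B"
    and f: "\<And>k :: nat. ciso (f k) (C k) (D k) \<and> C k \<subseteq> A - {p} \<and> D k \<subseteq> B - {q}"
    and ext: "\<And>k. extends (f (Suc k)) (C (Suc k)) (D (Suc k)) (f k) (C k) (D k)"
    and exC: "\<And>U. U \<in> \<A> \<Longrightarrow> U \<subseteq> A - {p} \<Longrightarrow> \<exists>k. U \<subseteq> C k"
    and exD: "\<And>U. U \<in> \<A> \<Longrightarrow> U \<subseteq> B - {q} \<Longrightarrow> \<exists>k. U \<subseteq> D k"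
  shows "\<exists>F. ciso F A B"
proof -
  have ext': "extends (f (k + j)) (C (k + j)) (D (k + j)) (f k) (C k) (D k)" for k j
  proof (induction j)
    case (Suc j)
    then show ?case using extends_trans ext[of "k + j"] by (metis add_Suc_right)
  qed (auto simp: extends_def)
  define F where "F x = (if x = p then q else f (LEAST k. x \<in> C k) x)" for x
  have Ff: "F x = f k x" if "x \<in> C k" for x k
  proof -
    define j where "j = (LEAST k. x \<in> C k)"
    have "x \<in> C j" "j \<le> k" unfolding j_def using that by (auto intro: LeastI Least_le)
    moreover have "x \<noteq> p" using f that by blast
    ultimately show ?thesis using ext'[of j "k - j"] by (simp add: F_def j_def extends_def)
  qed
  have isoF: "ciso F (C k) (D k)" for k
    using ciso_cong[of "C k" F "f k" "D k"] Ff f by auto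
  have pt: "\<exists>k. x \<in> C k" if x: "x \<in> A" "x \<noteq> p" for x
  proof -
    have "p \<noteq> x" using x by auto
    then obtain W where "W \<in> \<A>" "x \<in> W" "W \<subseteq> A" "p \<notin> W" using avoid_point[OF x(1) A(1)] by blast
    then show ?thesis using exC[of W] by blast
  qed
  have ptD: "\<exists>k. y \<in> D k" if x: "y \<in> B" "y \<noteq> q" for y
  proof -
    have "q \<noteq> y" using x by auto
    then obtain W where "W \<in> \<A>" "y \<in> W" "W \<subseteq> B" "q \<notin> W" using avoid_point[OF x(1) B(1)] by blast
    then show ?thesis using exD[of W] by blast
  qed
  have Fp: "F p = q" by (simp add: F_def)
  have Fnp: "F x \<in> B - {q}" if "x \<in> A" "x \<noteq> p" for x
    using pt[OF that] ciso_mem[OF isoF] f by blast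
  have inj: "inj_on F A"
  proof (rule inj_onI)
    fix x y assume xy: "x \<in> A" "y \<in> A" "F x = F y"
    show "x = y"
    proof (cases "x = p \<or> y = p")
      case True
      then show ?thesis using Fp Fnp xy by fastforce
    next
      case False
      then obtain k j where kj: "x \<in> C k" "y \<in> C j" using pt xy by metis
      then have "x \<in> C (k + j)" "y \<in> C (k + j)"
        using ext'[of k j] ext'[of j k] by (auto simp: extends_def add.commute)
      then show ?thesis using inj_onD[OF ciso_inj[OF isoF] xy(3)] by blast
    qed
  qed
  have im: "F ` A = B"
  proof
    show "F ` A \<subseteq> B"
    proof
      fix y assume "y \<in> F ` A"
      then obtain x where "x \<in> A" "y = F x" by blast
      then show "y \<in> B" using Fnp[of x] Fp B by (cases "x = p") auto
    qed
    show "B \<subseteq> F ` A"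
    proof
      fix y assume y: "y \<in> B"
      show "y \<in> F ` A"
      proof (cases "y = q")
        case True
        then show ?thesis using Fp A by force
      next
        case False
        then obtain k where "y \<in> D k" using ptD y by blast
        then have "y \<in> F ` C k" using ciso_image[OF isoF] by simp
        then show ?thesis using f[of k] by blast
      qed
    qed
  qed
  have iff0: "F ` U \<in> \<A> \<longleftrightarrow> U \<in> \<A>" if U: "U \<subseteq> A - {p}" for U
  proof
    assume "U \<in> \<A>"
    then obtain k where "U \<subseteq> C k" using exC[OF _ U] by blast
    then show "F ` U \<in> \<A>" using ciso_image_clopen[OF isoF \<open>U \<in> \<A>\<close>] by simp
  next
    assume FU: "F ` U \<in> \<A>"
    have "F ` U \<subseteq> B - {q}" using Fnp U by auto
    then obtain k where k: "F ` U \<subseteq> D k" using exD[OF FU] by blast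
    have "U \<subseteq> C k"
    proof
      fix x assume x: "x \<in> U"
      then have "F x \<in> F ` C k" using k ciso_image[OF isoF] by auto
      then obtain y where "y \<in> C k" "F x = F y" by blast
      moreover from this have "y \<in> A" using f[of k] by auto
      moreover have "x \<in> A" using x U by auto
      ultimately show "x \<in> C k" using inj_onD[OF inj, of x y] by simp
    qed
    then show "U \<in> \<A>" using ciso_clopen_iff[OF isoF] FU by simp
  qed
  have "F ` U \<in> \<A> \<longleftrightarrow> U \<in> \<A>" if U: "U \<subseteq> A" for U
  proof (cases "p \<in> U")
    case False
    then show ?thesis using iff0[of U] U by blast
  next
    case True
    have 1: "F ` (A - U) = B - F ` U" using inj_on_image_set_diff[OF inj] im U by auto
    have 2: "U \<in> \<A> \<longleftrightarrow> A - U \<in> \<A>" using clopen_Diff[OF A(1)] U double_diff[OF U] by fastforce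
    have "F ` U \<subseteq> B" using U im by blast
    then have 3: "F ` U \<in> \<A> \<longleftrightarrow> B - F ` U \<in> \<A>" using clopen_Diff[OF B(1)] double_diff[of "F ` U" B B] by fastforce
    have "F ` (A - U) \<in> \<A> \<longleftrightarrow> A - U \<in> \<A>" using iff0[of "A - U"] True by blast
    then show ?thesis using 1 2 3 by simp
  qed
  then show ?thesis using inj im A B by (intro exI[of _ F] cisoI) (auto simp: bij_betw_def)
qed

theorem peaked_ciso: "peaked A p \<Longrightarrow> peaked B q \<Longrightarrow> rk p = rk q \<Longrightarrow> \<exists>f. ciso f A B"
proof (induction "rk q" arbitrary: A B p q rule: less_induct)
  case less
  note A = less.prems(1) and B = less.prems(2)
  have P: "peaked_ciso_below (rk q)"
    unfolding peaked_ciso_below_def using less.hyps by blast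
  obtain N :: "nat \<Rightarrow> 'a set" where N: "\<And>k. N k \<in> \<A> \<and> p \<in> N k" "\<And>U. U \<in> \<A> \<Longrightarrow> p \<notin> U \<Longrightarrow> \<exists>k. U \<inter> N k = {}"
    using nbhd_base[OF peaked_mem[OF A] peaked_clopen[OF A]] by metis
  obtain M :: "nat \<Rightarrow> 'a set" where M: "\<And>k. M k \<in> \<A> \<and> q \<in> M k" "\<And>U. U \<in> \<A> \<Longrightarrow> q \<notin> U \<Longrightarrow> \<exists>k. U \<inter> M k = {}"
    using nbhd_base[OF peaked_mem[OF B] peaked_clopen[OF B]] by metis
  define good where "good s \<longleftrightarrow> (case s of (f, C, D) \<Rightarrow> ciso f C D \<and> C \<subseteq> A - {p} \<and> D \<subseteq> B - {q})" for s
  \<comment> \<open>Stage \<open>k\<close> has to absorb \<open>A - N k\<close> and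
    \<open>B - M k\<close>: by the choice of \<open>N\<close> and \<open>M\<close>, every clopen set
    that avoids the peak lies in one of these.\<close>
  define nxt where "nxt k s s' \<longleftrightarrow> (case s of (f, C, D) \<Rightarrow> case s' of (f', C', D') \<Rightarrow>
      extends f' C' D' f C D \<and> A - N k \<subseteq> C' \<and> B - M k \<subseteq> D')" for k :: nat and s s'
  have step: "\<exists>s'. good s' \<and> nxt k s s'" if s: "good s" for s k
  proof -
    obtain f C D where s_eq: "s = (f, C, D)" by (cases s) auto
    have f: "ciso f C D" "C \<subseteq> A - {p}" "D \<subseteq> B - {q}" using s by (auto simp: good_def s_eq)
    have AN: "A - N k \<in> \<A>" "A - N k \<subseteq> A - {p}" using N peaked_clopen[OF A] clopen_Diff by auto
    have BM: "B - M k \<in> \<A>" "B - M k \<subseteq> B - {q}" using M peaked_clopen[OF B] clopen_Diff by auto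
    obtain f1 C1 D1 where 1: "ciso f1 C1 D1" "extends f1 C1 D1 f C D" "A - N k \<subseteq> C1" "C1 \<subseteq> A - {p}" "D1 \<subseteq> B - {q}"
      using extend_forth[OF P A B less.prems(3) refl f AN] by blast
    obtain f2 C2 D2 where 2: "ciso f2 C2 D2" "extends f2 C2 D2 f1 C1 D1" "B - M k \<subseteq> D2" "C2 \<subseteq> A - {p}" "D2 \<subseteq> B - {q}"
      using extend_back[OF P A B less.prems(3) refl 1(1,4,5) BM] by blast
    have "A - N k \<subseteq> C2" using 1(3) 2(2) by (auto simp: extends_def)
    then have "good (f2, C2, D2) \<and> nxt k s (f2, C2, D2)"
      using 2 extends_trans[OF 1(2) 2(2)] by (auto simp: good_def nxt_def s_eq)
    then show ?thesis by blast
  qed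
  have "good (id, {}, {})" using ciso_id[OF clopen_empty] by (simp add: good_def)
  then obtain s where s: "\<And>k. good (s k)" "\<And>k. nxt k (s k) (s (Suc k))"
    using dependent_nat_choice[of "\<lambda>_. good" nxt] step by metis
  define f where "f k = fst (s k)" for k
  define C where "C k = fst (snd (s k))" for k
  define D where "D k = snd (snd (s k))" for k
  have s_eq: "s k = (f k, C k, D k)" for k by (simp add: f_def C_def D_def)
  have 1: "ciso (f k) (C k) (D k) \<and> C k \<subseteq> A - {p} \<and> D k \<subseteq> B - {q}" for k
    using s(1)[of k] by (simp add: good_def s_eq)
  have 2: "extends (f (Suc k)) (C (Suc k)) (D (Suc k)) (f k) (C k) (D k)"
    "A - N k \<subseteq> C (Suc k)" "B - M k \<subseteq> D (Suc k)" for k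
    using s(2)[of k] by (simp_all add: nxt_def s_eq)
  have "\<exists>k. U \<subseteq> C k" if U: "U \<in> \<A>" "U \<subseteq> A - {p}" for U
  proof -
    obtain k where "U \<inter> N k = {}" using N(2)[OF U(1)] U(2) by blast
    then have "U \<subseteq> C (Suc k)" using 2(2)[of k] U(2) by blast
    then show ?thesis ..
  qed
  moreover have "\<exists>k. U \<subseteq> D k" if U: "U \<in> \<A>" "U \<subseteq> B - {q}" for U
  proof -
    obtain k where "U \<inter> M k = {}" using M(2)[OF U(1)] U(2) by blast
    then have "U \<subseteq> D (Suc k)" using 2(3)[of k] U(2) by blast
    then show ?thesis ..
  qed
  ultimately show ?case
    using ciso_limit[of A p B q f C D] A B 1 2(1) peaked_clopen peaked_mem by metis
qed

lemma embed:
  assumes "A \<in> \<A>" "\<And>y. y \<in> A \<Longrightarrow> rk y < rk q" "B \<in> \<A>" "q \<in> B"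
  shows "\<exists>f C. ciso f A C \<and> C \<subseteq> B - {q}"
proof (rule embed_aux[OF _ assms order_refl])
  show "peaked_ciso_below (rk q)" unfolding peaked_ciso_below_def using peaked_ciso by blast
qed

end

section \<open>Bounded length functions\<close>

context clopen_space
begin

section \<open>Homeomorphisms of the whole space and their supports\<close>

abbreviation homeo :: "('a \<Rightarrow> 'a) \<Rightarrow> bool" where
  "homeo g \<equiv> ciso g T T"

definition supported :: "('a \<Rightarrow> 'a) \<Rightarrow> 'a set \<Rightarrow> bool" where
  "supported g D \<longleftrightarrow> (\<forall>x\<in>T - D. g x = x)"

lemma supportedD: "supported g D \<Longrightarrow> x \<in> T \<Longrightarrow> x \<notin> D \<Longrightarrow> g x = x"
  by (auto simp: supported_def)

lemma supported_mono: "supported g D \<Longrightarrow> D \<subseteq> E \<Longrightarrow> supported g E"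
  by (auto simp: supported_def)

lemma supported_comp: "supported g D \<Longrightarrow> supported h D \<Longrightarrow> supported (g \<circ> h) D"
  by (auto simp: supported_def)

lemma homeo_mem: "homeo g \<Longrightarrow> x \<in> T \<Longrightarrow> g x \<in> T"
  by (rule ciso_mem)

lemma homeo_eq_iff: "homeo g \<Longrightarrow> x \<in> T \<Longrightarrow> y \<in> T \<Longrightarrow> g x = g y \<longleftrightarrow> x = y"
  using inj_on_eq_iff[OF ciso_inj] by metis

lemma homeo_inv_left: "homeo g \<Longrightarrow> x \<in> T \<Longrightarrow> inv_into T g (g x) = x"
  using inv_into_f_f[OF ciso_inj] by metis

lemma homeo_inv_right: "homeo g \<Longrightarrow> x \<in> T \<Longrightarrow> g (inv_into T g x) = x"
  using f_inv_into_f[of x g T] ciso_image by metis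

lemma homeo_inv: "homeo g \<Longrightarrow> homeo (inv_into T g)"
  by (rule ciso_inv)

lemma homeo_inv_mem: "homeo g \<Longrightarrow> x \<in> T \<Longrightarrow> inv_into T g x \<in> T"
  using homeo_inv homeo_mem by blast

lemma homeo_image_clopen: "homeo g \<Longrightarrow> U \<in> \<A> \<Longrightarrow> g ` U \<in> \<A>"
  using ciso_image_clopen clopen_sub by blast

lemma homeo_ciso: "homeo g \<Longrightarrow> U \<in> \<A> \<Longrightarrow> ciso g U (g ` U)"
  using ciso_subset clopen_sub by blast

lemma homeo_extend:
  assumes "ciso g D D"
  shows "homeo (\<lambda>x. if x \<in> D then g x else x)"
proof -
  have D: "D \<in> \<A>" using assms ciso_clopen by auto
  have "ciso (\<lambda>x. if x \<in> D then g x else x) (D \<union> (T - D)) (D \<union> (T - D))"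
    by (rule ciso_Un[OF assms ciso_id]) (use D in \<open>auto intro: clopen_intros\<close>)
  moreover have "D \<union> (T - D) = T" using clopen_sub[OF D] by auto
  ultimately show ?thesis by simp
qed

lemma supported_image:
  assumes g: "homeo g" "supported g D" and D: "D \<subseteq> P" "P \<subseteq> T"
  shows "g ` P = P"
proof -
  have T: "g ` T = T" using ciso_image[OF g(1)] .
  have "g ` (T - P) = id ` (T - P)" using g(2) D by (intro image_cong) (auto simp: supported_def)
  then have "g ` (T - P) = T - P" by simp
  moreover have "g ` (T - P) = g ` T - g ` P"
    using inj_on_image_set_diff[OF ciso_inj[OF g(1)], of T P] D by auto
  moreover have "g ` P \<subseteq> T" using T D by auto
  ultimately show ?thesis
    using T double_diff[of "g ` P" T T] double_diff[OF D(2) order_refl] by simp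
qed

lemma supported_image_disjoint:
  assumes "supported g D" "D \<inter> P = {}" "P \<subseteq> T"
  shows "g ` P = P"
proof -
  have "g ` P = id ` P" using assms by (intro image_cong) (auto simp: supported_def)
  then show ?thesis by simp
qed

lemma swap_left: "a \<in> A \<Longrightarrow> swap f A B a = f a"
  by (simp add: swap_def)

lemma swap_right: "ciso f A B \<Longrightarrow> A \<inter> B = {} \<Longrightarrow> a \<in> A \<Longrightarrow> swap f A B (f a) = a"
  using ciso_mem[of f A B a] inv_into_f_f[OF ciso_inj, of f A B a] by (auto simp: swap_def)

lemma swap_other: "x \<notin> A \<Longrightarrow> x \<notin> B \<Longrightarrow> swap f A B x = x"
  by (simp add: swap_def)

lemma swap_supported: "A \<subseteq> D \<Longrightarrow> B \<subseteq> D \<Longrightarrow> supported (swap f A B) D"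
  by (auto simp: supported_def swap_def)

lemma swap_swap:
  assumes "ciso f A B" "A \<inter> B = {}"
  shows "swap f A B (swap f A B x) = x"
proof (cases "x \<in> B")
  case True
  then obtain a where "a \<in> A" "x = f a" using ciso_image[OF assms(1)] by blast
  then show ?thesis using swap_left[of a A f B] swap_right[OF assms] by simp
next
  case False
  then show ?thesis using swap_left[of x A f B] swap_right[OF assms] swap_other[of x A B f]
    by (cases "x \<in> A") auto
qed

end

context ranked_space
begin

lemma homeo_rank: "homeo g \<Longrightarrow> x \<in> T \<Longrightarrow> rk (g x) = rk x"
  by (rule ciso_rank)

lemma peaked_fixed:
  assumes "homeo g" "supported g D" "peaked D p"
  shows "g p = p"
proof -
  have D: "D \<subseteq> T" "p \<in> D" using assms peaked_clopen peaked_mem clopen_sub by auto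
  have "g p \<in> D" using supported_image[OF assms(1,2) order_refl D(1)] D by auto
  moreover have "rk (g p) = rk p" using homeo_rank assms D by auto
  ultimately show ?thesis using peaked_unique[OF assms(3)] by auto
qed

text \<open>\<open>N\<close> and \<open>N'\<close> may overlap, so a single swap need not carry one
  to the other. A third copy \<open>C\<close>, disjoint from both, serves as an intermediate stop;
  room for it is found near \<open>p\<close>.\<close>

lemma move:
  assumes D: "peaked D p" and f: "ciso f N N'" and N: "N \<subseteq> D - {p}" "N' \<subseteq> D - {p}"
  shows "\<exists>v. homeo v \<and> supported v D \<and> (\<forall>x\<in>N. v x = f x)"
proof -
  have NA: "N \<in> \<A>" "N' \<in> \<A>" using f ciso_clopen by auto
  have rank: "rk y < rk p" if "y \<in> N" for y using peaked_less[OF D, of y] N that by auto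
  have D': "D - N - N' \<in> \<A>" "p \<in> D - N - N'"
    using NA peaked_clopen[OF D] clopen_Diff N peaked_mem[OF D] by auto
  obtain g C where g: "ciso g N C" "C \<subseteq> D - N - N' - {p}" using embed[OF NA(1) rank D'] by blast
  define k where "k = f \<circ> inv_into N g"
  have k: "ciso k C N'" unfolding k_def using ciso_comp[OF ciso_inv[OF g(1)] f] .
  have dis: "N \<inter> C = {}" "C \<inter> N' = {}" using g(2) by auto
  define v where "v = swap k C N' \<circ> swap g N C"
  have "homeo v" unfolding v_def using ciso_comp[OF swap_ciso[OF g(1) dis(1)] swap_ciso[OF k dis(2)]] .
  moreover have "supported v D" unfolding v_def using N g
    by (intro supported_comp swap_supported) auto
  moreover have "v x = f x" if "x \<in> N" for x
  proof -
    have "v x = swap k C N' (g x)" using that by (simp add: v_def swap_left)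
    also have "\<dots> = k (g x)" using ciso_mem[OF g(1) that] by (simp add: swap_left)
    also have "\<dots> = f x" using inv_into_f_f[OF ciso_inj[OF g(1)] that] by (simp add: k_def)
    finally show ?thesis .
  qed
  ultimately show ?thesis by blast
qed

end

text \<open>\<open>L\<close> abstracts the distance to the identity in a continuous left-invariant
  pseudometric. \<open>L_small\<close> is continuity at the identity, where the setwise stabilisers
  of finite clopen families form a neighbourhood base.\<close>

locale length_space = ranked_space T \<A> rk
  for T :: "'a set" and \<A> and rk :: "'a \<Rightarrow> 'o::wellorder" +
  fixes L :: "('a \<Rightarrow> 'a) \<Rightarrow> real"
  assumes L_comp: "homeo g \<Longrightarrow> homeo h \<Longrightarrow> L (g \<circ> h) \<le> L g + L h"
    and L_cong: "(\<And>x. x \<in> T \<Longrightarrow> g x = h x) \<Longrightarrow> L g = L h"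
    and L_inv: "homeo g \<Longrightarrow> L (inv_into T g) = L g"
    and L_small: "\<exists>\<P>. finite \<P> \<and> \<P> \<subseteq> \<A> \<and> (\<forall>g. homeo g \<and> (\<forall>P\<in>\<P>. g ` P = P) \<longrightarrow> L g \<le> 1)"
begin

text \<open>\<open>U\<close> is a neighbourhood of the peak so small that homeomorphisms supported
  in it have length at most 1. The rest \<open>A\<close> of \<open>D\<close> has ranks below that of
  \<open>p\<close>, so copies of it fit into \<open>U\<close>. A homeomorphism \<open>u\<close> of
  controlled length is made to agree with \<open>g\<close> outside \<open>U\<close>; the quotient of
  \<open>g\<close> by \<open>u\<close> is then supported in \<open>U\<close>.\<close>

lemma bounded_peaked:
  assumes D: "peaked D p"
  shows "\<exists>C. \<forall>g. homeo g \<and> supported g D \<longrightarrow> L g \<le> C"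
proof -
  obtain \<P> where \<P>: "finite \<P>" "\<P> \<subseteq> \<A>" "\<And>g. homeo g \<Longrightarrow> (\<And>P. P \<in> \<P> \<Longrightarrow> g ` P = P) \<Longrightarrow> L g \<le> 1"
    using L_small by metis
  have DT: "D \<in> \<A>" "D \<subseteq> T" "p \<in> D" using D peaked_clopen peaked_mem clopen_sub by auto
  \<comment> \<open>Each \<open>P\<close> of the family contains \<open>U\<close> or misses it, so a
    homeomorphism supported in \<open>U\<close> preserves every \<open>P\<close>.\<close>
  define U where "U = D \<inter> (\<Inter>P\<in>\<P>. if p \<in> P then P else T - P)"
  have UA: "U \<in> \<A>" unfolding U_def
    by (rule clopen_INT[OF \<P>(1) DT(1)]) (use \<P>(2) clopen_Diff[OF clopen_T] in auto)
  have U: "p \<in> U" "U \<subseteq> D" "U \<subseteq> T" using DT unfolding U_def by auto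
  have Up: "peaked U p" using peaked_subset[OF D UA U(2,1)] .
  have small: "L g \<le> 1" if g: "homeo g" "supported g U" for g
  proof (rule \<P>(3)[OF g(1)])
    fix P assume P: "P \<in> \<P>"
    then have PT: "P \<subseteq> T" using \<P>(2) clopen_sub by auto
    show "g ` P = P"
    proof (cases "p \<in> P")
      case True
      then have "U \<subseteq> P" using P unfolding U_def by auto
      then show ?thesis using supported_image[OF g _ PT] by simp
    next
      case False
      then have "U \<inter> P = {}" using P unfolding U_def by auto
      then show ?thesis using supported_image_disjoint[OF g(2) _ PT] by simp
    qed
  qed
  define A where "A = D - U"
  have A: "A \<in> \<A>" "A \<subseteq> D" "A \<inter> U = {}" using DT UA clopen_Diff unfolding A_def by auto
  have rA: "rk y < rk p" if "y \<in> A" for y using peaked_less[OF D, of y] that U unfolding A_def by auto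
  obtain \<phi> A1 where \<phi>: "ciso \<phi> A A1" "A1 \<subseteq> U - {p}" using embed[OF A(1) rA UA U(1)] by blast
  have A1: "A1 \<in> \<A>" "A \<inter> A1 = {}" using \<phi> ciso_clopen A by auto
  define f where "f = swap \<phi> A A1"
  have f: "homeo f" "supported f D" unfolding f_def using swap_ciso[OF \<phi>(1) A1(2)] swap_supported[OF A(2)] \<phi>(2) U(2) by auto
  \<comment> \<open>The maps \<open>v\<close>, \<open>v2\<close>, \<open>h'\<close> and
    \<open>k\<close> below are supported in \<open>U\<close> and cost 1 each. This gives
    \<open>L w \<le> L f + 2\<close>, then \<open>L h \<le> 2 * L f + 5\<close>, then
    \<open>L u \<le> 3 * L f + 6\<close>, and one more for \<open>k\<close>.\<close>
  have "L g \<le> 3 * L f + 7" if g: "homeo g" "supported g D" for g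
  proof -
    have gp: "g p = p" using peaked_fixed[OF g D] .
    define G where "G = g ` A"
    have G: "G \<in> \<A>" "G \<subseteq> D" unfolding G_def
      using homeo_image_clopen[OF g(1) A(1)] supported_image[OF g order_refl DT(2)] A(2) by auto
    have pG: "p \<notin> G"
    proof
      assume "p \<in> G"
      then obtain a where a: "a \<in> A" "g a = g p" unfolding G_def using gp by auto
      then have "a = p" using homeo_eq_iff[OF g(1), of a p] A DT by auto
      then show False using a A U by auto
    qed
    \<comment> \<open>\<open>W\<close> avoids \<open>A1\<close> and the image \<open>G\<close> of
      \<open>A\<close>, so the copies \<open>A2\<close> and \<open>B\<close> of \<open>A\<close>
      chosen in it are disjoint from all the sets already in use.\<close>
    define W where "W = U - A1 - G"
    have W: "W \<in> \<A>" "p \<in> W" using UA A1 G pG U \<phi> clopen_Diff unfolding W_def by auto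
    obtain \<psi> A2 where \<psi>: "ciso \<psi> A A2" "A2 \<subseteq> W - {p}" using embed[OF A(1) rA W] by blast
    have A2: "A2 \<in> \<A>" "W - A2 \<in> \<A>" "p \<in> W - A2" using \<psi> ciso_clopen W clopen_Diff by auto
    obtain \<xi> B where \<xi>: "ciso \<xi> A B" "B \<subseteq> W - A2 - {p}" using embed[OF A(1) rA A2(2,3)] by blast
    have dis: "A1 \<inter> A2 = {}" "A1 \<inter> B = {}" "A \<inter> B = {}" "A \<inter> A2 = {}" "A2 \<inter> G = {}" "B \<inter> G = {}" "A2 \<inter> B = {}"
      using \<psi>(2) \<xi>(2) A(3) unfolding W_def by auto
    have sub: "A1 \<subseteq> U" "A2 \<subseteq> U" "B \<subseteq> U" using \<phi>(2) \<psi>(2) \<xi>(2) unfolding W_def by auto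
    define v where "v = swap (\<psi> \<circ> inv_into A \<phi>) A1 A2"
    have vi: "ciso (\<psi> \<circ> inv_into A \<phi>) A1 A2" using ciso_comp[OF ciso_inv[OF \<phi>(1)] \<psi>(1)] .
    have v: "homeo v" "supported v U" unfolding v_def using swap_ciso[OF vi dis(1)] swap_supported sub by auto
    define v2 where "v2 = swap (\<xi> \<circ> inv_into A \<phi>) A1 B"
    have v2i: "ciso (\<xi> \<circ> inv_into A \<phi>) A1 B" using ciso_comp[OF ciso_inv[OF \<phi>(1)] \<xi>(1)] .
    have v2: "homeo v2" "supported v2 U" unfolding v2_def using swap_ciso[OF v2i dis(2)] swap_supported sub by auto
    define w where "w = swap \<xi> A B"
    have w: "homeo w" "supported w D" unfolding w_def
      using swap_ciso[OF \<xi>(1) dis(3)] swap_supported[of A D B] A(2) sub U by auto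
    have ww: "w (w x) = x" for x unfolding w_def using swap_swap[OF \<xi>(1) dis(3)] .
    have \<phi>m: "\<phi> a \<in> A1" "inv_into A \<phi> (\<phi> a) = a" if "a \<in> A" for a
      using ciso_mem[OF \<phi>(1) that] inv_into_f_f[OF ciso_inj[OF \<phi>(1)] that] by auto
    have v2a: "v2 (\<phi> a) = \<xi> a" "v2 (\<xi> a) = \<phi> a" "v2 a = a" if "a \<in> A" for a
    proof -
      show "v2 (\<phi> a) = \<xi> a" unfolding v2_def using \<phi>m[OF that] by (simp add: swap_left)
      show "v2 (\<xi> a) = \<phi> a"
        using swap_right[OF v2i dis(2) \<phi>m(1)[OF that]] \<phi>m[OF that] unfolding v2_def by simp
      show "v2 a = a" unfolding v2_def using that A1(2) dis(3) by (intro swap_other) auto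
    qed
    have fa: "f a = \<phi> a" "f (\<phi> a) = a" if "a \<in> A" for a
      unfolding f_def using swap_left[OF that] swap_right[OF \<phi>(1) A1(2) that] by auto
    \<comment> \<open>The swap of \<open>A\<close> with \<open>B\<close> is the fixed swap
      \<open>f\<close> conjugated by an element supported in \<open>U\<close>; this bounds
      \<open>L w\<close> independently of \<open>g\<close>.\<close>
    have w_eq: "w x = (v2 \<circ> (f \<circ> v2)) x" if "x \<in> T" for x
    proof -
      consider "x \<in> A" | "x \<in> A1" | "x \<in> B" | "x \<notin> A" "x \<notin> A1" "x \<notin> B" by blast
      then show ?thesis
      proof cases
        case 1
        then show ?thesis using v2a[OF 1] fa[OF 1] swap_left[OF 1] by (simp add: w_def)
      next
        case 2
        then obtain a where a: "a \<in> A" "x = \<phi> a" using ciso_image[OF \<phi>(1)] by blast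
        have "\<xi> a \<in> B" using ciso_mem[OF \<xi>(1) a(1)] .
        then have "f (\<xi> a) = \<xi> a" unfolding f_def using dis by (intro swap_other) auto
        moreover have "w x = x" unfolding w_def using 2 A1 dis by (intro swap_other) auto
        ultimately show ?thesis using v2a[OF a(1)] a by simp
      next
        case 3
        then obtain a where a: "a \<in> A" "x = \<xi> a" using ciso_image[OF \<xi>(1)] by blast
        then show ?thesis using v2a[OF a(1)] fa[OF a(1)] swap_right[OF \<xi>(1) dis(3) a(1)] by (simp add: w_def)
      next
        case 4
        then show ?thesis by (simp add: w_def v2_def f_def swap_other)
      qed
    qed
    have "L w = L (v2 \<circ> (f \<circ> v2))" using w_eq by (rule L_cong)
    also have "\<dots> \<le> L v2 + (L f + L v2)"
      using L_comp[OF v2(1) ciso_comp[OF v2(1) f(1)]] L_comp[OF f(1) v2(1)] by simp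
    finally have Lw: "L w \<le> L f + 2" using small[OF v2] by simp
    define \<theta> where "\<theta> = g \<circ> inv_into A \<psi>"
    have \<theta>: "ciso \<theta> A2 G"
      unfolding \<theta>_def G_def using ciso_comp[OF ciso_inv[OF \<psi>(1)] homeo_ciso[OF g(1) A(1)]] .
    define h where "h = swap \<theta> A2 G"
    have h: "homeo h" "supported h D" unfolding h_def
      using swap_ciso[OF \<theta> dis(5)] swap_supported[of A2 D G] sub U G by auto
    \<comment> \<open>\<open>h\<close> may move points of \<open>A\<close>. Conjugation by
      \<open>w\<close> puts \<open>B\<close> in the place of \<open>A\<close>, and \<open>h\<close>
      fixes \<open>B\<close>, so all movement ends up in \<open>U\<close>.\<close>
    define h' where "h' = w \<circ> (h \<circ> w)"
    have h': "homeo h'" unfolding h'_def using ciso_comp[OF ciso_comp[OF w(1) h(1)] w(1)] .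
    have "supported h' U" unfolding supported_def
    proof
      fix x assume x: "x \<in> T - U"
      show "h' x = x"
      proof (cases "x \<in> D")
        case True
        then have xA: "x \<in> A" using x unfolding A_def by auto
        have "w x \<in> B" unfolding w_def using swap_left[OF xA] ciso_mem[OF \<xi>(1) xA] by metis
        then have "h (w x) = w x" unfolding h_def using dis by (intro swap_other) auto
        then show ?thesis using ww by (simp add: h'_def)
      next
        case False
        then show ?thesis using supportedD[OF w(2)] supportedD[OF h(2)] x by (simp add: h'_def)
      qed
    qed
    then have "L h' \<le> 1" using small h' by simp
    moreover have "L h = L (w \<circ> (h' \<circ> w))" by (rule L_cong) (simp add: h'_def ww)
    moreover have "L (w \<circ> (h' \<circ> w)) \<le> L w + (L h' + L w)"
      using L_comp[OF w(1) ciso_comp[OF w(1) h']] L_comp[OF h' w(1)] by simp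
    ultimately have Lh: "L h \<le> 2 * L f + 5" using Lw by simp
    \<comment> \<open>Along \<open>A\<close> the composite runs through \<open>A1\<close> and
      \<open>A2\<close> to \<open>G\<close>, and \<theta> is chosen so that the result is
      \<open>g\<close>.\<close>
    define u where "u = h \<circ> (v \<circ> f)"
    have u: "homeo u" unfolding u_def using ciso_comp[OF ciso_comp[OF f(1) v(1)] h(1)] .
    have Lu: "L u \<le> 3 * L f + 6"
      using L_comp[OF h(1) ciso_comp[OF f(1) v(1)]] L_comp[OF v(1) f(1)] Lh small[OF v] unfolding u_def by simp
    have ua: "u a = g a" if "a \<in> A" for a
    proof -
      have "v (\<phi> a) = \<psi> a" unfolding v_def using \<phi>m[OF that] by (simp add: swap_left)
      moreover have "h (\<psi> a) = \<theta> (\<psi> a)" unfolding h_def using swap_left[OF ciso_mem[OF \<psi>(1) that]] .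
      moreover have "\<theta> (\<psi> a) = g a" unfolding \<theta>_def using inv_into_f_f[OF ciso_inj[OF \<psi>(1)] that] by simp
      ultimately show ?thesis using fa[OF that] by (simp add: u_def)
    qed
    define k where "k = inv_into T u \<circ> g"
    have k: "homeo k" unfolding k_def using ciso_comp[OF g(1) homeo_inv[OF u]] .
    have "supported k U" unfolding supported_def
    proof
      fix x assume x: "x \<in> T - U"
      have "u x = g x"
      proof (cases "x \<in> D")
        case True
        then show ?thesis using ua x unfolding A_def by auto
      next
        case False
        then have "x \<notin> U" using U by auto
        then show ?thesis using False x supportedD[OF f(2)] supportedD[OF v(2)] supportedD[OF h(2)] supportedD[OF g(2)]
          by (simp add: u_def)
      qed
      then show "k x = x" using homeo_inv_left[OF u, of x] x by (simp add: k_def)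
    qed
    then have "L k \<le> 1" using small k by simp
    moreover have "L g = L (u \<circ> k)"
      by (rule L_cong) (simp add: k_def homeo_inv_right[OF u] homeo_mem[OF g(1)])
    ultimately show ?thesis using L_comp[OF u k] Lu by simp
  qed
  then show ?thesis by blast
qed

end

section \<open>Labellings of a space by its points of maximal rank\<close>

locale split_space = ranked_space T \<A> rk
  for T :: "'a set" and \<A> and rk :: "'a \<Rightarrow> 'o::wellorder" +
  fixes \<alpha> :: 'o and K :: "'a set" and X :: "'a \<Rightarrow> 'a set"
  assumes finite_K: "finite K"
    and K_nonempty: "K \<noteq> {}"
    and K_rank: "p \<in> K \<Longrightarrow> rk p = \<alpha>"
    and X_peaked: "p \<in> K \<Longrightarrow> peaked (X p) p"
    and X_disjoint: "p \<in> K \<Longrightarrow> q \<in> K \<Longrightarrow> p \<noteq> q \<Longrightarrow> X p \<inter> X q = {}"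
    and X_cover: "(\<Union>p\<in>K. X p) = T"
begin

section \<open>Labels and junk of a homeomorphism\<close>

definition block :: "'a \<Rightarrow> 'a" where
  "block x = (THE p. p \<in> K \<and> x \<in> X p)"

lemma block_eq: "p \<in> K \<Longrightarrow> x \<in> X p \<Longrightarrow> block x = p"
  unfolding block_def using X_disjoint by (intro the_equality) blast+

lemma block_mem: "x \<in> T \<Longrightarrow> block x \<in> K" "x \<in> T \<Longrightarrow> x \<in> X (block x)"
  using X_cover block_eq by blast+

lemma X_clopen: "p \<in> K \<Longrightarrow> X p \<in> \<A>"
  and X_sub: "p \<in> K \<Longrightarrow> X p \<subseteq> T"
  and X_mem: "p \<in> K \<Longrightarrow> p \<in> X p"
  using X_peaked[of p] peaked_clopen[of "X p" p] peaked_mem[of "X p" p] clopen_sub[of "X p"] by auto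

lemma K_sub: "K \<subseteq> T"
  using X_sub X_mem by blast

lemma block_K: "p \<in> K \<Longrightarrow> block p = p"
  using block_eq X_mem by blast

lemma rank_less: "x \<in> T \<Longrightarrow> x \<notin> K \<Longrightarrow> rk x < \<alpha>"
  using block_mem[of x] peaked_less[OF X_peaked, of "block x" x] K_rank by metis

lemma rank_eq_K: "x \<in> T \<Longrightarrow> rk x = \<alpha> \<Longrightarrow> x \<in> K"
  using rank_less by force

lemma homeo_K: "homeo g \<Longrightarrow> p \<in> K \<Longrightarrow> g p \<in> K"
  using K_sub K_rank homeo_rank homeo_mem rank_eq_K by (metis subsetD)

text \<open>The images of the blocks under \<open>g\<close> partition \<open>T\<close>; each
  contains exactly one point of \<open>K\<close>, which is its label. Naming a piece by this point,
  not by the block it comes from, makes every point of \<open>K\<close> its own label, whatever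
  permutation \<open>g\<close> induces on \<open>K\<close>.\<close>

definition lab :: "('a \<Rightarrow> 'a) \<Rightarrow> 'a \<Rightarrow> 'a" where
  "lab g x = g (block (inv_into T g x))"

lemma lab_apply: "homeo g \<Longrightarrow> x \<in> T \<Longrightarrow> lab g (g x) = g (block x)"
  by (simp add: lab_def homeo_inv_left)

lemma lab_mem: "homeo g \<Longrightarrow> x \<in> T \<Longrightarrow> lab g x \<in> K"
  unfolding lab_def using homeo_inv_mem block_mem homeo_K by blast

lemma lab_K: "homeo g \<Longrightarrow> p \<in> K \<Longrightarrow> lab g p = p"
  unfolding lab_def using homeo_K[OF homeo_inv] block_K homeo_inv_right K_sub by (metis subsetD)

text \<open>This equivariance is the source of left invariance for all distances built from
  junk.\<close>

lemma lab_comp: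
  assumes "homeo g" "homeo h" "x \<in> T"
  shows "lab (g \<circ> h) (g x) = g (lab h x)"
proof -
  have y: "inv_into T h x \<in> T" "h (inv_into T h x) = x" using assms homeo_inv_mem homeo_inv_right by auto
  have "lab (g \<circ> h) ((g \<circ> h) (inv_into T h x)) = (g \<circ> h) (block (inv_into T h x))"
    by (rule lab_apply[OF ciso_comp[OF assms(2,1)] y(1)])
  then show ?thesis using y(2) by (simp add: lab_def)
qed

lemma lab_cong:
  assumes "homeo g" "\<And>x. x \<in> T \<Longrightarrow> g x = h x" "x \<in> T"
  shows "lab g x = lab h x"
proof -
  have "homeo h" using assms(1,2) ciso_cong[of T g h] by auto
  define y where "y = inv_into T g x"
  have y: "y \<in> T" "g y = x" unfolding y_def
    using homeo_inv_mem[OF assms(1,3)] homeo_inv_right[OF assms(1,3)] by auto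
  moreover from this have "h y = x" using assms(2) by simp
  ultimately show ?thesis
    using lab_apply[OF assms(1) y(1)] lab_apply[OF \<open>homeo h\<close> y(1)] assms(2) block_mem[OF y(1)] K_sub by auto
qed

lemma lab_id: "x \<in> T \<Longrightarrow> lab id x = block x"
  using lab_apply[OF ciso_id[OF clopen_T]] by simp

lemma lab_fiber_clopen:
  assumes g: "homeo g" and p: "p \<in> K"
  shows "{x \<in> T. lab g x = p} \<in> \<A>"
proof -
  define q where "q = inv_into T g p"
  have q: "q \<in> K" "g q = p" unfolding q_def
    using homeo_K[OF homeo_inv[OF g] p] homeo_inv_right[OF g] p K_sub by auto
  have "{x \<in> T. lab g x = p} = g ` X q"
  proof (intro Set.set_eqI iffI)
    fix x assume x: "x \<in> {x \<in> T. lab g x = p}"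
    define y where "y = inv_into T g x"
    have y: "y \<in> T" "g y = x" unfolding y_def using x homeo_inv_mem[OF g] homeo_inv_right[OF g] by auto
    then have "g (block y) = g q" using x q lab_apply[OF g y(1)] by simp
    then have "block y = q" using homeo_eq_iff[OF g] block_mem[OF y(1)] q K_sub by blast
    then show "x \<in> g ` X q" using y block_mem by blast
  next
    fix x assume "x \<in> g ` X q"
    then obtain y where "y \<in> X q" "x = g y" by blast
    then show "x \<in> {x \<in> T. lab g x = p}"
      using lab_apply[OF g] X_sub[OF q(1)] block_eq[OF q(1)] q(2) homeo_mem[OF g] by auto
  qed
  then show ?thesis using homeo_image_clopen[OF g X_clopen[OF q(1)]] by simp
qed

definition junk :: "('a \<Rightarrow> 'a) \<Rightarrow> ('a \<Rightarrow> 'a) \<Rightarrow> 'a set" where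
  "junk g h = {x \<in> T. lab g x \<noteq> lab h x}"

lemma junk_clopen:
  assumes "homeo g" "homeo h"
  shows "junk g h \<in> \<A>"
proof -
  have "junk g h = T - (\<Union>p\<in>K. {x \<in> T. lab g x = p} \<inter> {x \<in> T. lab h x = p})"
    unfolding junk_def using lab_mem[OF assms(2)] by auto
  moreover have "(\<Union>p\<in>K. {x \<in> T. lab g x = p} \<inter> {x \<in> T. lab h x = p}) \<in> \<A>"
    using assms by (intro clopen_UN[OF finite_K] clopen_Int lab_fiber_clopen)
  ultimately show ?thesis using clopen_Diff[OF clopen_T] by simp
qed

lemma junk_rank:
  assumes "homeo g" "homeo h" "x \<in> junk g h"
  shows "rk x < \<alpha>"
proof (rule rank_less)
  show "x \<in> T" using assms(3) by (simp add: junk_def)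
  show "x \<notin> K" using assms(3) lab_K[OF assms(1), of x] lab_K[OF assms(2), of x] by (auto simp: junk_def)
qed

lemma junk_sym: "junk g h = junk h g"
  by (auto simp: junk_def)

lemma junk_triangle: "junk g k \<subseteq> junk g h \<union> junk h k"
  by (auto simp: junk_def)

lemma junk_translate:
  assumes f: "homeo f" and gh: "homeo g" "homeo h"
  shows "junk (f \<circ> g) (f \<circ> h) = f ` junk g h"
proof (intro Set.set_eqI iffI)
  fix x assume x: "x \<in> junk (f \<circ> g) (f \<circ> h)"
  define y where "y = inv_into T f x"
  have y: "y \<in> T" "x = f y" unfolding y_def
    using x homeo_inv_mem[OF f] homeo_inv_right[OF f] by (auto simp: junk_def)
  then have "lab g y \<noteq> lab h y" using x lab_comp[OF f] gh by (auto simp: junk_def)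
  then show "x \<in> f ` junk g h" using y by (auto simp: junk_def)
next
  fix x assume "x \<in> f ` junk g h"
  then obtain y where y: "y \<in> T" "lab g y \<noteq> lab h y" "x = f y" by (auto simp: junk_def)
  then have "f (lab g y) \<noteq> f (lab h y)"
    using homeo_eq_iff[OF f] lab_mem[OF gh(1)] lab_mem[OF gh(2)] K_sub by blast
  then show "x \<in> junk (f \<circ> g) (f \<circ> h)"
    using y lab_comp[OF f] gh homeo_mem[OF f] by (auto simp: junk_def)
qed

lemma junk_cong:
  assumes "homeo g" "homeo h" "\<And>x. x \<in> T \<Longrightarrow> g x = g' x" "\<And>x. x \<in> T \<Longrightarrow> h x = h' x"
  shows "junk g h = junk g' h'"
  using lab_cong[OF assms(1,3)] lab_cong[OF assms(2,4)] by (auto simp: junk_def)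

lemma junk_inv:
  assumes "homeo g" "homeo h"
  shows "junk id (inv_into T g \<circ> h) = inv_into T g ` junk g h"
proof -
  have "junk id (inv_into T g \<circ> h) = junk (inv_into T g \<circ> g) (inv_into T g \<circ> h)"
  proof (rule junk_cong)
    show "homeo id" using ciso_id[OF clopen_T] .
    show "homeo (inv_into T g \<circ> h)" using ciso_comp[OF assms(2) homeo_inv[OF assms(1)]] .
  qed (simp_all add: homeo_inv_left[OF assms(1)])
  then show ?thesis using junk_translate[OF homeo_inv[OF assms(1)] assms] by simp
qed

text \<open>Blocks have unique peaks, so a block that is preserved keeps its label. This serves for
  continuity: a distance that depends on junk alone vanishes on the stabiliser of the finite family
  of blocks, an open subgroup.\<close>

lemma junk_stabilizer:
  assumes v: "homeo v" "\<And>p. p \<in> K \<Longrightarrow> v ` X p = X p"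
  shows "junk id v = {}"
proof -
  have "lab v x = block x" if x: "x \<in> T" for x
  proof -
    define y where "y = inv_into T v x"
    have y: "y \<in> T" "v y = x" unfolding y_def using x homeo_inv_mem[OF v(1)] homeo_inv_right[OF v(1)] by auto
    define p where "p = block y"
    have p: "p \<in> K" "y \<in> X p" using block_mem[OF y(1)] p_def by auto
    have "v p \<in> X p" "rk (v p) = rk p"
      using v(2)[OF p(1)] X_mem[OF p(1)] homeo_rank[OF v(1)] K_sub p by auto
    then have "v p = p" using peaked_unique[OF X_peaked[OF p(1)]] by auto
    moreover have "x \<in> X p" using v(2)[OF p(1)] p y by auto
    ultimately show ?thesis using lab_apply[OF v(1) y(1)] y block_eq[OF p(1)] by (simp add: p_def)
  qed
  then show ?thesis using lab_id by (auto simp: junk_def)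
qed

text \<open>The clopen set \<open>U\<close> is handed over from the block of \<open>z\<close> to
  that of \<open>p\<close>. It contains no top point, so the modified blocks \<open>Y r\<close> are
  peaked at the same points and hence homeomorphic to the old ones; gluing these homeomorphisms
  gives \<open>f\<close>.\<close>

lemma relabel:
  assumes z: "z \<in> T" "z \<notin> K" and p: "p \<in> K" "p \<noteq> block z"
  shows "\<exists>f U. homeo f \<and> peaked U z \<and> U \<subseteq> X (block z) - {block z} \<and>
           (\<forall>x\<in>T. lab f x = (if x \<in> U then p else block x))"
proof -
  define q where "q = block z"
  have q: "q \<in> K" "z \<in> X q" "p \<noteq> q" "z \<noteq> q" using block_mem[OF z(1)] z p unfolding q_def by auto
  obtain V where V: "V \<in> \<A>" "z \<in> V" "V \<subseteq> X q" "q \<notin> V"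
    using avoid_point[OF q(2) X_clopen[OF q(1)]] q(4) by metis
  obtain U where U: "U \<subseteq> V" "peaked U z" using peaked_exists[OF V(1,2)] by blast
  have UA: "U \<in> \<A>" "U \<subseteq> X q" "q \<notin> U" using U V peaked_clopen by auto
  define Y where "Y r = (if r = p then X p \<union> U else if r = q then X q - U else X r)" for r
  have UK: "rk x < \<alpha>" if "x \<in> U" for x
  proof (rule rank_less)
    show "x \<in> T" using that UA X_sub[OF q(1)] by auto
    show "x \<notin> K" using that UA block_eq[OF q(1), of x] block_K[of x] by auto
  qed
  have Y: "peaked (Y r) r" if r: "r \<in> K" for r
  proof -
    have "peaked (X p \<union> U) p"
      using X_peaked[OF p(1)] UK UA K_rank[OF p(1)] clopen_Un by (auto simp: peaked_def)
    moreover have "peaked (X q - U) q"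
      using peaked_subset[OF X_peaked[OF q(1)]] UA X_mem[OF q(1)] clopen_Diff X_clopen[OF q(1)] by auto
    ultimately show ?thesis using X_peaked[OF r] by (simp add: Y_def)
  qed
  have "\<forall>r. r \<in> K \<longrightarrow> (\<exists>f. ciso f (X r) (Y r))" using peaked_ciso[OF X_peaked Y refl] by simp
  then obtain \<phi> where \<phi>: "\<And>r. r \<in> K \<Longrightarrow> ciso (\<phi> r) (X r) (Y r)" by metis
  define f where "f x = \<phi> (block x) x" for x
  have UX: "U \<inter> X r = {}" if "r \<in> K" "r \<noteq> q" for r using X_disjoint[OF that(1) q(1) that(2)] UA by auto
  have Ydis: "Y r \<inter> Y s = {}" if "r \<in> K" "s \<in> K" "r \<noteq> s" for r s
    using X_disjoint[OF that] X_disjoint[OF p(1) that(1)] X_disjoint[OF p(1) that(2)] UX[OF that(1)] UX[OF that(2)] that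
    unfolding Y_def by auto
  have Ycover: "(\<Union>r\<in>K. Y r) = T"
  proof
    show "(\<Union>r\<in>K. Y r) \<subseteq> T" using Y peaked_clopen clopen_sub by blast
    show "T \<subseteq> (\<Union>r\<in>K. Y r)"
    proof
      fix x assume x: "x \<in> T"
      show "x \<in> (\<Union>r\<in>K. Y r)"
      proof (cases "x \<in> U")
        case True
        then show ?thesis using p by (auto simp: Y_def)
      next
        case False
        then have "x \<in> Y (block x)" using block_mem[OF x] by (auto simp: Y_def)
        then show ?thesis using block_mem[OF x] by blast
      qed
    qed
  qed
  have "ciso f (\<Union>r\<in>K. X r) (\<Union>r\<in>K. Y r)"
    by (rule ciso_UN[OF finite_K \<phi> X_disjoint Ydis]) (simp_all add: f_def block_eq)
  then have f: "homeo f" using X_cover Ycover by simp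
  have fY: "f x \<in> Y (block x)" if "x \<in> T" for x
    using ciso_mem[OF \<phi>] block_mem[OF that] by (simp add: f_def)
  have fK: "f r = r" if r: "r \<in> K" for r
  proof -
    have "f r \<in> Y r" using fY[of r] r K_sub block_K by auto
    moreover have "rk (f r) = rk r" using homeo_rank[OF f] r K_sub by auto
    ultimately show ?thesis using peaked_unique[OF Y[OF r]] by auto
  qed
  have "lab f y = (if y \<in> U then p else block y)" if y: "y \<in> T" for y
  proof -
    define x where "x = inv_into T f y"
    have x: "x \<in> T" "f x = y" unfolding x_def using y homeo_inv_mem[OF f] homeo_inv_right[OF f] by auto
    define r where "r = block x"
    have r: "r \<in> K" "y \<in> Y r" using block_mem[OF x(1)] fY[OF x(1)] x r_def by auto
    have "lab f y = r" using lab_apply[OF f x(1)] x fK[OF r(1)] by (simp add: r_def)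
    moreover have "r = p" if "y \<in> U" using that r UX[OF r(1)] by (auto simp: Y_def split: if_splits)
    moreover have "block y = r" if "y \<notin> U" using that r by (intro block_eq) (auto simp: Y_def split: if_splits)
    ultimately show ?thesis by auto
  qed
  moreover have "U \<subseteq> X q - {q}" using UA by auto
  ultimately show ?thesis using f U(2) unfolding q_def by blast
qed

end

section \<open>Upper bounds for lengths in terms of junk\<close>

locale split_length_space =
  split_space T \<A> rk \<alpha> K X + length_space T \<A> rk L
  for T :: "'a set" and \<A> and rk :: "'a \<Rightarrow> 'o::wellorder" and \<alpha> K X L
begin

text \<open>A homeomorphism that preserves every block is a product of one factor per block, each
  bounded by \<open>bounded_peaked\<close>. The induction peels off one block at a time.\<close>

lemma bounded_stabilizer:
  "\<exists>C. \<forall>g. homeo g \<and> (\<forall>p\<in>K. g ` X p = X p) \<longrightarrow> L g \<le> C"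
proof -
  have "\<exists>C. \<forall>g. homeo g \<and> (\<forall>p\<in>K. g ` X p = X p) \<and> supported g (\<Union>p\<in>Q. X p) \<longrightarrow> L g \<le> C"
    if "finite Q" "Q \<subseteq> K" for Q
    using that
  proof (induction Q rule: finite_induct)
    case empty
    have "L g = L id" if "supported g {}" for g
      using that by (intro L_cong) (auto simp: supported_def)
    then show ?case by (intro exI[of _ "L id"]) auto
  next
    case (insert q Q)
    have q: "q \<in> K" using insert by auto
    obtain C where C: "\<And>g. homeo g \<Longrightarrow> (\<And>p. p \<in> K \<Longrightarrow> g ` X p = X p) \<Longrightarrow> supported g (\<Union>p\<in>Q. X p) \<Longrightarrow> L g \<le> C"
      using insert by (metis insert_subset)
    obtain C' where C': "\<And>g. homeo g \<Longrightarrow> supported g (X q) \<Longrightarrow> L g \<le> C'"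
      using bounded_peaked[OF X_peaked[OF q]] by metis
    have "L g \<le> C' + C"
      if g: "homeo g" and gX: "\<And>p. p \<in> K \<Longrightarrow> g ` X p = X p" and sup: "supported g (\<Union>p\<in>insert q Q. X p)" for g
    proof -
      define D where "D = T - X q"
      have D: "D \<in> \<A>" unfolding D_def using clopen_Diff[OF clopen_T X_clopen[OF q]] .
      have gD: "g ` D = D" unfolding D_def
        using inj_on_image_set_diff[OF ciso_inj[OF g], of T "X q"] X_sub[OF q] gX[OF q] ciso_image[OF g] by auto
      define a where "a x = (if x \<in> X q then g x else x)" for x
      define r where "r x = (if x \<in> D then g x else x)" for x
      have a: "homeo a" unfolding a_def using homeo_extend homeo_ciso[OF g X_clopen[OF q]] gX[OF q] by simp
      have r: "homeo r" unfolding r_def using homeo_extend homeo_ciso[OF g D] gD by simp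
      have rX: "r ` X p = X p" if p: "p \<in> K" for p
      proof (cases "p = q")
        case True
        then have "r ` X p = id ` X p" by (intro image_cong) (auto simp: r_def D_def)
        then show ?thesis by simp
      next
        case False
        then have "X p \<subseteq> D" using X_sub[OF p] X_disjoint[OF p q] unfolding D_def by auto
        then have "r ` X p = g ` X p" by (intro image_cong) (auto simp: r_def)
        then show ?thesis using gX[OF p] by simp
      qed
      have "supported r (\<Union>p\<in>Q. X p)" using sup by (auto simp: supported_def r_def D_def)
      then have "L r \<le> C" using C r rX by simp
      moreover have "L a \<le> C'" using C' a by (simp add: supported_def a_def)
      moreover have "L g = L (a \<circ> r)"
      proof (rule L_cong)
        fix x assume x: "x \<in> T"
        show "g x = (a \<circ> r) x"
        proof (cases "x \<in> D")
          case True
          then have "g x \<in> D" using gD by blast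
          then show ?thesis using True by (simp add: a_def r_def D_def)
        next
          case False
          then show ?thesis using x by (simp add: a_def r_def D_def)
        qed
      qed
      ultimately show ?thesis using L_comp[OF a r] by simp
    qed
    then show ?case by blast
  qed
  from this[OF finite_K order_refl] obtain C
    where "\<forall>g. homeo g \<and> (\<forall>p\<in>K. g ` X p = X p) \<and> supported g T \<longrightarrow> L g \<le> C"
    using X_cover by auto
  moreover have "supported g T" for g by (simp add: supported_def)
  ultimately show ?thesis by blast
qed

text \<open>Empty junk means that the blocks are permuted as whole sets. There are finitely many
  permutations of \<open>K\<close>, and dividing by a chosen representative of the permutation
  leaves a homeomorphism that preserves every block.\<close>

lemma bounded_permuting:
  "\<exists>C. \<forall>g. homeo g \<and> junk id g = {} \<longrightarrow> L g \<le> C"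
proof -
  obtain C where C: "\<And>g. homeo g \<Longrightarrow> (\<And>p. p \<in> K \<Longrightarrow> g ` X p = X p) \<Longrightarrow> L g \<le> C"
    using bounded_stabilizer by metis
  define W where "W = {g. homeo g \<and> junk id g = {}}"
  define R where "R = (\<lambda>g. restrict g K) ` W"
  have "R \<subseteq> K \<rightarrow>\<^sub>E K" unfolding R_def W_def using homeo_K by auto
  then have fR: "finite R" using finite_PiE[OF finite_K, of "\<lambda>_. K"] finite_K finite_subset by blast
  define \<tau> where "\<tau> \<pi> = (SOME g. g \<in> W \<and> restrict g K = \<pi>)" for \<pi>
  have \<tau>: "\<tau> \<pi> \<in> W" "restrict (\<tau> \<pi>) K = \<pi>" if "\<pi> \<in> R" for \<pi>
  proof -
    have "\<exists>g. g \<in> W \<and> restrict g K = \<pi>" using that unfolding R_def by auto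
    then show "\<tau> \<pi> \<in> W" "restrict (\<tau> \<pi>) K = \<pi>" unfolding \<tau>_def using someI_ex by (metis (mono_tags, lifting))+
  qed
  define B where "B = Max ((\<lambda>\<pi>. L (\<tau> \<pi>)) ` R)"
  have maps: "g x \<in> X (g (block x))" if "g \<in> W" "x \<in> T" for g x
  proof -
    have g: "homeo g" using that W_def by auto
    have gx: "g x \<in> T" using homeo_mem[OF g that(2)] .
    then have "block (g x) = lab g (g x)" using that lab_id[OF gx] unfolding W_def junk_def by auto
    then have "block (g x) = g (block x)" using lab_apply[OF g that(2)] by simp
    then show ?thesis using block_mem[OF gx] by simp
  qed
  have "L g \<le> B + C" if g: "g \<in> W" for g
  proof -
    define \<pi> where "\<pi> = restrict g K"
    have \<pi>: "\<pi> \<in> R" using g unfolding \<pi>_def R_def by auto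
    define t where "t = \<tau> \<pi>"
    have t: "t \<in> W" "homeo t" "\<And>p. p \<in> K \<Longrightarrow> t p = g p"
      using \<tau>[OF \<pi>] unfolding t_def W_def \<pi>_def by (auto simp: restrict_def fun_eq_iff) metis
    have hg: "homeo g" using g W_def by auto
    have "L t \<le> B" unfolding t_def B_def using fR \<pi> by auto
    define s where "s = inv_into T t \<circ> g"
    have s: "homeo s" unfolding s_def using ciso_comp[OF hg homeo_inv[OF t(2)]] .
    have sX: "s x \<in> X p" if p: "p \<in> K" and x: "x \<in> X p" for p x
    proof -
      have xT: "x \<in> T" using X_sub[OF p] x by auto
      have sx: "s x \<in> T" using homeo_mem[OF s xT] .
      have "t (s x) = g x" unfolding s_def using homeo_inv_right[OF t(2)] homeo_mem[OF hg xT] by simp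
      then have "g x \<in> X (t (block (s x)))" using maps[OF t(1) sx] by simp
      moreover have "g x \<in> X (g p)" using maps[OF g xT] block_eq[OF p x] by simp
      ultimately have "t (block (s x)) = g p"
        using block_eq homeo_K[OF hg p] homeo_K[OF t(2)] block_mem[OF sx] by metis
      then have "t (block (s x)) = t p" using t(3)[OF p] by simp
      then have "block (s x) = p" using homeo_eq_iff[OF t(2)] block_mem[OF sx] K_sub p by blast
      then show ?thesis using block_mem[OF sx] by simp
    qed
    have "s ` X p = X p" if p: "p \<in> K" for p
    proof
      show "s ` X p \<subseteq> X p" using sX[OF p] by auto
      show "X p \<subseteq> s ` X p"
      proof
        fix y assume y: "y \<in> X p"
        then obtain x where x: "x \<in> T" "y = s x" using ciso_image[OF s] X_sub[OF p] by blast
        have "s x \<in> X (block x)" using sX block_mem[OF x(1)] by auto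
        then have "block x = p" using block_eq y p x block_mem by metis
        then show "y \<in> s ` X p" using x block_mem by blast
      qed
    qed
    then have "L s \<le> C" using C[OF s] by simp
    moreover have "L g = L (t \<circ> s)"
      by (rule L_cong) (simp add: s_def homeo_inv_right[OF t(2)] homeo_mem[OF hg])
    ultimately show ?thesis using L_comp[OF t(2) s] \<open>L t \<le> B\<close> by simp
  qed
  then show ?thesis unfolding W_def by blast
qed

text \<open>A reservoir \<open>R p\<close> with peak \<open>r p\<close> of rank \<beta> is fixed in
  every block. A block-preserving \<open>v\<close> pushes the junk into the reservoirs, a map
  \<open>h\<close> supported in their union \<open>RR\<close> corrects the labels there, and what
  remains permutes the blocks. Since \<beta> < \<alpha>, the union of \<open>RR\<close> with one
  block is peaked, so the length of \<open>h\<close> is bounded in advance.\<close>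

theorem bounded_junk:
  assumes \<beta>: "\<beta> < \<alpha>"
  shows "\<exists>C. \<forall>g. homeo g \<and> (\<forall>x\<in>junk id g. rk x < \<beta>) \<longrightarrow> L g \<le> C"
proof -
  have "\<exists>R r. peaked R r \<and> R \<subseteq> X p - {p} \<and> rk r = \<beta>" if p: "p \<in> K" for p
  proof -
    obtain r where r: "r \<in> X p" "rk r = \<beta>"
      using rank_dense[OF X_clopen[OF p] X_mem[OF p], of \<beta>] \<beta> K_rank[OF p] by auto
    have "p \<noteq> r" using r \<beta> K_rank[OF p] by auto
    then obtain V where V: "V \<in> \<A>" "r \<in> V" "V \<subseteq> X p" "p \<notin> V"
      using avoid_point[OF r(1) X_clopen[OF p]] by blast
    then show ?thesis using peaked_exists[OF V(1,2)] r(2) by blast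
  qed
  then obtain R r where R: "\<And>p. p \<in> K \<Longrightarrow> peaked (R p) (r p) \<and> R p \<subseteq> X p - {p} \<and> rk (r p) = \<beta>"
    by metis
  have RA: "R p \<in> \<A>" "r p \<in> R p" "R p \<subseteq> X p" "p \<notin> R p" "r p \<in> T" "rk (r p) = \<beta>" if "p \<in> K" for p
    using R[OF that] peaked_clopen[of "R p" "r p"] peaked_mem[of "R p" "r p"] X_sub[OF that] by auto
  define RR where "RR = (\<Union>p\<in>K. R p)"
  have RR: "RR \<in> \<A>" unfolding RR_def using RA by (intro clopen_UN[OF finite_K]) auto
  have RRT: "RR \<subseteq> T" using clopen_sub[OF RR] .
  have Rdis: "R p \<inter> R q = {}" if "p \<in> K" "q \<in> K" "p \<noteq> q" for p q
    using X_disjoint[OF that] RA that by blast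
  have RRX: "x \<in> R (block x)" if "x \<in> RR" for x
    using that RA block_eq unfolding RR_def by (metis UN_E subsetD)
  have rank_RR: "rk x \<le> \<beta>" if "x \<in> RR" for x
    using that R peaked_less RA(6) unfolding RR_def by (metis UN_E less_imp_le order_refl)
  have RK: "p \<notin> RR" if "p \<in> K" for p using RRX[of p] block_K[OF that] RA(4)[OF that] by auto
  obtain p0 where p0: "p0 \<in> K" using K_nonempty by auto
  have "peaked (X p0 \<union> RR) p0"
    unfolding peaked_def using clopen_Un[OF X_clopen[OF p0] RR] X_mem[OF p0] K_rank[OF p0]
      peaked_less[OF X_peaked[OF p0]] rank_RR \<beta> by (auto intro: le_less_trans)
  then obtain C0 where C0: "\<And>g. homeo g \<Longrightarrow> supported g (X p0 \<union> RR) \<Longrightarrow> L g \<le> C0"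
    using bounded_peaked by metis
  obtain C1 where C1: "\<And>g. homeo g \<Longrightarrow> (\<And>p. p \<in> K \<Longrightarrow> g ` X p = X p) \<Longrightarrow> L g \<le> C1"
    using bounded_stabilizer by metis
  obtain C2 where C2: "\<And>g. homeo g \<Longrightarrow> junk id g = {} \<Longrightarrow> L g \<le> C2"
    using bounded_permuting by metis
  have "L g \<le> C0 + C1 + C2" if g: "homeo g" and small: "\<And>x. x \<in> junk id g \<Longrightarrow> rk x < \<beta>" for g
  proof -
    have hid: "homeo id" using ciso_id[OF clopen_T] .
    define M where "M = junk id g"
    have M: "M \<in> \<A>" unfolding M_def using junk_clopen[OF hid g] .
    have Mlab: "x \<in> M \<longleftrightarrow> x \<in> T \<and> lab g x \<noteq> block x" for x
      unfolding M_def junk_def using lab_id by auto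
    have "\<exists>v. homeo v \<and> supported v (X p) \<and> v ` (M \<inter> X p) \<subseteq> R p" if p: "p \<in> K" for p
    proof -
      have MX: "M \<inter> X p \<in> \<A>" using M X_clopen[OF p] clopen_Int by auto
      have "rk y < rk (r p)" if "y \<in> M \<inter> X p" for y using small that RA(6)[OF p] unfolding M_def by auto
      from embed[OF MX this RA(1,2)[OF p]] obtain f N where f: "ciso f (M \<inter> X p) N" "N \<subseteq> R p - {r p}" by blast
      have pM: "p \<notin> M" using Mlab lab_K[OF g p] block_K[OF p] by auto
      have sub: "M \<inter> X p \<subseteq> X p - {p}" "N \<subseteq> X p - {p}" using pM f(2) RA[OF p] by auto
      obtain v where "homeo v" "supported v (X p)" "\<forall>x\<in>M \<inter> X p. v x = f x"
        using move[OF X_peaked[OF p] f(1) sub] by blast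
      moreover have "f x \<in> R p" if "x \<in> M \<inter> X p" for x using ciso_mem[OF f(1) that] f(2) by auto
      ultimately show ?thesis by (intro exI[of _ v]) auto
    qed
    then obtain w where w: "\<And>p. p \<in> K \<Longrightarrow> homeo (w p) \<and> supported (w p) (X p) \<and> w p ` (M \<inter> X p) \<subseteq> R p"
      by metis
    define v where "v x = w (block x) x" for x
    have wX: "ciso (w p) (X p) (X p)" if "p \<in> K" for p
      using w[OF that] homeo_ciso[OF _ X_clopen[OF that]] supported_image[OF _ _ order_refl X_sub[OF that]] by metis
    have vw: "v x = w p x" if "p \<in> K" "x \<in> X p" for p x using block_eq[OF that] by (simp add: v_def)
    have "ciso v (\<Union>p\<in>K. X p) (\<Union>p\<in>K. X p)"
      by (rule ciso_UN[OF finite_K wX X_disjoint X_disjoint]) (simp_all add: vw)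
    then have v: "homeo v" using X_cover by simp
    have vX: "v ` X p = X p" if p: "p \<in> K" for p
    proof -
      have "v ` X p = w p ` X p" using vw[OF p] by (intro image_cong) auto
      then show ?thesis using ciso_image[OF wX[OF p]] by simp
    qed
    have vK: "v p = p" if p: "p \<in> K" for p
      using vw[OF p X_mem[OF p]] peaked_fixed[OF _ _ X_peaked[OF p]] w[OF p] by auto
    have vb: "block (v x) = block x" if "x \<in> T" for x
      using block_eq[of "block x" "v x"] block_mem[OF that] vX by auto
    have vM: "v x \<in> R (block x)" if "x \<in> M" for x
    proof -
      have "x \<in> T" using that Mlab by auto
      then show ?thesis using w[of "block x"] vw block_mem that by fastforce
    qed
    define g1 where "g1 = v \<circ> g"
    have g1: "homeo g1" unfolding g1_def using ciso_comp[OF g v] .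
    have lab1: "lab g1 (v x) = lab g x" if "x \<in> T" for x
      unfolding g1_def using lab_comp[OF v g that] vK[OF lab_mem[OF g that]] by simp
    have junk1: "y \<in> RR \<and> rk y < \<beta>" if y: "y \<in> T" "lab g1 y \<noteq> block y" for y
    proof -
      obtain x where x: "x \<in> T" "y = v x" using ciso_image[OF v] y(1) by blast
      then have "x \<in> M" using y(2) lab1 vb Mlab by simp
      then show ?thesis using vM[of x] x small homeo_rank[OF v x(1)] block_mem[OF x(1)]
        unfolding RR_def M_def by auto
    qed
    \<comment> \<open>\<open>E p\<close> is the part of the reservoirs that is labelled
      \<open>p\<close> after \<open>v\<close>. The points \<open>r p\<close> have rank \<beta>, too
      large for junk, so they carry the right label; thus \<open>E p\<close> is peaked at
      \<open>r p\<close> and homeomorphic to \<open>R p\<close>.\<close>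
    define E where "E p = {x \<in> RR. lab g1 x = p}" for p
    have EA: "E p \<in> \<A>" if "p \<in> K" for p
    proof -
      have "E p = RR \<inter> {x \<in> T. lab g1 x = p}" using RRT by (auto simp: E_def)
      then show ?thesis using clopen_Int[OF RR lab_fiber_clopen[OF g1 that]] by simp
    qed
    have lab_r: "lab g1 (r p) = p" if p: "p \<in> K" for p
      using junk1[of "r p"] RA[OF p] block_eq[OF p, of "r p"] by (metis less_irrefl subsetD)
    have Ep: "peaked (E p) (r p)" if p: "p \<in> K" for p
    proof -
      have "rk y < \<beta>" if y: "y \<in> E p" "y \<noteq> r p" for y
      proof (cases "block y = p")
        case True
        then have "y \<in> R p" using RRX y by (auto simp: E_def)
        then show ?thesis using peaked_less[of "R p" "r p" y] R[OF p] y by auto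
      next
        case False
        then show ?thesis using junk1[of y] y RRT by (auto simp: E_def)
      qed
      moreover have "r p \<in> E p" using lab_r[OF p] RA[OF p] p by (auto simp: E_def RR_def)
      ultimately show ?thesis using EA[OF p] RA[OF p] by (auto simp: peaked_def)
    qed
    have "\<forall>p. p \<in> K \<longrightarrow> (\<exists>f. ciso f (E p) (R p))"
    proof (intro allI impI)
      fix p assume p: "p \<in> K"
      show "\<exists>f. ciso f (E p) (R p)" using peaked_ciso[OF Ep[OF p] _ refl] R[OF p] by simp
    qed
    then obtain \<theta> where \<theta>: "\<And>p. p \<in> K \<Longrightarrow> ciso (\<theta> p) (E p) (R p)" by metis
    define h0 where "h0 x = \<theta> (lab g1 x) x" for x
    have EE: "(\<Union>p\<in>K. E p) = RR" using lab_mem[OF g1] RRT by (auto simp: E_def)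
    have "ciso h0 (\<Union>p\<in>K. E p) (\<Union>p\<in>K. R p)"
      by (rule ciso_UN[OF finite_K \<theta> _ Rdis]) (auto simp: h0_def E_def)
    then have h0: "ciso h0 RR RR" using EE by (simp add: RR_def)
    define h where "h x = (if x \<in> RR then h0 x else x)" for x
    have h: "homeo h" unfolding h_def using homeo_extend[OF h0] .
    have hRR: "supported h RR" by (simp add: supported_def h_def)
    have hK: "h p = p" if "p \<in> K" for p using RK[OF that] by (simp add: h_def)
    define t where "t = h \<circ> g1"
    have t: "homeo t" unfolding t_def using ciso_comp[OF g1 h] .
    have "lab t y = block y" if y: "y \<in> T" for y
    proof -
      obtain x where x: "x \<in> T" "y = h x" using ciso_image[OF h] y by blast
      have l: "lab g1 x \<in> K" using lab_mem[OF g1 x(1)] .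
      have "lab t y = lab g1 x" unfolding t_def x(2) using lab_comp[OF h g1 x(1)] hK[OF l] by simp
      moreover have "block y = lab g1 x"
      proof (cases "x \<in> RR")
        case True
        then have "h x \<in> R (lab g1 x)" using ciso_mem[OF \<theta>[OF l], of x] by (auto simp: E_def h_def h0_def)
        then show ?thesis using block_eq[OF l] RA(3)[OF l] x by auto
      next
        case False
        then have "lab g1 x = block x" using junk1[OF x(1)] by blast
        then show ?thesis using False x by (simp add: h_def)
      qed
      ultimately show ?thesis by simp
    qed
    then have "junk id t = {}" using lab_id by (auto simp: junk_def)
    then have Lt: "L t \<le> C2" using C2[OF t] by simp
    have Lh: "L h \<le> C0" using C0[OF h supported_mono[OF hRR]] by auto
    have Lv: "L v \<le> C1" using C1[OF v vX] by simp
    \<comment> \<open>Undoing both corrections writes \<open>g\<close> as a product of the inverses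
      of \<open>v\<close> and \<open>h\<close> with \<open>t\<close>, which are bounded by
      \<open>C1\<close>, \<open>C0\<close> and \<open>C2\<close>.\<close>
    have "L g = L (inv_into T v \<circ> (inv_into T h \<circ> t))"
      by (rule L_cong) (simp add: t_def g1_def homeo_inv_left[OF h] homeo_inv_left[OF v] homeo_mem[OF g] homeo_mem[OF v])
    then show ?thesis
      using L_comp[OF homeo_inv[OF v] ciso_comp[OF t homeo_inv[OF h]]] L_comp[OF homeo_inv[OF h] t]
        L_inv[OF v] L_inv[OF h] Lt Lh Lv by simp
  qed
  then show ?thesis by blast
qed

end

section \<open>The compact-open topology\<close>

definition clopens :: "'a topology \<Rightarrow> 'a set set" where
  "clopens X = {U. openin X U \<and> closedin X U}"

text \<open>A Urysohn function has countable range here, so it misses some \<open>r\<close> between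
  0 and 1; cutting at \<open>r\<close> gives a set that is both open and closed.\<close>

lemma clopens_separate:
  assumes "compact_space X" "Hausdorff_space X" "countable (topspace X)"
    and "x \<in> topspace X" "y \<in> topspace X" "x \<noteq> y"
  shows "\<exists>U\<in>clopens X. x \<in> U \<and> y \<notin> U"
proof -
  have normal: "normal_space X"
    using compact_Hausdorff_or_regular_imp_normal_space assms(1,2) by blast
  have "closedin X {x}" "closedin X {y}" "disjnt {x} {y}"
    using assms(2,4,5,6) by (auto simp: closedin_Hausdorff_singleton)
  then obtain f where f: "continuous_map X euclideanreal f" "f ` {x} \<subseteq> {0}" "f ` {y} \<subseteq> {1}"
    using Urysohn_lemma_alt[OF normal] by metis
  have "countable (f ` topspace X)" using assms(3) by auto
  then have "\<not> {0<..<1} \<subseteq> f ` topspace X"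
    using uncountable_open_interval[of 0 "1::real"] countable_subset by auto
  then obtain r where "r \<in> {0<..<1}" and r3: "r \<notin> f ` topspace X" by blast
  then have r: "0 < r" "r < 1" "r \<notin> f ` topspace X" by auto
  define U where "U = {z \<in> topspace X. f z \<in> {..<r}}"
  have "U = {z \<in> topspace X. f z \<in> {..r}}" using r(3) unfolding U_def by (auto simp: less_le)
  then have "closedin X U" using closedin_continuous_map_preimage[OF f(1), of "{..r}"] by auto
  moreover have "openin X U" unfolding U_def using openin_continuous_map_preimage[OF f(1), of "{..<r}"] by auto
  ultimately have "U \<in> clopens X" by (simp add: clopens_def)
  moreover have "x \<in> U" "y \<notin> U" using f r assms(4) unfolding U_def by auto
  ultimately show ?thesis by blast
qed

lemma clopen_space_clopens:
  assumes "compact_space X" "Hausdorff_space X" "countable (topspace X)"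
  shows "clopen_space (topspace X) (clopens X)"
proof
  fix U \<C> assume U: "U \<in> clopens X" "\<C> \<subseteq> clopens X" "U \<subseteq> \<Union>\<C>"
  then have "compactin X U" using closedin_compact_space[OF assms(1)] by (auto simp: clopens_def)
  moreover have "\<forall>V\<in>\<C>. openin X V" using U by (auto simp: clopens_def)
  ultimately show "\<exists>\<F>. finite \<F> \<and> \<F> \<subseteq> \<C> \<and> U \<subseteq> \<Union>\<F>"
    using U(3) unfolding compactin_def by meson
qed (use assms clopens_separate in \<open>auto simp: clopens_def openin_subset\<close>)

text \<open>The complement of \<open>W\<close> is compact and covered by the clopen sets that miss
  \<open>x\<close>; the union of finitely many of them is removed from the space.\<close>

lemma clopens_base:
  assumes X: "compact_space X" "Hausdorff_space X" "countable (topspace X)"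
    and W: "openin X W" "x \<in> W"
  shows "\<exists>U\<in>clopens X. x \<in> U \<and> U \<subseteq> W"
proof -
  interpret clopen_space "topspace X" "clopens X" by (rule clopen_space_clopens[OF X])
  have xT: "x \<in> topspace X" using W openin_subset by auto
  define \<C> where "\<C> = {V \<in> clopens X. x \<notin> V}"
  have "compactin X (topspace X - W)" using closedin_compact_space[OF X(1)] W(1) by blast
  moreover have "\<forall>V\<in>\<C>. openin X V" by (auto simp: \<C>_def clopens_def)
  moreover have "topspace X - W \<subseteq> \<Union>\<C>"
  proof
    fix y assume "y \<in> topspace X - W"
    then have "y \<in> topspace X" "y \<noteq> x" using W by auto
    then show "y \<in> \<Union>\<C>" using separated[of y x] xT by (auto simp: \<C>_def)
  qed
  ultimately obtain \<F> where \<F>: "finite \<F>" "\<F> \<subseteq> \<C>" "topspace X - W \<subseteq> \<Union>\<F>"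
    unfolding compactin_def by meson
  have "(\<Union>V\<in>\<F>. V) \<in> clopens X" using \<F> by (intro clopen_UN) (auto simp: \<C>_def)
  then have "topspace X - \<Union>\<F> \<in> clopens X" using clopen_Diff[OF clopen_T] by simp
  moreover have "x \<in> topspace X - \<Union>\<F>" using xT \<F>(2) by (auto simp: \<C>_def)
  ultimately show ?thesis using \<F>(3) by (intro bexI[of _ "topspace X - \<Union>\<F>"]) auto
qed

text \<open>Clopen sets form a base, so a bijection that matches them is open in both directions.
  This translates the group into the language of the clopen algebra.\<close>

lemma homeomorphic_map_iff_ciso:
  assumes X: "compact_space X" "Hausdorff_space X" "countable (topspace X)"
  shows "homeomorphic_map X X f \<longleftrightarrow> clopen_space.ciso (clopens X) f (topspace X) (topspace X)"
proof -
  interpret clopen_space "topspace X" "clopens X" by (rule clopen_space_clopens[OF X])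
  show ?thesis
  proof
    assume f: "homeomorphic_map X X f"
    show "homeo f"
    proof (rule cisoI[OF clopen_T clopen_T])
      show "bij_betw f (topspace X) (topspace X)"
        using homeomorphic_imp_surjective_map[OF f] homeomorphic_imp_injective_map[OF f] by (auto simp: bij_betw_def)
      show "f ` U \<in> clopens X \<longleftrightarrow> U \<in> clopens X" if "U \<subseteq> topspace X" for U
        using homeomorphic_map_openness[OF f that] homeomorphic_map_closedness[OF f that]
        by (simp add: clopens_def)
    qed
  next
    have open_map: "openin X (f ` U)" if f: "homeo f" and U: "openin X U" for f U
    proof (subst openin_subopen, intro ballI)
      fix y assume "y \<in> f ` U"
      then obtain x where x: "x \<in> U" "y = f x" by blast
      obtain V where V: "V \<in> clopens X" "x \<in> V" "V \<subseteq> U" using clopens_base[OF X U x(1)] by blast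
      have "openin X (f ` V)" using homeo_image_clopen[OF f V(1)] by (simp add: clopens_def)
      then show "\<exists>W. openin X W \<and> y \<in> W \<and> W \<subseteq> f ` U" using V x by blast
    qed
    assume f: "homeo f"
    show "homeomorphic_map X X f"
    proof (rule bijective_open_imp_homeomorphic_map)
      show "open_map X X f" using open_map[OF f] by (simp add: open_map_def)
      show "continuous_map X X f"
        unfolding continuous_map_def
      proof (intro conjI allI impI)
        show "f \<in> topspace X \<rightarrow> topspace X" using homeo_mem[OF f] by auto
        fix U assume U: "openin X U"
        have "{x \<in> topspace X. f x \<in> U} = inv_into (topspace X) f ` U"
        proof (intro Set.set_eqI iffI)
          fix x assume "x \<in> {x \<in> topspace X. f x \<in> U}"
          then show "x \<in> inv_into (topspace X) f ` U" using homeo_inv_left[OF f, of x] by force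
        next
          fix x assume "x \<in> inv_into (topspace X) f ` U"
          then obtain y where y: "y \<in> U" "x = inv_into (topspace X) f y" by blast
          then have "y \<in> topspace X" using openin_subset[OF U] by auto
          then show "x \<in> {x \<in> topspace X. f x \<in> U}"
            using y homeo_inv_right[OF f] homeo_inv_mem[OF f] by auto
        qed
        then show "openin X {x \<in> topspace X. f x \<in> U}" using open_map[OF homeo_inv[OF f] U] by simp
      qed
      show "f ` topspace X = topspace X" using ciso_image[OF f] .
      show "inj_on f (topspace X)" using ciso_inj[OF f] .
    qed
  qed
qed

locale countable_stone =
  fixes X :: "'a topology"
  assumes compact_X: "compact_space X"
    and Hausdorff_X: "Hausdorff_space X"
    and countable_X: "countable (topspace X)"

sublocale countable_stone \<subseteq> clopen_space "topspace X" "clopens X"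
  by (rule clopen_space_clopens[OF compact_X Hausdorff_X countable_X])

context countable_stone
begin

lemmas base = clopens_base[OF compact_X Hausdorff_X countable_X]

abbreviation T :: "'a set" where "T \<equiv> topspace X"

text \<open>Group elements are extensional, whereas \<open>homeo\<close> looks only at values on
  \<open>T\<close>. Constructions use arbitrary functions and become group elements by
  \<open>restrict\<close>; the congruence conditions on lengths and distances make this
  harmless.\<close>

lemma carrier_Homeo: "g \<in> carrier (Homeo X) \<longleftrightarrow> g \<in> extensional T \<and> homeo g"
  using homeomorphic_map_iff_ciso[OF compact_X Hausdorff_X countable_X, of g] ciso_bij[of g T T]
  by (auto simp: Homeo_def Bij_def)

lemma mult_Homeo:
  "g \<in> carrier (Homeo X) \<Longrightarrow> h \<in> carrier (Homeo X) \<Longrightarrow> g \<otimes>\<^bsub>Homeo X\<^esub> h = restrict (g \<circ> h) T"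
  by (auto simp: Homeo_def BijGroup_def compose_def restrict_def)

lemma homeo_restrict: "homeo (restrict g T) \<longleftrightarrow> homeo g"
  by (rule ciso_cong) simp

lemma restrict_carrier: "homeo g \<Longrightarrow> restrict g T \<in> carrier (Homeo X)"
  by (simp add: carrier_Homeo homeo_restrict)

lemma homeo_id: "homeo id"
  using ciso_id[OF clopen_T] .

lemma homeo_comp: "homeo g \<Longrightarrow> homeo h \<Longrightarrow> homeo (g \<circ> h)"
  by (rule ciso_comp)

lemma restrict_image: "U \<subseteq> T \<Longrightarrow> restrict g T ` U = g ` U"
  by (intro image_cong) auto

section \<open>Neighbourhoods and continuity in the compact-open topology\<close>

lemma topspace_compact_open: "topspace (compact_open_topology X) = carrier (Homeo X)"
proof -
  have "carrier (Homeo X) = {f \<in> carrier (Homeo X). f ` {} \<subseteq> {}}" by simp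
  moreover have "compactin X {}" "openin X {}" by auto
  ultimately have "carrier (Homeo X) \<in> {{f \<in> carrier (Homeo X). f ` K \<subseteq> U} | K U. compactin X K \<and> openin X U}"
    by blast
  then show ?thesis unfolding compact_open_topology_def topology_generated_by_topspace by blast
qed

lemma compact_open_basic:
  "compactin X K \<Longrightarrow> openin X U \<Longrightarrow> openin (compact_open_topology X) {f \<in> carrier (Homeo X). f ` K \<subseteq> U}"
  unfolding compact_open_topology_def by (rule topology_generated_by_Basis) blast

lemma clopen_compactin: "U \<in> clopens X \<Longrightarrow> compactin X U"
  using closedin_compact_space[OF compact_X] by (simp add: clopens_def)

text \<open>For a clopen \<open>P\<close> the equality of images splits into two subbasic
  conditions, one for \<open>P\<close> and one for its complement, both compact with open
  targets.\<close>

lemma coset_open: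
  assumes "finite \<P>" "\<P> \<subseteq> clopens X" and g: "g \<in> carrier (Homeo X)"
  shows "openin (compact_open_topology X) {h \<in> carrier (Homeo X). \<forall>P\<in>\<P>. h ` P = g ` P}"
  using assms(1,2)
proof (induction \<P> rule: finite_induct)
  case empty
  then show ?case using openin_topspace[of "compact_open_topology X"] by (simp add: topspace_compact_open)
next
  case (insert P \<P>)
  have P: "P \<in> clopens X" "P \<subseteq> T" using insert clopen_sub by auto
  have g': "homeo g" using g carrier_Homeo by simp
  have "openin X (g ` Q)" "compactin X Q" if "Q \<in> clopens X" for Q
    using homeo_image_clopen[OF g' that] clopen_compactin[OF that] by (simp_all add: clopens_def)
  then have "openin (compact_open_topology X) {h \<in> carrier (Homeo X). h ` Q \<subseteq> g ` Q}" if "Q \<in> clopens X" for Q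
    using compact_open_basic that by blast
  then have "openin (compact_open_topology X)
     ({h \<in> carrier (Homeo X). h ` P \<subseteq> g ` P} \<inter> {h \<in> carrier (Homeo X). h ` (T - P) \<subseteq> g ` (T - P)} \<inter>
      {h \<in> carrier (Homeo X). \<forall>P\<in>\<P>. h ` P = g ` P})"
    using P insert clopen_Diff[OF clopen_T P(1)] by auto
  moreover have "h ` P \<subseteq> g ` P \<and> h ` (T - P) \<subseteq> g ` (T - P) \<longleftrightarrow> h ` P = g ` P"
    if h: "h \<in> carrier (Homeo X)" for h
  proof -
    have h': "homeo h" using h carrier_Homeo by simp
    have d: "k ` (T - P) = T - k ` P" "k ` P \<subseteq> T" if "homeo k" for k
      using inj_on_image_set_diff[OF ciso_inj[OF that], of T P] image_mono[OF P(2), of k] P ciso_image[OF that] by auto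
    show ?thesis unfolding d(1)[OF h'] d(1)[OF g'] using d(2)[OF h'] d(2)[OF g'] by blast
  qed
  then have "{h \<in> carrier (Homeo X). h ` P \<subseteq> g ` P} \<inter> {h \<in> carrier (Homeo X). h ` (T - P) \<subseteq> g ` (T - P)} \<inter>
      {h \<in> carrier (Homeo X). \<forall>P\<in>\<P>. h ` P = g ` P} = {h \<in> carrier (Homeo X). \<forall>P\<in>insert P \<P>. h ` P = g ` P}"
    by (intro Set.set_eqI) (simp only: Int_iff mem_Collect_eq ball_simps(7), metis)
  ultimately show ?case by simp
qed

text \<open>The converse of \<open>coset_open\<close> at the identity: if a compact \<open>K\<close>
  lies in an open \<open>U\<close>, then \<open>K\<close> has a finite clopen cover inside
  \<open>U\<close>, and a homeomorphism that preserves its members keeps \<open>K\<close> in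
  \<open>U\<close>.\<close>

lemma identity_nbhd:
  assumes "openin (compact_open_topology X) W" "restrict id T \<in> W"
  shows "\<exists>\<P>. finite \<P> \<and> \<P> \<subseteq> clopens X \<and> (\<forall>g. homeo g \<and> (\<forall>P\<in>\<P>. g ` P = P) \<longrightarrow> restrict g T \<in> W)"
proof -
  have "generate_topology_on {{f \<in> carrier (Homeo X). f ` K \<subseteq> U} | K U. compactin X K \<and> openin X U} W"
    using assms(1) unfolding compact_open_topology_def openin_topology_generated_by_iff .
  then show ?thesis using assms(2)
  proof (induction W rule: generate_topology_on.induct)
    case Empty
    then show ?case by simp
  next
    case (Int a b)
    obtain \<P> where "finite \<P>" "\<P> \<subseteq> clopens X" "\<forall>g. homeo g \<and> (\<forall>P\<in>\<P>. g ` P = P) \<longrightarrow> restrict g T \<in> a"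
      using Int by blast
    moreover obtain \<Q> where "finite \<Q>" "\<Q> \<subseteq> clopens X" "\<forall>g. homeo g \<and> (\<forall>P\<in>\<Q>. g ` P = P) \<longrightarrow> restrict g T \<in> b"
      using Int by blast
    ultimately show ?case by (intro exI[of _ "\<P> \<union> \<Q>"]) (auto simp del: restrict_apply)
  next
    case (UN \<W>)
    then obtain a where a: "a \<in> \<W>" "restrict id T \<in> a" by blast
    then obtain \<P> where "finite \<P>" "\<P> \<subseteq> clopens X" "\<forall>g. homeo g \<and> (\<forall>P\<in>\<P>. g ` P = P) \<longrightarrow> restrict g T \<in> a"
      using UN.IH[OF a] by (elim exE conjE) (rule that)
    then show ?case using a by (intro exI[of _ \<P>]) (auto simp del: restrict_apply)
  next
    case (Basis s)
    then obtain K U where s: "s = {f \<in> carrier (Homeo X). f ` K \<subseteq> U}" "compactin X K" "openin X U" by blast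
    have KT: "K \<subseteq> T" using s compactin_subset_topspace by blast
    then have KU: "K \<subseteq> U" using Basis s restrict_image[OF KT, of id] by auto
    define \<C> where "\<C> = {V \<in> clopens X. V \<subseteq> U}"
    have "K \<subseteq> \<Union>\<C>"
    proof
      fix x assume "x \<in> K"
      then show "x \<in> \<Union>\<C>" using base[OF s(3), of x] KU by (auto simp: \<C>_def)
    qed
    moreover have "\<forall>V\<in>\<C>. openin X V" by (auto simp: \<C>_def clopens_def)
    ultimately obtain \<F> where \<F>: "finite \<F>" "\<F> \<subseteq> \<C>" "K \<subseteq> \<Union>\<F>" using s(2) unfolding compactin_def by meson
    have "restrict g T \<in> s" if g: "homeo g" "\<forall>P\<in>\<F>. g ` P = P" for g
    proof -
      have "g ` K \<subseteq> U"
      proof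
        fix y assume "y \<in> g ` K"
        then obtain x P where x: "x \<in> P" "P \<in> \<F>" "y = g x" using \<F>(3) by blast
        then have "y \<in> P" using g(2) by blast
        then show "y \<in> U" using x \<F>(2) by (auto simp: \<C>_def)
      qed
      then have "restrict g T ` K \<subseteq> U" unfolding restrict_image[OF KT] .
      then show ?thesis unfolding s(1) using restrict_carrier[OF g(1)] by blast
    qed
    then show ?case using \<F> by (intro exI[of _ \<F>]) (auto simp: \<C>_def simp del: restrict_apply)
  qed
qed

text \<open>The continuity criterion for distances built from junk. If \<open>d\<close> vanishes on
  an open stabiliser, then left invariance and the triangle inequality make it constant on products
  of two cosets, hence locally constant.\<close>

lemma pseudometricI:
  fixes d :: "('a \<Rightarrow> 'a) \<Rightarrow> ('a \<Rightarrow> 'a) \<Rightarrow> real"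
  assumes refl: "\<And>g. homeo g \<Longrightarrow> d g g = 0"
    and nonneg: "\<And>g h. homeo g \<Longrightarrow> homeo h \<Longrightarrow> 0 \<le> d g h"
    and sym: "\<And>g h. homeo g \<Longrightarrow> homeo h \<Longrightarrow> d g h = d h g"
    and tri: "\<And>g h k. homeo g \<Longrightarrow> homeo h \<Longrightarrow> homeo k \<Longrightarrow> d g k \<le> d g h + d h k"
    and inv: "\<And>f g h. homeo f \<Longrightarrow> homeo g \<Longrightarrow> homeo h \<Longrightarrow> d (f \<circ> g) (f \<circ> h) = d g h"
    and cong: "\<And>g h g' h'. homeo g \<Longrightarrow> homeo h \<Longrightarrow> (\<And>x. x \<in> T \<Longrightarrow> g x = g' x) \<Longrightarrow>
      (\<And>x. x \<in> T \<Longrightarrow> h x = h' x) \<Longrightarrow> d g h = d g' h'"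
    and \<P>: "finite \<P>" "\<P> \<subseteq> clopens X"
    and stab: "\<And>v. homeo v \<Longrightarrow> (\<And>P. P \<in> \<P> \<Longrightarrow> v ` P = P) \<Longrightarrow> d id v = 0"
  shows "continuous_left_invariant_pseudometric (Homeo X) (compact_open_topology X) d"
proof -
  have hom: "homeo g" if "g \<in> carrier (Homeo X)" for g using that carrier_Homeo by simp
  have zero: "d g h = 0" if gh: "homeo g" "homeo h" "\<And>P. P \<in> \<P> \<Longrightarrow> h ` P = g ` P" for g h
  proof -
    have "d (inv_into T g \<circ> g) (inv_into T g \<circ> h) = d g h" by (rule inv[OF homeo_inv[OF gh(1)] gh(1,2)])
    moreover have "d (inv_into T g \<circ> g) (inv_into T g \<circ> h) = d id (inv_into T g \<circ> h)"
      by (rule cong) (auto simp: homeo_inv_left[OF gh(1)] intro!: homeo_comp homeo_inv gh)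
    moreover have "d id (inv_into T g \<circ> h) = 0"
    proof (rule stab)
      show "homeo (inv_into T g \<circ> h)" by (intro homeo_comp homeo_inv gh)
      fix P assume P: "P \<in> \<P>"
      have "P \<subseteq> T" using P \<P> clopen_sub by auto
      then have "inv_into T g ` g ` P = P" using inv_into_image_cancel[OF ciso_inj[OF gh(1)]] by simp
      then show "(inv_into T g \<circ> h) ` P = P" using gh(3)[OF P] by (metis image_comp)
    qed
    ultimately show ?thesis by simp
  qed
  have "continuous_map (prod_topology (compact_open_topology X) (compact_open_topology X)) euclideanreal (\<lambda>(g, h). d g h)"
    unfolding continuous_map_def
  proof (intro conjI allI impI)
    fix U :: "real set" assume "openin euclideanreal U"
    show "openin (prod_topology (compact_open_topology X) (compact_open_topology X))
      {x \<in> topspace (prod_topology (compact_open_topology X) (compact_open_topology X)). (case x of (g, h) \<Rightarrow> d g h) \<in> U}"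
      unfolding openin_prod_topology_alt
    proof (intro allI impI)
      fix g h assume "(g, h) \<in> {x \<in> topspace (prod_topology (compact_open_topology X) (compact_open_topology X)). (case x of (g, h) \<Rightarrow> d g h) \<in> U}"
      then have gh: "g \<in> carrier (Homeo X)" "h \<in> carrier (Homeo X)" "d g h \<in> U"
        by (auto simp: topspace_compact_open)
      define V where "V f = {k \<in> carrier (Homeo X). \<forall>P\<in>\<P>. k ` P = f ` P}" for f
      have "d k l \<in> U" if "k \<in> V g" "l \<in> V h" for k l
      proof -
        have kl: "homeo k" "homeo l" "homeo g" "homeo h" using that gh hom by (auto simp: V_def)
        have "d g k = 0" "d h l = 0" using that kl zero by (auto simp: V_def)
        then have "d k l = d g h"
          using tri[OF kl(3) kl(1) kl(4)] tri[OF kl(1,2,4)] tri[OF kl(1,3,2)] tri[OF kl(3,4,2)]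
            sym[OF kl(3,1)] sym[OF kl(4,2)] by linarith
        then show ?thesis using gh by simp
      qed
      moreover have "openin (compact_open_topology X) (V g)" "openin (compact_open_topology X) (V h)"
        unfolding V_def using coset_open[OF \<P>] gh by auto
      moreover have "g \<in> V g" "h \<in> V h" using gh by (auto simp: V_def)
      ultimately show "\<exists>A B. openin (compact_open_topology X) A \<and> openin (compact_open_topology X) B \<and> g \<in> A \<and> h \<in> B \<and>
        A \<times> B \<subseteq> {x \<in> topspace (prod_topology (compact_open_topology X) (compact_open_topology X)). (case x of (g, h) \<Rightarrow> d g h) \<in> U}"
        by (intro exI[of _ "V g"] exI[of _ "V h"]) (auto simp: topspace_compact_open V_def)
    qed
  qed auto
  moreover have "d (f \<otimes>\<^bsub>Homeo X\<^esub> g) (f \<otimes>\<^bsub>Homeo X\<^esub> h) = d g h"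
    if c: "f \<in> carrier (Homeo X)" "g \<in> carrier (Homeo X)" "h \<in> carrier (Homeo X)" for f g h
  proof -
    have "d (f \<circ> g) (f \<circ> h) = d (restrict (f \<circ> g) T) (restrict (f \<circ> h) T)"
      by (rule cong[OF homeo_comp[OF hom hom] homeo_comp[OF hom hom], OF c(1,2) c(1,3)]) auto
    then show ?thesis using mult_Homeo[OF c(1,2)] mult_Homeo[OF c(1,3)] inv[OF hom hom hom, OF c] by simp
  qed
  ultimately show ?thesis
    unfolding continuous_left_invariant_pseudometric_def using refl nonneg sym tri hom by auto
qed

section \<open>From pseudometrics to length functions\<close>

definition len :: "(('a \<Rightarrow> 'a) \<Rightarrow> ('a \<Rightarrow> 'a) \<Rightarrow> real) \<Rightarrow> ('a \<Rightarrow> 'a) \<Rightarrow> real" where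
  "len d g = d (restrict id T) (restrict g T)"

context
  fixes d
  assumes d: "continuous_left_invariant_pseudometric (Homeo X) (compact_open_topology X) d"
begin

lemma pseudometric_translate:
  assumes "homeo f" "homeo g" "homeo h"
  shows "d (restrict (f \<circ> g) T) (restrict (f \<circ> h) T) = d (restrict g T) (restrict h T)"
proof -
  have c: "restrict k T \<in> carrier (Homeo X)" if "homeo k" for k using restrict_carrier that .
  have "restrict f T \<otimes>\<^bsub>Homeo X\<^esub> restrict k T = restrict (f \<circ> k) T" if "homeo k" for k
    unfolding mult_Homeo[OF c[OF assms(1)] c[OF that]] using homeo_mem[OF that]
    by (auto simp: restrict_def fun_eq_iff)
  then show ?thesis using d c assms unfolding continuous_left_invariant_pseudometric_def by metis
qed

text \<open>Left invariance reduces distances to lengths, so bounds on sets of pairs become bounds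
  on single elements.\<close>

lemma dist_len:
  assumes g: "homeo g" and h: "homeo h"
  shows "d (restrict g T) (restrict h T) = len d (inv_into T g \<circ> h)"
proof -
  have "restrict (g \<circ> (inv_into T g \<circ> h)) T = restrict h T"
    using homeo_inv_right[OF g] homeo_mem[OF h] by (auto simp: restrict_def fun_eq_iff)
  then show ?thesis
    using pseudometric_translate[OF g homeo_id homeo_comp[OF homeo_inv[OF g] h]] by (simp add: len_def)
qed

lemma dist_triangle_sym:
  assumes "homeo f" "homeo g" "homeo h"
  shows "d (restrict f T) (restrict h T) \<le> d (restrict f T) (restrict g T) + d (restrict g T) (restrict h T)"
    and "d (restrict f T) (restrict g T) = d (restrict g T) (restrict f T)"
proof -
  have c: "restrict f T \<in> carrier (Homeo X)" "restrict g T \<in> carrier (Homeo X)" "restrict h T \<in> carrier (Homeo X)"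
    using restrict_carrier assms by auto
  note D = d[unfolded continuous_left_invariant_pseudometric_def]
  show "d (restrict f T) (restrict h T) \<le> d (restrict f T) (restrict g T) + d (restrict g T) (restrict h T)"
    using D c by simp
  show "d (restrict f T) (restrict g T) = d (restrict g T) (restrict f T)"
    using D c by simp
qed

lemma len_small: "\<exists>\<P>. finite \<P> \<and> \<P> \<subseteq> clopens X \<and> (\<forall>g. homeo g \<and> (\<forall>P\<in>\<P>. g ` P = P) \<longrightarrow> len d g \<le> 1)"
proof -
  let ?C = "compact_open_topology X"
  let ?S = "{x \<in> topspace (prod_topology ?C ?C). (case x of (g, h) \<Rightarrow> d g h) \<in> {..<1}}"
  have e: "restrict id T \<in> carrier (Homeo X)" using restrict_carrier[OF homeo_id] .
  have 1: "openin (prod_topology ?C ?C) ?S"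
    using d unfolding continuous_left_invariant_pseudometric_def
    by (intro openin_continuous_map_preimage[of _ euclideanreal]) auto
  have 2: "(restrict id T, restrict id T) \<in> ?S"
    using e d by (auto simp: topspace_compact_open continuous_left_invariant_pseudometric_def)
  obtain U V where UV: "openin ?C U" "openin ?C V" "restrict id T \<in> U" "restrict id T \<in> V" "U \<times> V \<subseteq> ?S"
    using openin_prod_topology_alt[THEN iffD1, rule_format, OF 1 2] by (elim exE conjE) (rule that)
  obtain \<P> where \<P>: "finite \<P>" "\<P> \<subseteq> clopens X" "\<And>g. homeo g \<Longrightarrow> (\<And>P. P \<in> \<P> \<Longrightarrow> g ` P = P) \<Longrightarrow> restrict g T \<in> V"
    using identity_nbhd[OF UV(2,4)] by metis
  have "len d g \<le> 1" if "homeo g" "\<forall>P\<in>\<P>. g ` P = P" for g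
    using \<P>(3)[OF that(1)] that(2) UV(3,5) by (auto simp: len_def)
  then show ?thesis using \<P> by blast
qed

lemma length_space_len:
  assumes "ranked_space T (clopens X) rk"
  shows "length_space T (clopens X) rk (len d)"
proof -
  interpret ranked_space T "clopens X" rk by (rule assms)
  show ?thesis
  proof
    fix g h assume g: "homeo g" and h: "homeo h"
    have "len d (g \<circ> h) \<le> d (restrict id T) (restrict g T) + d (restrict g T) (restrict (g \<circ> h) T)"
        unfolding len_def using dist_triangle_sym(1)[OF homeo_id g homeo_comp[OF g h]] .
    also have "d (restrict g T) (restrict (g \<circ> h) T) = len d h"
      using pseudometric_translate[OF g homeo_id h] by (simp add: len_def)
    finally show "len d (g \<circ> h) \<le> len d g + len d h" by (simp only: len_def)
  next
    fix g h :: "'a \<Rightarrow> 'a" assume "\<And>x. x \<in> T \<Longrightarrow> g x = h x"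
    then have "restrict g T = restrict h T" by (auto simp: restrict_def fun_eq_iff)
    then show "len d g = len d h" by (simp add: len_def)
  next
    fix g assume g: "homeo g"
    have "len d (inv_into T g) = len d (inv_into T g \<circ> id)" by simp
    also have "\<dots> = d (restrict g T) (restrict id T)" using dist_len[OF g homeo_id] by simp
    finally show "len d (inv_into T g) = len d g"
      using dist_triangle_sym(2)[OF g homeo_id g] by (simp add: len_def)
  next
    show "\<exists>\<P>. finite \<P> \<and> \<P> \<subseteq> clopens X \<and> (\<forall>g. homeo g \<and> (\<forall>P\<in>\<P>. g ` P = P) \<longrightarrow> len d g \<le> 1)" by (rule len_small)
  qed
qed

end

end

section \<open>The Cantor--Bendixson rank function\<close>

lemma CB_derivative_0: "CB_derivative X 0 = topspace X"
  by (subst CB_derivative.simps) simp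

lemma zero_least: "(0 :: countable_ordinal) \<le> \<gamma>"
  unfolding zero_countable_ordinal_def by (rule Least_le) simp

lemma predecessor_pos: "is_predecessor \<gamma> \<delta> \<Longrightarrow> \<delta> \<noteq> 0"
  using zero_least[of \<gamma>] by (auto simp: is_predecessor_def)

lemma CB_derivative_successor:
  "is_predecessor \<gamma> \<delta> \<Longrightarrow> CB_derivative X \<delta> = remove_isolated X (CB_derivative X \<gamma>)"
  using predecessor_pos[of \<gamma> \<delta>] predecessor_eq[of \<gamma> \<delta>]
  by (subst CB_derivative.simps) (auto simp: successor_ordinal_def)

lemma CB_derivative_limit:
  "limit_ordinal \<delta> \<Longrightarrow> CB_derivative X \<delta> = (\<Inter>\<gamma>\<in>{..<\<delta>}. CB_derivative X \<gamma>)"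
  by (subst CB_derivative.simps) (auto simp: limit_ordinal_def)

lemma ordinal_cases:
  obtains "\<delta> = 0" | \<gamma> where "is_predecessor \<gamma> \<delta>" | "limit_ordinal \<delta>"
  by (auto simp: limit_ordinal_def successor_ordinal_def)

lemma next_ordinal:
  assumes "\<gamma> < (\<delta> :: countable_ordinal)"
  shows "\<exists>\<epsilon>\<le>\<delta>. is_predecessor \<gamma> \<epsilon>"
proof -
  define \<epsilon> where "\<epsilon> = (LEAST \<epsilon>. \<gamma> < \<epsilon>)"
  have "\<gamma> < \<epsilon>" "\<epsilon> \<le> \<delta>" unfolding \<epsilon>_def using assms by (auto intro: LeastI Least_le)
  moreover have "\<zeta> \<le> \<gamma>" if "\<zeta> < \<epsilon>" for \<zeta> using not_less_Least[of \<zeta> "\<lambda>\<epsilon>. \<gamma> < \<epsilon>"] that by (simp add: \<epsilon>_def not_less)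
  ultimately show ?thesis by (auto simp: is_predecessor_def)
qed

lemma limit_between:
  assumes "limit_ordinal \<delta>" "\<gamma> < \<delta>"
  shows "\<exists>\<epsilon>. \<gamma> < \<epsilon> \<and> \<epsilon> < \<delta>"
proof -
  have "\<not> is_predecessor \<gamma> \<delta>" using assms by (auto simp: limit_ordinal_def successor_ordinal_def)
  then show ?thesis using assms by (auto simp: is_predecessor_def not_le)
qed

lemma CB_derivative_antimono: "\<gamma> \<le> \<delta> \<Longrightarrow> CB_derivative X \<delta> \<subseteq> CB_derivative X \<gamma>"
proof (induction \<delta> arbitrary: \<gamma> rule: less_induct)
  case (less \<delta>)
  show ?case
  proof (cases "\<gamma> = \<delta>")
    case False
    then have lt: "\<gamma> < \<delta>" using less.prems by simp
    show ?thesis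
    proof (cases \<delta> rule: ordinal_cases)
      case 1
      then show ?thesis using lt zero_least[of \<gamma>] by simp
    next
      case (2 \<epsilon>)
      then have "\<gamma> \<le> \<epsilon>" "\<epsilon> < \<delta>" using lt by (auto simp: is_predecessor_def)
      then have "CB_derivative X \<epsilon> \<subseteq> CB_derivative X \<gamma>" using less.IH by blast
      then show ?thesis unfolding CB_derivative_successor[OF 2] remove_isolated_def by blast
    next
      case 3
      then show ?thesis using lt by (auto simp: CB_derivative_limit)
    qed
  qed simp
qed

lemma CB_derivative_subset: "CB_derivative X \<gamma> \<subseteq> topspace X"
  using CB_derivative_antimono[OF zero_least] CB_derivative_0 by metis

section \<open>The rank of a point as the stage at which it becomes isolated\<close>

definition isolated_at :: "'a topology \<Rightarrow> 'a \<Rightarrow> countable_ordinal \<Rightarrow> bool" where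
  "isolated_at X x \<gamma> \<longleftrightarrow> x \<in> CB_derivative X \<gamma> \<and> openin (subtopology X (CB_derivative X \<gamma>)) {x}"

definition CB_rank :: "'a topology \<Rightarrow> 'a \<Rightarrow> countable_ordinal" where
  "CB_rank X x = (THE \<gamma>. isolated_at X x \<gamma>)"

lemma isolated_at_notin:
  assumes "isolated_at X x \<gamma>" "\<gamma> < \<delta>"
  shows "x \<notin> CB_derivative X \<delta>"
proof -
  obtain \<epsilon> where \<epsilon>: "\<epsilon> \<le> \<delta>" "is_predecessor \<gamma> \<epsilon>" using next_ordinal[OF assms(2)] by blast
  have "x \<notin> CB_derivative X \<epsilon>"
    using assms(1) by (simp add: CB_derivative_successor[OF \<epsilon>(2)] remove_isolated_def isolated_at_def)
  then show ?thesis using CB_derivative_antimono[OF \<epsilon>(1), of X] by blast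
qed

lemma CB_rank_eq: "isolated_at X x \<gamma> \<Longrightarrow> CB_rank X x = \<gamma>"
  unfolding CB_rank_def
proof (rule the_equality)
  fix \<delta> assume "isolated_at X x \<gamma>" "isolated_at X x \<delta>"
  then show "\<delta> = \<gamma>"
    using isolated_at_notin[of X x \<gamma> \<delta>] isolated_at_notin[of X x \<delta> \<gamma>]
    by (metis isolated_at_def linorder_neqE)
qed

locale stone_of_type =
  fixes X :: "'a topology" and \<alpha> :: countable_ordinal and n :: nat
  assumes type: "countable_stone_space_of_type \<alpha> n X" and n: "n \<ge> 1"

sublocale stone_of_type \<subseteq> countable_stone X
  using type by unfold_locales (auto simp: countable_stone_space_of_type_def stone_space_def)

context stone_of_type
begin

abbreviation rk :: "'a \<Rightarrow> countable_ordinal" where "rk \<equiv> CB_rank X"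

definition K :: "'a set" where "K = CB_derivative X \<alpha>"

lemma K: "finite K" "card K = n" "K \<noteq> {}" "K \<subseteq> T"
  using type n CB_derivative_subset[of X \<alpha>] by (auto simp: countable_stone_space_of_type_def K_def)

text \<open>The first derivative that omits \<open>x\<close> is neither the initial one nor an
  intersection of earlier ones, so it is a successor stage, and \<open>x\<close> is isolated just
  before it. Points that survive to stage \<alpha> are isolated there because \<open>K\<close> is
  finite.\<close>

lemma isolated_at_exists:
  assumes x: "x \<in> T"
  shows "\<exists>\<gamma>\<le>\<alpha>. isolated_at X x \<gamma>"
proof (cases "x \<in> K")
  case True
  have "closedin X (K - {x})" using K Hausdorff_X by (intro closedin_Hausdorff_finite) auto
  then have "openin X (T - (K - {x}))" by blast
  moreover have "{x} = (T - (K - {x})) \<inter> CB_derivative X \<alpha>" using True x K(4) unfolding K_def by auto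
  ultimately have "openin (subtopology X (CB_derivative X \<alpha>)) {x}" unfolding openin_subtopology by blast
  then show ?thesis using True by (auto simp: isolated_at_def K_def)
next
  case False
  define \<delta> where "\<delta> = (LEAST \<delta>. x \<notin> CB_derivative X \<delta>)"
  have \<delta>: "x \<notin> CB_derivative X \<delta>" "\<delta> \<le> \<alpha>" unfolding \<delta>_def
    using False LeastI[of "\<lambda>\<delta>. x \<notin> CB_derivative X \<delta>" \<alpha>] Least_le[of "\<lambda>\<delta>. x \<notin> CB_derivative X \<delta>" \<alpha>]
    by (auto simp: K_def)
  have below: "x \<in> CB_derivative X \<gamma>" if "\<gamma> < \<delta>" for \<gamma> using not_less_Least that unfolding \<delta>_def by blast
  show ?thesis
  proof (cases \<delta> rule: ordinal_cases)
    case 1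
    then show ?thesis using \<delta> x by (simp add: CB_derivative_0)
  next
    case (2 \<gamma>)
    then have "\<gamma> < \<delta>" by (simp add: is_predecessor_def)
    then have "isolated_at X x \<gamma>" using below[of \<gamma>] \<delta>(1)
      by (simp add: isolated_at_def CB_derivative_successor[OF 2] remove_isolated_def)
    then show ?thesis using \<open>\<gamma> < \<delta>\<close> \<delta>(2) by (intro exI[of _ \<gamma>]) auto
  next
    case 3
    then show ?thesis using \<delta> below by (simp add: CB_derivative_limit)
  qed
qed

lemma rank_isolated_at:
  assumes "x \<in> T"
  shows "isolated_at X x (rk x)" "rk x \<le> \<alpha>"
  using isolated_at_exists[OF assms] CB_rank_eq[of X x] by auto

lemma CB_derivative_rank: "CB_derivative X \<gamma> = {x \<in> T. \<gamma> \<le> rk x}"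
proof (intro Set.set_eqI iffI)
  fix x assume x: "x \<in> CB_derivative X \<gamma>"
  then have "x \<in> T" using CB_derivative_subset[of X \<gamma>] by blast
  moreover have "\<gamma> \<le> rk x" using isolated_at_notin[OF rank_isolated_at(1)] x \<open>x \<in> T\<close> by (metis not_le)
  ultimately show "x \<in> {x \<in> T. \<gamma> \<le> rk x}" by simp
next
  fix x assume x: "x \<in> {x \<in> T. \<gamma> \<le> rk x}"
  then have "x \<in> CB_derivative X (rk x)" using rank_isolated_at(1) by (auto simp: isolated_at_def)
  then show "x \<in> CB_derivative X \<gamma>" using x CB_derivative_antimono[of \<gamma> "rk x" X] by auto
qed

lemma rank_isolated_nbhd:
  assumes "x \<in> T" "U \<in> clopens X" "x \<in> U"
  shows "\<exists>V\<in>clopens X. x \<in> V \<and> V \<subseteq> U \<and> (\<forall>y\<in>V - {x}. rk y < rk x)"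
proof -
  obtain W where W: "openin X W" "{x} = W \<inter> CB_derivative X (rk x)"
    using rank_isolated_at(1)[OF assms(1)] by (auto simp: isolated_at_def openin_subtopology)
  have "openin X (W \<inter> U)" "x \<in> W \<inter> U" using W assms by (auto simp: clopens_def)
  then obtain V where V: "V \<in> clopens X" "x \<in> V" "V \<subseteq> W \<inter> U" using base by blast
  have "rk y < rk x" if y: "y \<in> V - {x}" for y
  proof -
    have "y \<notin> CB_derivative X (rk x)" using W(2) V(3) y by blast
    moreover have "y \<in> T" using y V clopen_sub by blast
    ultimately show ?thesis by (simp add: CB_derivative_rank not_le)
  qed
  then show ?thesis using V by blast
qed

end

sublocale stone_of_type \<subseteq> ranked_space "topspace X" "clopens X" "CB_rank X"
proof
  fix x assume "x \<in> topspace X"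
  then show "\<exists>U\<in>clopens X. x \<in> U \<and> (\<forall>y\<in>U - {x}. rk y < rk x)"
    using rank_isolated_nbhd[OF _ clopen_T] by blast
next
  fix U x \<gamma> assume U: "U \<in> clopens X" "x \<in> U" "\<gamma> < rk x"
  \<comment> \<open>Take \<open>y\<close> in \<open>U\<close> whose rank is least among those that
    are at least \<gamma>. If it exceeded \<gamma>, then \<open>y\<close> would not be isolated in
    the derivative of index \<gamma>, and a nearby point of that derivative would have smaller rank,
    still at least \<gamma>.\<close>
  define S where "S = {\<delta>. \<exists>y\<in>U. rk y = \<delta> \<and> \<gamma> \<le> \<delta>}"
  have "rk x \<in> S" using U by (auto simp: S_def)
  then have "(LEAST \<delta>. \<delta> \<in> S) \<in> S" by (rule LeastI)
  then obtain y where y: "y \<in> U" "rk y = (LEAST \<delta>. \<delta> \<in> S)" "\<gamma> \<le> rk y" by (auto simp: S_def)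
  have yT: "y \<in> topspace X" using y U clopen_sub by blast
  show "\<exists>y\<in>U. rk y = \<gamma>"
  proof (cases "rk y = \<gamma>")
    case False
    then have "\<gamma> < rk y" using y by simp
    then obtain \<epsilon> where \<epsilon>: "\<epsilon> \<le> rk y" "is_predecessor \<gamma> \<epsilon>" using next_ordinal by blast
    obtain V where V: "V \<in> clopens X" "y \<in> V" "V \<subseteq> U" "\<forall>z\<in>V - {y}. rk z < rk y"
      using rank_isolated_nbhd[OF yT U(1) y(1)] by blast
    have "y \<in> CB_derivative X \<epsilon>" using yT \<epsilon>(1) by (simp add: CB_derivative_rank)
    then have ni: "\<not> openin (subtopology X (CB_derivative X \<gamma>)) {y}"
      by (simp add: CB_derivative_successor[OF \<epsilon>(2)] remove_isolated_def)
    have "V \<inter> CB_derivative X \<gamma> \<noteq> {y}"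
    proof
      assume "V \<inter> CB_derivative X \<gamma> = {y}"
      then have "openin (subtopology X (CB_derivative X \<gamma>)) {y}"
        using V(1) unfolding openin_subtopology clopens_def by blast
      then show False using ni by simp
    qed
    moreover have "y \<in> V \<inter> CB_derivative X \<gamma>" using V yT y by (simp add: CB_derivative_rank)
    ultimately obtain z where z: "z \<in> V" "z \<noteq> y" "z \<in> CB_derivative X \<gamma>" by blast
    then have "rk z \<in> S" using V(3) by (auto simp: S_def CB_derivative_rank)
    then have "rk y \<le> rk z" unfolding y(2) by (rule Least_le)
    moreover have "rk z < rk y" using V(4) z by blast
    ultimately show ?thesis by simp
  qed (use y in blast)
qed

context stone_of_type
begin

lemma K_rank_eq: "K = {x \<in> T. rk x = \<alpha>}"
  unfolding K_def CB_derivative_rank using rank_isolated_at(2) by force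

text \<open>After disjoint clopen neighbourhoods of the top points are chosen, the uncovered rest
  \<open>R\<close> contains no top point, so adding it to one of them creates no second
  peak.\<close>

lemma split_exists: "\<exists>Y. split_space T (clopens X) rk \<alpha> K Y"
proof -
  have "\<exists>W\<in>clopens X. p \<in> W \<and> W \<inter> K \<subseteq> {p}" if "p \<in> K" for p
    using separated_finite[of p T K] that K clopen_T by blast
  then obtain W where W: "\<And>p. p \<in> K \<Longrightarrow> W p \<in> clopens X \<and> p \<in> W p \<and> W p \<inter> K \<subseteq> {p}" by metis
  define V where "V p = W p - (\<Union>q\<in>K - {p}. W q)" for p
  have V: "V p \<in> clopens X" "p \<in> V p" "V p \<inter> K \<subseteq> {p}" if "p \<in> K" for p
  proof -
    have "(\<Union>q\<in>K - {p}. W q) \<in> clopens X" using K(1) W by (intro clopen_UN) auto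
    then show "V p \<in> clopens X" using W[OF that] clopen_Diff by (simp add: V_def)
    have "p \<notin> W q" if "q \<in> K" "q \<noteq> p" for q using W[OF that(1)] that \<open>p \<in> K\<close> by blast
    then show "p \<in> V p" "V p \<inter> K \<subseteq> {p}" using W[OF that] by (auto simp: V_def)
  qed
  obtain p0 where p0: "p0 \<in> K" using K(3) by blast
  define R where "R = T - (\<Union>p\<in>K. V p)"
  have R: "R \<in> clopens X" unfolding R_def using K(1) V by (intro clopen_Diff clopen_T clopen_UN) auto
  define Y where "Y p = (if p = p0 then V p \<union> R else V p)" for p
  have "split_space T (clopens X) rk \<alpha> K Y"
  proof
    show "finite K" "K \<noteq> {}" by (fact K)+
    show "rk p = \<alpha>" if "p \<in> K" for p using that K_rank_eq by auto
    show "peaked (Y p) p" if p: "p \<in> K" for p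
    proof -
      have "Y p \<in> clopens X" "p \<in> Y p" using V[OF p] R clopen_Un by (auto simp: Y_def)
      moreover have "rk y < rk p" if y: "y \<in> Y p - {p}" for y
      proof -
        have "y \<in> T" using y calculation clopen_sub by blast
        moreover have "y \<notin> K" using y V(2,3) p unfolding Y_def R_def by (auto split: if_splits)
        ultimately show ?thesis using K_rank_eq p rank_isolated_at(2)[of y] by (auto simp: less_le)
      qed
      ultimately show ?thesis by (simp add: peaked_def)
    qed
    show "Y p \<inter> Y q = {}" if "p \<in> K" "q \<in> K" "p \<noteq> q" for p q
      using that by (auto simp: Y_def R_def V_def)
    show "(\<Union>p\<in>K. Y p) = T"
    proof
      show "(\<Union>p\<in>K. Y p) \<subseteq> T" using V(1) clopen_sub by (auto simp: Y_def R_def split: if_splits)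
      show "T \<subseteq> (\<Union>p\<in>K. Y p)" using p0 by (auto simp: Y_def R_def)
    qed
  qed
  then show ?thesis by blast
qed

end

section \<open>Coarse spaces\<close>

text \<open>The record \<open>coarse_space\<close> carries no axioms; the closure properties that
  allow coarse equivalences to be reversed and composed are collected here and verified for each
  space in use.\<close>

definition coarse_structure :: "'a coarse_space \<Rightarrow> bool" where
  "coarse_structure A \<longleftrightarrow>
     (\<forall>E\<in>entourages A. E \<subseteq> points A \<times> points A) \<and>
     Id_on (points A) \<in> entourages A \<and>
     (\<forall>E\<in>entourages A. \<forall>F\<subseteq>E. F \<in> entourages A) \<and>
     (\<forall>E\<in>entourages A. E\<inverse> \<in> entourages A) \<and>
     (\<forall>E\<in>entourages A. \<forall>F\<in>entourages A. E O F \<in> entourages A)"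

lemma
  assumes "coarse_structure A"
  shows coarse_sub: "E \<in> entourages A \<Longrightarrow> E \<subseteq> points A \<times> points A"
    and coarse_Id: "Id_on (points A) \<in> entourages A"
    and coarse_subset: "E \<in> entourages A \<Longrightarrow> F \<subseteq> E \<Longrightarrow> F \<in> entourages A"
    and coarse_converse: "E \<in> entourages A \<Longrightarrow> E\<inverse> \<in> entourages A"
    and coarse_comp: "E \<in> entourages A \<Longrightarrow> F \<in> entourages A \<Longrightarrow> E O F \<in> entourages A"
  using assms unfolding coarse_structure_def by auto

lemma
  assumes "coarse_equivalence A B f"
  shows equivalence_mem: "x \<in> points A \<Longrightarrow> f x \<in> points B"
    and equivalence_image: "E \<in> entourages A \<Longrightarrow> map_prod f f ` E \<in> entourages B"
    and equivalence_vimage: "F \<in> entourages B \<Longrightarrow> map_prod f f -` F \<inter> points A \<times> points A \<in> entourages A"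
    and equivalence_cobounded: "\<exists>E \<in> entourages B. \<forall>y \<in> points B. \<exists>x \<in> points A. (y, f x) \<in> E"
  using assms unfolding coarse_equivalence_def by auto

lemma coarsely_equivalent_refl:
  assumes "coarse_structure A"
  shows "coarsely_equivalent A A"
proof -
  have "map_prod id id -` E \<inter> points A \<times> points A = E" if "E \<in> entourages A" for E
    using coarse_sub[OF assms that] by auto
  moreover have "\<exists>E\<in>entourages A. \<forall>y\<in>points A. \<exists>x\<in>points A. (y, id x) \<in> E"
    using coarse_Id[OF assms] by (intro bexI[of _ "Id_on (points A)"]) auto
  ultimately have "coarse_equivalence A A id"
    by (auto simp: coarse_equivalence_def prod.map_id0)
  then show ?thesis by (auto simp: coarsely_equivalent_def)
qed

text \<open>Coboundedness supplies a coarse inverse \<open>g\<close> with \<open>f (g y)\<close>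
  within a fixed entourage \<open>E0\<close> of \<open>y\<close>; both transport conditions follow
  after thickening by \<open>E0\<close> on either side.\<close>

lemma coarsely_equivalent_sym:
  assumes A: "coarse_structure A" and B: "coarse_structure B" and "coarsely_equivalent A B"
  shows "coarsely_equivalent B A"
proof -
  obtain f where f: "coarse_equivalence A B f" using assms(3) by (auto simp: coarsely_equivalent_def)
  obtain E0 where E0: "E0 \<in> entourages B" "\<forall>y\<in>points B. \<exists>x\<in>points A. (y, f x) \<in> E0"
    using equivalence_cobounded[OF f] by blast
  then obtain g where g: "\<And>y. y \<in> points B \<Longrightarrow> g y \<in> points A \<and> (y, f (g y)) \<in> E0" by metis
  have "map_prod g g ` F \<in> entourages A" if F: "F \<in> entourages B" for F
  proof -
    have "E0\<inverse> O F O E0 \<in> entourages B" using E0 F coarse_converse[OF B] coarse_comp[OF B] by blast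
    then have "map_prod f f -` (E0\<inverse> O F O E0) \<inter> points A \<times> points A \<in> entourages A"
      by (rule equivalence_vimage[OF f])
    moreover have "map_prod g g ` F \<subseteq> map_prod f f -` (E0\<inverse> O F O E0) \<inter> points A \<times> points A"
      using g coarse_sub[OF B F] by fastforce
    ultimately show ?thesis by (rule coarse_subset[OF A])
  qed
  moreover have "map_prod g g -` E \<inter> points B \<times> points B \<in> entourages B" if E: "E \<in> entourages A" for E
  proof -
    have "E0 O (map_prod f f ` E) O E0\<inverse> \<in> entourages B"
      using E0 equivalence_image[OF f E] coarse_converse[OF B] coarse_comp[OF B] by blast
    moreover have "map_prod g g -` E \<inter> points B \<times> points B \<subseteq> E0 O (map_prod f f ` E) O E0\<inverse>"
    proof clarsimp
      fix y z assume "(g y, g z) \<in> E" "y \<in> points B" "z \<in> points B"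
      then have "(y, f (g y)) \<in> E0" "(f (g y), f (g z)) \<in> map_prod f f ` E" "(f (g z), z) \<in> E0\<inverse>"
        using g by force+
      then show "(y, z) \<in> E0 O (map_prod f f ` E) O E0\<inverse>" by (intro relcompI)
    qed
    ultimately show ?thesis by (rule coarse_subset[OF B])
  qed
  moreover have "\<exists>E\<in>entourages A. \<forall>x\<in>points A. \<exists>y\<in>points B. (x, g y) \<in> E"
  proof (rule bexI[of _ "map_prod f f -` E0 \<inter> points A \<times> points A"], intro ballI)
    show "map_prod f f -` E0 \<inter> points A \<times> points A \<in> entourages A" by (rule equivalence_vimage[OF f E0(1)])
    fix x assume x: "x \<in> points A"
    then show "\<exists>y\<in>points B. (x, g y) \<in> map_prod f f -` E0 \<inter> points A \<times> points A"
      using g[OF equivalence_mem[OF f x]] equivalence_mem[OF f x] by (intro bexI[of _ "f x"]) auto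
  qed
  ultimately have "coarse_equivalence B A g" using g by (auto simp: coarse_equivalence_def)
  then show ?thesis by (auto simp: coarsely_equivalent_def)
qed

lemma coarsely_equivalent_trans:
  assumes A: "coarse_structure A" and B: "coarse_structure B" and C: "coarse_structure C"
    and "coarsely_equivalent A B" "coarsely_equivalent B C"
  shows "coarsely_equivalent A C"
proof -
  obtain f g where f: "coarse_equivalence A B f" and g: "coarse_equivalence B C g"
    using assms(4,5) by (auto simp: coarsely_equivalent_def)
  have "map_prod (g \<circ> f) (g \<circ> f) ` E \<in> entourages C" if "E \<in> entourages A" for E
    using equivalence_image[OF g equivalence_image[OF f that]] by (simp add: image_comp map_prod.comp)
  moreover have "map_prod (g \<circ> f) (g \<circ> f) -` E \<inter> points A \<times> points A \<in> entourages A"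
    if "E \<in> entourages C" for E
  proof (rule coarse_subset[OF A])
    show "map_prod f f -` (map_prod g g -` E \<inter> points B \<times> points B) \<inter> points A \<times> points A \<in> entourages A"
      by (rule equivalence_vimage[OF f equivalence_vimage[OF g that]])
  qed (use equivalence_mem[OF f] in auto)
  moreover have "\<exists>E\<in>entourages C. \<forall>z\<in>points C. \<exists>x\<in>points A. (z, (g \<circ> f) x) \<in> E"
  proof -
    obtain E where E: "E \<in> entourages B" "\<forall>y\<in>points B. \<exists>x\<in>points A. (y, f x) \<in> E"
      using equivalence_cobounded[OF f] by blast
    obtain F where F: "F \<in> entourages C" "\<forall>z\<in>points C. \<exists>y\<in>points B. (z, g y) \<in> F"
      using equivalence_cobounded[OF g] by blast
    have "\<exists>x\<in>points A. (z, (g \<circ> f) x) \<in> F O (map_prod g g ` E)" if "z \<in> points C" for z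
    proof -
      obtain y where y: "y \<in> points B" "(z, g y) \<in> F" using F(2) \<open>z \<in> points C\<close> by blast
      obtain x where x: "x \<in> points A" "(y, f x) \<in> E" using E(2) y(1) by blast
      have "(g y, g (f x)) \<in> map_prod g g ` E" using x(2) by force
      then have "(z, (g \<circ> f) x) \<in> F O (map_prod g g ` E)" using relcompI[OF y(2)] by simp
      then show ?thesis using x(1) by (rule bexI)
    qed
    moreover have "F O (map_prod g g ` E) \<in> entourages C"
      by (rule coarse_comp[OF C F(1) equivalence_image[OF g E(1)]])
    ultimately show ?thesis by blast
  qed
  moreover have "g \<circ> f \<in> points A \<rightarrow> points C" using equivalence_mem[OF f] equivalence_mem[OF g] by auto
  ultimately have "coarse_equivalence A C (g \<circ> f)" by (simp add: coarse_equivalence_def)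
  then show ?thesis by (auto simp: coarsely_equivalent_def)
qed

section \<open>Coarse structures of metric spaces and of groups\<close>

lemma points_metric [simp]: "points (metric_coarse_space M d) = M"
  by (simp add: metric_coarse_space_def)

lemma entourages_metric:
  "E \<in> entourages (metric_coarse_space M d) \<longleftrightarrow> E \<subseteq> M \<times> M \<and> (\<exists>B. \<forall>x y. (x, y) \<in> E \<longrightarrow> d x y \<le> B)"
  by (auto simp: metric_coarse_space_def)

lemma coarse_structure_metric:
  assumes refl: "\<And>x. x \<in> M \<Longrightarrow> d x x \<le> 0"
    and sym: "\<And>x y. x \<in> M \<Longrightarrow> y \<in> M \<Longrightarrow> d x y = d y x"
    and tri: "\<And>x y z. x \<in> M \<Longrightarrow> y \<in> M \<Longrightarrow> z \<in> M \<Longrightarrow> d x z \<le> d x y + d y z"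
  shows "coarse_structure (metric_coarse_space M d)"
  unfolding coarse_structure_def points_metric
proof (intro conjI ballI allI impI)
  fix E assume "E \<in> entourages (metric_coarse_space M d)"
  then show "E \<subseteq> M \<times> M" by (simp add: entourages_metric)
next
  show "Id_on M \<in> entourages (metric_coarse_space M d)"
    unfolding entourages_metric using refl by (intro conjI exI[of _ 0]) auto
next
  fix E F assume "E \<in> entourages (metric_coarse_space M d)" "F \<subseteq> E"
  then show "F \<in> entourages (metric_coarse_space M d)" unfolding entourages_metric by blast
next
  fix E assume "E \<in> entourages (metric_coarse_space M d)"
  then obtain B where E: "E \<subseteq> M \<times> M" "\<And>x y. (x, y) \<in> E \<Longrightarrow> d x y \<le> B" unfolding entourages_metric by blast
  have "d x y \<le> B" if "(x, y) \<in> E\<inverse>" for x y using E sym[of x y] that by auto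
  then show "E\<inverse> \<in> entourages (metric_coarse_space M d)" unfolding entourages_metric using E(1) by blast
next
  fix E F assume EF: "E \<in> entourages (metric_coarse_space M d)" "F \<in> entourages (metric_coarse_space M d)"
  obtain B where E: "E \<subseteq> M \<times> M" "\<And>x y. (x, y) \<in> E \<Longrightarrow> d x y \<le> B" using EF(1) unfolding entourages_metric by blast
  obtain C where F: "F \<subseteq> M \<times> M" "\<And>x y. (x, y) \<in> F \<Longrightarrow> d x y \<le> C" using EF(2) unfolding entourages_metric by blast
  have "d x z \<le> B + C" if xz: "(x, z) \<in> E O F" for x z
  proof -
    obtain y where y: "(x, y) \<in> E" "(y, z) \<in> F" using xz by blast
    then have "x \<in> M" "y \<in> M" "z \<in> M" using E(1) F(1) by auto
    then show ?thesis using tri[of x y z] E(2)[OF y(1)] F(2)[OF y(2)] by simp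
  qed
  then show "E O F \<in> entourages (metric_coarse_space M d)" unfolding entourages_metric using E(1) F(1) by blast
qed

lemma points_group [simp]: "points (group_coarse_space G T) = carrier G"
  by (simp add: group_coarse_space_def)

lemma entourages_group:
  "E \<in> entourages (group_coarse_space G T) \<longleftrightarrow>
     E \<subseteq> carrier G \<times> carrier G \<and>
     (\<forall>d. continuous_left_invariant_pseudometric G T d \<longrightarrow> E \<in> entourages (metric_coarse_space (carrier G) d))"
  unfolding entourages_metric by (simp add: group_coarse_space_def case_prod_unfold) (metis fst_conv snd_conv surjective_pairing)

lemma coarse_structure_pseudometric:
  "continuous_left_invariant_pseudometric G T d \<Longrightarrow> coarse_structure (metric_coarse_space (carrier G) d)"
  unfolding continuous_left_invariant_pseudometric_def by (intro coarse_structure_metric) auto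

lemma coarse_structure_group: "coarse_structure (group_coarse_space G T)"
  unfolding coarse_structure_def points_group
proof (intro conjI ballI allI impI)
  fix E assume "E \<in> entourages (group_coarse_space G T)"
  then show "E \<subseteq> carrier G \<times> carrier G" by (simp add: entourages_group)
next
  show "Id_on (carrier G) \<in> entourages (group_coarse_space G T)"
    unfolding entourages_group using coarse_Id[OF coarse_structure_pseudometric, of G T]
    by auto
next
  fix E F assume "E \<in> entourages (group_coarse_space G T)" "F \<subseteq> E"
  then show "F \<in> entourages (group_coarse_space G T)"
    unfolding entourages_group using coarse_subset[OF coarse_structure_pseudometric, of G T] by blast
next
  fix E assume "E \<in> entourages (group_coarse_space G T)"
  then show "E\<inverse> \<in> entourages (group_coarse_space G T)"
    unfolding entourages_group using coarse_converse[OF coarse_structure_pseudometric, of G T] by blast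
next
  fix E F assume "E \<in> entourages (group_coarse_space G T)" "F \<in> entourages (group_coarse_space G T)"
  then show "E O F \<in> entourages (group_coarse_space G T)"
    unfolding entourages_group using coarse_comp[OF coarse_structure_pseudometric, of G T] by blast
qed

text \<open>A maximal pseudometric dominates all others, so it alone decides which sets are
  entourages. This is the passage from quasi-isometry to coarse equivalence.\<close>

lemma entourages_maximal:
  assumes "maximal_pseudometric G T d"
  shows "group_coarse_space G T = metric_coarse_space (carrier G) d"
proof -
  have d: "continuous_left_invariant_pseudometric G T d" using assms by (simp add: maximal_pseudometric_def)
  have "E \<in> entourages (group_coarse_space G T)" if E: "E \<in> entourages (metric_coarse_space (carrier G) d)" for E
    unfolding entourages_group
  proof (intro conjI allI impI)
    show sub: "E \<subseteq> carrier G \<times> carrier G" using E by (simp add: entourages_metric)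
    obtain B where B: "\<And>x y. (x, y) \<in> E \<Longrightarrow> d x y \<le> B" using E unfolding entourages_metric by blast
    fix d' assume "continuous_left_invariant_pseudometric G T d'"
    then obtain K C where KC: "\<And>x y. x \<in> carrier G \<Longrightarrow> y \<in> carrier G \<Longrightarrow> d' x y \<le> K * d x y + C"
      using assms unfolding maximal_pseudometric_def by metis
    \<comment> \<open>The factor \<open>K\<close> from \<open>maximal_pseudometric\<close> carries
      no sign, hence the absolute value.\<close>
    have "d' x y \<le> \<bar>K\<bar> * B + C" if xy: "(x, y) \<in> E" for x y
    proof -
      have c: "x \<in> carrier G" "y \<in> carrier G" using sub xy by auto
      then have "0 \<le> d x y" using d by (simp add: continuous_left_invariant_pseudometric_def)
      then have "K * d x y \<le> \<bar>K\<bar> * d x y" by (simp add: mult_right_mono)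
      also have "\<dots> \<le> \<bar>K\<bar> * B" using B[OF xy] by (simp add: mult_left_mono)
      finally show ?thesis using KC[OF c] by simp
    qed
    then show "E \<in> entourages (metric_coarse_space (carrier G) d')" unfolding entourages_metric using sub by blast
  qed
  then have "entourages (group_coarse_space G T) = entourages (metric_coarse_space (carrier G) d)"
    unfolding entourages_group using d by (auto simp: entourages_group entourages_metric)
  then show ?thesis by (simp add: group_coarse_space_def metric_coarse_space_def)
qed

lemma quasi_isometric_imp_coarsely_equivalent:
  assumes "quasi_isometric M d N e"
  shows "coarsely_equivalent (metric_coarse_space M d) (metric_coarse_space N e)"
proof -
  obtain f K C where f: "f \<in> M \<rightarrow> N" and K: "K \<ge> 1" "C \<ge> 0"
    and lower: "\<And>x y. x \<in> M \<Longrightarrow> y \<in> M \<Longrightarrow> d x y / K - C \<le> e (f x) (f y)"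
    and upper: "\<And>x y. x \<in> M \<Longrightarrow> y \<in> M \<Longrightarrow> e (f x) (f y) \<le> K * d x y + C"
    and cob: "\<And>z. z \<in> N \<Longrightarrow> \<exists>x\<in>M. e z (f x) \<le> C"
    using assms unfolding quasi_isometric_def by metis
  have "map_prod f f ` E \<in> entourages (metric_coarse_space N e)"
    if E: "E \<in> entourages (metric_coarse_space M d)" for E
  proof -
    obtain B where B: "E \<subseteq> M \<times> M" "\<And>x y. (x, y) \<in> E \<Longrightarrow> d x y \<le> B" using E unfolding entourages_metric by blast
    have "e (f x) (f y) \<le> K * B + C" if xy: "(x, y) \<in> E" for x y
    proof -
      have "x \<in> M" "y \<in> M" using B(1) xy by auto
      moreover have "K * d x y \<le> K * B" using mult_left_mono[OF B(2)[OF xy], of K] K by simp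
      ultimately show ?thesis using upper[of x y] by simp
    qed
    then have "\<And>u v. (u, v) \<in> map_prod f f ` E \<Longrightarrow> e u v \<le> K * B + C" by auto
    moreover have "map_prod f f ` E \<subseteq> N \<times> N" using B(1) f by auto
    ultimately show ?thesis unfolding entourages_metric by blast
  qed
  moreover have "map_prod f f -` E \<inter> M \<times> M \<in> entourages (metric_coarse_space M d)"
    if E: "E \<in> entourages (metric_coarse_space N e)" for E
  proof -
    obtain B where B: "\<And>x y. (x, y) \<in> E \<Longrightarrow> e x y \<le> B" using E unfolding entourages_metric by blast
    have "d x y \<le> K * (B + C)" if "(x, y) \<in> map_prod f f -` E \<inter> M \<times> M" for x y
    proof -
      have "d x y / K \<le> B + C" using lower[of x y] B[of "f x" "f y"] that by auto
      then show ?thesis using K by (simp add: field_simps)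
    qed
    then show ?thesis unfolding entourages_metric by blast
  qed
  moreover have "\<exists>E\<in>entourages (metric_coarse_space N e). \<forall>y\<in>N. \<exists>x\<in>M. (y, f x) \<in> E"
  proof (rule bexI[of _ "{(y, z) \<in> N \<times> N. e y z \<le> C}"])
    show "{(y, z) \<in> N \<times> N. e y z \<le> C} \<in> entourages (metric_coarse_space N e)"
      unfolding entourages_metric by blast
    show "\<forall>y\<in>N. \<exists>x\<in>M. (y, f x) \<in> {(y, z) \<in> N \<times> N. e y z \<le> C}" using cob f by fastforce
  qed
  ultimately have "coarse_equivalence (metric_coarse_space M d) (metric_coarse_space N e) f"
    using f by (simp add: coarse_equivalence_def)
  then show ?thesis by (auto simp: coarsely_equivalent_def)
qed

lemma group_quasi_isometric_imp_coarsely_equivalent: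
  "group_quasi_isometric G T N e \<Longrightarrow> coarsely_equivalent (group_coarse_space G T) (metric_coarse_space N e)"
  unfolding group_quasi_isometric_def
  using entourages_maximal quasi_isometric_imp_coarsely_equivalent by metis

section \<open>Invariants that separate coarse classes\<close>

definition coarsely_trivial :: "'a coarse_space \<Rightarrow> bool" where
  "coarsely_trivial A \<longleftrightarrow> points A \<noteq> {} \<and> points A \<times> points A \<in> entourages A"

lemma coarsely_trivial_equivalent:
  assumes A: "coarse_structure A" and B: "coarse_structure B" and "coarsely_trivial A" "coarsely_trivial B"
  shows "coarsely_equivalent A B"
proof -
  obtain b where b: "b \<in> points B" using assms(4) by (auto simp: coarsely_trivial_def)
  have all: "E \<in> entourages A" if "E \<subseteq> points A \<times> points A" for E
    using coarse_subset[OF A _ that] assms(3) by (simp add: coarsely_trivial_def)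
  have all': "E \<in> entourages B" if "E \<subseteq> points B \<times> points B" for E
    using coarse_subset[OF B _ that] assms(4) by (simp add: coarsely_trivial_def)
  have "coarse_equivalence A B (\<lambda>_. b)"
    unfolding coarse_equivalence_def
  proof (intro conjI ballI)
    show "(\<lambda>_. b) \<in> points A \<rightarrow> points B" using b by simp
    show "map_prod (\<lambda>_. b) (\<lambda>_. b) ` E \<in> entourages B" for E using b by (intro all') auto
    show "map_prod (\<lambda>_. b) (\<lambda>_. b) -` E \<inter> points A \<times> points A \<in> entourages A" for E by (intro all) auto
    show "\<exists>E\<in>entourages B. \<forall>y\<in>points B. \<exists>x\<in>points A. (y, b) \<in> E"
      using assms(3,4) b by (intro bexI[of _ "points B \<times> points B"]) (auto simp: coarsely_trivial_def)
  qed
  then show ?thesis by (auto simp: coarsely_equivalent_def)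
qed

lemma coarsely_trivial_pullback:
  assumes A: "coarse_structure A" and "coarsely_equivalent A B" "coarsely_trivial B"
  shows "coarsely_trivial A"
proof -
  obtain f where f: "coarse_equivalence A B f" using assms(2) by (auto simp: coarsely_equivalent_def)
  have "map_prod f f -` (points B \<times> points B) \<inter> points A \<times> points A \<in> entourages A"
    using equivalence_vimage[OF f] assms(3) by (simp add: coarsely_trivial_def)
  moreover have "map_prod f f -` (points B \<times> points B) \<inter> points A \<times> points A = points A \<times> points A"
    using equivalence_mem[OF f] by auto
  moreover have "points A \<noteq> {}" using equivalence_cobounded[OF f] assms(3) by (auto simp: coarsely_trivial_def)
  ultimately show ?thesis by (simp add: coarsely_trivial_def)
qed

text \<open>In \<open>A\<close> one entourage generates everything, while in \<open>B\<close> the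
  relation generated by an entourage is again an entourage. An equivalence would carry the
  generating entourage of \<open>A\<close> into a relation whose closure is bounded, and pulling
  that back would make \<open>A\<close> trivial.\<close>

lemma coarsely_connected_not_equivalent:
  assumes A: "coarse_structure A" and E: "E \<in> entourages A" "points A \<times> points A \<subseteq> E\<^sup>*"
    and ne: "points A \<noteq> {}" "\<not> coarsely_trivial A"
    and B: "\<And>F. F \<in> entourages B \<Longrightarrow> F\<^sup>* \<inter> points B \<times> points B \<in> entourages B"
  shows "\<not> coarsely_equivalent A B"
proof
  assume "coarsely_equivalent A B"
  then obtain f where f: "coarse_equivalence A B f" by (auto simp: coarsely_equivalent_def)
  define F where "F = (map_prod f f ` E)\<^sup>*"
  have "F \<inter> points B \<times> points B \<in> entourages B" unfolding F_def using B equivalence_image[OF f E(1)] by blast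
  then have FA: "map_prod f f -` (F \<inter> points B \<times> points B) \<inter> points A \<times> points A \<in> entourages A"
    by (rule equivalence_vimage[OF f])
  have FE: "(f x, f y) \<in> F" if "(x, y) \<in> E\<^sup>*" for x y
    using that
  proof (induction rule: rtrancl_induct)
    case (step y z)
    have "(f y, f z) \<in> map_prod f f ` E" using step.hyps(2) by force
    then show ?case using step.IH unfolding F_def by (rule rtrancl.rtrancl_into_rtrancl[rotated])
  qed (simp add: F_def)
  have "points A \<times> points A \<subseteq> map_prod f f -` (F \<inter> points B \<times> points B) \<inter> points A \<times> points A"
    using E(2) equivalence_mem[OF f] FE by auto
  then have "points A \<times> points A \<in> entourages A" by (rule coarse_subset[OF A FA])
  then show False using ne by (simp add: coarsely_trivial_def)
qed

section \<open>Words and the Hamming cube\<close>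

lemma matching_add_left:
  assumes M: "finite M" "M \<subseteq> {(a, b). a \<in> A \<and> b \<in> B \<and> P a b}" "inj_on fst M" "inj_on snd M"
    and inf: "infinite {b \<in> B. P a b}" and a: "a \<in> A"
  shows "\<exists>M'. M \<subseteq> M' \<and> a \<in> fst ` M' \<and> finite M' \<and> M' \<subseteq> {(a, b). a \<in> A \<and> b \<in> B \<and> P a b} \<and>
    inj_on fst M' \<and> inj_on snd M'"
proof (cases "a \<in> fst ` M")
  case False
  have "infinite ({b \<in> B. P a b} - snd ` M)" using inf M(1) by (intro Diff_infinite_finite) auto
  then have "{b \<in> B. P a b} - snd ` M \<noteq> {}" by (intro notI) simp
  then obtain b where b: "b \<in> B" "P a b" "b \<notin> snd ` M" by blast
  have "inj_on fst (insert (a, b) M)" "inj_on snd (insert (a, b) M)"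
    using M(3,4) False b(3) by (auto simp: inj_on_insert)
  then show ?thesis using M a b by (intro exI[of _ "insert (a, b) M"]) auto
qed (use M in blast)

lemma matching_add_right:
  assumes M: "finite M" "M \<subseteq> {(a, b). a \<in> A \<and> b \<in> B \<and> P a b}" "inj_on fst M" "inj_on snd M"
    and inf: "infinite {a \<in> A. P a b}" and b: "b \<in> B"
  shows "\<exists>M'. M \<subseteq> M' \<and> b \<in> snd ` M' \<and> finite M' \<and> M' \<subseteq> {(a, b). a \<in> A \<and> b \<in> B \<and> P a b} \<and>
    inj_on fst M' \<and> inj_on snd M'"
proof (cases "b \<in> snd ` M")
  case False
  have "infinite ({a \<in> A. P a b} - fst ` M)" using inf M(1) by (intro Diff_infinite_finite) auto
  then have "{a \<in> A. P a b} - fst ` M \<noteq> {}" by (intro notI) simp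
  then obtain a where a: "a \<in> A" "P a b" "a \<notin> fst ` M" by blast
  have "inj_on fst (insert (a, b) M)" "inj_on snd (insert (a, b) M)"
    using M(3,4) False a(3) by (auto simp: inj_on_insert)
  then show ?thesis using M a b by (intro exI[of _ "insert (a, b) M"]) auto
qed (use M in blast)

text \<open>Every element has infinitely many admissible partners, so a finite matching extends to
  the next element on either side. Prescribing the pair \<open>(a0, b0)\<close> allows zero to be
  matched with zero, which later preserves finite supports.\<close>

lemma infinite_matching:
  assumes "countable A" "countable B"
    and infA: "\<And>a. a \<in> A \<Longrightarrow> infinite {b \<in> B. P a b}"
    and infB: "\<And>b. b \<in> B \<Longrightarrow> infinite {a \<in> A. P a b}"
    and base: "a0 \<in> A" "b0 \<in> B" "P a0 b0"
  shows "\<exists>f. bij_betw f A B \<and> f a0 = b0 \<and> (\<forall>a\<in>A. P a (f a))"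
proof -
  define eA where "eA = from_nat_into A"
  define eB where "eB = from_nat_into B"
  have eA: "range eA = A" and eB: "range eB = B"
    unfolding eA_def eB_def using assms base by (auto intro!: range_from_nat_into)
  define good where "good M \<longleftrightarrow> finite M \<and> M \<subseteq> {(a, b). a \<in> A \<and> b \<in> B \<and> P a b} \<and> inj_on fst M \<and> inj_on snd M"
    for M :: "('a \<times> 'b) set"
  have step: "\<exists>M'. good M' \<and> (M \<subseteq> M' \<and> eA k \<in> fst ` M' \<and> eB k \<in> snd ` M')" if M: "good M" for M k
  proof -
    have kA: "eA k \<in> A" and kB: "eB k \<in> B" using eA eB by auto
    obtain M1 where 1: "M \<subseteq> M1" "eA k \<in> fst ` M1" "finite M1" "M1 \<subseteq> {(a, b). a \<in> A \<and> b \<in> B \<and> P a b}"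
      "inj_on fst M1" "inj_on snd M1"
      using matching_add_left[of M A B P, OF _ _ _ _ infA[OF kA] kA] M unfolding good_def by blast
    obtain M2 where 2: "M1 \<subseteq> M2" "eB k \<in> snd ` M2" "finite M2" "M2 \<subseteq> {(a, b). a \<in> A \<and> b \<in> B \<and> P a b}"
      "inj_on fst M2" "inj_on snd M2"
      using matching_add_right[of M1 A B P, OF 1(3-6) infB[OF kB] kB] by blast
    then show ?thesis using 1 unfolding good_def by (intro exI[of _ M2]) auto
  qed
  have "good {(a0, b0)}" using base by (simp add: good_def)
  then obtain M where M: "M 0 = {(a0, b0)}" "\<And>k. good (M k)"
    "\<And>k. M k \<subseteq> M (Suc k) \<and> eA k \<in> fst ` M (Suc k) \<and> eB k \<in> snd ` M (Suc k)"
    using dependent_nat_choice[of "\<lambda>k M. good M \<and> (k = 0 \<longrightarrow> M = {(a0, b0)})"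
        "\<lambda>k M M'. M \<subseteq> M' \<and> eA k \<in> fst ` M' \<and> eB k \<in> snd ` M'"] step
    by (metis Zero_not_Suc)
  have mono: "M k \<subseteq> M l" if "k \<le> l" for k l using lift_Suc_mono_le[of M, OF _ that] M(3) by blast
  define N where "N = (\<Union>k. M k)"
  have NP: "a \<in> A" "b \<in> B" "P a b" if "(a, b) \<in> N" for a b
    using that M(2) unfolding N_def good_def by blast+
  have uniq: "(a = a') = (b = b')" if ab: "(a, b) \<in> N" "(a', b') \<in> N" for a b a' b'
  proof -
    obtain k l where "(a, b) \<in> M k" "(a', b') \<in> M l" using ab unfolding N_def by blast
    then have "(a, b) \<in> M (max k l)" "(a', b') \<in> M (max k l)" using mono[of k "max k l"] mono[of l "max k l"] by auto
    then show ?thesis using M(2)[of "max k l"] unfolding good_def inj_on_def by fastforce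
  qed
  have totA: "\<exists>b. (a, b) \<in> N" if a: "a \<in> A" for a
  proof -
    obtain k where "eA k = a" using a eA by auto
    then show ?thesis using M(3)[of k] unfolding N_def by force
  qed
  have totB: "\<exists>a. (a, b) \<in> N" if b: "b \<in> B" for b
  proof -
    obtain k where "eB k = b" using b eB by auto
    then show ?thesis using M(3)[of k] unfolding N_def by force
  qed
  obtain f where f: "\<And>a. a \<in> A \<Longrightarrow> (a, f a) \<in> N" using totA by metis
  have "bij_betw f A B"
  proof (rule bij_betw_imageI)
    show "inj_on f A" using f uniq by (meson inj_onI)
    show "f ` A = B"
    proof
      show "f ` A \<subseteq> B" using f NP by blast
      show "B \<subseteq> f ` A"
      proof
        fix b assume "b \<in> B"
        then obtain a where a: "(a, b) \<in> N" using totB by blast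
        then have "f a = b" using uniq[OF f a] NP(1) by blast
        then show "b \<in> f ` A" using NP(1)[OF a] by blast
      qed
    qed
  qed
  moreover have "(a0, b0) \<in> N" using M(1) unfolding N_def by blast
  then have "f a0 = b0" using uniq[OF f] base(1) by blast
  ultimately show ?thesis using f NP(3) by blast
qed

section \<open>Finitely supported words with the Hamming distance\<close>

definition words :: "nat \<Rightarrow> (nat \<Rightarrow> nat) set" where
  "words b = {s. finite {i. s i \<noteq> 0} \<and> (\<forall>i. s i < b)}"

definition hdist :: "(nat \<Rightarrow> 'b) \<Rightarrow> (nat \<Rightarrow> 'b) \<Rightarrow> nat" where
  "hdist s t = card {i. s i \<noteq> t i}"

lemma finite_diff: "s \<in> words a \<Longrightarrow> t \<in> words b \<Longrightarrow> finite {i. s i \<noteq> t i}"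
  by (rule finite_subset[of _ "{i. s i \<noteq> 0} \<union> {i. t i \<noteq> 0}"]) (auto simp: words_def)

lemma hdist_sym: "hdist s t = hdist t s"
  by (simp add: hdist_def eq_commute)

lemma hdist_triangle:
  assumes "finite {i. s i \<noteq> t i}" "finite {i. t i \<noteq> u i}"
  shows "hdist s u \<le> hdist s t + hdist t u"
proof -
  have "hdist s u \<le> card ({i. s i \<noteq> t i} \<union> {i. t i \<noteq> u i})"
    unfolding hdist_def using assms by (intro card_mono) auto
  also have "\<dots> \<le> hdist s t + hdist t u" unfolding hdist_def by (rule card_Un_le)
  finally show ?thesis .
qed

lemma hdist_eq_0: "finite {i. s i \<noteq> t i} \<Longrightarrow> hdist s t = 0 \<longleftrightarrow> s = t"
  by (auto simp: hdist_def fun_eq_iff)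

lemma zero_word: "b \<ge> 1 \<Longrightarrow> (\<lambda>_. 0) \<in> words b"
  by (simp add: words_def)

lemma countable_words: "countable (words b)"
proof -
  define f where "f s = {(i, s i) | i. s i \<noteq> 0}" for s :: "nat \<Rightarrow> nat"
  have "inj f"
  proof (rule injI)
    fix s t assume eq: "f s = f t"
    show "s = t"
    proof
      fix i
      have "(i, s i) \<in> f t \<longleftrightarrow> s i \<noteq> 0" "(i, t i) \<in> f s \<longleftrightarrow> t i \<noteq> 0" using eq by (auto simp: f_def)
      then show "s i = t i" by (auto simp: f_def)
    qed
  qed
  moreover have "f ` words b \<subseteq> Collect finite"
  proof
    fix F assume "F \<in> f ` words b"
    then obtain s where s: "s \<in> words b" "F = f s" by blast
    have "f s = (\<lambda>i. (i, s i)) ` {i. s i \<noteq> 0}" by (auto simp: f_def)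
    then show "F \<in> Collect finite" using s by (simp add: words_def)
  qed
  ultimately show ?thesis
    using countable_image_inj_on[OF countable_subset[OF _ countable_Collect_finite]] inj_on_subset[of f UNIV "words b"]
    by simp
qed

lemma infinite_neighbours:
  assumes w: "w \<in> words b" and b: "b \<ge> 2"
  shows "infinite {v \<in> words b. hdist v w \<le> 1}"
proof -
  define f where "f i = w(i := if w i = 0 then 1 else 0)" for i
  have fne: "f i k \<noteq> w k \<longleftrightarrow> k = i" for i k by (auto simp: f_def)
  have "inj f"
  proof (rule injI)
    fix i j assume "f i = f j"
    then have "f j i \<noteq> w i" using fne[of i i] by simp
    then show "i = j" using fne[of j i] by simp
  qed
  moreover have "range f \<subseteq> {v \<in> words b. hdist v w \<le> 1}"
  proof clarify
    fix i
    have "finite {k. f i k \<noteq> 0}"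
      using w by (intro finite_subset[of "{k. f i k \<noteq> 0}" "insert i {k. w k \<noteq> 0}"]) (auto simp: f_def words_def)
    then have "f i \<in> words b" using w b by (auto simp: f_def words_def)
    moreover have "{k. f i k \<noteq> w k} = {i}" using fne by auto
    ultimately show "f i \<in> words b \<and> hdist (f i) w \<le> 1" by (simp add: hdist_def)
  qed
  ultimately show ?thesis using range_inj_infinite infinite_super by blast
qed

text \<open>Every ball of radius 1 is infinite, so a greedy matching absorbs the extra letter.\<close>

lemma absorb_letter:
  assumes a: "a \<ge> 1" and b: "b \<ge> 2"
  shows "\<exists>\<psi> :: nat \<times> (nat \<Rightarrow> nat) \<Rightarrow> nat \<Rightarrow> nat. bij_betw \<psi> ({..<a} \<times> words b) (words b) \<and> \<psi> (0, \<lambda>_. 0) = (\<lambda>_. 0) \<and>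
    (\<forall>x w. x < a \<longrightarrow> w \<in> words b \<longrightarrow> hdist (\<psi> (x, w)) w \<le> 1)"
proof -
  define P where "P = (\<lambda>(x :: nat, w :: nat \<Rightarrow> nat) v. hdist v w \<le> 1)"
  have "\<exists>\<psi> :: nat \<times> (nat \<Rightarrow> nat) \<Rightarrow> nat \<Rightarrow> nat. bij_betw \<psi> ({..<a} \<times> words b) (words b) \<and> \<psi> (0, \<lambda>_. 0) = (\<lambda>_. 0) \<and>
    (\<forall>p\<in>{..<a} \<times> words b. P p (\<psi> p))"
  proof (rule infinite_matching)
    show "countable ({..<a} \<times> words b)" "countable (words b)" using countable_words by auto
    show "infinite {v \<in> words b. P p v}" if "p \<in> {..<a} \<times> words b" for p
      using infinite_neighbours[OF _ b] that by (auto simp: P_def)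
    show "infinite {p \<in> {..<a} \<times> words b. P p v}" if v: "v \<in> words b" for v
    proof -
      have "Pair 0 ` {w \<in> words b. hdist w v \<le> 1} \<subseteq> {p \<in> {..<a} \<times> words b. P p v}"
        using a by (auto simp: P_def hdist_sym)
      moreover have "infinite (Pair (0 :: nat) ` {w \<in> words b. hdist w v \<le> 1})"
        using infinite_neighbours[OF v b] by (subst finite_image_iff) (auto intro: inj_onI)
      ultimately show ?thesis using infinite_super by blast
    qed
  qed (use a b zero_word in \<open>auto simp: P_def hdist_def\<close>)
  then show ?thesis by (auto simp: P_def)
qed

text \<open>The pairing function cuts the index set into infinitely many infinite rows, so a word
  becomes a sequence of words, each of which can absorb one extra letter; \<open>assemble\<close> is
  the inverse.\<close>

definition slice :: "(nat \<Rightarrow> nat) \<Rightarrow> nat \<Rightarrow> nat \<Rightarrow> nat" where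
  "slice s j = (\<lambda>i. s (prod_encode (j, i)))"

definition assemble :: "(nat \<Rightarrow> nat \<Rightarrow> nat) \<Rightarrow> nat \<Rightarrow> nat" where
  "assemble f m = (case prod_decode m of (j, i) \<Rightarrow> f j i)"

lemma slice_assemble [simp]: "slice (assemble f) j = f j"
  by (simp add: slice_def assemble_def)

lemma assemble_slice [simp]: "assemble (slice s) = s"
proof
  fix m
  obtain j i where ji: "prod_decode m = (j, i)" by (cases "prod_decode m")
  then show "assemble (slice s) m = s m"
    using prod_decode_inverse[of m] by (simp add: slice_def assemble_def)
qed

lemma slice_words: "s \<in> words b \<Longrightarrow> slice s j \<in> words b"
proof -
  assume s: "s \<in> words b"
  have "{i. slice s j i \<noteq> 0} = (\<lambda>i. prod_encode (j, i)) -` {m. s m \<noteq> 0}" by (auto simp: slice_def)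
  moreover have "finite ((\<lambda>i. prod_encode (j, i)) -` {m. s m \<noteq> 0})"
    using s by (intro finite_vimageI) (auto simp: words_def inj_def)
  ultimately show ?thesis using s by (auto simp: words_def slice_def)
qed

lemma finite_slices: "s \<in> words b \<Longrightarrow> finite {j. slice s j \<noteq> (\<lambda>_. 0)}"
proof -
  assume s: "s \<in> words b"
  have "{j. slice s j \<noteq> (\<lambda>_. 0)} \<subseteq> (\<lambda>m. fst (prod_decode m)) ` {m. s m \<noteq> 0}"
  proof
    fix j assume "j \<in> {j. slice s j \<noteq> (\<lambda>_. 0)}"
    then obtain i where "s (prod_encode (j, i)) \<noteq> 0" by (auto simp: slice_def fun_eq_iff)
    then show "j \<in> (\<lambda>m. fst (prod_decode m)) ` {m. s m \<noteq> 0}"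
      by (intro image_eqI[of _ _ "prod_encode (j, i)"]) auto
  qed
  then show ?thesis using s finite_subset by (fastforce simp: words_def)
qed

lemma assemble_words:
  assumes f: "\<And>j. f j \<in> words b" and fin: "finite {j. f j \<noteq> (\<lambda>_. 0)}"
  shows "assemble f \<in> words b"
proof -
  have "{m. assemble f m \<noteq> 0} \<subseteq> prod_encode ` (SIGMA j:{j. f j \<noteq> (\<lambda>_. 0)}. {i. f j i \<noteq> 0})"
  proof
    fix m assume m: "m \<in> {m. assemble f m \<noteq> 0}"
    obtain j i where ji: "prod_decode m = (j, i)" by (cases "prod_decode m")
    then have "f j i \<noteq> 0" using m by (simp add: assemble_def)
    moreover have "m = prod_encode (j, i)" using ji prod_decode_inverse[of m] by simp
    ultimately show "m \<in> prod_encode ` (SIGMA j:{j. f j \<noteq> (\<lambda>_. 0)}. {i. f j i \<noteq> 0})" by force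
  qed
  moreover have "finite (prod_encode ` (SIGMA j:{j. f j \<noteq> (\<lambda>_. 0)}. {i. f j i \<noteq> 0}))"
    using f fin by (auto simp: words_def)
  ultimately have "finite {m. assemble f m \<noteq> 0}" using finite_subset by blast
  moreover have "assemble f m < b" for m
    using f by (auto simp: assemble_def words_def split: prod.split)
  ultimately show ?thesis by (simp add: words_def)
qed

lemma hdist_slices:
  assumes s: "s \<in> words b" and t: "t \<in> words b" and J: "finite J" "\<And>j. j \<notin> J \<Longrightarrow> slice s j = slice t j"
  shows "hdist s t = (\<Sum>j\<in>J. hdist (slice s j) (slice t j))"
proof -
  have "{m. s m \<noteq> t m} = prod_encode ` (SIGMA j:J. {i. slice s j i \<noteq> slice t j i})"
  proof (intro Set.set_eqI iffI)
    fix m assume m: "m \<in> {m. s m \<noteq> t m}"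
    obtain j i where ji: "prod_decode m = (j, i)" by (cases "prod_decode m")
    then have m': "m = prod_encode (j, i)" using prod_decode_inverse[of m] by simp
    then have "slice s j i \<noteq> slice t j i" using m by (simp add: slice_def)
    moreover from this have "j \<in> J" using J(2) by metis
    ultimately show "m \<in> prod_encode ` (SIGMA j:J. {i. slice s j i \<noteq> slice t j i})" using m' by blast
  qed (auto simp: slice_def)
  then have "hdist s t = card (SIGMA j:J. {i. slice s j i \<noteq> slice t j i})"
    unfolding hdist_def by (simp add: card_image inj_prod_encode)
  also have "\<dots> = (\<Sum>j\<in>J. hdist (slice s j) (slice t j))"
    unfolding hdist_def using J(1) finite_diff[OF slice_words[OF s] slice_words[OF t]] by (intro card_SigmaI) auto
  finally show ?thesis .
qed

text \<open>The \<open>j\<close>-th letter of \<open>u\<close> is absorbed by the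
  \<open>j\<close>-th slice of \<open>w\<close>. Distances add up over slices, so one slice at a
  time can be estimated; that \<psi> fixes zero keeps all but finitely many slices zero.\<close>

lemma absorb_word:
  assumes a: "a \<ge> 1" and b: "b \<ge> 2"
  shows "\<exists>\<Psi>. bij_betw \<Psi> (words a \<times> words b) (words b) \<and>
    (\<forall>u\<in>words a. \<forall>w\<in>words b. \<forall>u'\<in>words a. \<forall>w'\<in>words b.
       hdist (\<Psi> (u, w)) (\<Psi> (u', w')) \<le> 3 * (hdist u u' + hdist w w') \<and>
       hdist u u' + hdist w w' \<le> 4 * hdist (\<Psi> (u, w)) (\<Psi> (u', w')))"
proof -
  obtain \<psi> where \<psi>: "bij_betw \<psi> ({..<a} \<times> words b) (words b)" "\<psi> (0, \<lambda>_. 0) = (\<lambda>_. 0)"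
    "\<And>x w. x < a \<Longrightarrow> w \<in> words b \<Longrightarrow> hdist (\<psi> (x, w)) w \<le> 1"
    using absorb_letter[OF a b] by blast
  define \<Psi> where "\<Psi> = (\<lambda>(u, w). assemble (\<lambda>j. \<psi> (u j, slice w j)))"
  have ul: "u j < a" if "u \<in> words a" for u j using that by (simp add: words_def)
  have \<psi>w: "\<psi> (x, w) \<in> words b" if "x < a" "w \<in> words b" for x w
    using bij_betwE[OF \<psi>(1)] that by auto
  have \<psi>inj: "\<psi> (x, w) = \<psi> (x', w') \<Longrightarrow> x = x' \<and> w = w'"
    if "x < a" "w \<in> words b" "x' < a" "w' \<in> words b" for x w x' w'
    using inj_onD[OF bij_betw_imp_inj_on[OF \<psi>(1)], of "(x, w)" "(x', w')"] that by auto
  have sl: "slice (\<Psi> (u, w)) j = \<psi> (u j, slice w j)" for u w j by (simp add: \<Psi>_def)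
  have \<Psi>w: "\<Psi> (u, w) \<in> words b" if u: "u \<in> words a" and w: "w \<in> words b" for u w
    unfolding \<Psi>_def prod.case
  proof (rule assemble_words)
    show "\<psi> (u j, slice w j) \<in> words b" for j by (rule \<psi>w[OF ul[OF u] slice_words[OF w]])
    show "finite {j. \<psi> (u j, slice w j) \<noteq> (\<lambda>_. 0)}"
    proof (rule finite_subset)
      show "{j. \<psi> (u j, slice w j) \<noteq> (\<lambda>_. 0)} \<subseteq> {j. u j \<noteq> 0} \<union> {j. slice w j \<noteq> (\<lambda>_. 0)}"
        using \<psi>(2) by auto
      show "finite ({j. u j \<noteq> 0} \<union> {j. slice w j \<noteq> (\<lambda>_. 0)})" using u finite_slices[OF w] by (simp add: words_def)
    qed
  qed
  have "bij_betw \<Psi> (words a \<times> words b) (words b)"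
  proof (rule bij_betw_imageI)
    show "inj_on \<Psi> (words a \<times> words b)"
    proof (rule inj_onI, clarify)
      fix u w u' w' assume uw: "u \<in> words a" "w \<in> words b" "u' \<in> words a" "w' \<in> words b"
        and eq: "\<Psi> (u, w) = \<Psi> (u', w')"
      have "u j = u' j \<and> slice w j = slice w' j" for j
        by (rule \<psi>inj) (use uw ul slice_words sl eq in \<open>auto\<close>, metis sl)
      then show "u = u' \<and> w = w'" using assemble_slice[of w] assemble_slice[of w'] by presburger
    qed
    show "\<Psi> ` (words a \<times> words b) = words b"
    proof
      show "\<Psi> ` (words a \<times> words b) \<subseteq> words b" using \<Psi>w by auto
      show "words b \<subseteq> \<Psi> ` (words a \<times> words b)"
      proof
        fix v assume v: "v \<in> words b"
        define \<phi> where "\<phi> j = inv_into ({..<a} \<times> words b) \<psi> (slice v j)" for j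
        have \<phi>: "\<phi> j \<in> {..<a} \<times> words b" "\<psi> (\<phi> j) = slice v j" for j
          unfolding \<phi>_def using bij_betw_imp_surj_on[OF \<psi>(1)] slice_words[OF v, of j]
          by (metis inv_into_into, metis f_inv_into_f)
        have \<phi>0: "\<phi> j = (0, \<lambda>_. 0)" if "slice v j = (\<lambda>_. 0)" for j
          using \<psi>inj[of "fst (\<phi> j)" "snd (\<phi> j)" 0 "\<lambda>_. 0"] \<phi>[of j] \<psi>(2) that a b zero_word[of b]
          by (auto simp: mem_Times_iff prod_eq_iff)
        define u where "u j = fst (\<phi> j)" for j
        define w where "w = assemble (\<lambda>j. snd (\<phi> j))"
        have "u \<in> words a"
        proof -
          have "{j. u j \<noteq> 0} \<subseteq> {j. slice v j \<noteq> (\<lambda>_. 0)}" using \<phi>0 by (auto simp: u_def)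
          then have "finite {j. u j \<noteq> 0}" using finite_slices[OF v] finite_subset by blast
          then show ?thesis using \<phi>(1) by (auto simp: words_def u_def mem_Times_iff)
        qed
        moreover have "w \<in> words b" unfolding w_def
        proof (rule assemble_words)
          show "snd (\<phi> j) \<in> words b" for j using \<phi>(1)[of j] by (simp add: mem_Times_iff)
          have "{j. snd (\<phi> j) \<noteq> (\<lambda>_. 0)} \<subseteq> {j. slice v j \<noteq> (\<lambda>_. 0)}" using \<phi>0 by auto
          then show "finite {j. snd (\<phi> j) \<noteq> (\<lambda>_. 0)}" using finite_slices[OF v] finite_subset by blast
        qed
        moreover have "\<Psi> (u, w) = v" using \<phi>(2) by (simp add: \<Psi>_def u_def w_def)
        ultimately show "v \<in> \<Psi> ` (words a \<times> words b)" by force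
      qed
    qed
  qed
  moreover have "hdist (\<Psi> (u, w)) (\<Psi> (u', w')) \<le> 3 * (hdist u u' + hdist w w') \<and>
       hdist u u' + hdist w w' \<le> 4 * hdist (\<Psi> (u, w)) (\<Psi> (u', w'))"
    if uw: "u \<in> words a" "w \<in> words b" "u' \<in> words a" "w' \<in> words b" for u w u' w'
  proof -
    define J where "J = {j. u j \<noteq> u' j} \<union> {j. slice w j \<noteq> slice w' j}"
    have "finite {j. slice w j \<noteq> slice w' j}"
      by (rule finite_subset[of _ "{j. slice w j \<noteq> (\<lambda>_. 0)} \<union> {j. slice w' j \<noteq> (\<lambda>_. 0)}"])
        (use finite_slices uw in auto)
    then have J: "finite J" using finite_diff uw by (auto simp: J_def)
    define e where "e j = (if u j \<noteq> u' j then 1 else 0 :: nat)" for j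
    have "hdist u u' = (\<Sum>j\<in>J. e j)"
    proof -
      have "{j. u j \<noteq> u' j} = {j \<in> J. u j \<noteq> u' j}" by (auto simp: J_def)
      then show ?thesis using J by (simp add: hdist_def e_def sum.If_cases Int_def)
    qed
    moreover have "hdist w w' = (\<Sum>j\<in>J. hdist (slice w j) (slice w' j))"
      using hdist_slices[OF uw(2,4) J] by (auto simp: J_def)
    ultimately have d: "hdist u u' + hdist w w' = (\<Sum>j\<in>J. e j + hdist (slice w j) (slice w' j))"
      by (simp add: sum.distrib)
    have D: "hdist (\<Psi> (u, w)) (\<Psi> (u', w')) = (\<Sum>j\<in>J. hdist (\<psi> (u j, slice w j)) (\<psi> (u' j, slice w' j)))"
      using hdist_slices[OF \<Psi>w[OF uw(1,2)] \<Psi>w[OF uw(3,4)] J] by (auto simp: J_def sl)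
    \<comment> \<open>\<psi> moves each slice by at most 1, so the distance of two slices changes by
      at most 2. On \<open>J\<close> both sides are at least 1, which turns the additive errors into
      factors: 1 + 2 = 3, and 1 + 2 + 1 = 4 where the last 1 pays for \<open>e j\<close>.\<close>
    have "hdist (\<psi> (u j, slice w j)) (\<psi> (u' j, slice w' j)) \<le> 3 * (e j + hdist (slice w j) (slice w' j)) \<and>
        e j + hdist (slice w j) (slice w' j) \<le> 4 * hdist (\<psi> (u j, slice w j)) (\<psi> (u' j, slice w' j))"
      if j: "j \<in> J" for j
    proof -
      define x where "x = \<psi> (u j, slice w j)"
      define x' where "x' = \<psi> (u' j, slice w' j)"
      note w4 = slice_words[OF uw(2), of j] slice_words[OF uw(4), of j]
      have x: "x \<in> words b" "x' \<in> words b" unfolding x_def x'_def using \<psi>w ul uw w4 by auto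
      have 1: "hdist x (slice w j) \<le> 1" "hdist x' (slice w' j) \<le> 1"
        unfolding x_def x'_def using \<psi>(3) ul uw w4 by auto
      have "hdist x x' \<le> hdist x (slice w j) + (hdist (slice w j) (slice w' j) + hdist (slice w' j) x')"
        using hdist_triangle[of x "slice w j" x'] hdist_triangle[of "slice w j" "slice w' j" x']
          finite_diff x w4 by (meson add_left_mono order_trans)
      moreover have "hdist (slice w j) (slice w' j) \<le> hdist (slice w j) x + (hdist x x' + hdist x' (slice w' j))"
        using hdist_triangle[of "slice w j" x "slice w' j"] hdist_triangle[of x x' "slice w' j"]
          finite_diff x w4 by (meson add_left_mono order_trans)
      moreover have "e j + hdist (slice w j) (slice w' j) \<ge> 1"
        using j hdist_eq_0[OF finite_diff[OF w4]] by (auto simp: J_def e_def Suc_le_eq)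
      moreover have "hdist x x' \<ge> 1"
      proof -
        have "x \<noteq> x'" using \<psi>inj[of "u j" "slice w j" "u' j" "slice w' j"] j ul uw w4
          unfolding x_def x'_def J_def by auto
        then show ?thesis using hdist_eq_0[OF finite_diff[OF x]] by (simp add: Suc_le_eq)
      qed
      moreover have "e j \<le> 1" by (simp add: e_def)
      ultimately show ?thesis using 1 unfolding x_def[symmetric] x'_def[symmetric]
        by (simp add: hdist_sym)
    qed
    then show ?thesis unfolding d D sum_distrib_left by (auto intro!: sum_mono)
  qed
  ultimately show ?thesis by blast
qed

text \<open>Both \<open>words n\<close> and \<open>words 2\<close> correspond to the product of the
  two, since each absorbs the other. Each inequality combines the factor 3 of one correspondence
  with the factor 4 of the other, whence 12.\<close>

lemma words_bilipschitz:
  assumes n: "n \<ge> 2"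
  shows "\<exists>\<Phi>. bij_betw \<Phi> (words n) (words 2) \<and>
    (\<forall>s\<in>words n. \<forall>t\<in>words n. hdist (\<Phi> s) (\<Phi> t) \<le> 12 * hdist s t \<and> hdist s t \<le> 12 * hdist (\<Phi> s) (\<Phi> t))"
proof -
  obtain F where F: "bij_betw F (words 2 \<times> words n) (words n)"
    "\<forall>u\<in>words 2. \<forall>w\<in>words n. \<forall>u'\<in>words 2. \<forall>w'\<in>words n.
       hdist (F (u, w)) (F (u', w')) \<le> 3 * (hdist u u' + hdist w w') \<and>
       hdist u u' + hdist w w' \<le> 4 * hdist (F (u, w)) (F (u', w'))"
    using absorb_word[of 2 n] n by auto
  obtain G where G: "bij_betw G (words n \<times> words 2) (words 2)"
    "\<forall>w\<in>words n. \<forall>u\<in>words 2. \<forall>w'\<in>words n. \<forall>u'\<in>words 2.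
       hdist (G (w, u)) (G (w', u')) \<le> 3 * (hdist w w' + hdist u u') \<and>
       hdist w w' + hdist u u' \<le> 4 * hdist (G (w, u)) (G (w', u'))"
    using absorb_word[of n 2] n by auto
  have sw: "bij_betw prod.swap (words 2 \<times> words n) (words n \<times> words 2)"
    by (rule bij_betwI[of _ _ _ prod.swap]) auto
  define \<Phi> where "\<Phi> = G \<circ> (prod.swap \<circ> inv_into (words 2 \<times> words n) F)"
  have "bij_betw \<Phi> (words n) (words 2)"
    unfolding \<Phi>_def using bij_betw_trans[OF bij_betw_trans[OF bij_betw_inv_into[OF F(1)] sw] G(1)] .
  moreover have "hdist (\<Phi> s) (\<Phi> t) \<le> 12 * hdist s t \<and> hdist s t \<le> 12 * hdist (\<Phi> s) (\<Phi> t)"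
    if st: "s \<in> words n" "t \<in> words n" for s t
  proof -
    have "s \<in> F ` (words 2 \<times> words n)" "t \<in> F ` (words 2 \<times> words n)"
      using st bij_betw_imp_surj_on[OF F(1)] by auto
    then obtain u w u' w' where e: "u \<in> words 2" "w \<in> words n" "s = F (u, w)" "u' \<in> words 2" "w' \<in> words n" "t = F (u', w')"
      by auto
    have "\<Phi> s = G (w, u)" "\<Phi> t = G (w', u')"
      using e inv_into_f_f[OF bij_betw_imp_inj_on[OF F(1)]] by (auto simp: \<Phi>_def)
    moreover have "hdist s t \<le> 3 * (hdist u u' + hdist w w')" "hdist u u' + hdist w w' \<le> 4 * hdist s t"
      using F(2) e by auto
    moreover have "hdist (G (w, u)) (G (w', u')) \<le> 3 * (hdist w w' + hdist u u')"
      "hdist w w' + hdist u u' \<le> 4 * hdist (G (w, u)) (G (w', u'))" using G(2) e by auto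
    ultimately show ?thesis by simp
  qed
  ultimately show ?thesis by blast
qed

section \<open>The graph metric of the Hamming cube\<close>

lemma finite_diff_hamming: "s \<in> hamming_vertices \<Longrightarrow> t \<in> hamming_vertices \<Longrightarrow> finite {i. s i \<noteq> t i}"
  by (rule finite_subset[of _ "{i. s i} \<union> {i. t i}"]) (auto simp: hamming_vertices_def)

lemma ex1_iff_card: "(\<exists>!x. P x) \<longleftrightarrow> card (Collect P) = 1"
proof
  assume "\<exists>!x. P x"
  then have "Collect P = {THE x. P x}" using theI'[of P] by auto
  then show "card (Collect P) = 1" by simp
next
  assume "card (Collect P) = 1"
  then obtain x where x: "Collect P = {x}" by (rule card_1_singletonE)
  show "\<exists>!x. P x"
  proof (rule ex1I)
    show "P x" using x by blast
    show "y = x" if "P y" for y using x that by blast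
  qed
qed

lemma hamming_edge_iff:
  "(s, t) \<in> hamming_edges \<longleftrightarrow> s \<in> hamming_vertices \<and> t \<in> hamming_vertices \<and> hdist s t = 1"
  by (simp add: hamming_edges_def hdist_def ex1_iff_card)

lemma hamming_path_bound: "(s, t) \<in> hamming_edges ^^ n \<Longrightarrow> s \<in> hamming_vertices \<Longrightarrow> hdist s t \<le> n \<and> t \<in> hamming_vertices"
proof (induction n arbitrary: t)
  case (Suc n)
  then obtain u where u: "(s, u) \<in> hamming_edges ^^ n" "(u, t) \<in> hamming_edges" by auto
  then have "hdist s u \<le> n" "u \<in> hamming_vertices" "t \<in> hamming_vertices" "hdist u t = 1"
    using Suc by (auto simp: hamming_edge_iff)
  then show ?case using hdist_triangle[of s u t] finite_diff_hamming Suc.prems by fastforce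
qed (simp add: hdist_def)

lemma hamming_path_exists:
  "s \<in> hamming_vertices \<Longrightarrow> t \<in> hamming_vertices \<Longrightarrow> hdist s t = n \<Longrightarrow> (s, t) \<in> hamming_edges ^^ n"
proof (induction n arbitrary: t)
  case 0
  then show ?case using hdist_eq_0[OF finite_diff_hamming] by auto
next
  case (Suc n)
  note fin = finite_diff_hamming[OF Suc.prems(1,2)]
  have "{i. s i \<noteq> t i} \<noteq> {}" using Suc.prems(3) by (intro notI) (simp add: hdist_def)
  then obtain i where i: "s i \<noteq> t i" by blast
  define u where "u = t(i := s i)"
  have "{j. u j} \<subseteq> insert i {j. t j}" by (auto simp: u_def)
  then have u: "u \<in> hamming_vertices" using Suc.prems(2) finite_subset by (auto simp: hamming_vertices_def)
  have "{j. s j \<noteq> u j} = {j. s j \<noteq> t j} - {i}" "{j. u j \<noteq> t j} = {i}" using i by (auto simp: u_def)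
  then have "hdist s u = n" "hdist u t = 1" using Suc.prems(3) i fin by (auto simp: hdist_def)
  then show ?case using Suc.IH[OF Suc.prems(1) u] u Suc.prems(2) by (auto simp: hamming_edge_iff)
qed

lemma hamming_dist:
  assumes "s \<in> hamming_vertices" "t \<in> hamming_vertices"
  shows "graph_dist hamming_edges s t = real (hdist s t)"
proof -
  have "(LEAST n. (s, t) \<in> hamming_edges ^^ n) = hdist s t"
    using hamming_path_exists[OF assms refl] hamming_path_bound assms(1) by (intro Least_equality) blast+
  then show ?thesis by (simp add: graph_dist_def)
qed

text \<open>The coding \<open>c\<close> need not be injective, since a pseudometric \<open>d\<close>
  may vanish on distinct points; surjectivity of the code makes the additive constant 0
  suffice.\<close>

lemma words_quasi_isometric_hamming:
  assumes n: "n \<ge> 2" and c: "c ` M = words n"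
    and d: "\<And>x y. x \<in> M \<Longrightarrow> y \<in> M \<Longrightarrow> d x y = real (hdist (c x) (c y))"
  shows "quasi_isometric M d hamming_vertices (graph_dist hamming_edges)"
proof -
  obtain \<Phi> where \<Phi>: "bij_betw \<Phi> (words n) (words 2)"
    "\<And>s t. s \<in> words n \<Longrightarrow> t \<in> words n \<Longrightarrow> hdist (\<Phi> s) (\<Phi> t) \<le> 12 * hdist s t \<and> hdist s t \<le> 12 * hdist (\<Phi> s) (\<Phi> t)"
    using words_bilipschitz[OF n] by blast
  define \<iota> where "\<iota> s = (\<lambda>i. s i \<noteq> (0 :: nat))" for s :: "nat \<Rightarrow> nat"
  have \<iota>v: "\<iota> s \<in> hamming_vertices" if "s \<in> words 2" for s using that by (simp add: \<iota>_def hamming_vertices_def words_def)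
  have \<iota>d: "hdist (\<iota> s) (\<iota> t) = hdist s t" if "s \<in> words 2" "t \<in> words 2" for s t
  proof -
    have "s i < 2" "t i < 2" for i using that by (auto simp: words_def)
    then have "s i = 0 \<or> s i = 1" "t i = 0 \<or> t i = 1" for i by (auto simp: less_2_cases_iff)
    then have "(s i \<noteq> 0) \<noteq> (t i \<noteq> 0) \<longleftrightarrow> s i \<noteq> t i" for i by (metis zero_neq_one)
    then show ?thesis by (simp add: hdist_def \<iota>_def)
  qed
  define f where "f = \<iota> \<circ> \<Phi> \<circ> c"
  have cw: "c x \<in> words n" "\<Phi> (c x) \<in> words 2" if "x \<in> M" for x
    using that c bij_betwE[OF \<Phi>(1)] by auto
  have fd: "graph_dist hamming_edges (f x) (f y) = real (hdist (\<Phi> (c x)) (\<Phi> (c y)))" if "x \<in> M" "y \<in> M" for x y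
    using that cw \<iota>v \<iota>d by (simp add: f_def hamming_dist)
  have "\<exists>x\<in>M. graph_dist hamming_edges v (f x) \<le> 0" if v: "v \<in> hamming_vertices" for v
  proof -
    define s where "s i = (if v i then 1 else 0 :: nat)" for i
    have s: "s \<in> words 2" "\<iota> s = v" using v by (auto simp: s_def words_def hamming_vertices_def \<iota>_def)
    have "s \<in> \<Phi> ` words n" using s(1) bij_betw_imp_surj_on[OF \<Phi>(1)] by simp
    then obtain t where t: "t \<in> words n" "\<Phi> t = s" by (elim imageE) simp
    have "t \<in> c ` M" using t(1) c by simp
    then obtain x where x: "x \<in> M" "c x = t" by (elim imageE) simp
    then have "f x = v" using t s by (simp add: f_def)
    then have "graph_dist hamming_edges v (f x) \<le> 0" using hamming_dist[OF v v] by (simp add: hdist_def)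
    then show ?thesis using x(1) by blast
  qed
  moreover have "d x y / 12 - 0 \<le> graph_dist hamming_edges (f x) (f y) \<and>
      graph_dist hamming_edges (f x) (f y) \<le> 12 * d x y + 0" if "x \<in> M" "y \<in> M" for x y
    using \<Phi>(2)[OF cw(1) cw(1), OF that] d[OF that] fd[OF that] by simp
  moreover have "f \<in> M \<rightarrow> hamming_vertices" using cw \<iota>v by (simp add: f_def)
  ultimately show ?thesis unfolding quasi_isometric_def
    by (intro exI[of _ f] exI[of _ "12 :: real"] exI[of _ "0 :: real"] conjI ballI) simp_all
qed

section \<open>Ultrametric branching and the one-ended tree\<close>

definition sequences :: "(nat \<Rightarrow> nat) set" where
  "sequences = {s. finite {i. s i \<noteq> 0}}"

text \<open>A sequence stands for a leaf and its tail from \<open>k\<close> on for the ancestor at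
  height \<open>k\<close>; the distance is the height at which two leaves first share an
  ancestor.\<close>

definition tail_dist :: "(nat \<Rightarrow> nat) \<Rightarrow> (nat \<Rightarrow> nat) \<Rightarrow> real" where
  "tail_dist s t = real (LEAST k. \<forall>j\<ge>k. s j = t j)"

abbreviation sequence_space :: "(nat \<Rightarrow> nat) coarse_space" where
  "sequence_space \<equiv> metric_coarse_space sequences tail_dist"

lemma tails_meet: "s \<in> sequences \<Longrightarrow> t \<in> sequences \<Longrightarrow> \<exists>k. \<forall>j\<ge>k. s j = t j"
proof -
  assume "s \<in> sequences" "t \<in> sequences"
  then have "finite ({i. s i \<noteq> 0} \<union> {i. t i \<noteq> 0})" by (simp add: sequences_def)
  then obtain k where "\<And>i. i \<in> {i. s i \<noteq> 0} \<union> {i. t i \<noteq> 0} \<Longrightarrow> i \<le> k"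
    using finite_nat_set_iff_bounded_le by auto
  then have "s j = 0 \<and> t j = 0" if "j \<ge> Suc k" for j
    using that by (metis (mono_tags, lifting) UnI1 UnI2 mem_Collect_eq not_less_eq_eq)
  then show ?thesis by (intro exI[of _ "Suc k"]) simp
qed

lemma tail_dist_le_iff:
  assumes "s \<in> sequences" "t \<in> sequences"
  shows "tail_dist s t \<le> real k \<longleftrightarrow> (\<forall>j\<ge>k. s j = t j)"
proof
  define m where "m = (LEAST k. \<forall>j\<ge>k. s j = t j)"
  have m: "tail_dist s t = real m" by (simp add: tail_dist_def m_def)
  have "\<forall>j\<ge>m. s j = t j" unfolding m_def
    by (rule LeastI_ex[of "\<lambda>k. \<forall>j\<ge>k. s j = t j"]) (rule tails_meet[OF assms])
  then show "\<forall>j\<ge>k. s j = t j" if "tail_dist s t \<le> real k" using that unfolding m by auto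
  show "tail_dist s t \<le> real k" if "\<forall>j\<ge>k. s j = t j"
    using Least_le[of "\<lambda>k. \<forall>j\<ge>k. s j = t j", OF that] unfolding m m_def by (rule of_nat_mono)
qed

lemma entourages_sequence_space:
  "E \<in> entourages sequence_space \<longleftrightarrow>
     E \<subseteq> sequences \<times> sequences \<and> (\<exists>k. \<forall>s t. (s, t) \<in> E \<longrightarrow> (\<forall>j\<ge>k. s j = t j))"
proof
  assume E: "E \<in> entourages sequence_space"
  then obtain B where B: "E \<subseteq> sequences \<times> sequences" "\<And>s t. (s, t) \<in> E \<Longrightarrow> tail_dist s t \<le> B"
    unfolding entourages_metric by blast
  obtain k :: nat where "B \<le> real k" using real_arch_simple by blast
  have "\<forall>j\<ge>k. s j = t j" if st: "(s, t) \<in> E" for s t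
  proof -
    have "s \<in> sequences" "t \<in> sequences" using B(1) st by auto
    then show ?thesis using tail_dist_le_iff[of s t k] B(2)[OF st] \<open>B \<le> real k\<close> by simp
  qed
  then show "E \<subseteq> sequences \<times> sequences \<and> (\<exists>k. \<forall>s t. (s, t) \<in> E \<longrightarrow> (\<forall>j\<ge>k. s j = t j))" using B(1) by blast
next
  assume E: "E \<subseteq> sequences \<times> sequences \<and> (\<exists>k. \<forall>s t. (s, t) \<in> E \<longrightarrow> (\<forall>j\<ge>k. s j = t j))"
  then obtain k where k: "\<And>s t. (s, t) \<in> E \<Longrightarrow> (\<forall>j\<ge>k. s j = t j)" by blast
  have "tail_dist s t \<le> real k" if st: "(s, t) \<in> E" for s t
  proof -
    have "s \<in> sequences" "t \<in> sequences" using E st by auto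
    then show ?thesis using tail_dist_le_iff[of s t k] k[OF st] by simp
  qed
  then show "E \<in> entourages sequence_space" unfolding entourages_metric using E by blast
qed

lemma coarse_structure_sequence_space: "coarse_structure sequence_space"
  unfolding coarse_structure_def points_metric
proof (intro conjI ballI allI impI)
  fix E assume "E \<in> entourages sequence_space"
  then show "E \<subseteq> sequences \<times> sequences" by (simp add: entourages_metric)
next
  show "Id_on sequences \<in> entourages sequence_space" unfolding entourages_sequence_space by auto
next
  fix E F assume "E \<in> entourages sequence_space" "F \<subseteq> E"
  then show "F \<in> entourages sequence_space" unfolding entourages_sequence_space by blast
next
  fix E assume "E \<in> entourages sequence_space"
  then obtain k where E: "E \<subseteq> sequences \<times> sequences" "\<forall>s t. (s, t) \<in> E \<longrightarrow> (\<forall>j\<ge>k. s j = t j)"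
    unfolding entourages_sequence_space by blast
  then have "E\<inverse> \<subseteq> sequences \<times> sequences" "\<forall>s t. (s, t) \<in> E\<inverse> \<longrightarrow> (\<forall>j\<ge>k. s j = t j)" by fastforce+
  then show "E\<inverse> \<in> entourages sequence_space" unfolding entourages_sequence_space by blast
next
  fix E F assume EF: "E \<in> entourages sequence_space" "F \<in> entourages sequence_space"
  obtain k where E: "E \<subseteq> sequences \<times> sequences" "\<forall>s t. (s, t) \<in> E \<longrightarrow> (\<forall>j\<ge>k. s j = t j)"
    using EF(1) unfolding entourages_sequence_space by blast
  obtain l where F: "F \<subseteq> sequences \<times> sequences" "\<forall>s t. (s, t) \<in> F \<longrightarrow> (\<forall>j\<ge>l. s j = t j)"
    using EF(2) unfolding entourages_sequence_space by blast
  have "\<forall>s t. (s, t) \<in> E O F \<longrightarrow> (\<forall>j\<ge>max k l. s j = t j)"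
    using E(2) F(2) by (auto elim!: relcompE) metis
  moreover have "E O F \<subseteq> sequences \<times> sequences" using E(1) F(1) by auto
  ultimately show "E O F \<in> entourages sequence_space" unfolding entourages_sequence_space by blast
qed

text \<open>Agreement from \<open>k\<close> on is an equivalence relation, so chains of bounded
  steps stay bounded.\<close>

lemma sequence_space_rtrancl:
  assumes "F \<in> entourages sequence_space"
  shows "F\<^sup>* \<inter> points sequence_space \<times> points sequence_space \<in> entourages sequence_space"
proof -
  obtain k where k: "\<And>s t. (s, t) \<in> F \<Longrightarrow> (\<forall>j\<ge>k. s j = t j)"
    using assms unfolding entourages_sequence_space by blast
  have "\<forall>j\<ge>k. s j = t j" if "(s, t) \<in> F\<^sup>*" for s t
    using that by (induction rule: rtrancl_induct) (auto dest: k)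
  then show ?thesis unfolding entourages_sequence_space by auto
qed

lemma sequence_space_nontrivial: "\<not> coarsely_trivial sequence_space"
proof
  assume "coarsely_trivial sequence_space"
  then obtain k where k: "\<And>s t. s \<in> sequences \<Longrightarrow> t \<in> sequences \<Longrightarrow> (\<forall>j\<ge>k. s j = t j)"
    unfolding coarsely_trivial_def entourages_sequence_space by auto
  have "(\<lambda>_. 0) \<in> sequences" "(\<lambda>i. if i = k then 1 else 0) \<in> sequences" by (auto simp: sequences_def)
  from k[OF this] show False by force
qed

text \<open>An increasing sequence of equivalence relations that exhausts all pairs, in which every
  class splits into countably infinitely many classes of the level below. The homeomorphism group in
  the limit case and the leaves of the tree are both instances, so they are compared through their
  codes.\<close>

locale branching =
  fixes G :: "'g set" and R :: "nat \<Rightarrow> 'g \<Rightarrow> 'g \<Rightarrow> bool"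
  assumes nonempty: "G \<noteq> {}"
    and refl: "x \<in> G \<Longrightarrow> R k x x"
    and sym: "x \<in> G \<Longrightarrow> y \<in> G \<Longrightarrow> R k x y \<Longrightarrow> R k y x"
    and trans: "x \<in> G \<Longrightarrow> y \<in> G \<Longrightarrow> z \<in> G \<Longrightarrow> R k x y \<Longrightarrow> R k y z \<Longrightarrow> R k x z"
    and mono: "x \<in> G \<Longrightarrow> y \<in> G \<Longrightarrow> R k x y \<Longrightarrow> R (Suc k) x y"
    and join: "x \<in> G \<Longrightarrow> y \<in> G \<Longrightarrow> \<exists>k. R k x y"
    and countable_branching: "x \<in> G \<Longrightarrow> countable ((\<lambda>y. {z \<in> G. R k y z}) ` {y \<in> G. R (Suc k) x y})"
    and infinite_branching: "x \<in> G \<Longrightarrow> infinite ((\<lambda>y. {z \<in> G. R k y z}) ` {y \<in> G. R (Suc k) x y})"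
begin

definition cls :: "nat \<Rightarrow> 'g \<Rightarrow> 'g set" where
  "cls k x = {z \<in> G. R k x z}"

lemma cls_eq_iff: "x \<in> G \<Longrightarrow> y \<in> G \<Longrightarrow> cls k x = cls k y \<longleftrightarrow> R k x y"
proof -
  assume x: "x \<in> G" and y: "y \<in> G"
  show ?thesis
  proof
    assume "cls k x = cls k y"
    then show "R k x y" using refl[OF y, of k] y by (auto simp: cls_def)
  next
    assume "R k x y"
    then show "cls k x = cls k y" using trans sym x y unfolding cls_def by blast
  qed
qed

lemma mono_le: "x \<in> G \<Longrightarrow> y \<in> G \<Longrightarrow> R k x y \<Longrightarrow> k \<le> l \<Longrightarrow> R l x y"
  by (induction l) (auto simp: le_Suc_eq intro: mono)

text \<open>The code of a point lists, level by level, the label of its class among the subclasses of the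
  next larger class; the classes of a base point get label 0, which makes all codes finitely
  supported.\<close>

theorem coding:
  "\<exists>c. c ` G = sequences \<and> (\<forall>x\<in>G. \<forall>y\<in>G. \<forall>k. R k x y \<longleftrightarrow> (\<forall>j\<ge>k. c x j = c y j))"
proof -
  obtain x0 where x0: "x0 \<in> G" using nonempty by blast
  have ex: "\<exists>f. bij_betw f (cls k ` C) (UNIV :: nat set) \<and> (x0 \<in> C \<longrightarrow> f (cls k x0) = 0)"
    if C: "C \<in> cls (Suc k) ` G" for k C
  proof -
    obtain x where x: "x \<in> G" "C = cls (Suc k) x" using C by blast
    have "countable (cls k ` C)" "infinite (cls k ` C)"
      using countable_branching[OF x(1), of k] infinite_branching[OF x(1), of k]
      unfolding x(2) cls_def by simp_all
    then obtain g where g: "bij_betw g (cls k ` C) (UNIV :: nat set)"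
      using countableE_infinite by blast
    \<comment> \<open>The transposition gives the class of the base point the label 0.\<close>
    define f where "f = Transposition.transpose (g (cls k x0)) 0 \<circ> g"
    have "bij_betw f (cls k ` C) UNIV" unfolding f_def by (rule bij_betw_trans[OF g bij_transpose])
    then show ?thesis by (intro exI[of _ f]) (simp add: f_def)
  qed
  define f where "f k C = (SOME f. bij_betw f (cls k ` C) (UNIV :: nat set) \<and> (x0 \<in> C \<longrightarrow> f (cls k x0) = 0))" for k C
  have "bij_betw (f k C) (cls k ` C) (UNIV :: nat set) \<and> (x0 \<in> C \<longrightarrow> f k C (cls k x0) = 0)"
    if "C \<in> cls (Suc k) ` G" for k C
    unfolding f_def by (rule someI_ex[OF ex[OF that]])
  then have f: "\<And>k C. C \<in> cls (Suc k) ` G \<Longrightarrow> bij_betw (f k C) (cls k ` C) (UNIV :: nat set)"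
    "\<And>k C. C \<in> cls (Suc k) ` G \<Longrightarrow> x0 \<in> C \<Longrightarrow> f k C (cls k x0) = 0"
    by simp_all
  define c where "c x k = f k (cls (Suc k) x) (cls k x)" for x k
  have inC: "cls k y \<in> cls k ` cls (Suc k) x" if "x \<in> G" "y \<in> G" "R (Suc k) x y" for x y k
    using that by (auto simp: cls_def)
  have down: "R k x y" if xy: "x \<in> G" "y \<in> G" "R (Suc k) x y" "c x k = c y k" for x y k
  proof -
    have eq: "cls (Suc k) x = cls (Suc k) y" using cls_eq_iff xy by simp
    have inj: "inj_on (f k (cls (Suc k) x)) (cls k ` cls (Suc k) x)"
      using f(1)[of "cls (Suc k) x" k] xy(1) by (simp add: bij_betw_def)
    have "cls k x = cls k y"
    proof (rule inj_onD[OF inj])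
      show "f k (cls (Suc k) x) (cls k x) = f k (cls (Suc k) x) (cls k y)"
        using xy(4) by (simp add: c_def eq)
      show "cls k x \<in> cls k ` cls (Suc k) x" by (rule inC[OF xy(1,1) refl[OF xy(1)]])
      show "cls k y \<in> cls k ` cls (Suc k) x" by (rule inC[OF xy(1-3)])
    qed
    then show ?thesis using cls_eq_iff xy by simp
  qed
  have code: "R k x y \<longleftrightarrow> (\<forall>j\<ge>k. c x j = c y j)" if xy: "x \<in> G" "y \<in> G" for x y k
  proof
    assume k: "R k x y"
    show "\<forall>j\<ge>k. c x j = c y j"
    proof (intro allI impI)
      fix j assume "k \<le> j"
      then have "cls j x = cls j y" "cls (Suc j) x = cls (Suc j) y"
        using mono_le[OF xy k] cls_eq_iff[OF xy] by auto
      then show "c x j = c y j" by (simp add: c_def)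
    qed
  next
    assume eq: "\<forall>j\<ge>k. c x j = c y j"
    obtain m where m: "R m x y" using join[OF xy] by blast
    have "R (k + i) x y \<Longrightarrow> R k x y" for i
    proof (induction i)
      case (Suc i)
      then show ?case using down[OF xy, of "k + i"] eq by simp
    qed simp
    then show "R k x y" using mono_le[OF xy m, of "k + m"] by simp
  qed
  have c0: "c x0 k = 0" for k
    unfolding c_def using f(2)[of "cls (Suc k) x0" k] x0 refl[OF x0] by (simp add: cls_def)
  have "c ` G = sequences"
  proof
    show "c ` G \<subseteq> sequences"
    proof
      fix s assume "s \<in> c ` G"
      then obtain x where x: "x \<in> G" "s = c x" by blast
      obtain m where "R m x x0" using join[OF x(1) x0] by blast
      then have "\<forall>j\<ge>m. s j = 0" using code[OF x(1) x0] c0 x by simp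
      then have "{i. s i \<noteq> 0} \<subseteq> {..<m}" by (metis (mono_tags, lifting) lessThan_iff linorder_le_less_linear mem_Collect_eq subsetI)
      then show "s \<in> sequences" using finite_subset by (auto simp: sequences_def)
    qed
    show "sequences \<subseteq> c ` G"
    proof
      fix s assume s: "s \<in> sequences"
      have "(\<lambda>_. 0) \<in> sequences" by (simp add: sequences_def)
      then obtain m where m: "\<forall>j\<ge>m. s j = 0" using tails_meet[OF s] by auto
      \<comment> \<open>Starting from \<open>x0\<close>, the coordinates are corrected downwards
        from \<open>m\<close>: replacing a point within its class of level \<open>Suc k\<close>
        changes no coordinate above \<open>k\<close>. The truncated difference makes the claim
        stationary once \<open>i\<close> reaches \<open>m\<close>.\<close>
      have "\<exists>x\<in>G. \<forall>j\<ge>m - i. c x j = s j" for i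
      proof (induction i)
        case 0
        then show ?case using m c0 x0 by (intro bexI[of _ x0]) auto
      next
        case (Suc i)
        then obtain x where x: "x \<in> G" "\<forall>j\<ge>m - i. c x j = s j" by (elim bexE)
        show ?case
        proof (cases "i < m")
          case True
          define k where "k = m - Suc i"
          have k: "Suc k = m - i" using True by (simp add: k_def)
          have "s k \<in> f k (cls (Suc k) x) ` cls k ` cls (Suc k) x"
            using f(1)[of "cls (Suc k) x" k] x(1) by (simp add: bij_betw_def)
          then obtain y where y: "y \<in> cls (Suc k) x" "s k = f k (cls (Suc k) x) (cls k y)" by (elim imageE) simp
          then have yG: "y \<in> G" "R (Suc k) x y" by (auto simp: cls_def)
          have "cls (Suc k) y = cls (Suc k) x" using cls_eq_iff[OF x(1) yG(1), of "Suc k"] yG(2) by simp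
          then have "c y k = s k" using y(2) by (simp add: c_def)
          moreover have "c y j = s j" if "j \<ge> Suc k" for j
            using code[OF x(1) yG(1)] yG(2) that x(2) k by metis
          ultimately have "\<forall>j\<ge>k. c y j = s j" by (metis le_antisym not_less_eq_eq)
          then show ?thesis using yG(1) unfolding k_def by blast
        next
          case False
          then show ?thesis using x by (intro bexI[of _ x]) auto
        qed
      qed
      from this[of m] obtain x where x: "x \<in> G" "\<forall>j. c x j = s j" by auto
      then have "c x = s" by auto
      then show "s \<in> c ` G" using x(1) by blast
    qed
  qed
  then show ?thesis using code by blast
qed

lemma coarse_structure_branching:
  assumes "points A = G"
    and ent: "\<And>E. E \<in> entourages A \<longleftrightarrow> E \<subseteq> G \<times> G \<and> (\<exists>k. \<forall>x y. (x, y) \<in> E \<longrightarrow> R k x y)"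
  shows "coarse_structure A"
  unfolding coarse_structure_def assms(1)
proof (intro conjI ballI allI impI)
  fix E assume "E \<in> entourages A"
  then show "E \<subseteq> G \<times> G" by (simp add: ent)
next
  show "Id_on G \<in> entourages A" unfolding ent using refl by auto
next
  fix E F assume "E \<in> entourages A" "F \<subseteq> E"
  then show "F \<in> entourages A" unfolding ent by blast
next
  fix E assume "E \<in> entourages A"
  then obtain k where E: "E \<subseteq> G \<times> G" "\<And>x y. (x, y) \<in> E \<Longrightarrow> R k x y" unfolding ent by blast
  have "R k x y" if "(x, y) \<in> E\<inverse>" for x y using E(1) E(2)[of y x] sym[of y x k] that by auto
  then show "E\<inverse> \<in> entourages A" unfolding ent using E(1) by blast
next
  fix E F assume EF: "E \<in> entourages A" "F \<in> entourages A"
  obtain k where E: "E \<subseteq> G \<times> G" "\<And>x y. (x, y) \<in> E \<Longrightarrow> R k x y" using EF(1) unfolding ent by blast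
  obtain l where F: "F \<subseteq> G \<times> G" "\<And>x y. (x, y) \<in> F \<Longrightarrow> R l x y" using EF(2) unfolding ent by blast
  have "R (max k l) x z" if xz: "(x, z) \<in> E O F" for x z
  proof -
    obtain y where y: "(x, y) \<in> E" "(y, z) \<in> F" using xz by blast
    then have G: "x \<in> G" "y \<in> G" "z \<in> G" using E(1) F(1) by auto
    show ?thesis
      using trans[OF G mono_le[OF G(1,2) E(2)[OF y(1)]] mono_le[OF G(2,3) F(2)[OF y(2)]], of "max k l"] by simp
  qed
  then show "E O F \<in> entourages A" unfolding ent using E(1) F(1) by blast
qed

theorem equivalent_sequence_space:
  assumes "points A = G"
    and ent: "\<And>E. E \<in> entourages A \<longleftrightarrow> E \<subseteq> G \<times> G \<and> (\<exists>k. \<forall>x y. (x, y) \<in> E \<longrightarrow> R k x y)"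
  shows "coarsely_equivalent A sequence_space"
proof -
  obtain c where c0: "c ` G = sequences \<and> (\<forall>x\<in>G. \<forall>y\<in>G. \<forall>k. R k x y \<longleftrightarrow> (\<forall>j\<ge>k. c x j = c y j))"
    using coding by (rule exE)
  then have c1: "c ` G = sequences" by (rule conjunct1)
  have c2: "R k x y \<longleftrightarrow> (\<forall>j\<ge>k. c x j = c y j)" if "x \<in> G" "y \<in> G" for x y k
    using that conjunct2[OF c0] by blast
  note c = c1 c2
  have "map_prod c c ` E \<in> entourages sequence_space" if E: "E \<in> entourages A" for E
  proof -
    obtain k where k: "E \<subseteq> G \<times> G" "\<And>x y. (x, y) \<in> E \<Longrightarrow> R k x y" using E unfolding ent by blast
    have "\<forall>j\<ge>k. s j = t j" if st: "(s, t) \<in> map_prod c c ` E" for s t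
    proof -
      obtain x y where xy: "(x, y) \<in> E" "s = c x" "t = c y" using st by auto
      then have "x \<in> G" "y \<in> G" using k(1) by auto
      then show ?thesis using c(2) k(2)[OF xy(1)] xy by simp
    qed
    moreover have "map_prod c c ` E \<subseteq> sequences \<times> sequences" using k(1) c(1) by auto
    ultimately show ?thesis unfolding entourages_sequence_space by blast
  qed
  moreover have "map_prod c c -` E \<inter> G \<times> G \<in> entourages A" if E: "E \<in> entourages sequence_space" for E
  proof -
    obtain k where k: "\<And>s t. (s, t) \<in> E \<Longrightarrow> (\<forall>j\<ge>k. s j = t j)" using E unfolding entourages_sequence_space by blast
    have "R k x y" if "(x, y) \<in> map_prod c c -` E \<inter> G \<times> G" for x y
      using that k[of "c x" "c y"] c(2) by simp
    then show ?thesis unfolding ent by blast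
  qed
  moreover have "\<exists>E\<in>entourages sequence_space. \<forall>y\<in>sequences. \<exists>x\<in>G. (y, c x) \<in> E"
  proof (rule bexI[of _ "Id_on sequences"], intro ballI)
    show "Id_on sequences \<in> entourages sequence_space" unfolding entourages_sequence_space by auto
    fix y assume y: "y \<in> sequences"
    then obtain x where "x \<in> G" "y = c x" using c(1) by blast
    then show "\<exists>x\<in>G. (y, c x) \<in> Id_on sequences" using y by auto
  qed
  moreover have "c \<in> G \<rightarrow> sequences" using c(1) by auto
  ultimately have "coarse_equivalence A sequence_space c"
    unfolding coarse_equivalence_def by (simp add: assms(1))
  then show ?thesis by (auto simp: coarsely_equivalent_def)
qed

end

section \<open>The leaves of the one-ended tree\<close>

locale one_ended_tree =
  fixes V :: "'v set" and E :: "'v rel" and height :: "'v \<Rightarrow> nat"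
  assumes regular: "regular_one_ended_tree V E height"
begin

lemma edge_sub: "E \<subseteq> V \<times> V" and edge_sym: "sym E" and V_nonempty: "V \<noteq> {}"
  using regular by (auto simp: regular_one_ended_tree_def tree_def)

definition par :: "'v \<Rightarrow> 'v" where
  "par v = (THE w. (v, w) \<in> E \<and> height w = height v + 1)"

lemma par: "v \<in> V \<Longrightarrow> (v, par v) \<in> E" "v \<in> V \<Longrightarrow> height (par v) = Suc (height v)"
proof -
  assume "v \<in> V"
  then have "\<exists>!w. (v, w) \<in> E \<and> height w = height v + 1"
    using regular by (simp add: regular_one_ended_tree_def)
  from theI'[OF this] show "(v, par v) \<in> E" "height (par v) = Suc (height v)" by (auto simp: par_def)
qed

lemma par_eq: "(v, w) \<in> E \<Longrightarrow> height w = Suc (height v) \<Longrightarrow> w = par v"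
proof -
  assume vw: "(v, w) \<in> E" "height w = Suc (height v)"
  then have v: "v \<in> V" using edge_sub by auto
  then have "\<exists>!w. (v, w) \<in> E \<and> height w = height v + 1"
    using regular by (simp add: regular_one_ended_tree_def)
  then show ?thesis using vw par[OF v] by auto
qed

lemma par_mem: "v \<in> V \<Longrightarrow> par v \<in> V"
  using par edge_sub by auto

lemma par_iter_mem: "v \<in> V \<Longrightarrow> (par ^^ i) v \<in> V"
  by (induction i) (auto intro: par_mem)

lemma height_iter: "v \<in> V \<Longrightarrow> height ((par ^^ i) v) = height v + i"
  by (induction i) (auto simp: par par_iter_mem)

lemma edge_cases: "(v, w) \<in> E \<Longrightarrow> w = par v \<or> v = par w"
proof -
  assume vw: "(v, w) \<in> E"
  then have "height w = height v + 1 \<or> height v = height w + 1"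
    using regular by (auto simp: regular_one_ended_tree_def)
  then show ?thesis using par_eq[OF vw] par_eq[of w v] symD[OF edge_sym vw] by auto
qed

lemma children:
  assumes "v \<in> V" "height v \<ge> 1"
  shows "countable {w \<in> V. par w = v}" "infinite {w \<in> V. par w = v}"
proof -
  have "{w. (v, w) \<in> E \<and> height w + 1 = height v} = {w \<in> V. par w = v}"
  proof (intro Set.set_eqI iffI)
    fix w assume "w \<in> {w. (v, w) \<in> E \<and> height w + 1 = height v}"
    then show "w \<in> {w \<in> V. par w = v}" using par_eq[of w v] symD[OF edge_sym, of v w] edge_sub by auto
  next
    fix w assume "w \<in> {w \<in> V. par w = v}"
    then show "w \<in> {w. (v, w) \<in> E \<and> height w + 1 = height v}"
      using par[of w] symD[OF edge_sym, of w v] by auto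
  qed
  moreover have "countable {w. (v, w) \<in> E \<and> height w + 1 = height v} \<and>
      infinite {w. (v, w) \<in> E \<and> height w + 1 = height v}"
    using regular assms by (simp add: regular_one_ended_tree_def)
  ultimately show "countable {w \<in> V. par w = v}" "infinite {w \<in> V. par w = v}" by simp_all
qed

lemma leaves_iff: "v \<in> leaves V E \<longleftrightarrow> v \<in> V \<and> height v = 0"
proof
  assume v: "v \<in> leaves V E"
  then have vV: "v \<in> V" and ex: "\<exists>!w. (v, w) \<in> E" by (auto simp: leaves_def)
  have "height v = 0"
  proof (rule ccontr)
    assume "height v \<noteq> 0"
    then have h: "height v \<ge> 1" by simp
    then have "{w \<in> V. par w = v} \<noteq> {}" using children(2)[OF vV] by (intro notI) simp
    then obtain w where w: "w \<in> V" "par w = v" by blast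
    then have "(v, w) \<in> E" using par(1)[OF w(1)] symD[OF edge_sym] by auto
    then have "w = par v" using ex par(1)[OF vV] by blast
    then have "height w = Suc (height v)" using par(2)[OF vV] by simp
    moreover have "height v = Suc (height w)" using par(2)[OF w(1)] w(2) by simp
    ultimately show False by simp
  qed
  then show "v \<in> V \<and> height v = 0" using vV by simp
next
  assume "v \<in> V \<and> height v = 0"
  then show "v \<in> leaves V E" using regular by (simp add: regular_one_ended_tree_def)
qed

lemma descend: "v \<in> V \<Longrightarrow> \<exists>x\<in>leaves V E. (par ^^ height v) x = v"
proof (induction "height v" arbitrary: v)
  case 0
  then show ?case by (intro bexI[of _ v]) (auto simp: leaves_iff)
next
  case (Suc n)
  then have "{w \<in> V. par w = v} \<noteq> {}" using children(2)[of v] by (intro notI) simp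
  then obtain w where w: "w \<in> V" "par w = v" by blast
  then have hw: "height w = n" using par(2)[OF w(1)] Suc.hyps(2) by simp
  then obtain x where x: "x \<in> leaves V E" "(par ^^ n) x = w" using Suc.hyps(1)[of w] w(1) by auto
  then have "(par ^^ height v) x = v" using w(2) Suc.hyps(2)[symmetric] by simp
  then show ?case using x(1) by blast
qed

text \<open>Every edge joins a vertex to its parent, so one more step of the path costs at most one
  more step of climbing at one end.\<close>

lemma path_meet:
  "(x, y) \<in> E ^^ m \<Longrightarrow> \<exists>i\<le>m. \<exists>j\<le>m. (par ^^ i) x = (par ^^ j) y"
proof (induction m arbitrary: y)
  case 0
  then show ?case by simp
next
  case (Suc m)
  then obtain z where z: "(x, z) \<in> E ^^ m" "(z, y) \<in> E" by auto
  obtain i j where ij: "i \<le> m" "j \<le> m" "(par ^^ i) x = (par ^^ j) z" using Suc.IH[OF z(1)] by blast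
  from edge_cases[OF z(2)] show ?case
  proof
    assume y: "y = par z"
    show ?thesis
    proof (cases j)
      case 0
      then have "(par ^^ Suc i) x = (par ^^ 0) y" using ij(3) y by simp
      then show ?thesis using ij(1) by (intro exI[of _ "Suc i"] conjI exI[of _ 0]) auto
    next
      case (Suc k)
      then have "(par ^^ i) x = (par ^^ k) y" using ij(3) y by (simp add: funpow_swap1)
      then show ?thesis using ij Suc by (intro exI[of _ i] conjI exI[of _ k]) auto
    qed
  next
    assume "z = par y"
    then have "(par ^^ i) x = (par ^^ Suc j) y" using ij(3) by (simp add: funpow_swap1)
    then show ?thesis using ij by (intro exI[of _ i] conjI exI[of _ "Suc j"]) auto
  qed
qed

lemma path_up: "x \<in> V \<Longrightarrow> (x, (par ^^ k) x) \<in> E ^^ k"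
  by (induction k) (auto intro: par par_iter_mem)

lemma path_down: "x \<in> V \<Longrightarrow> ((par ^^ k) x, x) \<in> E ^^ k"
proof (induction k)
  case (Suc k)
  have "((par ^^ Suc k) x, (par ^^ k) x) \<in> E"
    using par(1)[OF par_iter_mem[OF Suc.prems, of k]] symD[OF edge_sym] by simp
  then show ?case using relpow_Suc_I2[OF _ Suc.IH[OF Suc.prems]] by blast
qed simp

text \<open>Leaves have equal height, so their climbs to a common ancestor have equal length. The
  bounds in the two directions differ by a factor 2, which the coarse structure does not
  see.\<close>

lemma leaves_dist:
  assumes x: "x \<in> leaves V E" and y: "y \<in> leaves V E"
  shows "(par ^^ k) x = (par ^^ k) y \<Longrightarrow> graph_dist E x y \<le> 2 * real k"
    and "graph_dist E x y \<le> real k \<Longrightarrow> (par ^^ k) x = (par ^^ k) y"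
    and "\<exists>k. (par ^^ k) x = (par ^^ k) y"
proof -
  have V: "x \<in> V" "y \<in> V" "height x = 0" "height y = 0" using x y by (auto simp: leaves_iff)
  show "graph_dist E x y \<le> 2 * real k" if "(par ^^ k) x = (par ^^ k) y"
  proof -
    have "(x, y) \<in> E ^^ (k + k)"
      using path_up[OF V(1), of k] path_down[OF V(2), of k] that by (auto simp: relpow_add)
    then have "(LEAST n. (x, y) \<in> E ^^ n) \<le> k + k" by (rule Least_le)
    then show ?thesis by (simp add: graph_dist_def)
  qed
  have meet: "(par ^^ m) x = (par ^^ m) y" if xy: "(x, y) \<in> E ^^ n" "n \<le> m" for n m
  proof -
    obtain i j where ij: "i \<le> n" "(par ^^ i) x = (par ^^ j) y" using path_meet[OF xy(1)] by blast
    then have "i = j" using height_iter[OF V(1), of i] height_iter[OF V(2), of j] V by simp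
    have "(par ^^ m) z = (par ^^ (m - i)) ((par ^^ i) z)" for z
      using xy(2) ij(1) funpow_add[of "m - i" i par] by (simp add: comp_def)
    then show ?thesis using ij(2) \<open>i = j\<close> by metis
  qed
  have "\<exists>!p. simple_path E x p y" using regular V(1,2) by (simp add: regular_one_ended_tree_def tree_def)
  then obtain p where p: "simple_path E x p y" by (rule ex1E)
  have "(hd p, last p) \<in> E\<^sup>*" if "p \<noteq> []" "successively (\<lambda>u v. (u, v) \<in> E) p" for p
    using that
  proof (induction p rule: induct_list012)
    case (3 a b p)
    then show ?case by (auto intro: converse_rtrancl_into_rtrancl)
  qed auto
  then have "(x, y) \<in> E\<^sup>*" using p by (auto simp: simple_path_def)
  then obtain n where n: "(x, y) \<in> E ^^ n" using rtrancl_imp_relpow by blast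
  then show "\<exists>k. (par ^^ k) x = (par ^^ k) y" using meet by blast
  show "(par ^^ k) x = (par ^^ k) y" if "graph_dist E x y \<le> real k"
    using meet[OF LeastI[of "\<lambda>n. (x, y) \<in> E ^^ n", OF n], of k] that by (simp add: graph_dist_def)
qed

lemma branching_leaves: "branching (leaves V E) (\<lambda>k x y. (par ^^ k) x = (par ^^ k) y)"
proof
  show "leaves V E \<noteq> {}" using descend V_nonempty by blast
next
  fix x k assume x: "x \<in> leaves V E"
  let ?cl = "\<lambda>y. {z \<in> leaves V E. (par ^^ k) y = (par ^^ k) z}"
  define v where "v = (par ^^ Suc k) x"
  have v: "v \<in> V" "height v = Suc k"
    using x par_iter_mem height_iter[of x "Suc k"] by (auto simp: v_def leaves_iff simp del: funpow.simps)
  \<comment> \<open>A class of level \<open>k\<close> is the set of leaves below a vertex of height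
    \<open>k\<close>; the classes inside one of level \<open>Suc k\<close> correspond to the
    children of \<open>v\<close>.\<close>
  define F where "F w = {z \<in> leaves V E. w = (par ^^ k) z}" for w
  have "?cl ` {y \<in> leaves V E. (par ^^ Suc k) x = (par ^^ Suc k) y} = F ` {w \<in> V. par w = v}"
  proof (intro Set.set_eqI iffI)
    fix C assume "C \<in> ?cl ` {y \<in> leaves V E. (par ^^ Suc k) x = (par ^^ Suc k) y}"
    then obtain y where y: "y \<in> leaves V E" "v = (par ^^ Suc k) y" "C = ?cl y" by (auto simp: v_def)
    then have "C = F ((par ^^ k) y)" "(par ^^ k) y \<in> V" "par ((par ^^ k) y) = v"
      using par_iter_mem by (auto simp: F_def leaves_iff)
    then show "C \<in> F ` {w \<in> V. par w = v}" by blast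
  next
    fix C assume "C \<in> F ` {w \<in> V. par w = v}"
    then obtain w where w: "w \<in> V" "par w = v" "C = F w" by blast
    then have "height w = k" using par(2)[OF w(1)] v(2) by simp
    then obtain y where y: "y \<in> leaves V E" "(par ^^ k) y = w" using descend[OF w(1)] by auto
    then show "C \<in> ?cl ` {y \<in> leaves V E. (par ^^ Suc k) x = (par ^^ Suc k) y}"
    proof (intro image_eqI[of _ _ y])
      show "C = ?cl y" using w(3) y(2) by (simp add: F_def)
      have "(par ^^ Suc k) y = v" using y(2) w(2) by simp
      then show "y \<in> {y \<in> leaves V E. (par ^^ Suc k) x = (par ^^ Suc k) y}"
        unfolding v_def using y(1) by simp
    qed
  qed
  moreover have "inj_on F {w \<in> V. par w = v}"
  proof (rule inj_onI)
    fix w w' assume w: "w \<in> {w \<in> V. par w = v}" "w' \<in> {w \<in> V. par w = v}" "F w = F w'"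
    then have "height w = k" using par(2)[of w] v(2) by auto
    then obtain y where "y \<in> leaves V E" "(par ^^ k) y = w" using descend[of w] w(1) by auto
    then have "y \<in> F w" by (auto simp: F_def)
    then have "y \<in> F w'" using w(3) by simp
    then show "w = w'" using \<open>(par ^^ k) y = w\<close> by (simp add: F_def)
  qed
  ultimately show "countable (?cl ` {y \<in> leaves V E. (par ^^ Suc k) x = (par ^^ Suc k) y})"
    and "infinite (?cl ` {y \<in> leaves V E. (par ^^ Suc k) x = (par ^^ Suc k) y})"
    using children[OF v(1)] v(2) by (simp_all add: finite_image_iff)
qed (use leaves_dist(3) in \<open>auto\<close>)

lemma entourages_leaves:
  "F \<in> entourages (metric_coarse_space (leaves V E) (graph_dist E)) \<longleftrightarrow>
    F \<subseteq> leaves V E \<times> leaves V E \<and> (\<exists>k. \<forall>x y. (x, y) \<in> F \<longrightarrow> (par ^^ k) x = (par ^^ k) y)"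
proof
  assume "F \<in> entourages (metric_coarse_space (leaves V E) (graph_dist E))"
  then obtain B where B: "F \<subseteq> leaves V E \<times> leaves V E" "\<And>x y. (x, y) \<in> F \<Longrightarrow> graph_dist E x y \<le> B"
    unfolding entourages_metric by blast
  obtain k :: nat where "B \<le> real k" using real_arch_simple by blast
  then have "(par ^^ k) x = (par ^^ k) y" if "(x, y) \<in> F" for x y
    using leaves_dist(2)[of x y k] B(1) B(2)[OF that] that by force
  then show "F \<subseteq> leaves V E \<times> leaves V E \<and> (\<exists>k. \<forall>x y. (x, y) \<in> F \<longrightarrow> (par ^^ k) x = (par ^^ k) y)"
    using B(1) by blast
next
  assume F: "F \<subseteq> leaves V E \<times> leaves V E \<and> (\<exists>k. \<forall>x y. (x, y) \<in> F \<longrightarrow> (par ^^ k) x = (par ^^ k) y)"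
  then obtain k where "\<And>x y. (x, y) \<in> F \<Longrightarrow> (par ^^ k) x = (par ^^ k) y" by blast
  then have "graph_dist E x y \<le> 2 * real k" if "(x, y) \<in> F" for x y
    using leaves_dist(1)[of x y k] F that by blast
  then show "F \<in> entourages (metric_coarse_space (leaves V E) (graph_dist E))"
    unfolding entourages_metric using F by blast
qed

theorem leaves_equivalent: "coarsely_equivalent (metric_coarse_space (leaves V E) (graph_dist E)) sequence_space"
  by (rule branching.equivalent_sequence_space[OF branching_leaves _ entourages_leaves]) simp

lemma coarse_structure_leaves: "coarse_structure (metric_coarse_space (leaves V E) (graph_dist E))"
  by (rule branching.coarse_structure_branching[OF branching_leaves _ entourages_leaves]) simp

end

section \<open>Coarse structure of the homeomorphism group\<close>

locale split_stone = stone_of_type X \<alpha> n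
  for X :: "'a topology" and \<alpha> n +
  fixes Y :: "'a \<Rightarrow> 'a set"
  assumes split: "split_space (topspace X) (clopens X) (CB_rank X) \<alpha> (stone_of_type.K X \<alpha>) Y"

sublocale split_stone \<subseteq> split_space "topspace X" "clopens X" "CB_rank X" \<alpha> K Y
  by (rule split)

context stone_of_type
begin

lemma len_bounded_peaked:
  assumes d: "continuous_left_invariant_pseudometric (Homeo X) (compact_open_topology X) d"
    and D: "peaked D p"
  shows "\<exists>C. \<forall>g. homeo g \<and> supported g D \<longrightarrow> len d g \<le> C"
  using length_space.bounded_peaked[OF length_space_len[OF d ranked_space_axioms] D] .

lemma dist_eq_len:
  assumes d: "continuous_left_invariant_pseudometric (Homeo X) (compact_open_topology X) d"
    and "g \<in> carrier (Homeo X)" "h \<in> carrier (Homeo X)"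
  shows "d g h = len d (inv_into T g \<circ> h)"
  using dist_len[OF d, of g h] assms(2,3) by (auto simp: carrier_Homeo extensional_restrict)

text \<open>A single top point makes the whole space peaked, so every homeomorphism is supported in
  a peaked set.\<close>

lemma coarsely_bounded_of_type_1:
  assumes "n = 1"
  shows "coarsely_bounded_group (Homeo X) (compact_open_topology X)"
proof -
  obtain p where p: "K = {p}" using K(2) assms by (auto simp: card_1_singleton_iff)
  have pT: "p \<in> T" "rk p = \<alpha>" using p K_rank_eq by auto
  have "rk y < rk p" if "y \<in> T - {p}" for y
    using that p K_rank_eq rank_isolated_at(2)[of y] pT by (force simp: less_le)
  then have "peaked T p" using pT clopen_T by (simp add: peaked_def)
  then have "\<exists>B. \<forall>x\<in>carrier (Homeo X). \<forall>y\<in>carrier (Homeo X). d x y \<le> B"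
    if d: "continuous_left_invariant_pseudometric (Homeo X) (compact_open_topology X) d" for d
  proof -
    obtain C where C: "\<And>g. homeo g \<Longrightarrow> supported g T \<Longrightarrow> len d g \<le> C"
      using len_bounded_peaked[OF d \<open>peaked T p\<close>] by blast
    have "d x y \<le> C" if "x \<in> carrier (Homeo X)" "y \<in> carrier (Homeo X)" for x y
      unfolding dist_eq_len[OF d that]
      using that by (intro C homeo_comp homeo_inv) (auto simp: carrier_Homeo supported_def)
    then show ?thesis by blast
  qed
  then show ?thesis by (simp add: coarsely_bounded_group_def coarsely_bounded_in_def)
qed

end

lemma bounded_group_quasi_isometric_point:
  assumes "coarsely_bounded_group G T" "carrier G \<noteq> {}"
  shows "group_quasi_isometric G T {()} (\<lambda>_ _. 0)"
proof -
  have "continuous_left_invariant_pseudometric G T (\<lambda>_ _. 0)"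
    by (auto simp: continuous_left_invariant_pseudometric_def case_prod_unfold)
  moreover have "\<exists>K C. \<forall>x\<in>carrier G. \<forall>y\<in>carrier G. d x y \<le> K * 0 + C"
    if "continuous_left_invariant_pseudometric G T d" for d
    using assms that unfolding coarsely_bounded_group_def coarsely_bounded_in_def by simp
  ultimately have "maximal_pseudometric G T (\<lambda>_ _. 0)" by (simp add: maximal_pseudometric_def)
  moreover have "quasi_isometric (carrier G) (\<lambda>_ _. 0) {()} (\<lambda>_ _. 0)"
    using assms(2) unfolding quasi_isometric_def
    by (intro exI[of _ "\<lambda>_. ()"] exI[of _ "1 :: real"] exI[of _ "0 :: real"]) auto
  ultimately show ?thesis unfolding group_quasi_isometric_def by blast
qed

lemma bounded_group_coarsely_trivial:
  assumes "coarsely_bounded_group G T" "carrier G \<noteq> {}"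
  shows "coarsely_trivial (group_coarse_space G T)"
  unfolding coarsely_trivial_def entourages_group entourages_metric points_group
proof (intro conjI allI impI)
  fix d assume "continuous_left_invariant_pseudometric G T d"
  then have "\<exists>B. \<forall>x\<in>carrier G. \<forall>y\<in>carrier G. d x y \<le> B"
    using assms(1) by (simp add: coarsely_bounded_group_def coarsely_bounded_in_def)
  then show "\<exists>B. \<forall>x y. (x, y) \<in> carrier G \<times> carrier G \<longrightarrow> d x y \<le> B" by blast
qed (use assms in auto)

context countable_stone
begin

lemma carrier_nonempty: "carrier (Homeo X) \<noteq> {}"
  using restrict_carrier[OF homeo_id] by blast

end

context split_stone
begin

lemma len_bounded_junk:
  assumes d: "continuous_left_invariant_pseudometric (Homeo X) (compact_open_topology X) d"
    and \<beta>: "\<beta> < \<alpha>"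
  shows "\<exists>C. \<forall>g. homeo g \<and> (\<forall>x\<in>junk id g. rk x < \<beta>) \<longrightarrow> len d g \<le> C"
proof -
  interpret length_space T "clopens X" rk "len d" by (rule length_space_len[OF d ranked_space_axioms])
  interpret split_length_space T "clopens X" rk \<alpha> K Y "len d" by unfold_locales
  show ?thesis by (rule bounded_junk[OF \<beta>])
qed

lemma junk_inv_rank:
  assumes gh: "homeo g" "homeo h" and "\<And>x. x \<in> junk g h \<Longrightarrow> P (rk x)" "x \<in> junk id (inv_into T g \<circ> h)"
  shows "P (rk x)"
proof -
  obtain y where y: "y \<in> junk g h" "x = inv_into T g y" using assms(4) junk_inv[OF gh] by auto
  have "y \<in> T" using y(1) by (simp add: junk_def)
  then have "rk x = rk y" using homeo_rank[OF homeo_inv[OF gh(1)]] y(2) by simp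
  then show ?thesis using assms(3)[OF y(1)] by simp
qed

text \<open>A labelling is determined by its fibres, a finite family of clopen sets.\<close>

lemma countable_labellings:
  "countable ((\<lambda>g. restrict (lab g) T) ` {g. homeo g})"
proof -
  define F where "F l = restrict (\<lambda>p. {x \<in> T. l x = p}) K" for l :: "'a \<Rightarrow> 'a"
  have "inj_on F ((\<lambda>g. restrict (lab g) T) ` {g. homeo g})"
  proof (rule inj_onI, clarsimp)
    fix g h assume gh: "homeo g" "homeo h" and eq: "F (restrict (lab g) T) = F (restrict (lab h) T)"
    have "lab g x = lab h x" if x: "x \<in> T" for x
    proof -
      have "lab g x \<in> K" using lab_mem[OF gh(1) x] .
      then have "x \<in> F (restrict (lab g) T) (lab g x)" using x by (simp add: F_def)
      then have "x \<in> F (restrict (lab h) T) (lab g x)" using eq by simp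
      then have "restrict (lab h) T x = lab g x"
        unfolding F_def restrict_apply'[OF \<open>lab g x \<in> K\<close>] by auto
      then show ?thesis unfolding restrict_apply'[OF x] by simp
    qed
    then show "restrict (lab g) T = restrict (lab h) T" by (auto simp: restrict_def fun_eq_iff)
  qed
  moreover have "F ` (\<lambda>g. restrict (lab g) T) ` {g. homeo g} \<subseteq> PiE K (\<lambda>_. clopens X)"
  proof clarsimp
    fix g assume g: "homeo g"
    have "{x \<in> T. restrict (lab g) T x = p} = {x \<in> T. lab g x = p}" for p by auto
    then have "F (restrict (lab g) T) = restrict (\<lambda>p. {x \<in> T. lab g x = p}) K" by (simp only: F_def)
    then show "F (restrict (lab g) T) \<in> PiE K (\<lambda>_. clopens X)"
      using lab_fiber_clopen[OF g] by (simp only: restrict_PiE_iff) simp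
  qed
  moreover have "countable (PiE K (\<lambda>_. clopens X))"
    using finite_K countable_clopen by (intro countable_PiE) auto
  ultimately show ?thesis by (intro countable_image_inj_on[of F]) (rule countable_subset)
qed

end

text \<open>Only countably many ordinals lie below \<alpha>; each step moves the sequence above the
  next one in an enumeration.\<close>

lemma cofinal_sequence:
  assumes "limit_ordinal \<alpha>"
  shows "\<exists>\<beta> :: nat \<Rightarrow> countable_ordinal. (\<forall>k. \<beta> k < \<beta> (Suc k) \<and> \<beta> k < \<alpha>) \<and> (\<forall>\<gamma><\<alpha>. \<exists>k. \<gamma> < \<beta> k)"
proof -
  have "\<alpha> \<noteq> 0" using assms by (simp add: limit_ordinal_def)
  then have 0: "0 < \<alpha>" using zero_least[of \<alpha>] by (metis le_neq_trans)
  define e where "e = from_nat_into {..<\<alpha>}"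
  have e: "range e = {..<\<alpha>}"
    unfolding e_def using 0 countable_lessThan_ordinal by (intro range_from_nat_into) auto
  have "\<exists>\<gamma>'. \<gamma>' < \<alpha> \<and> (\<gamma> < \<gamma>' \<and> e k < \<gamma>')" if "\<gamma> < \<alpha>" for \<gamma> k
  proof -
    have "max \<gamma> (e k) < \<alpha>" using that e by auto
    then show ?thesis using limit_between[OF assms] by fastforce
  qed
  then obtain \<beta> where \<beta>: "\<And>k. \<beta> k < \<alpha>" "\<And>k. \<beta> k < \<beta> (Suc k) \<and> e k < \<beta> (Suc k)"
    using dependent_nat_choice[of "\<lambda>_ \<gamma>. \<gamma> < \<alpha>" "\<lambda>k \<gamma> \<gamma>'. \<gamma> < \<gamma>' \<and> e k < \<gamma>'"] 0 by metis
  have "\<exists>k. \<gamma> < \<beta> k" if "\<gamma> < \<alpha>" for \<gamma>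
  proof -
    have "\<gamma> \<in> range e" using e that by simp
    then obtain k where "\<gamma> = e k" by (elim rangeE)
    then show ?thesis using \<beta>(2)[of k] by (intro exI[of _ "Suc k"]) simp
  qed
  then show ?thesis using \<beta> by blast
qed

section \<open>Limit ordinals: an ultrametric on the group\<close>

locale limit_stone = split_stone X \<alpha> n Y
  for X :: "'a topology" and \<alpha> n Y +
  fixes \<beta> :: "nat \<Rightarrow> countable_ordinal"
  assumes n2: "n > 1"
    and \<beta>_Suc: "\<beta> k < \<beta> (Suc k)" and \<beta>_less: "\<beta> k < \<alpha>"
    and cofinal: "\<gamma> < \<alpha> \<Longrightarrow> \<exists>k. \<gamma> < \<beta> k"
begin

definition near :: "nat \<Rightarrow> ('a \<Rightarrow> 'a) \<Rightarrow> ('a \<Rightarrow> 'a) \<Rightarrow> bool" where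
  "near k g h \<longleftrightarrow> (\<forall>x\<in>junk g h. rk x < \<beta> k)"

lemma \<beta>_mono: "k \<le> l \<Longrightarrow> \<beta> k \<le> \<beta> l"
  by (rule lift_Suc_mono_le[of \<beta>]) (use \<beta>_Suc in \<open>auto intro: less_imp_le\<close>)

lemma near_mono: "near k g h \<Longrightarrow> k \<le> l \<Longrightarrow> near l g h"
  using \<beta>_mono unfolding near_def by (meson less_le_trans)

lemma near_refl: "near k g g"
  by (simp add: near_def junk_def)

lemma near_sym: "near k g h \<Longrightarrow> near k h g"
  by (simp add: near_def junk_sym)

lemma near_trans: "near k g h \<Longrightarrow> near k h f \<Longrightarrow> near k g f"
  using junk_triangle[of g f h] by (auto simp: near_def)

text \<open>Every junk point has rank below \<alpha>, hence below some \<open>\<beta> k\<close>, and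
  so has a whole neighbourhood of it; compactness makes one \<open>k\<close> serve for all of the
  junk.\<close>

lemma near_exists:
  assumes "homeo g" "homeo h"
  shows "\<exists>k. near k g h"
proof -
  have "\<exists>k. \<forall>x\<in>junk g h. rk x < \<beta> k"
  proof (rule clopen_induct[OF junk_clopen[OF assms]])
    fix x assume x: "x \<in> junk g h"
    obtain k where k: "rk x < \<beta> k" using cofinal[OF junk_rank[OF assms x]] by blast
    obtain W where W: "peaked W x" using peaked_exists[OF junk_clopen[OF assms] x] by blast
    have "rk y < \<beta> k" if "y \<in> W" for y using peaked_less[OF W that] k by (cases "y = x") auto
    then show "\<exists>W\<in>clopens X. x \<in> W \<and> (\<exists>k. \<forall>y\<in>W. rk y < \<beta> k)"
      using peaked_clopen[OF W] peaked_mem[OF W] by blast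
  next
    fix V W assume "\<exists>k. \<forall>x\<in>V. rk x < \<beta> k" "\<exists>k. \<forall>x\<in>W. rk x < \<beta> k"
    then obtain k l where kl: "\<forall>x\<in>V. rk x < \<beta> k" "\<forall>x\<in>W. rk x < \<beta> l" by blast
    have "\<beta> k \<le> \<beta> (max k l)" "\<beta> l \<le> \<beta> (max k l)" using \<beta>_mono by simp_all
    then have "\<forall>x\<in>V \<union> W. rk x < \<beta> (max k l)" using kl by (meson UnE less_le_trans)
    then show "\<exists>k. \<forall>x\<in>V \<union> W. rk x < \<beta> k" ..
  qed blast+
  then show ?thesis by (simp add: near_def)
qed

lemma near_translate:
  assumes "homeo f" "homeo g" "homeo h"
  shows "near k (f \<circ> g) (f \<circ> h) \<longleftrightarrow> near k g h"
proof -
  have "rk (f x) = rk x" if "x \<in> junk g h" for x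
    using homeo_rank[OF assms(1)] that by (auto simp: junk_def)
  then show ?thesis unfolding near_def junk_translate[OF assms] by auto
qed

definition ndist :: "('a \<Rightarrow> 'a) \<Rightarrow> ('a \<Rightarrow> 'a) \<Rightarrow> real" where
  "ndist g h = real (LEAST k. near k g h)"

lemma ndist_le_iff:
  assumes "homeo g" "homeo h"
  shows "ndist g h \<le> real k \<longleftrightarrow> near k g h"
proof
  define m where "m = (LEAST k. near k g h)"
  have "near m g h" unfolding m_def using near_exists[OF assms] by (rule LeastI_ex)
  then show "near k g h" if "ndist g h \<le> real k"
    using that near_mono by (simp add: ndist_def m_def[symmetric])
  show "ndist g h \<le> real k" if "near k g h" using that by (simp add: ndist_def Least_le)
qed

lemma ndist_pseudometric:
  "continuous_left_invariant_pseudometric (Homeo X) (compact_open_topology X) ndist"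
proof (rule pseudometricI)
  show zero: "ndist g g = 0" for g using near_refl by (simp add: ndist_def)
  show "0 \<le> ndist g h" for g h by (simp add: ndist_def)
  show "ndist g h = ndist h g" for g h
  proof -
    have "near k g h = near k h g" for k using near_sym by blast
    then show ?thesis by (simp only: ndist_def)
  qed
  show "ndist g k \<le> ndist g h + ndist h k" if gh: "homeo g" "homeo h" "homeo k" for g h k
  proof -
    obtain l m where lm: "ndist g h = real l" "ndist h k = real m" by (simp add: ndist_def)
    then have "near l g h" "near m h k" using ndist_le_iff[OF gh(1,2), of l] ndist_le_iff[OF gh(2,3), of m] by auto
    then have "near (l + m) g k" by (meson near_mono near_trans le_add1 le_add2)
    then show ?thesis using ndist_le_iff[OF gh(1,3), of "l + m"] lm by simp
  qed
  show "ndist (f \<circ> g) (f \<circ> h) = ndist g h" if "homeo f" "homeo g" "homeo h" for f g h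
    using near_translate[OF that] by (simp add: ndist_def)
  show "ndist g h = ndist g' h'" if "homeo g" "homeo h" "\<And>x. x \<in> T \<Longrightarrow> g x = g' x" "\<And>x. x \<in> T \<Longrightarrow> h x = h' x"
    for g h g' h'
    using junk_cong[OF that] by (simp add: ndist_def near_def)
  show "finite (Y ` K)" using finite_K by simp
  show "Y ` K \<subseteq> clopens X" using X_clopen by auto
  show "ndist id v = 0" if v: "homeo v" "\<And>P. P \<in> Y ` K \<Longrightarrow> v ` P = P" for v
  proof -
    have "junk id v = {}" using v by (intro junk_stabilizer) auto
    then have "near 0 id v" by (simp add: near_def)
    then show ?thesis using ndist_le_iff[OF homeo_id v(1), of 0] by (simp add: ndist_def)
  qed
qed

text \<open>One direction needs only the pseudometric \<open>ndist\<close>. The other concerns every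
  pseudometric and holds because junk of rank below \<open>\<beta> k\<close> forces bounded
  length.\<close>

lemma entourages_near:
  "E \<in> entourages (Homeo_coarse_space X) \<longleftrightarrow>
     E \<subseteq> carrier (Homeo X) \<times> carrier (Homeo X) \<and> (\<exists>k. \<forall>g h. (g, h) \<in> E \<longrightarrow> near k g h)"
proof
  assume E: "E \<in> entourages (Homeo_coarse_space X)"
  then have sub: "E \<subseteq> carrier (Homeo X) \<times> carrier (Homeo X)"
    and "E \<in> entourages (metric_coarse_space (carrier (Homeo X)) ndist)"
    using ndist_pseudometric by (simp_all add: Homeo_coarse_space_def entourages_group)
  then obtain B where B: "\<And>g h. (g, h) \<in> E \<Longrightarrow> ndist g h \<le> B" unfolding entourages_metric by blast
  obtain k :: nat where k: "B \<le> real k" using real_arch_simple by blast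
  have "near k g h" if gh: "(g, h) \<in> E" for g h
  proof -
    have "homeo g" "homeo h" using sub gh by (auto simp: carrier_Homeo)
    then show ?thesis using ndist_le_iff B[OF gh] k by (meson order_trans)
  qed
  then show "E \<subseteq> carrier (Homeo X) \<times> carrier (Homeo X) \<and> (\<exists>k. \<forall>g h. (g, h) \<in> E \<longrightarrow> near k g h)"
    using sub by blast
next
  assume E: "E \<subseteq> carrier (Homeo X) \<times> carrier (Homeo X) \<and> (\<exists>k. \<forall>g h. (g, h) \<in> E \<longrightarrow> near k g h)"
  then obtain k where k: "\<And>g h. (g, h) \<in> E \<Longrightarrow> near k g h" by blast
  show "E \<in> entourages (Homeo_coarse_space X)"
    unfolding Homeo_coarse_space_def entourages_group entourages_metric
  proof (intro conjI allI impI)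
    fix d assume d: "continuous_left_invariant_pseudometric (Homeo X) (compact_open_topology X) d"
    obtain C where C: "\<And>g. homeo g \<Longrightarrow> (\<And>x. x \<in> junk id g \<Longrightarrow> rk x < \<beta> k) \<Longrightarrow> len d g \<le> C"
      using len_bounded_junk[OF d \<beta>_less] by blast
    have "d g h \<le> C" if gh: "(g, h) \<in> E" for g h
    proof -
      have c: "g \<in> carrier (Homeo X)" "h \<in> carrier (Homeo X)" using E gh by auto
      then have hom: "homeo g" "homeo h" by (auto simp: carrier_Homeo)
      have "rk x < \<beta> k" if "x \<in> junk id (inv_into T g \<circ> h)" for x
        by (rule junk_inv_rank[OF hom, of "\<lambda>r. r < \<beta> k"]) (use k[OF gh] that in \<open>auto simp: near_def\<close>)
      then show ?thesis unfolding dist_eq_len[OF d c]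
        by (intro C homeo_comp[OF homeo_inv[OF hom(1)] hom(2)])
    qed
    then show "\<exists>B. \<forall>g h. (g, h) \<in> E \<longrightarrow> d g h \<le> B" by blast
  qed (use E in auto)
qed

text \<open>Since \<open>n > 1\<close>, there is a second label \<open>p\<close>. Relabelling around
  each of the infinitely many points \<open>z\<close> of rank \<open>\<beta> k\<close> in one block
  gives elements related to \<open>g\<close> at level \<open>Suc k\<close>; any two of them differ
  at such a point and are unrelated at level \<open>k\<close>.\<close>

lemma infinite_near_classes:
  assumes g: "homeo g"
  shows "infinite ((\<lambda>h. {f \<in> carrier (Homeo X). near k h f}) ` {h \<in> carrier (Homeo X). near (Suc k) g h})"
proof -
  obtain q where q: "q \<in> K" using K_nonempty by blast
  have "card (K - {q}) > 0" using q K(1,2) n2 by (simp add: card_Diff_singleton)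
  then have "K - {q} \<noteq> {}" by (intro notI) simp
  then obtain p where p: "p \<in> K" "p \<noteq> q" by blast
  define Z where "Z = {z \<in> Y q. rk z = \<beta> k}"
  have Z: "infinite Z" unfolding Z_def
    using rank_dense_infinite[OF X_clopen[OF q] X_mem[OF q]] K_rank[OF q] \<beta>_less by simp
  have ZT: "z \<in> T" "z \<notin> K" "block z = q" "rk z = \<beta> k" if "z \<in> Z" for z
    using that X_sub[OF q] block_eq[OF q] K_rank[of z] \<beta>_less[of k] by (auto simp: Z_def)
  have "\<forall>z\<in>Z. \<exists>f. homeo f \<and> (\<exists>U. peaked U z \<and> (\<forall>x\<in>T. lab f x = (if x \<in> U then p else block x)))"
    using relabel[OF ZT(1,2) p(1)] ZT(3) p(2) by blast
  then obtain f where f: "\<And>z. z \<in> Z \<Longrightarrow> homeo (f z)"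
    "\<And>z. z \<in> Z \<Longrightarrow> \<exists>U. peaked U z \<and> (\<forall>x\<in>T. lab (f z) x = (if x \<in> U then p else block x))"
    by metis
  have lab_f: "lab (f z) z = p" if "z \<in> Z" for z
    using f(2)[OF that] peaked_mem ZT(1)[OF that] by force
  have lab_f': "lab (f z) z' = q" if zz: "z \<in> Z" "z' \<in> Z" "z' \<noteq> z" for z z'
  proof -
    obtain U where U: "peaked U z" "\<forall>x\<in>T. lab (f z) x = (if x \<in> U then p else block x)" using f(2)[OF zz(1)] by blast
    have "z' \<notin> U" using peaked_less[OF U(1) _ zz(3)] ZT(4)[OF zz(1)] ZT(4)[OF zz(2)] by auto
    then show ?thesis using U(2) ZT(1,3)[OF zz(2)] by simp
  qed
  have near1: "near (Suc k) id (f z)" if z: "z \<in> Z" for z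
  proof -
    obtain U where U: "peaked U z" "\<forall>x\<in>T. lab (f z) x = (if x \<in> U then p else block x)" using f(2)[OF z] by blast
    have "rk x < \<beta> (Suc k)" if "x \<in> junk id (f z)" for x
    proof -
      have "x \<in> U" using that U(2) lab_id by (auto simp: junk_def split: if_splits)
      then have "rk x \<le> \<beta> k" using peaked_less[OF U(1)] ZT(4)[OF z] by (cases "x = z") (auto intro: less_imp_le)
      then show ?thesis using \<beta>_Suc by (rule le_less_trans)
    qed
    then show ?thesis by (simp add: near_def)
  qed
  define F where "F z = restrict (g \<circ> f z) T" for z
  have hF: "homeo (g \<circ> f z)" if "z \<in> Z" for z using homeo_comp[OF g f(1)[OF that]] .
  have Fc: "F z \<in> carrier (Homeo X)" if "z \<in> Z" for z
    unfolding F_def by (rule restrict_carrier[OF hF[OF that]])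
  have junkF: "junk (F z) (F z') = junk (g \<circ> f z) (g \<circ> f z')" if "z \<in> Z" "z' \<in> Z" for z z'
    by (rule junk_cong[symmetric]) (auto simp: F_def hF that)
  have nearF: "near k (F z) (F z') \<longleftrightarrow> near k (f z) (f z')" if "z \<in> Z" "z' \<in> Z" for z z'
    using near_translate[OF g f(1) f(1), OF that] junkF[OF that] by (simp add: near_def)
  have "inj_on (\<lambda>z. {h \<in> carrier (Homeo X). near k (F z) h}) Z"
  proof (rule inj_onI, rule ccontr)
    fix z z' assume z: "z \<in> Z" "z' \<in> Z" "z \<noteq> z'"
      and eq: "{h \<in> carrier (Homeo X). near k (F z) h} = {h \<in> carrier (Homeo X). near k (F z') h}"
    have "near k (F z) (F z')" using eq Fc[OF z(2)] near_refl[of k "F z'"] by blast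
    then have "near k (f z) (f z')" using nearF z by simp
    moreover have "z \<in> junk (f z) (f z')"
      using lab_f[OF z(1)] lab_f'[OF z(2,1,3)] p(2) ZT(1)[OF z(1)] by (simp add: junk_def)
    ultimately show False using ZT(4)[OF z(1)] by (auto simp: near_def)
  qed
  then have "infinite ((\<lambda>z. {h \<in> carrier (Homeo X). near k (F z) h}) ` Z)" using Z by (simp add: finite_image_iff)
  moreover have "(\<lambda>z. {h \<in> carrier (Homeo X). near k (F z) h}) ` Z \<subseteq>
      (\<lambda>h. {f \<in> carrier (Homeo X). near k h f}) ` {h \<in> carrier (Homeo X). near (Suc k) g h}"
  proof (rule image_subsetI)
    fix z assume z: "z \<in> Z"
    have "near (Suc k) (g \<circ> id) (g \<circ> f z)" using near_translate[OF g homeo_id f(1)[OF z]] near1[OF z] by simp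
    moreover have "junk g (F z) = junk (g \<circ> id) (g \<circ> f z)"
      by (rule junk_cong[symmetric]) (auto simp: F_def hF[OF z] g)
    ultimately have "near (Suc k) g (F z)" by (simp add: near_def)
    then show "{h \<in> carrier (Homeo X). near k (F z) h} \<in>
        (\<lambda>h. {f \<in> carrier (Homeo X). near k h f}) ` {h \<in> carrier (Homeo X). near (Suc k) g h}"
      using Fc[OF z] by (intro image_eqI[of _ _ "F z"]) auto
  qed
  ultimately show ?thesis using infinite_super by blast
qed

text \<open>The class of \<open>h\<close> depends on \<open>h\<close> only through its
  labelling.\<close>

lemma countable_near_classes:
  "countable ((\<lambda>h. {f \<in> carrier (Homeo X). near k h f}) ` {h \<in> carrier (Homeo X). near (Suc k) g h})"
proof -
  have "(\<lambda>h. {f \<in> carrier (Homeo X). near k h f}) ` {h \<in> carrier (Homeo X). near (Suc k) g h} \<subseteq>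
    (\<lambda>l. {f \<in> carrier (Homeo X). \<forall>x\<in>{x \<in> T. l x \<noteq> lab f x}. rk x < \<beta> k}) ` (\<lambda>g. restrict (lab g) T) ` {g. homeo g}"
  proof (rule image_subsetI)
    fix h assume h: "h \<in> {h \<in> carrier (Homeo X). near (Suc k) g h}"
    have "{x \<in> T. restrict (lab h) T x \<noteq> lab f x} = junk h f" for f by (auto simp: junk_def)
    then have "{f \<in> carrier (Homeo X). near k h f} =
      {f \<in> carrier (Homeo X). \<forall>x\<in>{x \<in> T. restrict (lab h) T x \<noteq> lab f x}. rk x < \<beta> k}"
      by (simp only: near_def)
    moreover have "homeo h" using h by (simp add: carrier_Homeo)
    ultimately show "{f \<in> carrier (Homeo X). near k h f} \<in>
      (\<lambda>l. {f \<in> carrier (Homeo X). \<forall>x\<in>{x \<in> T. l x \<noteq> lab f x}. rk x < \<beta> k}) ` (\<lambda>g. restrict (lab g) T) ` {g. homeo g}"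
      by blast
  qed
  then show ?thesis using countable_labellings by (meson countable_image countable_subset)
qed

theorem limit_equivalent: "coarsely_equivalent (Homeo_coarse_space X) sequence_space"
proof (rule branching.equivalent_sequence_space)
  show "branching (carrier (Homeo X)) near"
  proof
    show "carrier (Homeo X) \<noteq> {}" by (rule carrier_nonempty)
    show "near k g g" for k g by (rule near_refl)
    show "near k h g" if "near k g h" for k g h using near_sym[OF that] .
    show "near k g f" if "near k g h" "near k h f" for k g h f using near_trans[OF that] .
    show "near (Suc k) g h" if "near k g h" for k g h using near_mono[OF that] by simp
    show "\<exists>k. near k g h" if "g \<in> carrier (Homeo X)" "h \<in> carrier (Homeo X)" for g h
      using near_exists that by (simp add: carrier_Homeo)
    show "countable ((\<lambda>h. {f \<in> carrier (Homeo X). near k h f}) ` {h \<in> carrier (Homeo X). near (Suc k) g h})" for g k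
      by (rule countable_near_classes)
    show "infinite ((\<lambda>h. {f \<in> carrier (Homeo X). near k h f}) ` {h \<in> carrier (Homeo X). near (Suc k) g h})"
      if "g \<in> carrier (Homeo X)" for g k
      using infinite_near_classes that by (simp add: carrier_Homeo)
  qed
  show "points (Homeo_coarse_space X) = carrier (Homeo X)" by (simp add: Homeo_coarse_space_def)
qed (rule entourages_near)

end

lemma (in stone_of_type) limit_coarsely_equivalent:
  assumes "limit_ordinal \<alpha>" "n > 1"
  shows "coarsely_equivalent (Homeo_coarse_space X) sequence_space"
proof -
  obtain Y where Y: "split_space T (clopens X) rk \<alpha> K Y" using split_exists by (rule exE)
  obtain \<beta> where \<beta>: "(\<forall>k. \<beta> k < \<beta> (Suc k) \<and> \<beta> k < \<alpha>) \<and> (\<forall>\<gamma><\<alpha>. \<exists>k. \<gamma> < \<beta> k)"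
    using cofinal_sequence[OF assms(1)] by (rule exE)
  interpret split_stone X \<alpha> n Y
    by (intro split_stone.intro stone_of_type_axioms split_stone_axioms.intro Y)
  interpret limit_stone X \<alpha> n Y \<beta> by unfold_locales (use assms(2) \<beta> in blast)+
  show ?thesis by (rule limit_equivalent)
qed

section \<open>Successor ordinals: counting junk points of rank \<beta>\<close>

locale successor_stone = split_stone X \<alpha> n Y
  for X :: "'a topology" and \<alpha> n Y +
  fixes \<beta> :: countable_ordinal
  assumes n2: "n > 1" and pred: "is_predecessor \<beta> \<alpha>"
begin

definition Z :: "'a set" where
  "Z = {z \<in> T. rk z = \<beta>}"

lemma \<beta>_less: "\<beta> < \<alpha>"
  using pred by (simp add: is_predecessor_def)

lemma le_\<beta>: "\<gamma> < \<alpha> \<Longrightarrow> \<gamma> \<le> \<beta>"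
  using pred by (simp add: is_predecessor_def)

lemma Z_mem: "z \<in> Z \<Longrightarrow> z \<in> T" "z \<in> Z \<Longrightarrow> rk z = \<beta>" "z \<in> Z \<Longrightarrow> z \<notin> K"
  using \<beta>_less K_rank by (auto simp: Z_def)

lemma homeo_Z: "homeo g \<Longrightarrow> z \<in> T \<Longrightarrow> g z \<in> Z \<longleftrightarrow> z \<in> Z"
  using homeo_rank homeo_mem by (simp add: Z_def)

lemma infinite_Z: "p \<in> K \<Longrightarrow> infinite (Y p \<inter> Z)"
proof -
  assume p: "p \<in> K"
  have "infinite {z \<in> Y p. rk z = \<beta>}"
    using rank_dense_infinite[OF X_clopen[OF p] X_mem[OF p]] K_rank[OF p] \<beta>_less by simp
  moreover have "{z \<in> Y p. rk z = \<beta>} = Y p \<inter> Z" using X_sub[OF p] by (auto simp: Z_def)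
  ultimately show ?thesis by simp
qed

text \<open>Junk has rank at most \<beta>, so a peaked neighbourhood of a junk point contains at
  most one point of rank \<beta>; compactness makes the total finite.\<close>

lemma finite_junk_Z:
  assumes "homeo g" "homeo h"
  shows "finite (junk g h \<inter> Z)"
proof (rule clopen_induct[OF junk_clopen[OF assms]])
  fix x assume x: "x \<in> junk g h"
  obtain W where W: "peaked W x" using peaked_exists[OF junk_clopen[OF assms] x] by blast
  have "rk x \<le> \<beta>" using le_\<beta> junk_rank[OF assms x] .
  then have "W \<inter> Z \<subseteq> {x}" using peaked_less[OF W] Z_mem(2) by force
  then have "finite (W \<inter> Z)" using finite_subset by blast
  then show "\<exists>W\<in>clopens X. x \<in> W \<and> finite (W \<inter> Z)" using peaked_clopen[OF W] peaked_mem[OF W] by blast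
next
  fix V W assume "V \<subseteq> W" "finite (W \<inter> Z)"
  then show "finite (V \<inter> Z)" by (meson Int_mono finite_subset order_refl)
qed (simp_all add: Int_Un_distrib2)

definition jdist :: "('a \<Rightarrow> 'a) \<Rightarrow> ('a \<Rightarrow> 'a) \<Rightarrow> nat" where
  "jdist g h = card (junk g h \<inter> Z)"

lemma jdist_translate:
  assumes f: "homeo f" and gh: "homeo g" "homeo h"
  shows "jdist (f \<circ> g) (f \<circ> h) = jdist g h"
proof -
  have sub: "junk g h \<subseteq> T" by (auto simp: junk_def)
  have "junk (f \<circ> g) (f \<circ> h) \<inter> Z = f ` (junk g h \<inter> Z)"
    unfolding junk_translate[OF assms] using homeo_Z[OF f] sub by auto
  moreover have "inj_on f (junk g h \<inter> Z)" using inj_on_subset[OF ciso_inj[OF f]] sub by blast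
  ultimately show ?thesis by (simp add: jdist_def card_image)
qed

lemma jdist_cong:
  assumes "homeo g" "homeo h" "\<And>x. x \<in> T \<Longrightarrow> g x = g' x" "\<And>x. x \<in> T \<Longrightarrow> h x = h' x"
  shows "jdist g h = jdist g' h'"
  using junk_cong[OF assms] by (simp add: jdist_def)

lemma jdist_triangle:
  assumes "homeo g" "homeo h" "homeo k"
  shows "jdist g k \<le> jdist g h + jdist h k"
proof -
  have "jdist g k \<le> card ((junk g h \<inter> Z) \<union> (junk h k \<inter> Z))"
    unfolding jdist_def using junk_triangle[of g k h] finite_junk_Z assms by (intro card_mono) auto
  also have "\<dots> \<le> jdist g h + jdist h k" unfolding jdist_def by (rule card_Un_le)
  finally show ?thesis .
qed

lemma jdist_sym: "jdist g h = jdist h g"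
  by (simp add: jdist_def junk_sym)

lemma jdist_pseudometric:
  "continuous_left_invariant_pseudometric (Homeo X) (compact_open_topology X) (\<lambda>g h. real (jdist g h))"
proof (rule pseudometricI)
  show "real (jdist g g) = 0" for g by (simp add: jdist_def junk_def)
  show "0 \<le> real (jdist g h)" for g h by simp
  show "real (jdist g h) = real (jdist h g)" for g h by (simp add: jdist_sym)
  show "real (jdist g k) \<le> real (jdist g h) + real (jdist h k)" if "homeo g" "homeo h" "homeo k" for g h k
    using jdist_triangle[OF that] by linarith
  show "real (jdist (f \<circ> g) (f \<circ> h)) = real (jdist g h)" if "homeo f" "homeo g" "homeo h" for f g h
    using jdist_translate[OF that] by simp
  show "real (jdist g h) = real (jdist g' h')"
    if "homeo g" "homeo h" "\<And>x. x \<in> T \<Longrightarrow> g x = g' x" "\<And>x. x \<in> T \<Longrightarrow> h x = h' x" for g h g' h'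
    using jdist_cong[OF that] by simp
  show "finite (Y ` K)" using finite_K by simp
  show "Y ` K \<subseteq> clopens X" using X_clopen by auto
  show "real (jdist id v) = 0" if v: "homeo v" "\<And>P. P \<in> Y ` K \<Longrightarrow> v ` P = P" for v
  proof -
    have "junk id v = {}" using v by (intro junk_stabilizer) auto
    then show ?thesis by (simp add: jdist_def)
  qed
qed

text \<open>\<open>relabel\<close> at the preimage of \<open>z\<close>, followed by
  \<open>g\<close>. Only the peak of \<open>U\<close> has rank \<beta>, so exactly one letter of the
  word read along \<open>Z\<close> changes.\<close>

lemma relabel_Z:
  assumes g: "homeo g" and z: "z \<in> Z" and p: "p \<in> K" "p \<noteq> lab g z"
  shows "\<exists>g'. homeo g' \<and> lab g' z = p \<and> (\<forall>x\<in>Z - {z}. lab g' x = lab g x)"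
proof -
  define y where "y = inv_into T g z"
  have y: "y \<in> T" "g y = z" unfolding y_def using Z_mem(1)[OF z] homeo_inv_mem[OF g] homeo_inv_right[OF g] by auto
  then have yZ: "y \<in> Z" using homeo_Z[OF g y(1)] z by simp
  define q where "q = inv_into T g p"
  have q: "q \<in> K" "g q = p" unfolding q_def
    using homeo_K[OF homeo_inv[OF g] p(1)] homeo_inv_right[OF g] p(1) K_sub by auto
  have "q \<noteq> block y" using p(2) lab_apply[OF g y(1)] q(2) y(2) by auto
  then obtain f U where f: "homeo f" "peaked U y" "\<forall>x\<in>T. lab f x = (if x \<in> U then q else block x)"
    using relabel[OF y(1) Z_mem(3)[OF yZ] q(1)] by blast
  have fZ: "lab f x = (if x = y then q else block x)" if x: "x \<in> Z" for x
  proof -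
    have "x \<in> U \<longleftrightarrow> x = y" using peaked_less[OF f(2), of x] peaked_mem[OF f(2)] Z_mem(2)[OF x] Z_mem(2)[OF yZ] by auto
    then show ?thesis using f(3) Z_mem(1)[OF x] by simp
  qed
  have lab: "lab (g \<circ> f) (g x) = g (if x = y then q else block x)" if x: "x \<in> Z" for x
    using lab_comp[OF g f(1) Z_mem(1)[OF x]] fZ[OF x] by simp
  have "lab (g \<circ> f) x = lab g x" if x: "x \<in> Z - {z}" for x
  proof -
    have "x \<in> T" using x Z_mem by auto
    then obtain w where w: "w \<in> T" "x = g w" using ciso_image[OF g] by blast
    then have "w \<in> Z" "w \<noteq> y" using x homeo_Z[OF g] y(2) by auto
    then show ?thesis using lab[of w] lab_apply[OF g w(1)] w(2) by simp
  qed
  moreover have "lab (g \<circ> f) z = p" using lab[OF yZ] y(2) q(2) by simp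
  ultimately show ?thesis using homeo_comp[OF g f(1)] by (intro exI[of _ "g \<circ> f"]) simp
qed

text \<open>Peaked neighbourhoods of two points of equal rank are homeomorphic by a map that matches
  the peaks, and \<open>move\<close> extends it within the block.\<close>

lemma transport:
  assumes q: "q \<in> K" and z: "z \<in> Y q \<inter> Z" and w: "w \<in> Y q \<inter> Z"
  shows "\<exists>v. homeo v \<and> supported v (Y q) \<and> v w = z"
proof (cases "w = z")
  case True
  then show ?thesis using homeo_id by (intro exI[of _ id]) (simp add: supported_def)
next
  case False
  have ne: "q \<noteq> w" "q \<noteq> z" using Z_mem(3) z w q by auto
  obtain V where V: "V \<in> clopens X" "w \<in> V" "V \<subseteq> Y q" "V \<inter> {q, z} \<subseteq> {w}"
    using separated_finite[of w "Y q" "{q, z}"] X_clopen[OF q] w by auto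
  obtain U where U: "U \<subseteq> V" "peaked U w" using peaked_exists[OF V(1,2)] by blast
  obtain V' where V': "V' \<in> clopens X" "z \<in> V'" "V' \<subseteq> Y q" "q \<notin> V'"
    using avoid_point[OF _ X_clopen[OF q] ne(2)] z by blast
  obtain U' where U': "U' \<subseteq> V'" "peaked U' z" using peaked_exists[OF V'(1,2)] by blast
  have rk_eq: "rk w = rk z" using Z_mem(2) z w by simp
  obtain f where f: "ciso f U U'" using peaked_ciso[OF U(2) U'(2) rk_eq] by blast
  have "f w \<in> U'" "rk (f w) = rk z" using ciso_mem[OF f peaked_mem[OF U(2)]] ciso_rank[OF f peaked_mem[OF U(2)]] rk_eq by auto
  then have fw: "f w = z" using peaked_unique[OF U'(2)] by simp
  have "U \<subseteq> Y q - {q}" "U' \<subseteq> Y q - {q}" using U(1) V(3,4) U'(1) V'(3,4) ne by auto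
  then obtain v where "homeo v" "supported v (Y q)" "\<forall>x\<in>U. v x = f x" using move[OF X_peaked[OF q] f] by blast
  then show ?thesis using fw peaked_mem[OF U(2)] by auto
qed

lemma supported_block:
  assumes v: "homeo v" "supported v (Y q)" and q: "q \<in> K"
  shows "p \<in> K \<Longrightarrow> v p = p" and "x \<in> T \<Longrightarrow> block (v x) = block x"
proof -
  have vq: "v ` Y q = Y q" using supported_image[OF v order_refl X_sub[OF q]] .
  show "v p = p" if p: "p \<in> K" for p
  proof (cases "p = q")
    case True
    then show ?thesis using peaked_fixed[OF v X_peaked[OF q]] by simp
  next
    case False
    then have "p \<notin> Y q" using block_eq[OF q, of p] block_K[OF p] by auto
    then show ?thesis using supportedD[OF v(2)] p K_sub by auto
  qed
  show "block (v x) = block x" if x: "x \<in> T" for x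
  proof (cases "x \<in> Y q")
    case True
    then have "v x \<in> Y q" using vq by blast
    then show ?thesis using True block_eq[OF q] by simp
  next
    case False
    then show ?thesis using supportedD[OF v(2) x] by simp
  qed
qed

context
  fixes d
  assumes d: "continuous_left_invariant_pseudometric (Homeo X) (compact_open_topology X) d"
begin

lemma len_comp: "homeo g \<Longrightarrow> homeo h \<Longrightarrow> len d (g \<circ> h) \<le> len d g + len d h"
  and len_cong: "(\<And>x. x \<in> T \<Longrightarrow> g x = h x) \<Longrightarrow> len d g = len d h"
  using length_space.L_comp[OF length_space_len[OF d ranked_space_axioms]]
    length_space.L_cong[OF length_space_len[OF d ranked_space_axioms]] by blast+

lemma len_bounded_0: "\<exists>C. \<forall>g. homeo g \<and> jdist id g = 0 \<longrightarrow> len d g \<le> C"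
proof -
  obtain C where C: "\<And>g. homeo g \<Longrightarrow> (\<And>x. x \<in> junk id g \<Longrightarrow> rk x < \<beta>) \<Longrightarrow> len d g \<le> C"
    using len_bounded_junk[OF d \<beta>_less] by blast
  have "len d g \<le> C" if g: "homeo g" "jdist id g = 0" for g
  proof (rule C[OF g(1)])
    fix x assume x: "x \<in> junk id g"
    have "junk id g \<inter> Z = {}" using g finite_junk_Z[OF homeo_id g(1)] by (simp add: jdist_def)
    then have "rk x \<noteq> \<beta>" using x by (auto simp: Z_def junk_def)
    moreover have "rk x \<le> \<beta>" using le_\<beta> junk_rank[OF homeo_id g(1) x] .
    ultimately show "rk x < \<beta>" by simp
  qed
  then show ?thesis by blast
qed

text \<open>A homeomorphism that mislabels a single point of rank \<open>\<beta>\<close> is moved to one of finitely many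
  representatives by an element supported on one block.\<close>

lemma len_bounded_1: "\<exists>C. \<forall>g. homeo g \<and> jdist id g = 1 \<longrightarrow> len d g \<le> C"
proof -
  obtain C0 where C0: "\<And>g. homeo g \<Longrightarrow> jdist id g = 0 \<Longrightarrow> len d g \<le> C0" using len_bounded_0 by blast
  have "\<forall>q. q \<in> K \<longrightarrow> (\<exists>w. w \<in> Y q \<inter> Z)"
  proof (intro allI impI)
    fix q assume q: "q \<in> K"
    have "Y q \<inter> Z \<noteq> {}" using infinite_Z[OF q] by (intro notI) simp
    then show "\<exists>w. w \<in> Y q \<inter> Z" by blast
  qed
  then obtain w where w: "\<And>q. q \<in> K \<Longrightarrow> w q \<in> Y q \<inter> Z" by metis
  have wlab: "block (w q) = q" if "q \<in> K" for q using block_eq[OF that] w[OF that] by blast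
  have "\<forall>q. q \<in> K \<longrightarrow> (\<exists>C. \<forall>g. homeo g \<and> supported g (Y q) \<longrightarrow> len d g \<le> C)"
    using len_bounded_peaked[OF d X_peaked] by blast
  then obtain C1 where C1: "\<And>q g. q \<in> K \<Longrightarrow> homeo g \<Longrightarrow> supported g (Y q) \<Longrightarrow> len d g \<le> C1 q" by metis
  define R where "R q p r \<longleftrightarrow> homeo r \<and> (\<forall>x\<in>Z. lab r x = (if x = w q then p else block x))" for q p r
  have R_ex: "\<exists>r. R q p r" if q: "q \<in> K" and p: "p \<in> K" "p \<noteq> q" for q p
  proof -
    have "w q \<in> Z" "p \<noteq> lab id (w q)" using w[OF q] wlab[OF q] p Z_mem(1) lab_id by auto
    then obtain r where "homeo r" "lab r (w q) = p" "\<forall>x\<in>Z - {w q}. lab r x = lab id x"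
      using relabel_Z[OF homeo_id _ p(1)] by blast
    then have "R q p r" using lab_id Z_mem(1) by (auto simp: R_def)
    then show ?thesis by blast
  qed
  define \<rho> where "\<rho> q p = (SOME r. R q p r)" for q p
  have \<rho>: "R q p (\<rho> q p)" if "q \<in> K" "p \<in> K" "p \<noteq> q" for q p
    unfolding \<rho>_def using R_ex[OF that] by (rule someI_ex)
  \<comment> \<open>Summing absolute values over all blocks and pairs gives one bound for whichever
    \<open>q\<close> and \<open>p\<close> occur.\<close>
  define B where "B = (\<Sum>q\<in>K. \<bar>C1 q\<bar>) + (\<Sum>q\<in>K. \<Sum>p\<in>K. \<bar>len d (\<rho> q p)\<bar>) + C0"
  have "len d g \<le> B" if g: "homeo g" "jdist id g = 1" for g
  proof -
    obtain z where z: "junk id g \<inter> Z = {z}" using g(2) by (auto simp: jdist_def card_1_singleton_iff)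
    then have "z \<in> junk id g" "z \<in> Z" by blast+
    then have zZ: "z \<in> Z" "z \<in> T" "lab g z \<noteq> block z" using lab_id[of z] by (auto simp: junk_def)
    have other: "lab g x = block x" if "x \<in> Z" "x \<noteq> z" for x
    proof -
      have "x \<notin> junk id g" using z that by blast
      then show ?thesis using Z_mem(1)[OF that(1)] lab_id by (simp add: junk_def)
    qed
    define q where "q = block z"
    define p where "p = lab g z"
    have q: "q \<in> K" "z \<in> Y q \<inter> Z" using block_mem[OF zZ(2)] zZ(1) by (auto simp: q_def)
    have p: "p \<in> K" "p \<noteq> q" using lab_mem[OF g(1) zZ(2)] zZ(3) by (auto simp: p_def q_def)
    obtain v where v: "homeo v" "supported v (Y q)" "v (w q) = z" using transport[OF q w[OF q(1)]] by blast
    note vb = supported_block[OF v(1,2) q(1)]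
    have r: "homeo (\<rho> q p)" "\<And>x. x \<in> Z \<Longrightarrow> lab (\<rho> q p) x = (if x = w q then p else block x)"
      using \<rho>[OF q(1) p] by (auto simp: R_def)
    have vr: "homeo (v \<circ> \<rho> q p)" using homeo_comp[OF v(1) r(1)] .
    \<comment> \<open>On \<open>Z\<close> the map \<open>v \<circ> \<rho> q p\<close> has the same
      labels as \<open>g\<close>, so dividing by it leaves no junk of rank \<beta>.\<close>
    define k where "k = inv_into T (v \<circ> \<rho> q p) \<circ> g"
    have k: "homeo k" unfolding k_def using homeo_comp[OF homeo_inv[OF vr] g(1)] .
    have "x \<notin> junk (v \<circ> \<rho> q p) g" if x: "x \<in> Z" for x
    proof -
      obtain y where y: "y \<in> T" "x = v y" using ciso_image[OF v(1)] Z_mem(1)[OF x] by blast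
      then have yZ: "y \<in> Z" using homeo_Z[OF v(1)] x by simp
      have "lab (\<rho> q p) y \<in> K" using lab_mem[OF r(1) y(1)] .
      then have l: "lab (v \<circ> \<rho> q p) x = (if y = w q then p else block y)"
        using lab_comp[OF v(1) r(1) y(1)] vb(1) r(2)[OF yZ] y(2) by metis
      have "y = w q \<longleftrightarrow> x = z" using homeo_eq_iff[OF v(1) y(1), of "w q"] v(3) y(2) w[OF q(1)] Z_mem(1) by auto
      then have "lab g x = (if y = w q then p else block y)"
        using other[OF x] vb(2)[OF y(1)] y(2) by (auto simp: p_def)
      then show ?thesis using l by (simp add: junk_def)
    qed
    then have "junk (v \<circ> \<rho> q p) g \<inter> Z = {}" by blast
    then have "jdist (v \<circ> \<rho> q p) g = 0" by (simp add: jdist_def)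
    moreover have "jdist (v \<circ> \<rho> q p) g = jdist id k"
    proof -
      have "jdist (v \<circ> \<rho> q p) g = jdist ((v \<circ> \<rho> q p) \<circ> id) ((v \<circ> \<rho> q p) \<circ> k)"
        by (rule jdist_cong[OF vr g(1)]) (simp_all only: comp_id k_def comp_apply[of "v \<circ> \<rho> q p"]
            comp_apply[of "inv_into T (v \<circ> \<rho> q p)"] homeo_inv_right[OF vr homeo_mem[OF g(1)]])
      then show ?thesis using jdist_translate[OF vr homeo_id k] by simp
    qed
    ultimately have "len d k \<le> C0" using C0[OF k] by simp
    moreover have "len d g = len d ((v \<circ> \<rho> q p) \<circ> k)"
      by (rule len_cong) (simp only: k_def comp_apply[of "v \<circ> \<rho> q p"]
            comp_apply[of "inv_into T (v \<circ> \<rho> q p)"] homeo_inv_right[OF vr homeo_mem[OF g(1)]])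
    moreover have "len d v \<le> (\<Sum>q\<in>K. \<bar>C1 q\<bar>)"
    proof -
      have "\<bar>C1 q\<bar> \<le> (\<Sum>q\<in>K. \<bar>C1 q\<bar>)" using q(1) finite_K by (intro member_le_sum) auto
      then show ?thesis using C1[OF q(1) v(1,2)] by simp
    qed
    moreover have "len d (\<rho> q p) \<le> (\<Sum>q\<in>K. \<Sum>p\<in>K. \<bar>len d (\<rho> q p)\<bar>)"
    proof -
      have "\<bar>len d (\<rho> q p)\<bar> \<le> (\<Sum>p\<in>K. \<bar>len d (\<rho> q p)\<bar>)" using p(1) finite_K by (intro member_le_sum) auto
      also have "\<dots> \<le> (\<Sum>q\<in>K. \<Sum>p\<in>K. \<bar>len d (\<rho> q p)\<bar>)"
        using q(1) finite_K by (intro member_le_sum) (auto intro: sum_nonneg)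
      finally show ?thesis by simp
    qed
    ultimately show ?thesis using len_comp[OF vr k] len_comp[OF v(1) r(1)] unfolding B_def by linarith
  qed
  then show ?thesis by blast
qed

text \<open>Walk from \<open>g\<close> to \<open>h\<close>, correcting the label of one point of
  \<open>Z\<close> at a time. Each step is a left translate of a pair at \<open>jdist\<close> 1 and
  costs \<open>C1\<close>; the last stretch has no junk of rank \<beta> and costs
  \<open>C0\<close>.\<close>

lemma dist_linear_bound:
  "\<exists>K C. \<forall>g h. homeo g \<longrightarrow> homeo h \<longrightarrow> len d (inv_into T g \<circ> h) \<le> K * real (jdist g h) + C"
proof -
  obtain C0 where C0: "\<And>g. homeo g \<Longrightarrow> jdist id g = 0 \<Longrightarrow> len d g \<le> C0" using len_bounded_0 by blast
  obtain C1 where C1: "\<And>g. homeo g \<Longrightarrow> jdist id g = 1 \<Longrightarrow> len d g \<le> C1" using len_bounded_1 by blast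
  have inv: "jdist id (inv_into T g \<circ> h) = jdist g h" if g: "homeo g" and h: "homeo h" for g h
  proof -
    have k: "homeo (inv_into T g \<circ> h)" using homeo_comp[OF homeo_inv[OF g] h] .
    have "jdist g h = jdist (g \<circ> id) (g \<circ> (inv_into T g \<circ> h))"
      by (rule jdist_cong[OF g h]) (simp_all add: homeo_inv_right[OF g homeo_mem[OF h]])
    then show ?thesis using jdist_translate[OF g homeo_id k] by simp
  qed
  have "len d (inv_into T g \<circ> h) \<le> C1 * real m + C0" if "homeo g" "homeo h" "jdist g h = m" for g h m
    using that
  proof (induction m arbitrary: g)
    case 0
    then have "jdist id (inv_into T g \<circ> h) = 0" using inv by simp
    then show ?case using C0[OF homeo_comp[OF homeo_inv[OF 0(1)] 0(2)]] by (simp del: comp_apply)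
  next
    case (Suc m)
    note g = Suc.prems(1) and h = Suc.prems(2)
    have "junk g h \<inter> Z \<noteq> {}" using Suc.prems(3) by (intro notI) (simp add: jdist_def)
    then obtain z where z: "z \<in> junk g h" "z \<in> Z" by blast
    have zT: "z \<in> T" "lab h z \<noteq> lab g z" using z by (auto simp: junk_def)
    obtain g' where g': "homeo g'" "lab g' z = lab h z" "\<forall>x\<in>Z - {z}. lab g' x = lab g x"
      using relabel_Z[OF g z(2) lab_mem[OF h zT(1)] zT(2)] by blast
    have lg': "lab g' x = (if x = z then lab h z else lab g x)" if "x \<in> Z" for x
      using g'(2,3) that by simp
    have "junk g g' \<inter> Z = {z}" using lg' zT z by (auto simp: junk_def split: if_splits)
    then have 1: "jdist g g' = 1" by (simp add: jdist_def)
    have "junk g' h \<inter> Z = junk g h \<inter> Z - {z}" using lg' by (auto simp: junk_def split: if_splits)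
    then have "jdist g' h = m" using Suc.prems(3) z finite_junk_Z[OF g h] by (simp add: jdist_def)
    then have "len d (inv_into T g' \<circ> h) \<le> C1 * real m + C0" by (rule Suc.IH[OF g'(1) h])
    moreover have "len d (inv_into T g \<circ> g') \<le> C1"
      using C1[OF homeo_comp[OF homeo_inv[OF g] g'(1)]] inv[OF g g'(1)] 1 by simp
    moreover have "len d (inv_into T g \<circ> h) = len d ((inv_into T g \<circ> g') \<circ> (inv_into T g' \<circ> h))"
      by (rule len_cong) (simp add: homeo_inv_right[OF g'(1)] homeo_mem[OF h])
    ultimately have "len d (inv_into T g \<circ> h) \<le> C1 + (C1 * real m + C0)"
      using len_comp[OF homeo_comp[OF homeo_inv[OF g] g'(1)] homeo_comp[OF homeo_inv[OF g'(1)] h]] by simp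
    moreover have "C1 + (C1 * real m + C0) = C1 * real (Suc m) + C0" by (simp add: algebra_simps)
    ultimately show ?case by (rule order_trans[OF _ eq_refl])
  qed
  then show ?thesis by blast
qed

end

lemma jdist_maximal: "maximal_pseudometric (Homeo X) (compact_open_topology X) (\<lambda>g h. real (jdist g h))"
  unfolding maximal_pseudometric_def
proof (intro conjI allI impI)
  show "continuous_left_invariant_pseudometric (Homeo X) (compact_open_topology X) (\<lambda>g h. real (jdist g h))"
    by (rule jdist_pseudometric)
  fix d assume d: "continuous_left_invariant_pseudometric (Homeo X) (compact_open_topology X) d"
  obtain A C where AC: "\<And>g h. homeo g \<Longrightarrow> homeo h \<Longrightarrow> len d (inv_into T g \<circ> h) \<le> A * real (jdist g h) + C"
    using dist_linear_bound[OF d] by blast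
  have "d g h \<le> A * real (jdist g h) + C" if "g \<in> carrier (Homeo X)" "h \<in> carrier (Homeo X)" for g h
    using AC[of g h] dist_eq_len[OF d that] that by (simp add: carrier_Homeo)
  then show "\<exists>K C. \<forall>x\<in>carrier (Homeo X). \<forall>y\<in>carrier (Homeo X). d x y \<le> K * real (jdist x y) + C" by blast
qed

text \<open>The code reads the labels along an enumeration of \<open>Z\<close>. The alphabet is
  renamed block by block so that the label of the block itself becomes 0; the identity then has the
  zero word, and finite junk means finite support. Surjectivity changes one letter at a time by
  \<open>relabel_Z\<close>.\<close>

lemma word_code:
  "\<exists>c. c ` carrier (Homeo X) = words n \<and>
     (\<forall>g\<in>carrier (Homeo X). \<forall>h\<in>carrier (Homeo X). hdist (c g) (c h) = jdist g h)"
proof -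
  have "infinite Z" using infinite_Z K_nonempty finite_subset by blast
  moreover have "countable Z" using countable_X countable_subset by (auto simp: Z_def)
  ultimately obtain \<zeta>' where "bij_betw \<zeta>' Z (UNIV :: nat set)" using countableE_infinite by blast
  then obtain \<zeta> where \<zeta>: "bij_betw \<zeta> (UNIV :: nat set) Z" using bij_betw_inv by blast
  have \<zeta>Z: "\<zeta> i \<in> Z" "\<zeta> i \<in> T" for i using bij_betwE[OF \<zeta>] Z_mem by auto
  have "\<exists>k. bij_betw k K {..<n} \<and> k q = 0" if q: "q \<in> K" for q
  proof -
    obtain k where k: "bij_betw k K {..<n}"
      using bij_betw_iff_card[OF finite_K, of "{..<n}"] K(2) by auto
    have mem: "k q < n" using bij_betwE[OF k] q by auto
    have "bij_betw (Transposition.transpose (k q) 0) {..<n} {..<n}"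
      using mem by (intro bij_betw_imageI) (auto simp: Transposition.transpose_def inj_on_def image_iff)
    then have "bij_betw (Transposition.transpose (k q) 0 \<circ> k) K {..<n}" by (rule bij_betw_trans[OF k])
    then show ?thesis by (intro exI[of _ "Transposition.transpose (k q) 0 \<circ> k"]) simp
  qed
  then obtain \<kappa> where \<kappa>: "\<And>q. q \<in> K \<Longrightarrow> bij_betw (\<kappa> q) K {..<n}" "\<And>q. q \<in> K \<Longrightarrow> \<kappa> q q = 0" by metis
  have \<kappa>_eq: "\<kappa> q p = \<kappa> q p' \<longleftrightarrow> p = p'" if "q \<in> K" "p \<in> K" "p' \<in> K" for q p p'
    using inj_on_eq_iff[OF bij_betw_imp_inj_on[OF \<kappa>(1)[OF that(1)]] that(2,3)] .
  have bK: "block (\<zeta> i) \<in> K" for i using block_mem(1)[OF \<zeta>Z(2)] .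
  define c where "c g i = \<kappa> (block (\<zeta> i)) (lab g (\<zeta> i))" for g i
  have c_diff: "c g i \<noteq> c h i \<longleftrightarrow> \<zeta> i \<in> junk g h" if "homeo g" "homeo h" for g h i
    using \<kappa>_eq[OF bK lab_mem[OF that(1) \<zeta>Z(2)] lab_mem[OF that(2) \<zeta>Z(2)]] \<zeta>Z(2) by (simp add: c_def junk_def)
  have hd: "hdist (c g) (c h) = jdist g h" if gh: "homeo g" "homeo h" for g h
  proof -
    have "\<zeta> ` {i. c g i \<noteq> c h i} = junk g h \<inter> Z"
      unfolding c_diff[OF gh] bij_betw_imp_surj_on[OF \<zeta>, symmetric] by blast
    then show ?thesis
      using card_image[OF inj_on_subset[OF bij_betw_imp_inj_on[OF \<zeta>]], of "{i. c g i \<noteq> c h i}"]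
      by (simp add: hdist_def jdist_def)
  qed
  have c_id: "c id i = 0" for i using lab_id[OF \<zeta>Z(2)] \<kappa>(2)[OF bK] by (simp add: c_def)
  have c_words: "c g \<in> words n" if g: "homeo g" for g
  proof -
    have "{i. c g i \<noteq> 0} = \<zeta> -` (junk g id \<inter> Z)" using c_diff[OF g homeo_id] c_id \<zeta>Z(1) by auto
    moreover have "finite (\<zeta> -` (junk g id \<inter> Z))"
      using finite_junk_Z[OF g homeo_id] bij_betw_imp_inj_on[OF \<zeta>] by (intro finite_vimageI) auto
    moreover have "c g i < n" for i
      using bij_betwE[OF \<kappa>(1)[OF bK]] lab_mem[OF g \<zeta>Z(2)] by (auto simp: c_def)
    ultimately show ?thesis by (simp add: words_def)
  qed
  have surj: "\<exists>g. homeo g \<and> c g = s" if "s \<in> words n" "card {i. s i \<noteq> 0} = m" for s m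
    using that
  proof (induction m arbitrary: s)
    case 0
    then have "s = c id" by (auto simp: words_def c_id fun_eq_iff)
    then show ?case using homeo_id by blast
  next
    case (Suc m)
    have "{i. s i \<noteq> 0} \<noteq> {}" using Suc.prems(2) by (intro notI) simp
    then obtain i where i: "s i \<noteq> 0" by blast
    define s' where "s' = s(i := 0)"
    have e: "{j. s' j \<noteq> 0} = {j. s j \<noteq> 0} - {i}" by (auto simp: s'_def)
    have fin: "finite {j. s j \<noteq> 0}" using Suc.prems(1) by (simp add: words_def)
    have "s' \<in> words n" using Suc.prems(1) fin e n2 by (auto simp: words_def s'_def)
    moreover have "card {j. s' j \<noteq> 0} = m" using Suc.prems(2) i fin e by simp
    ultimately obtain g where g: "homeo g" "c g = s'" using Suc.IH by blast
    define q where "q = block (\<zeta> i)"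
    have q: "q \<in> K" using bK q_def by simp
    have "s i \<in> \<kappa> q ` K" using Suc.prems(1) bij_betw_imp_surj_on[OF \<kappa>(1)[OF q]] by (simp add: words_def)
    then obtain p where p: "p \<in> K" "\<kappa> q p = s i" by force
    have "p \<noteq> lab g (\<zeta> i)" using p(2) i fun_cong[OF g(2), of i] by (auto simp: c_def q_def s'_def)
    then obtain g' where g': "homeo g'" "lab g' (\<zeta> i) = p" "\<forall>x\<in>Z - {\<zeta> i}. lab g' x = lab g x"
      using relabel_Z[OF g(1) \<zeta>Z(1) p(1)] by blast
    have "c g' j = s j" for j
    proof (cases "j = i")
      case True
      then show ?thesis using g'(2) p(2) by (simp add: c_def q_def)
    next
      case False
      then have "\<zeta> j \<noteq> \<zeta> i" using inj_onD[OF bij_betw_imp_inj_on[OF \<zeta>]] by blast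
      then have "c g' j = c g j" using g'(3) \<zeta>Z(1) by (simp add: c_def)
      then show ?thesis using fun_cong[OF g(2), of j] False by (simp add: s'_def)
    qed
    then show ?case using g'(1) by blast
  qed
  have "c ` carrier (Homeo X) = words n"
  proof
    show "c ` carrier (Homeo X) \<subseteq> words n" using c_words by (auto simp: carrier_Homeo)
    show "words n \<subseteq> c ` carrier (Homeo X)"
    proof
      fix s assume "s \<in> words n"
      then obtain g where g: "homeo g" "c g = s" using surj by blast
      have "c (restrict g T) = c g"
      proof
        fix i
        have "lab g (\<zeta> i) = lab (restrict g T) (\<zeta> i)" by (rule lab_cong[OF g(1) _ \<zeta>Z(2)]) simp
        then show "c (restrict g T) i = c g i" by (simp add: c_def)
      qed
      then show "s \<in> c ` carrier (Homeo X)" using restrict_carrier[OF g(1)] g(2) by (metis image_eqI)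
    qed
  qed
  then show ?thesis using hd by (intro exI[of _ c]) (auto simp: carrier_Homeo)
qed

theorem successor_quasi_isometric:
  "group_quasi_isometric (Homeo X) (compact_open_topology X) hamming_vertices (graph_dist hamming_edges)"
proof -
  obtain c where c: "c ` carrier (Homeo X) = words n \<and>
     (\<forall>g\<in>carrier (Homeo X). \<forall>h\<in>carrier (Homeo X). hdist (c g) (c h) = jdist g h)"
    using word_code by (rule exE)
  have "quasi_isometric (carrier (Homeo X)) (\<lambda>g h. real (jdist g h)) hamming_vertices (graph_dist hamming_edges)"
    by (rule words_quasi_isometric_hamming[of n c]) (use n2 c in auto)
  then show ?thesis using jdist_maximal unfolding group_quasi_isometric_def by blast
qed

end

lemma (in stone_of_type) successor_group_quasi_isometric:
  assumes "successor_ordinal \<alpha>" "n > 1"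
  shows "group_quasi_isometric (Homeo X) (compact_open_topology X) hamming_vertices (graph_dist hamming_edges)"
proof -
  obtain Y where Y: "split_space T (clopens X) rk \<alpha> K Y" using split_exists by (rule exE)
  obtain \<beta> where \<beta>: "is_predecessor \<beta> \<alpha>" using assms(1) by (auto simp: successor_ordinal_def)
  interpret split_stone X \<alpha> n Y
    by (intro split_stone.intro stone_of_type_axioms split_stone_axioms.intro Y)
  interpret successor_stone X \<alpha> n Y \<beta> by unfold_locales (use assms(2) \<beta> in auto)
  show ?thesis by (rule successor_quasi_isometric)
qed

section \<open>Spaces of type \<open>(1,1)\<close>, \<open>(1,2)\<close> and \<open>(\<omega>,2)\<close>\<close>

lemma uncountable_ordinals: "uncountable (UNIV :: countable_ordinal set)"
proof
  include cardinal_syntax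
  assume "countable (UNIV :: countable_ordinal set)"
  then have "countable (range Rep_countable_ordinal)" by simp
  moreover have "range Rep_countable_ordinal = Field (cardSuc natLeq)"
    using type_definition.Rep_range[OF type_definition_countable_ordinal] .
  ultimately have "|Field (cardSuc natLeq)| \<le>o natLeq" using countable_card_le_natLeq by metis
  moreover have "natLeq <o |Field (cardSuc natLeq)|"
    using ordLess_ordIso_trans[OF cardSuc_greater[OF natLeq_Card_order]
        ordIso_symmetric[OF card_of_Field_ordIso[OF cardSuc_Card_order[OF natLeq_Card_order]]]] .
  ultimately show False using not_ordLess_ordLeq by blast
qed

text \<open>Initial segments are countable but the type is not, so countably many of them cannot
  exhaust it. This supplies successors and suprema.\<close>

lemma countable_ordinals_bounded:
  assumes "countable (B :: countable_ordinal set)"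
  shows "\<exists>\<delta>. \<forall>\<gamma>\<in>B. \<gamma> < \<delta>"
proof -
  have "countable {..\<gamma>}" for \<gamma> :: countable_ordinal
    using countable_insert[OF countable_lessThan_ordinal[of \<gamma>], of \<gamma>] by (simp add: lessThan_Suc_eq_insert_0 ivl_disj_un_singleton(2)[symmetric])
  then have "countable (\<Union>\<gamma>\<in>B. {..\<gamma>})" using assms by auto
  then have "(\<Union>\<gamma>\<in>B. {..\<gamma>}) \<noteq> UNIV" using uncountable_ordinals by auto
  then obtain \<delta> where "\<delta> \<notin> (\<Union>\<gamma>\<in>B. {..\<gamma>})" by blast
  then show ?thesis by (intro exI[of _ \<delta>]) (auto simp: not_le)
qed

lemma finite_ordinals_and_omega:
  "\<exists>(\<nu> :: nat \<Rightarrow> countable_ordinal) \<omega>. strict_mono \<nu> \<and> \<nu> 0 = 0 \<and> successor_ordinal (\<nu> 1) \<and> limit_ordinal \<omega> \<and>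
     (\<forall>k. \<nu> k < \<omega>) \<and> (\<forall>\<gamma>. \<gamma> < \<omega> \<longrightarrow> (\<exists>k. \<gamma> = \<nu> k))"
proof -
  have "\<exists>\<delta>. is_predecessor \<gamma> \<delta>" for \<gamma>
  proof -
    obtain \<delta> where "\<gamma> < \<delta>" using countable_ordinals_bounded[of "{\<gamma>}"] by auto
    then show ?thesis using next_ordinal by blast
  qed
  then obtain \<mu> where \<mu>: "\<mu> 0 = (0 :: countable_ordinal)" "\<And>k. is_predecessor (\<mu> k) (\<mu> (Suc k))"
    using dependent_nat_choice[of "\<lambda>k \<gamma>. k = 0 \<longrightarrow> \<gamma> = (0 :: countable_ordinal)" "\<lambda>_. is_predecessor"]
    by (metis nat.distinct(1))
  have mono: "strict_mono \<mu>" using \<mu>(2) by (intro strict_mono_Suc_iff[THEN iffD2]) (auto simp: is_predecessor_def)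
  have initial: "\<exists>j. \<gamma> = \<mu> j" if "\<gamma> \<le> \<mu> k" for \<gamma> k
    using that
  proof (induction k)
    case 0
    then show ?case using \<mu>(1) zero_least[of \<gamma>] by (metis antisym)
  next
    case (Suc k)
    show ?case
    proof (cases "\<gamma> = \<mu> (Suc k)")
      case False
      then have "\<gamma> \<le> \<mu> k" using Suc.prems \<mu>(2)[of k] by (auto simp: is_predecessor_def)
      then show ?thesis using Suc.IH by blast
    qed blast
  qed
  define \<omega> where "\<omega> = (LEAST \<delta>. \<forall>k. \<mu> k < \<delta>)"
  obtain \<delta> where \<delta>: "\<forall>\<gamma>\<in>range \<mu>. \<gamma> < \<delta>" using countable_ordinals_bounded[of "range \<mu>"] by auto
  have \<omega>: "\<forall>k. \<mu> k < \<omega>" unfolding \<omega>_def by (rule LeastI[of _ \<delta>]) (use \<delta> in blast)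
  have below: "\<exists>k. \<gamma> = \<mu> k" if "\<gamma> < \<omega>" for \<gamma>
  proof -
    have "\<not> (\<forall>k. \<mu> k < \<gamma>)" using not_less_Least[of \<gamma> "\<lambda>\<delta>. \<forall>k. \<mu> k < \<delta>"] that by (simp add: \<omega>_def)
    then obtain k where "\<gamma> \<le> \<mu> k" by (auto simp: not_less)
    then show ?thesis by (rule initial)
  qed
  have "\<not> successor_ordinal \<omega>"
  proof
    assume "successor_ordinal \<omega>"
    then obtain \<gamma> where \<gamma>: "is_predecessor \<gamma> \<omega>" by (auto simp: successor_ordinal_def)
    then obtain k where "\<gamma> = \<mu> k" using below by (auto simp: is_predecessor_def)
    then have "\<mu> (Suc k) \<le> \<mu> k" using \<gamma> \<omega> by (auto simp: is_predecessor_def)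
    then show False using strict_monoD[OF mono, of k "Suc k"] by simp
  qed
  moreover have "\<omega> \<noteq> 0" using \<omega> \<mu>(1) by (metis less_irrefl)
  ultimately have "limit_ordinal \<omega>" by (simp add: limit_ordinal_def)
  moreover have "successor_ordinal (\<mu> 1)" using \<mu>(2)[of 0] by (auto simp: successor_ordinal_def)
  ultimately show ?thesis using mono \<mu>(1) \<omega> below by blast
qed

text \<open>Any function with the two rank properties computes the derivatives, so an example can be
  given by an explicit rank.\<close>

lemma CB_derivative_from_rank:
  fixes rk :: "'a \<Rightarrow> countable_ordinal"
  assumes isolated: "\<And>x. x \<in> topspace X \<Longrightarrow> \<exists>U. openin X U \<and> x \<in> U \<and> (\<forall>y\<in>U - {x}. rk y < rk x)"
    and dense: "\<And>U x \<gamma>. openin X U \<Longrightarrow> x \<in> U \<Longrightarrow> \<gamma> < rk x \<Longrightarrow> \<exists>y\<in>U. rk y = \<gamma>"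
  shows "CB_derivative X \<gamma> = {x \<in> topspace X. \<gamma> \<le> rk x}"
proof (induction \<gamma> rule: less_induct)
  case (less \<gamma>)
  show ?case
  proof (cases \<gamma> rule: ordinal_cases)
    case 1
    then show ?thesis by (simp add: CB_derivative_0 zero_least)
  next
    case (2 \<delta>)
    then have IH: "CB_derivative X \<delta> = {x \<in> topspace X. \<delta> \<le> rk x}" using less.IH by (simp add: is_predecessor_def)
    have eq: "\<gamma> \<le> \<epsilon> \<longleftrightarrow> \<delta> < \<epsilon>" for \<epsilon> using 2 unfolding is_predecessor_def by (metis leD le_less_trans not_le)
    have "openin (subtopology X {x \<in> topspace X. \<delta> \<le> rk x}) {x} \<longleftrightarrow> rk x = \<delta>"
      if x: "x \<in> topspace X" "\<delta> \<le> rk x" for x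
    proof
      assume "openin (subtopology X {x \<in> topspace X. \<delta> \<le> rk x}) {x}"
      then obtain W where W: "openin X W" "{x} = W \<inter> {x \<in> topspace X. \<delta> \<le> rk x}" unfolding openin_subtopology by blast
      show "rk x = \<delta>"
      proof (rule ccontr)
        assume "rk x \<noteq> \<delta>"
        then have "\<delta> < rk x" using x by simp
        then obtain y where y: "y \<in> W" "rk y = \<delta>" using dense[OF W(1)] W(2) by blast
        then have "y \<in> {x}" unfolding W(2) using openin_subset[OF W(1)] by auto
        then show False using y \<open>rk x \<noteq> \<delta>\<close> by simp
      qed
    next
      assume eq: "rk x = \<delta>"
      obtain U where U: "openin X U" "x \<in> U" "\<forall>y\<in>U - {x}. rk y < rk x" using isolated[OF x(1)] by blast
      have "{x} = U \<inter> {x \<in> topspace X. \<delta> \<le> rk x}" using U x eq by (auto simp: not_le[symmetric])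
      then show "openin (subtopology X {x \<in> topspace X. \<delta> \<le> rk x}) {x}" unfolding openin_subtopology using U(1) by blast
    qed
    then show ?thesis
      unfolding CB_derivative_successor[OF 2] IH remove_isolated_def eq by (auto simp: less_le)
  next
    case 3
    then have "CB_derivative X \<gamma> = (\<Inter>\<delta>\<in>{..<\<gamma>}. {x \<in> topspace X. \<delta> \<le> rk x})"
      using less.IH by (simp add: CB_derivative_limit)
    also have "\<dots> = {x \<in> topspace X. \<gamma> \<le> rk x}"
    proof (intro Set.set_eqI iffI)
      fix x assume x: "x \<in> (\<Inter>\<delta>\<in>{..<\<gamma>}. {x \<in> topspace X. \<delta> \<le> rk x})"
      have "0 < \<gamma>" using 3 zero_least[of \<gamma>] by (metis le_neq_trans limit_ordinal_def)
      then have "x \<in> topspace X" using x by blast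
      moreover have "\<gamma> \<le> rk x"
      proof (rule ccontr)
        assume "\<not> \<gamma> \<le> rk x"
        then obtain \<epsilon> where "rk x < \<epsilon>" "\<epsilon> < \<gamma>" using limit_between[OF 3] by (meson not_le)
        then show False using x by (auto simp: not_le[symmetric])
      qed
      ultimately show "x \<in> {x \<in> topspace X. \<gamma> \<le> rk x}" by simp
    qed auto
    finally show ?thesis .
  qed
qed

lemma totally_disconnectedI:
  assumes "\<And>x y. x \<in> topspace X \<Longrightarrow> y \<in> topspace X \<Longrightarrow> x \<noteq> y \<Longrightarrow> \<exists>U. openin X U \<and> closedin X U \<and> x \<in> U \<and> y \<notin> U"
  shows "totally_disconnected_space X"
  unfolding totally_disconnected_space_def
proof
  fix C assume C: "C \<in> connected_components_of X"
  then have conn: "connectedin X C" and ne: "C \<noteq> {}"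
    by (simp_all add: connectedin_connected_components_of nonempty_connected_components_of)
  obtain x where x: "x \<in> C" using ne by blast
  have "y = x" if y: "y \<in> C" for y
  proof (rule ccontr)
    assume "y \<noteq> x"
    have "C \<subseteq> topspace X" using conn connectedin_subset_topspace by blast
    then obtain U where U: "openin X U" "closedin X U" "x \<in> U" "y \<notin> U" using assms[of x y] x y \<open>y \<noteq> x\<close> by blast
    then show False using connectedin_clopen_cases[OF conn U(2,1)] x y by (auto simp: disjnt_iff)
  qed
  then show "\<exists>x. C = {x}" using x by blast
qed

section \<open>Sets in Cantor space that depend on finitely many coordinates\<close>

abbreviation cantor :: "(nat \<Rightarrow> bool) topology" where
  "cantor \<equiv> product_topology (\<lambda>_. discrete_topology UNIV) UNIV"

lemma cantor_open:
  assumes "\<And>s t. Q s \<Longrightarrow> (\<And>i. i \<le> N \<Longrightarrow> t i = s i) \<Longrightarrow> Q t"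
  shows "openin cantor {s. Q s}"
proof (subst openin_subopen, intro ballI)
  fix s assume s: "s \<in> {s. Q s}"
  define V where "V = PiE UNIV (\<lambda>i. if i \<le> N then {s i} else (UNIV :: bool set))"
  have "openin cantor V" unfolding V_def
  proof (rule product_topology_basis)
    show "openin (discrete_topology UNIV) (if i \<le> N then {s i} else UNIV)" for i by simp
    show "finite {i. (if i \<le> N then {s i} else UNIV) \<noteq> topspace (discrete_topology UNIV)}"
      by (rule finite_subset[of _ "{..N}"]) auto
  qed
  moreover have "s \<in> V" by (auto simp: V_def)
  moreover have "V \<subseteq> {s. Q s}"
  proof
    fix t assume t: "t \<in> V"
    have "t i = s i" if "i \<le> N" for i using PiE_mem[OF t[unfolded V_def], of i] that by simp
    then show "t \<in> {s. Q s}" using assms s by simp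
  qed
  ultimately show "\<exists>V. openin cantor V \<and> s \<in> V \<and> V \<subseteq> {s. Q s}" by blast
qed

lemma cantor_openD:
  assumes "openin cantor W" "s \<in> W"
  shows "\<exists>N. \<forall>t. (\<forall>i\<le>N. t i = s i) \<longrightarrow> t \<in> W"
proof -
  obtain U where U: "finite {i. U i \<noteq> topspace (discrete_topology (UNIV :: bool set))}" "s \<in> PiE UNIV U" "PiE UNIV U \<subseteq> W"
    using assms unfolding openin_product_topology_alt by auto
  obtain N where N: "\<And>i. U i \<noteq> UNIV \<Longrightarrow> i \<le> N" using U(1) finite_nat_set_iff_bounded_le by auto
  have "t \<in> W" if t: "\<forall>i\<le>N. t i = s i" for t
  proof -
    have "t i \<in> U i" for i using t N[of i] U(2) by (cases "i \<le> N") (auto simp: PiE_iff)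
    then show ?thesis using U(3) by auto
  qed
  then show ?thesis by blast
qed

text \<open>The Schreier family on the positive integers. The coordinate 0 is an independent flag, which
  doubles the number of points of maximal rank; finite sets of natural numbers are encoded as natural
  numbers.\<close>

definition supp :: "(nat \<Rightarrow> bool) \<Rightarrow> nat set" where
  "supp s = {i. 1 \<le> i \<and> s i}"

definition schreier :: "(nat \<Rightarrow> bool) set" where
  "schreier = {s. supp s = {} \<or> finite (supp s) \<and> card (supp s) \<le> Min (supp s)}"

definition dec :: "nat \<Rightarrow> nat \<Rightarrow> bool" where
  "dec m i \<longleftrightarrow> i \<in> set_decode m"

text \<open>The pullback along \<open>dec\<close> puts the space on the natural numbers, the type
  over which the classes are counted. The condition \<open>C\<close> is used to cut out pieces of
  smaller type.\<close>

definition schreier_space :: "(nat \<Rightarrow> bool) set \<Rightarrow> nat topology" where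
  "schreier_space C = pullback_topology {m. dec m \<in> schreier \<inter> C} dec cantor"

text \<open>Failure of the Schreier condition is witnessed by finitely many coordinates: a finite
  part \<open>B\<close> that contains the minimum \<open>m\<close> and has more than
  \<open>m\<close> elements. A finite set containing \<open>B\<close> has minimum at most
  \<open>m\<close> and still too many elements.\<close>

lemma schreier_closed: "closedin cantor schreier"
proof -
  have "openin cantor (UNIV - schreier)"
  proof (subst openin_subopen, intro ballI)
    fix s assume s: "s \<in> UNIV - schreier"
    then have ne: "supp s \<noteq> {}" by (auto simp: schreier_def)
    define m where "m = (LEAST i. i \<in> supp s)"
    have m: "m \<in> supp s" unfolding m_def using ne by (meson LeastI ex_in_conv)
    have least: "m \<le> i" if "i \<in> supp s" for i unfolding m_def using that by (rule Least_le)
    have "\<exists>A\<subseteq>supp s. finite A \<and> m < card A"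
    proof (cases "finite (supp s)")
      case True
      then have "Min (supp s) = m" using m least by (intro Min_eqI) auto
      then show ?thesis using s True by (intro exI[of _ "supp s"]) (auto simp: schreier_def)
    next
      case False
      then show ?thesis using infinite_arbitrarily_large[OF False, of "Suc m"] by (metis lessI)
    qed
    then obtain A where A: "A \<subseteq> supp s" "finite A" "m < card A" by blast
    define B where "B = insert m A"
    have B: "B \<subseteq> supp s" "finite B" "m \<in> B" "m < card B"
      using A m card_mono[of "insert m A" A] by (auto simp: B_def intro: less_le_trans)
    define Q where "Q t \<longleftrightarrow> (\<forall>i\<in>B. t i)" for t :: "nat \<Rightarrow> bool"
    have "openin cantor {t. Q t}"
      by (rule cantor_open[of _ "Max B"]) (use B in \<open>auto simp: Q_def\<close>)
    moreover have "s \<in> {t. Q t}" using B(1) by (auto simp: Q_def supp_def)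
    moreover have "{t. Q t} \<subseteq> UNIV - schreier"
    proof
      fix t assume "t \<in> {t. Q t}"
      then have Bt: "B \<subseteq> supp t" using B(1) by (auto simp: Q_def supp_def)
      have "t \<notin> schreier"
      proof
        assume "t \<in> schreier"
        then have fin: "finite (supp t)" and le: "card (supp t) \<le> Min (supp t)" using Bt B(3) by (auto simp: schreier_def)
        have "Min (supp t) \<le> m" using fin Bt B(3) by (intro Min_le) auto
        moreover have "card B \<le> card (supp t)" using fin Bt by (rule card_mono)
        ultimately show False using le B(4) by simp
      qed
      then show "t \<in> UNIV - schreier" by simp
    qed
    ultimately show "\<exists>V. openin cantor V \<and> s \<in> V \<and> V \<subseteq> UNIV - schreier" by blast
  qed
  then show ?thesis by (simp add: closedin_def)
qed

lemma dec_set_encode: "finite {i. s i} \<Longrightarrow> dec (set_encode {i. s i}) = s"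
  by (auto simp: dec_def fun_eq_iff)

lemma inj_dec: "inj dec"
proof (rule injI)
  fix m k assume "dec m = dec k"
  then have "set_decode m = set_decode k" by (auto simp: dec_def fun_eq_iff)
  then show "m = k" by (metis set_decode_inverse)
qed

lemma schreier_finite: "s \<in> schreier \<Longrightarrow> finite {i. s i}"
proof -
  assume "s \<in> schreier"
  then have "finite (supp s)" by (auto simp: schreier_def)
  moreover have "{i. s i} \<subseteq> insert 0 (supp s)" by (auto simp: supp_def Suc_le_eq)
  ultimately show ?thesis using finite_subset by blast
qed

lemma openin_schreier_space:
  "openin (schreier_space C) U \<longleftrightarrow> (\<exists>W. openin cantor W \<and> U = {m. dec m \<in> schreier \<inter> C \<inter> W})"
proof -
  have "dec -` W \<inter> {m. dec m \<in> schreier \<inter> C} = {m. dec m \<in> schreier \<inter> C \<inter> W}" for W by auto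
  then show ?thesis unfolding schreier_space_def openin_pullback_topology by simp
qed

lemma topspace_schreier_space: "topspace (schreier_space C) = {m. dec m \<in> schreier \<inter> C}"
  unfolding schreier_space_def topspace_pullback_topology by auto

text \<open>\<open>dec\<close> is a homeomorphism onto a closed subset of Cantor space; it is onto
  because Schreier sets are finite.\<close>

lemma stone_schreier_space:
  assumes C: "closedin cantor C"
  shows "stone_space (schreier_space C)"
proof -
  let ?X = "schreier_space C" and ?Y = "subtopology cantor (schreier \<inter> C)"
  have im: "dec ` topspace ?X = topspace ?Y"
  proof
    show "topspace ?Y \<subseteq> dec ` topspace ?X"
    proof
      fix s assume "s \<in> topspace ?Y"
      then have "s \<in> schreier \<inter> C" by simp
      then show "s \<in> dec ` topspace ?X" unfolding topspace_schreier_space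
        using dec_set_encode[OF schreier_finite, of s] by (intro image_eqI[of _ _ "set_encode {i. s i}"]) auto
    qed
  qed (auto simp: topspace_schreier_space)
  have "homeomorphic_map ?X ?Y dec"
  proof (rule bijective_open_imp_homeomorphic_map)
    show "continuous_map ?X ?Y dec"
      unfolding continuous_map_def
    proof (intro conjI allI impI)
      show "dec \<in> topspace ?X \<rightarrow> topspace ?Y" using im by auto
      fix U assume "openin ?Y U"
      then obtain W where "openin cantor W" "U = W \<inter> (schreier \<inter> C)" unfolding openin_subtopology by blast
      then show "openin ?X {x \<in> topspace ?X. dec x \<in> U}"
        unfolding openin_schreier_space topspace_schreier_space by (intro exI[of _ W]) auto
    qed
    show "open_map ?X ?Y dec" unfolding open_map_def
    proof (intro allI impI)
      fix U assume "openin ?X U"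
      then obtain W where W: "openin cantor W" "U = {m. dec m \<in> schreier \<inter> C \<inter> W}" unfolding openin_schreier_space by blast
      have "dec ` U = W \<inter> (schreier \<inter> C)"
        using im W(2) unfolding topspace_schreier_space by auto
      then show "openin ?Y (dec ` U)" unfolding openin_subtopology using W(1) by blast
    qed
    show "dec ` topspace ?X = topspace ?Y" by (rule im)
    show "inj_on dec (topspace ?X)" using inj_dec inj_on_subset by blast
  qed
  then have hom: "?X homeomorphic_space ?Y" by (rule homeomorphic_map_imp_homeomorphic_space)
  have "compact_space cantor" by (simp add: compact_space_product_topology compact_space_discrete_topology)
  then have "compactin cantor (schreier \<inter> C)"
    using closedin_compact_space closedin_Int[OF schreier_closed C] by blast
  then have "compact_space ?Y" by (rule compact_space_subtopology)
  moreover have "Hausdorff_space ?Y"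
    by (simp add: Hausdorff_space_subtopology Hausdorff_space_product_topology)
  moreover have "totally_disconnected_space ?X"
  proof (rule totally_disconnectedI)
    fix x y assume "x \<in> topspace ?X" "y \<in> topspace ?X" "x \<noteq> y"
    then have x: "dec x \<in> schreier \<inter> C" and "dec x \<noteq> dec y"
      using injD[OF inj_dec, of x y] unfolding topspace_schreier_space by auto
    then obtain i where i: "dec x i \<noteq> dec y i" by (auto simp: fun_eq_iff)
    let ?U = "\<lambda>b. {m. dec m \<in> schreier \<inter> C \<inter> {s. s i = b}}"
    have op: "openin ?X (?U b)" for b unfolding openin_schreier_space
      by (intro exI[of _ "{s. s i = b}"] conjI cantor_open[of _ i] refl) auto
    have "topspace ?X - ?U (dec x i) = ?U (\<not> dec x i)" unfolding topspace_schreier_space by auto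
    then have "closedin ?X (?U (dec x i))" using op[of "\<not> dec x i"] by (auto simp: closedin_def topspace_schreier_space)
    then show "\<exists>U. openin ?X U \<and> closedin ?X U \<and> x \<in> U \<and> y \<notin> U"
      using op[of "dec x i"] i x by (intro exI[of _ "?U (dec x i)"]) auto
  qed
  ultimately show ?thesis
    unfolding stone_space_def
    using homeomorphic_compact_space[OF hom] homeomorphic_Hausdorff_space[OF hom] by simp
qed

lemma schreier_extend:
  assumes "supp s \<noteq> {}" "finite (supp s)" "A \<inter> supp s = {}" "finite A" "\<And>i. i \<in> A \<Longrightarrow> Min (supp s) < i"
    and t: "supp t = supp s \<union> A" and card: "card (supp s) + card A \<le> Min (supp s)"
  shows "t \<in> schreier" "Min (supp t) = Min (supp s)" "card (supp t) = card (supp s) + card A"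
proof -
  show c: "card (supp t) = card (supp s) + card A" unfolding t using assms by (subst card_Un_disjoint) auto
  show m: "Min (supp t) = Min (supp s)"
  proof (rule Min_eqI)
    show "Min (supp s) \<in> supp t" unfolding t using assms Min_in by blast
    show "Min (supp s) \<le> y" if "y \<in> supp t" for y using that assms(5)[of y] Min_le[OF assms(2), of y] unfolding t by auto
    show "finite (supp t)" unfolding t using assms by auto
  qed
  show "t \<in> schreier" unfolding schreier_def using c m card assms t by auto
qed

context
  fixes \<nu> :: "nat \<Rightarrow> countable_ordinal" and \<omega> :: countable_ordinal
  assumes nu_mono: "strict_mono \<nu>" and nu_less: "\<And>k. \<nu> k < \<omega>" and below_\<omega>: "\<And>\<gamma>. \<gamma> < \<omega> \<Longrightarrow> \<exists>k. \<gamma> = \<nu> k"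
begin

text \<open>For a nonempty Schreier set this counts how many larger elements can still be added, as
  these leave the minimum unchanged. The empty set, whose future minimum is arbitrarily large, gets
  rank \<omega>.\<close>

definition srank :: "(nat \<Rightarrow> bool) \<Rightarrow> countable_ordinal" where
  "srank s = (if supp s = {} then \<omega> else \<nu> (Min (supp s) - card (supp s)))"

text \<open>A set that agrees with a nonempty \<open>supp s\<close> up to its maximum contains it;
  if it is strictly larger, its minimum has not grown while its cardinality has, so the rank
  drops.\<close>

lemma srank_isolated:
  assumes s: "s \<in> schreier"
  shows "\<exists>N. \<forall>t\<in>schreier. (\<forall>i\<le>N. t i = s i) \<and> t \<noteq> s \<longrightarrow> srank t < srank s"
proof (cases "supp s = {}")
  case True
  \<comment> \<open>Agreement at 0 fixes the flag, so a different \<open>t\<close> has nonempty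
    support.\<close>
  have "srank t < srank s" if t: "\<forall>i\<le>0. t i = s i" "t \<noteq> s" for t
  proof -
    have "supp t \<noteq> {}"
    proof
      assume "supp t = {}"
      have "t i = s i" for i
      proof (cases "i = 0")
        case False
        then have "t i \<longleftrightarrow> i \<in> supp t" "s i \<longleftrightarrow> i \<in> supp s" by (auto simp: supp_def)
        then show ?thesis using True \<open>supp t = {}\<close> by simp
      qed (use t(1) in simp)
      then show False using t(2) by auto
    qed
    then show ?thesis using True nu_less by (simp add: srank_def)
  qed
  then show ?thesis by blast
next
  case False
  then have fin: "finite (supp s)" and le: "card (supp s) \<le> Min (supp s)" using s by (auto simp: schreier_def)
  define N where "N = Max (supp s)"
  have N: "i \<le> N" if "i \<in> supp s" for i using fin that by (simp add: N_def)
  have "srank t < srank s" if t: "t \<in> schreier" "\<forall>i\<le>N. t i = s i" "t \<noteq> s" for t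
  proof -
    have sub: "supp s \<subseteq> supp t" using t(2) N by (auto simp: supp_def)
    have "supp s \<noteq> supp t"
    proof
      assume eq: "supp s = supp t"
      have "t i = s i" for i
      proof (cases "i = 0")
        case False
        then have "t i \<longleftrightarrow> i \<in> supp t" "s i \<longleftrightarrow> i \<in> supp s" by (auto simp: supp_def)
        then show ?thesis using eq by simp
      qed (use t(2) in simp)
      then show False using t(3) by auto
    qed
    then have psub: "supp s \<subset> supp t" using sub by blast
    then have ft: "finite (supp t)" "card (supp t) \<le> Min (supp t)" using t(1) by (auto simp: schreier_def)
    have "card (supp s) < card (supp t)" using psubset_card_mono[OF ft(1) psub] .
    moreover have "Min (supp t) \<le> Min (supp s)" using Min_antimono[OF sub False ft(1)] .
    ultimately have "Min (supp t) - card (supp t) < Min (supp s) - card (supp s)" using ft(2) by linarith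
    then have "\<nu> (Min (supp t) - card (supp t)) < \<nu> (Min (supp s) - card (supp s))" by (rule strict_monoD[OF nu_mono])
    then show ?thesis using False sub by (auto simp: srank_def)
  qed
  then show ?thesis by blast
qed

text \<open>Elements beyond \<open>N\<close> can be added without leaving the neighbourhood; adding
  \<open>r - j\<close> of them lowers the rank from \<open>r\<close> to \<open>j\<close>.\<close>

lemma srank_dense:
  assumes s: "s \<in> schreier" and \<gamma>: "\<gamma> < srank s"
  shows "\<exists>t\<in>schreier. (\<forall>i\<le>N. t i = s i) \<and> srank t = \<gamma>"
proof (cases "supp s = {}")
  case True
  then obtain j where j: "\<gamma> = \<nu> j" using \<gamma> below_\<omega> by (auto simp: srank_def)
  \<comment> \<open>An interval of length \<open>N + 1\<close> that starts at
    \<open>N + 1 + j\<close> lies beyond \<open>N\<close> and has rank \<open>j\<close>.\<close>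
  define M where "M = N + 1 + j"
  define t where "t i = (if M \<le> i \<and> i < M + (N + 1) then True else s i)" for i
  have supp_t: "supp t = {M..<M + (N + 1)}" using True by (auto simp: supp_def t_def M_def)
  have "Min (supp t) = M" unfolding supp_t by (intro Min_eqI) auto
  then have "t \<in> schreier" "srank t = \<gamma>" using supp_t j by (auto simp: schreier_def srank_def M_def)
  moreover have "\<forall>i\<le>N. t i = s i" by (auto simp: t_def M_def)
  ultimately show ?thesis by blast
next
  case False
  then have fin: "finite (supp s)" and le: "card (supp s) \<le> Min (supp s)" using s by (auto simp: schreier_def)
  define r where "r = Min (supp s) - card (supp s)"
  have \<gamma>r: "\<gamma> < \<nu> r" using \<gamma> False by (simp add: srank_def r_def)
  then have "\<gamma> < \<omega>" using nu_less[of r] by (rule less_trans)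
  then obtain j where j: "\<gamma> = \<nu> j" using below_\<omega> by blast
  then have jr: "j < r" using \<gamma>r strict_mono_less[OF nu_mono] by simp
  define M where "M = Suc (max N (Max (supp s)))"
  define A where "A = {M..<M + (r - j)}"
  define t where "t i = (if i \<in> A then True else s i)" for i
  have M: "i < M" if "i \<in> supp s" for i using Max_ge[OF fin that] by (simp add: M_def)
  have "supp t = supp s \<union> A" by (auto simp: supp_def t_def A_def M_def)
  moreover have "A \<inter> supp s = {}" using M by (force simp: A_def)
  moreover have "Min (supp s) < i" if "i \<in> A" for i using M[OF Min_in[OF fin False]] that by (simp add: A_def)
  moreover have "card (supp s) + card A \<le> Min (supp s)" using le jr by (simp add: A_def r_def)
  ultimately have t: "t \<in> schreier" "Min (supp t) = Min (supp s)" "card (supp t) = card (supp s) + card A"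
    using schreier_extend[OF False fin _ _ _ \<open>supp t = supp s \<union> A\<close>] by (auto simp: A_def)
  have "supp t \<noteq> {}" using False \<open>supp t = supp s \<union> A\<close> by simp
  moreover have "Min (supp t) - card (supp t) = j" using t(2,3) le jr by (simp add: A_def r_def)
  ultimately have "srank t = \<gamma>" using j by (simp add: srank_def)
  moreover have "\<forall>i\<le>N. t i = s i" by (auto simp: t_def A_def M_def)
  ultimately show ?thesis using t(1) by blast
qed

lemma schreier_space_type:
  assumes C: "openin cantor C" "closedin cantor C"
    and card: "finite {m. dec m \<in> schreier \<inter> C \<and> \<alpha> \<le> srank (dec m)}"
      "card {m. dec m \<in> schreier \<inter> C \<and> \<alpha> \<le> srank (dec m)} = n"
  shows "countable_stone_space_of_type \<alpha> n (schreier_space C)"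
proof -
  have "CB_derivative (schreier_space C) \<alpha> = {x \<in> topspace (schreier_space C). \<alpha> \<le> srank (dec x)}"
  proof (rule CB_derivative_from_rank)
    fix x assume "x \<in> topspace (schreier_space C)"
    then have x: "dec x \<in> schreier" "dec x \<in> C" by (auto simp: topspace_schreier_space)
    obtain N where N: "\<And>t. t \<in> schreier \<Longrightarrow> (\<And>i. i \<le> N \<Longrightarrow> t i = dec x i) \<Longrightarrow> t \<noteq> dec x \<Longrightarrow> srank t < srank (dec x)"
      using srank_isolated[OF x(1)] by metis
    define W where "W = {t. \<forall>i\<le>N. t i = dec x i}"
    have "openin cantor W" unfolding W_def by (rule cantor_open[of _ N]) auto
    then have "openin (schreier_space C) {m. dec m \<in> schreier \<inter> C \<inter> W}" unfolding openin_schreier_space by blast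
    moreover have "x \<in> {m. dec m \<in> schreier \<inter> C \<inter> W}" using x by (simp add: W_def)
    moreover have "srank (dec y) < srank (dec x)" if y: "y \<in> {m. dec m \<in> schreier \<inter> C \<inter> W} - {x}" for y
    proof (rule N)
      show "dec y \<noteq> dec x" using y injD[OF inj_dec, of y x] by auto
    qed (use y in \<open>auto simp: W_def\<close>)
    ultimately show "\<exists>U. openin (schreier_space C) U \<and> x \<in> U \<and> (\<forall>y\<in>U - {x}. srank (dec y) < srank (dec x))" by blast
  next
    fix U x \<gamma> assume U: "openin (schreier_space C) U" "x \<in> U" "\<gamma> < srank (dec x)"
    then obtain W where W: "openin cantor W" "U = {m. dec m \<in> schreier \<inter> C \<inter> W}" unfolding openin_schreier_space by blast
    have x: "dec x \<in> schreier" "dec x \<in> W \<inter> C" using U(2) W(2) by auto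
    obtain N where N: "\<forall>t. (\<forall>i\<le>N. t i = dec x i) \<longrightarrow> t \<in> W \<inter> C"
      using cantor_openD[OF openin_Int[OF W(1) C(1)] x(2)] by (rule exE)
    obtain t where t: "t \<in> schreier" "\<forall>i\<le>N. t i = dec x i" "srank t = \<gamma>" using srank_dense[OF x(1) U(3)] by blast
    define y where "y = set_encode {i. t i}"
    have "dec y = t" unfolding y_def by (rule dec_set_encode[OF schreier_finite[OF t(1)]])
    then show "\<exists>y\<in>U. srank (dec y) = \<gamma>" using t N W(2) by (intro bexI[of _ y]) auto
  qed
  also have "\<dots> = {m. dec m \<in> schreier \<inter> C \<and> \<alpha> \<le> srank (dec m)}" by (auto simp: topspace_schreier_space)
  finally show ?thesis using card stone_schreier_space[OF C(2)] by (simp add: countable_stone_space_of_type_def)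
qed

lemma cantor_clopen:
  assumes "\<And>s t. Q s \<Longrightarrow> (\<And>i. i \<le> N \<Longrightarrow> t i = s i) \<Longrightarrow> Q t"
  shows "openin cantor {s. Q s}" "closedin cantor {s. Q s}"
proof -
  show "openin cantor {s. Q s}" by (rule cantor_open[OF assms])
  have "openin cantor {s. \<not> Q s}"
  proof (rule cantor_open[of _ N])
    fix s t assume "\<not> Q s" "\<And>i. i \<le> N \<Longrightarrow> t i = s i"
    then show "\<not> Q t" using assms[of t s] by fastforce
  qed
  moreover have "UNIV - {s. Q s} = {s. \<not> Q s}" by auto
  ultimately show "closedin cantor {s. Q s}" by (simp add: closedin_def)
qed

text \<open>The flag at 0 gives two copies of every set. Without a condition the top points are the
  empty set and {0}. Requiring 2 and excluding 1 forces the minimum 2, so the largest rank is 2 - 1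
  = 1, attained only at {2} up to the flag; clearing the flag leaves a single top point.\<close>

lemma types_exist:
  shows "countable_stone_space_of_type \<omega> 2 (schreier_space UNIV)"
    and "countable_stone_space_of_type (\<nu> 1) 2 (schreier_space {s. \<not> s 1 \<and> s 2})"
    and "countable_stone_space_of_type (\<nu> 1) 1 (schreier_space {s. \<not> s 0 \<and> \<not> s 1 \<and> s 2})"
proof -
  have supp_dec: "supp (dec m) = set_decode m - {0}" for m by (auto simp: supp_def dec_def Suc_le_eq)
  have inv: "set_decode m = A \<Longrightarrow> m = set_encode A" for m A using set_decode_inverse[of m] by simp
  have omega: "\<omega> \<le> srank s \<longleftrightarrow> supp s = {}" for s
    using nu_less by (auto simp: srank_def not_le[symmetric])
  have "{m. dec m \<in> schreier \<inter> UNIV \<and> \<omega> \<le> srank (dec m)} = {set_encode {}, set_encode {0}}"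
  proof (intro Set.set_eqI iffI)
    fix m assume "m \<in> {m. dec m \<in> schreier \<inter> UNIV \<and> \<omega> \<le> srank (dec m)}"
    then have "set_decode m \<subseteq> {0}" using supp_dec omega by auto
    then have "set_decode m = {} \<or> set_decode m = {0}" by blast
    then show "m \<in> {set_encode {}, set_encode {0}}" using inv by blast
  next
    fix m assume "m \<in> {set_encode {}, set_encode {0 :: nat}}"
    then obtain A :: "nat set" where A: "A \<subseteq> {0}" "m = set_encode A" by blast
    then have "set_decode m \<subseteq> {0}" using set_encode_inverse[of A] finite_subset[OF A(1)] by simp
    then have "supp (dec m) = {}" using supp_dec by auto
    then show "m \<in> {m. dec m \<in> schreier \<inter> UNIV \<and> \<omega> \<le> srank (dec m)}" using omega by (simp add: schreier_def)
  qed
  moreover have "card {set_encode {}, set_encode {0 :: nat}} = 2" by (simp add: set_encode_def)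
  ultimately show "countable_stone_space_of_type \<omega> 2 (schreier_space UNIV)"
    using closedin_topspace[of cantor] openin_topspace[of cantor] by (intro schreier_space_type) simp_all
  have sd: "set_decode (set_encode {2}) = {2}" "set_decode (set_encode {0, 2}) = {0, 2}"
    by (rule set_encode_inverse; simp)+
  have one: "dec m \<in> schreier \<and> \<not> dec m 1 \<and> dec m 2 \<and> \<nu> 1 \<le> srank (dec m) \<longleftrightarrow>
      m = set_encode {2} \<or> m = set_encode {0, 2}" for m
  proof
    assume m: "dec m \<in> schreier \<and> \<not> dec m 1 \<and> dec m 2 \<and> \<nu> 1 \<le> srank (dec m)"
    then have 2: "2 \<in> supp (dec m)" "1 \<notin> supp (dec m)" "0 \<notin> supp (dec m)" by (auto simp: supp_def)
    then have ne: "supp (dec m) \<noteq> {}" by blast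
    then have fin: "finite (supp (dec m))" using m by (auto simp: schreier_def)
    have "2 \<le> i" if "i \<in> supp (dec m)" for i
    proof -
      have "i \<noteq> 0" using 2(3) that by metis
      moreover have "i \<noteq> 1" using 2(2) that by metis
      ultimately show ?thesis by simp
    qed
    then have "Min (supp (dec m)) = 2" using 2(1) fin by (intro Min_eqI) auto
    then have "\<nu> 1 \<le> \<nu> (2 - card (supp (dec m)))" using m ne by (simp add: srank_def)
    then have "1 \<le> 2 - card (supp (dec m))" using strict_mono_less_eq[OF nu_mono] by blast
    then have "card (supp (dec m)) \<le> 1" by simp
    then have "supp (dec m) = {2}" using 2(1) fin by (metis card_le_Suc0_iff_eq One_nat_def is_singletonI' is_singleton_the_elem singletonD ne)
    then have "set_decode m - {0} = {2}" using supp_dec by simp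
    then have "set_decode m = {2} \<or> set_decode m = {0, 2}" by auto
    then show "m = set_encode {2} \<or> m = set_encode {0, 2}" using inv by blast
  next
    assume "m = set_encode {2} \<or> m = set_encode {0, 2}"
    then have "set_decode m = {2} \<or> set_decode m = {0, 2}" using sd by metis
    then have "supp (dec m) = {2}" "1 \<notin> set_decode m" "2 \<in> set_decode m" unfolding supp_dec by (elim disjE; simp)+
    then have s: "supp (dec m) = {2}" "\<not> dec m 1" "dec m 2" unfolding dec_def by blast+
    then show "dec m \<in> schreier \<and> \<not> dec m 1 \<and> dec m 2 \<and> \<nu> 1 \<le> srank (dec m)"
      by (simp add: schreier_def srank_def)
  qed
  have "{m. dec m \<in> schreier \<inter> {s. \<not> s 1 \<and> s 2} \<and> \<nu> 1 \<le> srank (dec m)} = {set_encode {2}, set_encode {0, 2}}"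
    using one by auto
  moreover have "card {set_encode {2}, set_encode {0, 2 :: nat}} = 2" by (simp add: set_encode_def)
  moreover have "openin cantor {s. \<not> s 1 \<and> s 2}" "closedin cantor {s. \<not> s 1 \<and> s 2}"
    by (rule cantor_clopen[of _ 2]; simp)+
  ultimately show "countable_stone_space_of_type (\<nu> 1) 2 (schreier_space {s. \<not> s 1 \<and> s 2})"
    by (intro schreier_space_type) simp_all
  have "\<not> dec (set_encode {2}) 0" "dec (set_encode {0, 2}) 0" unfolding dec_def sd by simp_all
  then have "{m. dec m \<in> schreier \<inter> {s. \<not> s 0 \<and> \<not> s 1 \<and> s 2} \<and> \<nu> 1 \<le> srank (dec m)} = {set_encode {2}}"
    using one by auto
  moreover have "openin cantor {s. \<not> s 0 \<and> \<not> s 1 \<and> s 2}" "closedin cantor {s. \<not> s 0 \<and> \<not> s 1 \<and> s 2}"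
    by (rule cantor_clopen[of _ 2]; simp)+
  ultimately show "countable_stone_space_of_type (\<nu> 1) 1 (schreier_space {s. \<not> s 0 \<and> \<not> s 1 \<and> s 2})"
    by (intro schreier_space_type) simp_all
qed

end

section \<open>The classification\<close>

abbreviation hamming_space :: "(nat \<Rightarrow> bool) coarse_space" where
  "hamming_space \<equiv> metric_coarse_space hamming_vertices (graph_dist hamming_edges)"

lemma coarse_structure_hamming: "coarse_structure hamming_space"
proof (rule coarse_structure_metric)
  show "graph_dist hamming_edges x x \<le> 0" if "x \<in> hamming_vertices" for x
    using that by (simp add: hamming_dist hdist_def)
  show "graph_dist hamming_edges x y = graph_dist hamming_edges y x"
    if "x \<in> hamming_vertices" "y \<in> hamming_vertices" for x y
    using that by (simp add: hamming_dist hdist_sym)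
  show "graph_dist hamming_edges x z \<le> graph_dist hamming_edges x y + graph_dist hamming_edges y z"
    if "x \<in> hamming_vertices" "y \<in> hamming_vertices" "z \<in> hamming_vertices" for x y z
    using that hdist_triangle[OF finite_diff_hamming finite_diff_hamming, of x y z]
    by (simp add: hamming_dist)
qed

lemma hamming_nontrivial: "\<not> coarsely_trivial hamming_space"
proof
  assume "coarsely_trivial hamming_space"
  then obtain B where B: "\<And>x y. x \<in> hamming_vertices \<Longrightarrow> y \<in> hamming_vertices \<Longrightarrow> graph_dist hamming_edges x y \<le> B"
    unfolding coarsely_trivial_def entourages_metric by auto
  obtain k :: nat where k: "B < real k" using reals_Archimedean2 by blast
  define s where "s = (\<lambda>i. i < k)"
  have v: "(\<lambda>_. False) \<in> hamming_vertices" "s \<in> hamming_vertices" by (auto simp: hamming_vertices_def s_def)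
  have "{i. False \<noteq> s i} = {..<k}" by (auto simp: s_def)
  then have "hdist (\<lambda>_. False) s = k" by (simp add: hdist_def)
  then show False using B[OF v] k hamming_dist[OF v] by simp
qed

text \<open>The edges of the cube form an entourage that connects all vertices, whereas bounded
  steps in the sequence space never leave a class of bounded diameter.\<close>

lemma hamming_not_equivalent_sequence_space: "\<not> coarsely_equivalent hamming_space sequence_space"
proof (rule coarsely_connected_not_equivalent[OF coarse_structure_hamming])
  have "graph_dist hamming_edges s t \<le> 1" if "(s, t) \<in> hamming_edges" for s t
    using that by (simp add: hamming_edge_iff hamming_dist)
  then show "hamming_edges \<in> entourages hamming_space"
    unfolding entourages_metric by (auto simp: hamming_edge_iff)
  show "points hamming_space \<times> points hamming_space \<subseteq> hamming_edges\<^sup>*"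
  proof clarsimp
    fix s t assume "s \<in> hamming_vertices" "t \<in> hamming_vertices"
    then have "(s, t) \<in> hamming_edges ^^ hdist s t" by (rule hamming_path_exists[OF _ _ refl])
    then show "(s, t) \<in> hamming_edges\<^sup>*" by (rule relpow_imp_rtrancl)
  qed
  have "(\<lambda>_. False) \<in> hamming_vertices" by (simp add: hamming_vertices_def)
  then show "points hamming_space \<noteq> {}" by auto
qed (use hamming_nontrivial sequence_space_rtrancl in auto)

lemma coarse_structure_Homeo: "coarse_structure (Homeo_coarse_space X)"
  unfolding Homeo_coarse_space_def by (rule coarse_structure_group)

lemma bounded_of_type_1:
  assumes "countable_stone_space_of_type \<alpha> 1 X"
  shows "coarsely_bounded_group (Homeo X) (compact_open_topology X)"
    and "group_quasi_isometric (Homeo X) (compact_open_topology X) {()} (\<lambda>_ _. 0)"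
    and "coarsely_trivial (Homeo_coarse_space X)"
proof -
  interpret stone_of_type X \<alpha> 1 by unfold_locales (rule assms, simp)
  show b: "coarsely_bounded_group (Homeo X) (compact_open_topology X)" by (rule coarsely_bounded_of_type_1) simp
  show "group_quasi_isometric (Homeo X) (compact_open_topology X) {()} (\<lambda>_ _. 0)"
    by (rule bounded_group_quasi_isometric_point[OF b carrier_nonempty])
  show "coarsely_trivial (Homeo_coarse_space X)"
    unfolding Homeo_coarse_space_def by (rule bounded_group_coarsely_trivial[OF b carrier_nonempty])
qed

lemma hamming_of_successor_type:
  assumes "countable_stone_space_of_type \<alpha> n X" "n > 1" "successor_ordinal \<alpha>"
  shows "group_quasi_isometric (Homeo X) (compact_open_topology X) hamming_vertices (graph_dist hamming_edges)"
    and "coarsely_equivalent (Homeo_coarse_space X) hamming_space"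
proof -
  interpret stone_of_type X \<alpha> n by unfold_locales (use assms in simp_all)
  show q: "group_quasi_isometric (Homeo X) (compact_open_topology X) hamming_vertices (graph_dist hamming_edges)"
    by (rule successor_group_quasi_isometric[OF assms(3,2)])
  show "coarsely_equivalent (Homeo_coarse_space X) hamming_space"
    unfolding Homeo_coarse_space_def by (rule group_quasi_isometric_imp_coarsely_equivalent[OF q])
qed

lemma sequences_of_limit_type:
  assumes "countable_stone_space_of_type \<alpha> n X" "n > 1" "limit_ordinal \<alpha>"
  shows "coarsely_equivalent (Homeo_coarse_space X) sequence_space"
proof -
  interpret stone_of_type X \<alpha> n by unfold_locales (use assms in simp_all)
  show ?thesis by (rule limit_coarsely_equivalent[OF assms(3,2)])
qed

lemma leaves_of_limit_type:
  assumes "countable_stone_space_of_type \<alpha> n X" "n > 1" "limit_ordinal \<alpha>" "regular_one_ended_tree V E height"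
  shows "coarsely_equivalent (Homeo_coarse_space X) (metric_coarse_space (leaves V E) (graph_dist E))"
proof -
  interpret one_ended_tree V E height by unfold_locales (rule assms(4))
  have L: "coarse_structure (metric_coarse_space (leaves V E) (graph_dist E))"
    by (rule coarse_structure_leaves)
  show ?thesis
    by (rule coarsely_equivalent_trans[OF coarse_structure_Homeo coarse_structure_sequence_space L sequences_of_limit_type[OF assms(1-3)]
          coarsely_equivalent_sym[OF L coarse_structure_sequence_space leaves_equivalent]])
qed

lemma successor_or_limit: "\<alpha> > 0 \<Longrightarrow> successor_ordinal \<alpha> \<or> limit_ordinal \<alpha>"
  by (auto simp: limit_ordinal_def)

text \<open>Each group is coarsely trivial or equivalent to one of two model spaces. Triviality is a
  coarse invariant, neither model is trivial, and the mixed cases reduce to the inequivalence of the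
  models.\<close>

lemma coarsely_equivalent_Homeo_iff:
  assumes X: "\<alpha> > 0" "n \<ge> 1" "countable_stone_space_of_type \<alpha> n X"
    and Y: "\<beta> > 0" "m \<ge> 1" "countable_stone_space_of_type \<beta> m Y"
  shows "coarsely_equivalent (Homeo_coarse_space X) (Homeo_coarse_space Y) \<longleftrightarrow>
           n = 1 \<and> m = 1 \<or>
           n > 1 \<and> m > 1 \<and> successor_ordinal \<alpha> \<and> successor_ordinal \<beta> \<or>
           n > 1 \<and> m > 1 \<and> limit_ordinal \<alpha> \<and> limit_ordinal \<beta>"
proof -
  let ?X = "Homeo_coarse_space X" and ?Y = "Homeo_coarse_space Y"
  note CX = coarse_structure_Homeo[of X] and CY = coarse_structure_Homeo[of Y]
  note CH = coarse_structure_hamming and CS = coarse_structure_sequence_space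
  have kX: "n = 1 \<and> coarsely_trivial ?X \<or>
      n > 1 \<and> successor_ordinal \<alpha> \<and> \<not> limit_ordinal \<alpha> \<and> coarsely_equivalent ?X hamming_space \<or>
      n > 1 \<and> limit_ordinal \<alpha> \<and> \<not> successor_ordinal \<alpha> \<and> coarsely_equivalent ?X sequence_space"
    using X successor_or_limit[OF X(1)] bounded_of_type_1(3) hamming_of_successor_type(2) sequences_of_limit_type unfolding limit_ordinal_def
    by (metis le_neq_implies_less)
  have kY: "m = 1 \<and> coarsely_trivial ?Y \<or>
      m > 1 \<and> successor_ordinal \<beta> \<and> \<not> limit_ordinal \<beta> \<and> coarsely_equivalent ?Y hamming_space \<or>
      m > 1 \<and> limit_ordinal \<beta> \<and> \<not> successor_ordinal \<beta> \<and> coarsely_equivalent ?Y sequence_space"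
    using Y successor_or_limit[OF Y(1)] bounded_of_type_1(3) hamming_of_successor_type(2) sequences_of_limit_type unfolding limit_ordinal_def
    by (metis le_neq_implies_less)
  have HX: "\<not> coarsely_trivial ?X" if "coarsely_equivalent ?X hamming_space"
    using coarsely_trivial_pullback[OF CH coarsely_equivalent_sym[OF CX CH that]] hamming_nontrivial by blast
  have HY: "\<not> coarsely_trivial ?Y" if "coarsely_equivalent ?Y hamming_space"
    using coarsely_trivial_pullback[OF CH coarsely_equivalent_sym[OF CY CH that]] hamming_nontrivial by blast
  have SX: "\<not> coarsely_trivial ?X" if "coarsely_equivalent ?X sequence_space"
    using coarsely_trivial_pullback[OF CS coarsely_equivalent_sym[OF CX CS that]] sequence_space_nontrivial by blast
  have SY: "\<not> coarsely_trivial ?Y" if "coarsely_equivalent ?Y sequence_space"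
    using coarsely_trivial_pullback[OF CS coarsely_equivalent_sym[OF CY CS that]] sequence_space_nontrivial by blast
  show ?thesis
  proof
    assume eq: "coarsely_equivalent ?X ?Y"
    have eq': "coarsely_equivalent ?Y ?X" by (rule coarsely_equivalent_sym[OF CX CY eq])
    have trivial: "coarsely_trivial ?X \<longleftrightarrow> coarsely_trivial ?Y"
      using coarsely_trivial_pullback[OF CX eq] coarsely_trivial_pullback[OF CY eq'] by blast
    have mixed1: False if "coarsely_equivalent ?X hamming_space" "coarsely_equivalent ?Y sequence_space"
    proof -
      have "coarsely_equivalent hamming_space ?Y"
        by (rule coarsely_equivalent_trans[OF CH CX CY coarsely_equivalent_sym[OF CX CH that(1)] eq])
      then have "coarsely_equivalent hamming_space sequence_space"
        by (rule coarsely_equivalent_trans[OF CH CY CS _ that(2)])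
      then show False using hamming_not_equivalent_sequence_space by simp
    qed
    have mixed2: False if "coarsely_equivalent ?Y hamming_space" "coarsely_equivalent ?X sequence_space"
    proof -
      have "coarsely_equivalent hamming_space ?X"
        by (rule coarsely_equivalent_trans[OF CH CY CX coarsely_equivalent_sym[OF CY CH that(1)] eq'])
      then have "coarsely_equivalent hamming_space sequence_space"
        by (rule coarsely_equivalent_trans[OF CH CX CS _ that(2)])
      then show False using hamming_not_equivalent_sequence_space by simp
    qed
    show "n = 1 \<and> m = 1 \<or>
           n > 1 \<and> m > 1 \<and> successor_ordinal \<alpha> \<and> successor_ordinal \<beta> \<or>
           n > 1 \<and> m > 1 \<and> limit_ordinal \<alpha> \<and> limit_ordinal \<beta>"
      using kX kY HX HY SX SY trivial mixed1 mixed2 by argo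
  next
    assume "n = 1 \<and> m = 1 \<or>
           n > 1 \<and> m > 1 \<and> successor_ordinal \<alpha> \<and> successor_ordinal \<beta> \<or>
           n > 1 \<and> m > 1 \<and> limit_ordinal \<alpha> \<and> limit_ordinal \<beta>"
    then consider "coarsely_trivial ?X" "coarsely_trivial ?Y"
      | "coarsely_equivalent ?X hamming_space" "coarsely_equivalent ?Y hamming_space"
      | "coarsely_equivalent ?X sequence_space" "coarsely_equivalent ?Y sequence_space"
      using kX kY by (metis less_irrefl)
    then show "coarsely_equivalent ?X ?Y"
    proof cases
      case 1
      then show ?thesis by (rule coarsely_trivial_equivalent[OF CX CY])
    next
      case 2
      show ?thesis by (rule coarsely_equivalent_trans[OF CX CH CY 2(1) coarsely_equivalent_sym[OF CY CH 2(2)]])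
    next
      case 3
      show ?thesis by (rule coarsely_equivalent_trans[OF CX CS CY 3(1) coarsely_equivalent_sym[OF CY CS 3(2)]])
    qed
  qed
qed

text \<open>The criterion allows at most three classes, and the Schreier examples show that all
  three occur. Topologies on the natural numbers represent all spaces in question, since these are
  countable.\<close>

lemma three_classes:
  assumes \<X>: "\<X> = {X :: nat topology. \<exists>\<alpha> n. \<alpha> > 0 \<and> n \<ge> 1 \<and> countable_stone_space_of_type \<alpha> n X}"
  shows "card (\<X> // {(X, Y) \<in> \<X> \<times> \<X>. coarsely_equivalent (Homeo_coarse_space X) (Homeo_coarse_space Y)}) = 3"
proof -
  define R where "R = {(X, Y) \<in> \<X> \<times> \<X>. coarsely_equivalent (Homeo_coarse_space X) (Homeo_coarse_space Y)}"
  have R: "equiv \<X> R"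
  proof (rule equivI)
    show "R \<subseteq> \<X> \<times> \<X>" by (auto simp: R_def)
    show "refl_on \<X> R" using coarsely_equivalent_refl[OF coarse_structure_Homeo] by (auto simp: refl_on_def R_def)
    show "sym R" using coarsely_equivalent_sym[OF coarse_structure_Homeo coarse_structure_Homeo]
      by (auto simp: sym_def R_def)
    show "trans R"
      using coarsely_equivalent_trans[OF coarse_structure_Homeo coarse_structure_Homeo coarse_structure_Homeo]
      unfolding trans_def R_def by blast
  qed
  obtain \<nu> :: "nat \<Rightarrow> countable_ordinal" and \<omega> where \<nu>: "strict_mono \<nu>" "\<nu> 0 = 0" "successor_ordinal (\<nu> 1)"
    "limit_ordinal \<omega>" "\<And>k. \<nu> k < \<omega>" "\<And>\<gamma>. \<gamma> < \<omega> \<Longrightarrow> \<exists>k. \<gamma> = \<nu> k"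
    using finite_ordinals_and_omega by metis
  have pos: "\<nu> 1 > 0" "\<omega> > 0" using strict_monoD[OF \<nu>(1), of 0 1] \<nu>(2) \<nu>(5)[of 0] by auto
  obtain X1 X2 X3 :: "nat topology" where type: "countable_stone_space_of_type \<omega> 2 X3"
    "countable_stone_space_of_type (\<nu> 1) 2 X2" "countable_stone_space_of_type (\<nu> 1) 1 X1"
    using types_exist[OF \<nu>(1,5,6)] by blast
  have mem: "X1 \<in> \<X>" "X2 \<in> \<X>" "X3 \<in> \<X>"
  proof -
    show "X1 \<in> \<X>" unfolding \<X> using type(3) pos by blast
    show "X2 \<in> \<X>" unfolding \<X> using type(2) pos by (intro CollectI exI[of _ "\<nu> 1"] exI[of _ 2]) simp
    show "X3 \<in> \<X>" unfolding \<X> using type(1) pos by (intro CollectI exI[of _ \<omega>] exI[of _ 2]) simp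
  qed
  have ex: "\<not> (successor_ordinal \<alpha> \<and> limit_ordinal \<alpha>)" for \<alpha> by (simp add: limit_ordinal_def)
  have "R `` {X1} \<noteq> R `` {X2}"
    using eq_equiv_class[OF _ R mem(2)] coarsely_equivalent_Homeo_iff[OF pos(1) _ type(3) pos(1) _ type(2)]
    by (auto simp: R_def)
  moreover have "R `` {X1} \<noteq> R `` {X3}"
    using eq_equiv_class[OF _ R mem(3)] coarsely_equivalent_Homeo_iff[OF pos(1) _ type(3) pos(2) _ type(1)]
    by (auto simp: R_def)
  moreover have "R `` {X2} \<noteq> R `` {X3}"
    using eq_equiv_class[OF _ R mem(3)] coarsely_equivalent_Homeo_iff[OF pos(1) _ type(2) pos(2) _ type(1)] ex \<nu>(3,4)
    by (auto simp: R_def)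
  moreover have "\<X> // R = {R `` {X1}, R `` {X2}, R `` {X3}}"
  proof
    show "\<X> // R \<subseteq> {R `` {X1}, R `` {X2}, R `` {X3}}"
    proof
      fix C assume "C \<in> \<X> // R"
      then obtain X where X: "X \<in> \<X>" "C = R `` {X}" by (auto simp: quotient_def)
      obtain \<alpha> n where a: "\<alpha> > 0" "n \<ge> 1" "countable_stone_space_of_type \<alpha> n X" using X(1) unfolding \<X> by blast
      have n: "n = 1 \<or> n > 1" using a(2) by auto
      have "(X, X1) \<in> R \<or> (X, X2) \<in> R \<or> (X, X3) \<in> R"
        using coarsely_equivalent_Homeo_iff[OF a pos(1) _ type(3)] coarsely_equivalent_Homeo_iff[OF a pos(1) _ type(2)]
          coarsely_equivalent_Homeo_iff[OF a pos(2) _ type(1)] n successor_or_limit[OF a(1)] \<nu>(3,4) X(1) mem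
        by (auto simp: R_def)
      then show "C \<in> {R `` {X1}, R `` {X2}, R `` {X3}}" using equiv_class_eq[OF R] X(2) by blast
    qed
    show "{R `` {X1}, R `` {X2}, R `` {X3}} \<subseteq> \<X> // R" using mem by (auto intro: quotientI)
  qed
  ultimately show ?thesis unfolding R_def[symmetric] by simp
qed

theorem theoremA:
  shows
    "(let \<X> = {X :: nat topology. \<exists>\<alpha> n. \<alpha> > 0 \<and> n \<ge> 1 \<and> countable_stone_space_of_type \<alpha> n X}
      in card (\<X> // {(X, Y) \<in> \<X> \<times> \<X>.
           coarsely_equivalent (Homeo_coarse_space X) (Homeo_coarse_space Y)}) = 3) \<and>
     (\<forall>(X :: 'a topology) (Y :: 'b topology) \<alpha> n \<beta> m.
        \<alpha> > 0 \<and> n \<ge> 1 \<and> countable_stone_space_of_type \<alpha> n X \<and>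
        \<beta> > 0 \<and> m \<ge> 1 \<and> countable_stone_space_of_type \<beta> m Y \<longrightarrow>
        (coarsely_equivalent (Homeo_coarse_space X) (Homeo_coarse_space Y) \<longleftrightarrow>
           n = 1 \<and> m = 1 \<or>
           n > 1 \<and> m > 1 \<and> successor_ordinal \<alpha> \<and> successor_ordinal \<beta> \<or>
           n > 1 \<and> m > 1 \<and> limit_ordinal \<alpha> \<and> limit_ordinal \<beta>)) \<and>
     (\<forall>(X :: 'a topology) \<alpha>.
        \<alpha> > 0 \<and> countable_stone_space_of_type \<alpha> 1 X \<longrightarrow>
        coarsely_bounded_group (Homeo X) (compact_open_topology X) \<and>
        group_quasi_isometric (Homeo X) (compact_open_topology X) {()} (\<lambda>_ _. 0)) \<and>
     (\<forall>(X :: 'a topology) \<alpha> n.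
        \<alpha> > 0 \<and> n > 1 \<and> successor_ordinal \<alpha> \<and> countable_stone_space_of_type \<alpha> n X \<longrightarrow>
        group_quasi_isometric (Homeo X) (compact_open_topology X)
          hamming_vertices (graph_dist hamming_edges)) \<and>
     (\<forall>(X :: 'a topology) \<alpha> n (V :: 'v set) E height.
        \<alpha> > 0 \<and> n > 1 \<and> limit_ordinal \<alpha> \<and> countable_stone_space_of_type \<alpha> n X \<and>
        regular_one_ended_tree V E height \<longrightarrow>
        coarsely_equivalent (Homeo_coarse_space X)
          (metric_coarse_space (leaves V E) (graph_dist E)))"
proof (intro conjI allI impI)
  show "let \<X> = {X :: nat topology. \<exists>\<alpha> n. \<alpha> > 0 \<and> n \<ge> 1 \<and> countable_stone_space_of_type \<alpha> n X}
      in card (\<X> // {(X, Y) \<in> \<X> \<times> \<X>.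
           coarsely_equivalent (Homeo_coarse_space X) (Homeo_coarse_space Y)}) = 3"
    unfolding Let_def by (rule three_classes[OF refl])
next
  fix X :: "'a topology" and Y :: "'b topology" and \<alpha> n \<beta> m
  assume "\<alpha> > 0 \<and> n \<ge> 1 \<and> countable_stone_space_of_type \<alpha> n X \<and>
    \<beta> > 0 \<and> m \<ge> 1 \<and> countable_stone_space_of_type \<beta> m Y"
  then show "coarsely_equivalent (Homeo_coarse_space X) (Homeo_coarse_space Y) \<longleftrightarrow>
           n = 1 \<and> m = 1 \<or>
           n > 1 \<and> m > 1 \<and> successor_ordinal \<alpha> \<and> successor_ordinal \<beta> \<or>
           n > 1 \<and> m > 1 \<and> limit_ordinal \<alpha> \<and> limit_ordinal \<beta>"
    by (intro coarsely_equivalent_Homeo_iff) simp_all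
next
  fix X :: "'a topology" and \<alpha>
  assume "\<alpha> > 0 \<and> countable_stone_space_of_type \<alpha> 1 X"
  then have X: "countable_stone_space_of_type \<alpha> 1 X" by simp
  show "coarsely_bounded_group (Homeo X) (compact_open_topology X)"
    and "group_quasi_isometric (Homeo X) (compact_open_topology X) {()} (\<lambda>_ _. 0)"
    using bounded_of_type_1[OF X] by simp_all
next
  fix X :: "'a topology" and \<alpha> n
  assume "\<alpha> > 0 \<and> n > 1 \<and> successor_ordinal \<alpha> \<and> countable_stone_space_of_type \<alpha> n X"
  then show "group_quasi_isometric (Homeo X) (compact_open_topology X)
          hamming_vertices (graph_dist hamming_edges)"
    by (intro hamming_of_successor_type(1)[of \<alpha> n]) simp_all
next
  fix X :: "'a topology" and \<alpha> n and V :: "'v set" and E height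
  assume "\<alpha> > 0 \<and> n > 1 \<and> limit_ordinal \<alpha> \<and> countable_stone_space_of_type \<alpha> n X \<and>
        regular_one_ended_tree V E height"
  then show "coarsely_equivalent (Homeo_coarse_space X)
          (metric_coarse_space (leaves V E) (graph_dist E))"
    by (intro leaves_of_limit_type[of \<alpha> n _ V E height]) simp_all
qed

end
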